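(* Let $\mathfrak{M}$ be either the free Brownian motion $S$ or the compensated free Poisson process $\hat N$. Let $n,m\ge1$ be natural numbers and let $\{f_k:k\ge1\}\subset L^2(\mathbb{R}_+^n)$ and $\{g_k:k\ge1\}\subset L^2(\mathbb{R}_+^m)$ be sequences of symmetric functions such that $\big(I_n^{\mathfrak{M}}(f_k),I_m^{\mathfrak{M}}(g_k)\big)\to(F,G)$ jointly in law as $k\to\infty$. Then $F$ and $G$ are free if and only if $$\mathrm{Cov}\big(I_n^{\mathfrak{M}}(f_k)^2,I_m^{\mathfrak{M}}(g_k)^2\big)\to0\quad\text{as }k\to\infty.$$
   Context: $\mathbb{R}_+=[0,\infty)$ with Lebesgue measure; $L^2(\mathbb{R}_+^n)$ is the space of complex-valued square-integrable functions. A function $f\in L^2(\mathbb{R}_+^n)$ is called symmetric if it is real-valued and $f(t_1,\dots,t_n)=f(t_{\sigma(1)},\dots,t_{\sigma(n)})$ for a.e. $(t_1,\dots,t_n)$ and every permutation $\sigma$. Its adjoint is $f^*(t_1,\dots,t_n)=\overline{f(t_n,\dots,t_1)}$. $(\mathscr{A},\varphi)$ is a tracial $W^*$-probability space: $\mathscr{A}$ is a von Neumann algebra and $\varphi:\mathscr{A}\to\mathbb{C}$ is a unital, weakly continuous, positive, faithful, tracial linear functional. $L^2(\mathscr{A},\varphi)$ is the completion of $\mathscr{A}$ for $\|X\|_2=\sqrt{\varphi(XX^* )}$. $\mathrm{Cov}(X,Y)=\varphi(XY)-\varphi(X)\varphi(Y)$. Random variables are self-adjoint elements; $F,G$ are random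 variables in $L^2(\mathscr{A},\varphi)$ and need not be multiple integrals. Freeness: $X_1,\dots,X_d$ are free if $\varphi\big([P_1(X_{i_1})-\varphi(P_1(X_{i_1}))]\cdots[P_r(X_{i_r})-\varphi(P_r(X_{i_r}))]\big)=0$ whenever $r\ge1$, $P_1,\dots,P_r$ are polynomials and $i_1,\dots,i_r\in\{1,\dots,d\}$ have no two adjacent indices equal. Joint convergence in law $(X_k^1,\dots,X_k^d)\to(X_\infty^1,\dots,X_\infty^d)$ means $\varphi_k(X_k^{i_1}\cdots X_k^{i_r})\to\varphi_\infty(X_\infty^{i_1}\cdots X_\infty^{i_r})$ for all $r\ge1$ and all $i_1,\dots,i_r\in\{1,\dots,d\}$ (the spaces $(\mathscr{A}_k,\varphi_k)$ may differ). Free Brownian motion $S=\{S_t\}_{t\ge0}$: self-adjoint elements of $\mathscr{A}$, adapted to an increasing filtration $(\mathscr{A}_t)_{t\ge 0}$ of von Neumann subalgebras, with $S_0=0$ and such that for $0\le u<t$ the increment $S_t-S_u$ is free from $\mathscr{A}_u$ and has the centered semicircular law of variance $t-u$, with density $(2\pi(t-u))^{-1}\sqrt{4(t-u)-x^2}$ on $[-2\sqrt{t-u},2\sqrt{t-u}]$. Free Poisson process $N=\{N_t\}_{t\ge0}$: positive elements of $\mathscr{A}$ adapted to such a filtration, with $N_0=0$ and $N_t-N_u$ free from $\mathscr{A}_u$ with the free Poisson law of rate $\lambda=t-u$, i.e. $(1-\lambda)\delta_0+\tilde\nu$ if $\lambda\le1$ (with the understanding that $\tilde\nu$ carries mass $\lambda$)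 and $\tilde\nu$ if $\lambda>1$, where $\tilde\nu(dx)=(2\pi x)^{-1}\sqrt{4\lambda-(x-1-\lambda)^2}\,dx$ on $[(1-\sqrt\lambda)^2,(1+\sqrt\lambda)^2]$. $\hat N_t=N_t-t\mathbf{1}$ is the compensated process. Multiple integrals: for $\mathfrak{M}\in\{S,\hat N\}$, $I_n^{\mathfrak{M}}$ is the linear map $L^2(\mathbb{R}_+^n)\to L^2(\mathscr{A},\varphi)$ determined by $I_n^{\mathfrak{M}}(\mathbf{1}_{[a_1,b_1]\times\cdots\times[a_n,b_n]})=(\mathfrak{M}_{b_1}-\mathfrak{M}_{a_1})\cdots(\mathfrak{M}_{b_n}-\mathfrak{M}_{a_n})$ for pairwise disjoint intervals and extended by linearity and the isometry $\varphi(I_n^{\mathfrak{M}}(f)I_n^{\mathfrak{M}}(g)^* )=\langle f,g\rangle_{L^2(\mathbb{R}_+^n)}$; $I_0^{\mathfrak M}(c)=c\mathbf 1$. Integrals of different orders are orthogonal, and $I_n^{\mathfrak{M}}(f)^*=I_n^{\mathfrak{M}}(f^* )$. Contractions, for $f\in L^2(\mathbb{R}_+^n)$, $g\in L^2(\mathbb{R}_+^m)$: for $0\le p\le n\wedge m$, $(f\stackrel{p}{\frown}g)(t_1,\dots,t_{n+m-2p})=\int_{\mathbb{R}_+^p}f(t_1,\dots,t_{n-p},s_1,\dots,s_p)\,g(s_p,\dots,s_1,t_{n-p+1},\dots,t_{n+m-2p})\,ds_1\cdots ds_p$; and for $1\le p\le n\wedge m$, $(f\star_p^{p-1}g)(t_1,\dots,t_{n+m-2p+1})=\int_{\mathbb{R}_+^{p-1}}f(t_1,\dots,t_{n-p+1},s_{p-1},\dots,s_1)\,g(s_1,\dots,s_{p-1},t_{n-p+1},\dots,t_{n+m-2p+1})\,ds_1\cdots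 ds_{p-1}$. Standing convention: the multiple integrals span a unital $*$-algebra, with products (hence moments) computed by $I_n^S(f)I_m^S(g)=\sum_{p=0}^{n\wedge m}I_{n+m-2p}^S(f\stackrel{p}{\frown}g)$ in the Wigner case and $I_n^{\hat N}(f)I_m^{\hat N}(g)=\sum_{p=0}^{n\wedge m}I_{n+m-2p}^{\hat N}(f\stackrel{p}{\frown}g)+\sum_{p=1}^{n\wedge m}I_{n+m-2p+1}^{\hat N}(f\star_p^{p-1}g)$ in the free Poisson case.
   Formalization: In the free Poisson case the kernels f_k, g_k are taken from spaces of L² kernels closed under sums, scalars, adjoints and both contractions, on which the product formula holds (e.g. bounded kernels with bounded support), since the star contraction of L² kernels need not lie in L². *)

theory Defs
  imports "HOL-Analysis.Analysis" "HOL-Combinatorics.Permutations"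
    "HOL-Computational_Algebra.Polynomial"
begin

section \<open>Complex Hilbert spaces and von Neumann algebras\<close>

class chilbert_space = real_inner + complete_space +
  fixes scaleC :: "complex \<Rightarrow> 'a \<Rightarrow> 'a"
    and cinner :: "'a \<Rightarrow> 'a \<Rightarrow> complex"
  assumes scaleC_add_right: "scaleC a (x + y) = scaleC a x + scaleC a y"
    and scaleC_add_left: "scaleC (a + b) x = scaleC a x + scaleC b x"
    and scaleC_scaleC: "scaleC a (scaleC b x) = scaleC (a * b) x"
    and scaleC_of_real: "scaleC (complex_of_real r) x = r *\<^sub>R x"
    and cinner_add_left: "cinner (x + y) z = cinner x z + cinner y z"
    and cinner_scaleC_left: "cinner (scaleC a x) y = a * cinner x y"
    and cinner_commute: "cinner x y = cnj (cinner y x)"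
    and Re_cinner: "Re (cinner x y) = inner x y"

text \<open>\<open>blinfun\<close> consists of the real-linear bounded operators; complex linearity
  is a separate requirement.\<close>

type_synonym 'h op = "'h \<Rightarrow>\<^sub>L 'h"

definition complex_linear :: "'h::chilbert_space op \<Rightarrow> bool" where
  "complex_linear T \<longleftrightarrow> (\<forall>c x. T (scaleC c x) = scaleC c (T x))"

definition op_scaleC :: "complex \<Rightarrow> 'h::chilbert_space op \<Rightarrow> 'h op" where
  "op_scaleC c T = Blinfun (\<lambda>x. scaleC c (T x))"

definition op_adj :: "'h::chilbert_space op \<Rightarrow> 'h op" where
  "op_adj T = (THE T' :: 'h op. \<forall>x y. cinner (T x) y = cinner x (T' y))"

definition op_prod :: "'h::chilbert_space op list \<Rightarrow> 'h op" where
  "op_prod Ts = foldr (o\<^sub>L) Ts id_blinfun"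

definition op_poly :: "complex poly \<Rightarrow> 'h::chilbert_space op \<Rightarrow> 'h op" where
  "op_poly P T = (\<Sum>i\<le>degree P. op_scaleC (coeff P i) (op_prod (replicate i T)))"

definition weak_operator_topology :: "'h::chilbert_space op topology" where
  "weak_operator_topology =
     pullback_topology UNIV (\<lambda>T (x, y). cinner (blinfun_apply T x) y)
       (euclidean :: ('h \<times> 'h \<Rightarrow> complex) topology)"

definition von_neumann_algebra :: "'h::chilbert_space op set \<Rightarrow> bool" where
  "von_neumann_algebra A \<longleftrightarrow>
     (\<forall>X\<in>A. complex_linear X) \<and> id_blinfun \<in> A \<and>
     (\<forall>X\<in>A. \<forall>Y\<in>A. X + Y \<in> A \<and> X o\<^sub>L Y \<in> A) \<and>
     (\<forall>c. \<forall>X\<in>A. op_scaleC c X \<in> A) \<and> (\<forall>X\<in>A. op_adj X \<in> A) \<and>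
     closedin weak_operator_topology A"

section \<open>Tracial \<open>W\<^sup>*\<close>-probability spaces\<close>

text \<open>\<open>wstar_emb W\<close> embeds the von Neumann algebra \<open>wstar_alg W\<close> into its completion
  \<open>L\<^sup>2\<close> for the norm given by the trace \<open>wstar_state W\<close>.  The completion is unique only up
  to a unitary isomorphism, so it is carried along as a Hilbert space \<open>'l\<close>.  The last two
  fields are relevant only on \<open>wstar_alg W\<close>.\<close>

record (overloaded) ('h::real_normed_vector, 'l) wstar_space =
  wstar_alg :: "'h op set"
  wstar_state :: "'h op \<Rightarrow> complex"
  wstar_emb :: "'h op \<Rightarrow> 'l"

definition tracial_wstar_space ::
    "('h::chilbert_space, 'l::chilbert_space) wstar_space \<Rightarrow> bool" where
  "tracial_wstar_space W \<longleftrightarrow> (let A = wstar_alg W; \<phi> = wstar_state W; \<iota> = wstar_emb W in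
     von_neumann_algebra A \<and>
     (\<forall>X\<in>A. \<forall>Y\<in>A. \<phi> (X + Y) = \<phi> X + \<phi> Y) \<and>
     (\<forall>c. \<forall>X\<in>A. \<phi> (op_scaleC c X) = c * \<phi> X) \<and>
     \<phi> id_blinfun = 1 \<and>
     continuous_map (subtopology weak_operator_topology A) euclidean \<phi> \<and>
     (\<forall>X\<in>A. \<phi> (X o\<^sub>L op_adj X) \<in> \<real>\<^sub>\<ge>\<^sub>0) \<and>
     (\<forall>X\<in>A. \<phi> (X o\<^sub>L op_adj X) = 0 \<longrightarrow> X = 0) \<and>
     (\<forall>X\<in>A. \<forall>Y\<in>A. \<phi> (X o\<^sub>L Y) = \<phi> (Y o\<^sub>L X)) \<and>
     (\<forall>X\<in>A. \<forall>Y\<in>A. \<iota> (X + Y) = \<iota> X + \<iota> Y) \<and>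
     (\<forall>c. \<forall>X\<in>A. \<iota> (op_scaleC c X) = scaleC c (\<iota> X)) \<and>
     (\<forall>X\<in>A. \<forall>Y\<in>A. cinner (\<iota> X) (\<iota> Y) = \<phi> (X o\<^sub>L op_adj Y)) \<and>
     closure (\<iota> ` A) = UNIV)"

section \<open>Random variables in \<open>L\<^sup>2\<close>\<close>

text \<open>The involution of \<open>L\<^sup>2\<close> is the continuous extension of the adjoint.\<close>

definition is_l2_adjoint ::
    "('h::chilbert_space, 'l::chilbert_space) wstar_space \<Rightarrow> 'l \<Rightarrow> 'l \<Rightarrow> bool" where
  "is_l2_adjoint W \<xi> \<eta> \<longleftrightarrow>
     (\<forall>a. range a \<subseteq> wstar_alg W \<and> (\<lambda>j. wstar_emb W (a j)) \<longlonglongrightarrow> \<xi> \<longrightarrow>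
          (\<lambda>j::nat. wstar_emb W (op_adj (a j))) \<longlonglongrightarrow> \<eta>)"

definition self_adjoint_rv ::
    "('h::chilbert_space, 'l::chilbert_space) wstar_space \<Rightarrow> 'l \<Rightarrow> bool" where
  "self_adjoint_rv W \<xi> \<longleftrightarrow> is_l2_adjoint W \<xi> \<xi>"

text \<open>The product of two elements of \<open>L\<^sup>2\<close> is in general only an element of \<open>L\<^sup>1\<close>, namely the
  \<open>L\<^sup>1\<close>-limit of \<open>a\<^sub>j b\<^sub>j\<close> for approximations \<open>a\<^sub>j\<close> and \<open>b\<^sub>j\<close> of the two factors by
  bounded elements.  An element of \<open>L\<^sup>1\<close> is determined by its pairing with the algebra;
  \<open>is_l2_product W \<xi> \<eta> \<zeta>\<close> says that the product of \<open>\<xi>\<close> and \<open>\<eta>\<close> lies in \<open>L\<^sup>2\<close> and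
  equals \<open>\<zeta>\<close>.\<close>

definition is_l2_product ::
    "('h::chilbert_space, 'l::chilbert_space) wstar_space \<Rightarrow> 'l \<Rightarrow> 'l \<Rightarrow> 'l \<Rightarrow> bool" where
  "is_l2_product W \<xi> \<eta> \<zeta> \<longleftrightarrow>
     (\<forall>a b. range a \<subseteq> wstar_alg W \<and> range b \<subseteq> wstar_alg W \<and>
        (\<lambda>j. wstar_emb W (a j)) \<longlonglongrightarrow> \<xi> \<and> (\<lambda>j. wstar_emb W (b j)) \<longlonglongrightarrow> \<eta> \<longrightarrow>
        (\<forall>X\<in>wstar_alg W. (\<lambda>j::nat. wstar_state W (a j o\<^sub>L b j o\<^sub>L op_adj X))
           \<longlonglongrightarrow> cinner \<zeta> (wstar_emb W X)))"

text \<open>\<open>l2_mult\<close>, and hence \<open>l2_prod\<close>, is meaningful only if the products in question lie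
  in \<open>L\<^sup>2\<close>.\<close>

definition l2_mult ::
    "('h::chilbert_space, 'l::chilbert_space) wstar_space \<Rightarrow> 'l \<Rightarrow> 'l \<Rightarrow> 'l" where
  "l2_mult W \<xi> \<eta> = (THE \<zeta>. is_l2_product W \<xi> \<eta> \<zeta>)"

definition l2_one :: "('h::chilbert_space, 'l::chilbert_space) wstar_space \<Rightarrow> 'l" where
  "l2_one W = wstar_emb W id_blinfun"

definition l2_prod ::
    "('h::chilbert_space, 'l::chilbert_space) wstar_space \<Rightarrow> 'l list \<Rightarrow> 'l" where
  "l2_prod W \<xi>s = foldr (l2_mult W) \<xi>s (l2_one W)"

definition l2_power ::
    "('h::chilbert_space, 'l::chilbert_space) wstar_space \<Rightarrow> 'l \<Rightarrow> nat \<Rightarrow> 'l" where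
  "l2_power W \<xi> i = l2_prod W (replicate i \<xi>)"

definition l2_poly ::
    "('h::chilbert_space, 'l::chilbert_space) wstar_space \<Rightarrow> complex poly \<Rightarrow> 'l \<Rightarrow> 'l" where
  "l2_poly W P \<xi> = (\<Sum>i\<le>degree P. scaleC (coeff P i) (l2_power W \<xi> i))"

text \<open>The extension of the trace to \<open>L\<^sup>2\<close>: \<open>\<phi>(\<xi>) = \<phi>(\<xi> 1\<^sup>*)\<close>.\<close>

definition l2_expect ::
    "('h::chilbert_space, 'l::chilbert_space) wstar_space \<Rightarrow> 'l \<Rightarrow> complex" where
  "l2_expect W \<xi> = cinner \<xi> (l2_one W)"

definition l2_cov ::
    "('h::chilbert_space, 'l::chilbert_space) wstar_space \<Rightarrow> 'l \<Rightarrow> 'l \<Rightarrow> complex" where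
  "l2_cov W \<xi> \<eta> = l2_expect W (l2_mult W \<xi> \<eta>) - l2_expect W \<xi> * l2_expect W \<eta>"

text \<open>All monomials in the given variables exist as elements of \<open>L\<^sup>2\<close>; equivalently, the
  variables have moments of all orders.\<close>

definition has_all_moments ::
    "('h::chilbert_space, 'l::chilbert_space) wstar_space \<Rightarrow> 'l list \<Rightarrow> bool" where
  "has_all_moments W Xs \<longleftrightarrow>
     (\<forall>\<xi> w. \<xi> \<in> set Xs \<and> set w \<subseteq> set Xs \<longrightarrow>
        is_l2_product W \<xi> (l2_prod W w) (l2_prod W (\<xi> # w)))"

definition converges_in_law ::
    "('h::chilbert_space, 'l::chilbert_space) wstar_space \<Rightarrow> (nat \<Rightarrow> 'l list) \<Rightarrow>
     ('h2::chilbert_space, 'l2::chilbert_space) wstar_space \<Rightarrow> 'l2 list \<Rightarrow> bool" where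
  "converges_in_law W X V Y \<longleftrightarrow>
     (\<forall>k. length (X k) = length Y \<and> has_all_moments W (X k)) \<and> has_all_moments V Y \<and>
     (\<forall>is. is \<noteq> [] \<and> set is \<subseteq> {..<length Y} \<longrightarrow>
        (\<lambda>k. l2_expect W (l2_prod W (map (\<lambda>i. X k ! i) is)))
          \<longlonglongrightarrow> l2_expect V (l2_prod V (map (\<lambda>i. Y ! i) is)))"

definition free_rvs ::
    "('h::chilbert_space, 'l::chilbert_space) wstar_space \<Rightarrow> 'l list \<Rightarrow> bool" where
  "free_rvs W Xs \<longleftrightarrow>
     (\<forall>ps :: (nat \<times> complex poly) list.
        ps \<noteq> [] \<and> fst ` set ps \<subseteq> {..<length Xs} \<and> distinct_adj (map fst ps) \<longrightarrow>
        l2_expect W (l2_prod W (map (\<lambda>(i, P).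
            l2_poly W P (Xs ! i) - scaleC (l2_expect W (l2_poly W P (Xs ! i))) (l2_one W)) ps))
          = 0)"

section \<open>Free Brownian motion and the free Poisson process\<close>

definition free_from ::
    "('h::chilbert_space, 'l::chilbert_space) wstar_space \<Rightarrow> 'h op \<Rightarrow> 'h op set \<Rightarrow> bool" where
  "free_from W T B \<longleftrightarrow>
     (\<forall>xs :: (bool \<times> 'h op) list.
        xs \<noteq> [] \<and> distinct_adj (map fst xs) \<and>
        (\<forall>(c, x)\<in>set xs. x \<in> (if c then range (\<lambda>P. op_poly P T) else B) \<and>
           wstar_state W x = 0) \<longrightarrow>
        wstar_state W (op_prod (map snd xs)) = 0)"

text \<open>A compactly supported law on the real line is determined by its moments.\<close>

definition has_law ::
    "('h::chilbert_space, 'l::chilbert_space) wstar_space \<Rightarrow> 'h op \<Rightarrow> real measure \<Rightarrow> bool" where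
  "has_law W T \<mu> \<longleftrightarrow>
     (\<forall>i. wstar_state W (op_prod (replicate i T)) = complex_of_real (\<integral>x. x ^ i \<partial>\<mu>))"

definition semicircle_law :: "real \<Rightarrow> real measure" where
  "semicircle_law v = density lborel (\<lambda>x. ennreal
     (indicator {- 2 * sqrt v..2 * sqrt v} x * (sqrt (4 * v - x\<^sup>2) / (2 * pi * v))))"

definition free_poisson_law :: "real \<Rightarrow> real measure" where
  "free_poisson_law r =
     (let \<nu> = density lborel (\<lambda>x. ennreal
        (indicator {(1 - sqrt r)\<^sup>2..(1 + sqrt r)\<^sup>2} x *
          (sqrt (4 * r - (x - 1 - r)\<^sup>2) / (2 * pi * x))))
      in if r \<le> 1
         then measure_of UNIV (sets borel)
           (\<lambda>B. ennreal (1 - r) * indicator B 0 + emeasure \<nu> B)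
         else \<nu>)"

definition filtration ::
    "('h::chilbert_space, 'l::chilbert_space) wstar_space \<Rightarrow> (real \<Rightarrow> 'h op set) \<Rightarrow> bool" where
  "filtration W \<A> \<longleftrightarrow>
     (\<forall>t\<ge>0. von_neumann_algebra (\<A> t) \<and> \<A> t \<subseteq> wstar_alg W) \<and>
     (\<forall>u t. 0 \<le> u \<and> u \<le> t \<longrightarrow> \<A> u \<subseteq> \<A> t)"

definition free_brownian_motion ::
    "('h::chilbert_space, 'l::chilbert_space) wstar_space \<Rightarrow> (real \<Rightarrow> 'h op) \<Rightarrow> bool" where
  "free_brownian_motion W S \<longleftrightarrow>
     (\<exists>\<A>. filtration W \<A> \<and>
        (\<forall>t\<ge>0. S t \<in> \<A> t \<and> op_adj (S t) = S t) \<and> S 0 = 0 \<and>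
        (\<forall>u t. 0 \<le> u \<and> u < t \<longrightarrow>
           free_from W (S t - S u) (\<A> u) \<and> has_law W (S t - S u) (semicircle_law (t - u))))"

definition free_poisson_process ::
    "('h::chilbert_space, 'l::chilbert_space) wstar_space \<Rightarrow> (real \<Rightarrow> 'h op) \<Rightarrow> bool" where
  "free_poisson_process W N \<longleftrightarrow>
     (\<exists>\<A>. filtration W \<A> \<and>
        (\<forall>t\<ge>0. N t \<in> \<A> t \<and> (\<forall>x. cinner (N t x) x \<in> \<real>\<^sub>\<ge>\<^sub>0)) \<and> N 0 = 0 \<and>
        (\<forall>u t. 0 \<le> u \<and> u < t \<longrightarrow>
           free_from W (N t - N u) (\<A> u) \<and> has_law W (N t - N u) (free_poisson_law (t - u))))"

definition compensated :: "(real \<Rightarrow> 'h::chilbert_space op) \<Rightarrow> real \<Rightarrow> 'h op" where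
  "compensated N t = N t - t *\<^sub>R id_blinfun"

section \<open>Kernels and contractions\<close>

text \<open>A function of \<open>n\<close> nonnegative variables is a function on the product space
  \<open>orthant n\<close>, whose points are the families indexed by \<open>{..<n}\<close> (extended by
  \<open>undefined\<close>); thus the variable \<open>t\<^sub>i\<close> of the mathematical notation is \<open>t (i - 1)\<close>.\<close>

type_synonym kernel = "(nat \<Rightarrow> real) \<Rightarrow> complex"

definition orthant :: "nat \<Rightarrow> (nat \<Rightarrow> real) measure" where
  "orthant n = (\<Pi>\<^sub>M i\<in>{..<n}. restrict_space lborel {0..})"

definition L2_kernels :: "nat \<Rightarrow> kernel set" where
  "L2_kernels n = {f. f \<in> borel_measurable (orthant n) \<and>
     integrable (orthant n) (\<lambda>t. (cmod (f t))\<^sup>2)}"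

definition kernel_adj :: "nat \<Rightarrow> kernel \<Rightarrow> kernel" where
  "kernel_adj n f = (\<lambda>t. cnj (f (\<lambda>i\<in>{..<n}. t (n - 1 - i))))"

definition symmetric_kernel :: "nat \<Rightarrow> kernel \<Rightarrow> bool" where
  "symmetric_kernel n f \<longleftrightarrow> (AE t in orthant n. f t \<in> \<real>) \<and>
     (\<forall>\<sigma>. \<sigma> permutes {..<n} \<longrightarrow> (AE t in orthant n. f (t \<circ> \<sigma>) = f t))"

text \<open>In the next two definitions \<open>f\<close> has \<open>n\<close> and \<open>g\<close> has \<open>m\<close> variables.  The first one
  integrates \<open>f (t\<^sub>1, \<dots>, t\<^sub>n\<^sub>-\<^sub>p, s\<^sub>1, \<dots>, s\<^sub>p) g (s\<^sub>p, \<dots>, s\<^sub>1, t\<^sub>n\<^sub>-\<^sub>p\<^sub>+\<^sub>1, \<dots>)\<close>, the second one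
  \<open>f (t\<^sub>1, \<dots>, t\<^sub>n\<^sub>-\<^sub>p\<^sub>+\<^sub>1, s\<^sub>p\<^sub>-\<^sub>1, \<dots>, s\<^sub>1) g (s\<^sub>1, \<dots>, s\<^sub>p\<^sub>-\<^sub>1, t\<^sub>n\<^sub>-\<^sub>p\<^sub>+\<^sub>1, \<dots>)\<close>.\<close>

definition contraction :: "nat \<Rightarrow> nat \<Rightarrow> nat \<Rightarrow> kernel \<Rightarrow> kernel \<Rightarrow> kernel" where
  "contraction n m p f g = (\<lambda>t. \<integral>s.
     f (\<lambda>i\<in>{..<n}. if i < n - p then t i else s (i - (n - p))) *
     g (\<lambda>i\<in>{..<m}. if i < p then s (p - 1 - i) else t (n - p + (i - p))) \<partial>orthant p)"

definition star_contraction :: "nat \<Rightarrow> nat \<Rightarrow> nat \<Rightarrow> kernel \<Rightarrow> kernel \<Rightarrow> kernel" where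
  "star_contraction n m p f g = (\<lambda>t. \<integral>s.
     f (\<lambda>i\<in>{..<n}. if i \<le> n - p then t i else s (p - 2 - (i - (n - p + 1)))) *
     g (\<lambda>i\<in>{..<m}. if i < p - 1 then s i else t (n - p + (i - (p - 1)))) \<partial>orthant (p - 1))"

section \<open>Multiple integrals\<close>

text \<open>The case \<open>n = 0\<close> of the condition on boxes is the convention \<open>I 0 c = c 1\<close>.\<close>

definition multiple_integrals ::
    "('h::chilbert_space, 'l::chilbert_space) wstar_space \<Rightarrow> (real \<Rightarrow> 'h op) \<Rightarrow>
     (nat \<Rightarrow> kernel \<Rightarrow> 'l) \<Rightarrow> bool" where
  "multiple_integrals W M I \<longleftrightarrow>
     (\<forall>n. \<forall>f\<in>L2_kernels n. \<forall>g\<in>L2_kernels n. I n (\<lambda>t. f t + g t) = I n f + I n g) \<and>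
     (\<forall>n c. \<forall>f\<in>L2_kernels n. I n (\<lambda>t. c * f t) = scaleC c (I n f)) \<and>
     (\<forall>n a b. (\<forall>i<n. 0 \<le> a i \<and> a i \<le> b i) \<and> disjoint_family_on (\<lambda>i. {a i..b i}) {..<n} \<longrightarrow>
        I n (\<lambda>t. if \<forall>i<n. t i \<in> {a i..b i} then 1 else 0) =
        wstar_emb W (op_prod (map (\<lambda>i. M (b i) - M (a i)) [0..<n]))) \<and>
     (\<forall>n. \<forall>f\<in>L2_kernels n. \<forall>g\<in>L2_kernels n.
        cinner (I n f) (I n g) = (\<integral>t. f t * cnj (g t) \<partial>orthant n)) \<and>
     (\<forall>n m. \<forall>f\<in>L2_kernels n. \<forall>g\<in>L2_kernels m. n \<noteq> m \<longrightarrow> cinner (I n f) (I m g) = 0) \<and>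
     (\<forall>n. \<forall>f\<in>L2_kernels n. is_l2_adjoint W (I n f) (I n (kernel_adj n f)))"

text \<open>In the Wigner case the product formula holds for all square-integrable kernels.\<close>

definition wigner_chaos ::
    "('h::chilbert_space, 'l::chilbert_space) wstar_space \<Rightarrow> (real \<Rightarrow> 'h op) \<Rightarrow>
     (nat \<Rightarrow> kernel \<Rightarrow> 'l) \<Rightarrow> (nat \<Rightarrow> kernel set) \<Rightarrow> bool" where
  "wigner_chaos W S I K \<longleftrightarrow>
     free_brownian_motion W S \<and> multiple_integrals W S I \<and> K = L2_kernels \<and>
     (\<forall>n m. \<forall>f\<in>K n. \<forall>g\<in>K m.
        is_l2_product W (I n f) (I m g)
          (\<Sum>p\<le>min n m. I (n + m - 2 * p) (contraction n m p f g)))"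

text \<open>In the free Poisson case \<open>star_contraction n m p f g\<close> need not be square-integrable if
  \<open>f\<close> and \<open>g\<close> are (for \<open>n = m = p = 1\<close> it is the pointwise product).  The multiple
  integrals that span an algebra are therefore those of a family \<open>K\<close> of spaces of
  square-integrable kernels that is stable under the operations of the product formula.\<close>

definition kernel_algebra :: "(nat \<Rightarrow> kernel set) \<Rightarrow> bool" where
  "kernel_algebra K \<longleftrightarrow>
     (\<forall>n. K n \<subseteq> L2_kernels n) \<and> (\<forall>c. (\<lambda>_. c) \<in> K 0) \<and>
     (\<forall>n. \<forall>f\<in>K n. \<forall>g\<in>K n. (\<lambda>t. f t + g t) \<in> K n) \<and>
     (\<forall>n c. \<forall>f\<in>K n. (\<lambda>t. c * f t) \<in> K n) \<and>
     (\<forall>n. \<forall>f\<in>K n. kernel_adj n f \<in> K n) \<and>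
     (\<forall>n m. \<forall>f\<in>K n. \<forall>g\<in>K m.
        (\<forall>p\<le>min n m. contraction n m p f g \<in> K (n + m - 2 * p)) \<and>
        (\<forall>p\<in>{1..min n m}. star_contraction n m p f g \<in> K (n + m - 2 * p + 1)))"

definition free_poisson_chaos ::
    "('h::chilbert_space, 'l::chilbert_space) wstar_space \<Rightarrow> (real \<Rightarrow> 'h op) \<Rightarrow>
     (nat \<Rightarrow> kernel \<Rightarrow> 'l) \<Rightarrow> (nat \<Rightarrow> kernel set) \<Rightarrow> bool" where
  "free_poisson_chaos W M I K \<longleftrightarrow>
     (\<exists>N. free_poisson_process W N \<and> M = compensated N) \<and> multiple_integrals W M I \<and>
     kernel_algebra K \<and>
     (\<forall>n m. \<forall>f\<in>K n. \<forall>g\<in>K m.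
        is_l2_product W (I n f) (I m g)
          ((\<Sum>p\<le>min n m. I (n + m - 2 * p) (contraction n m p f g)) +
           (\<Sum>p=1..min n m. I (n + m - 2 * p + 1) (star_contraction n m p f g))))"

end

theory Submission imports Defs begin

text \<open>
  \<^bold>\<open>The covariance measures the contractions.\<close>  Let \<open>X\<close> and \<open>Y\<close> be multiple integrals with symmetric
  kernels \<open>f\<close> and \<open>g\<close>.  By the product formula \<open>X Y\<close> is the sum of the integral \<open>X \<odot> Y\<close> of the tensor product
  \<open>f \<otimes> g\<close> and of the integrals of the contractions of \<open>f\<close> and \<open>g\<close>, whose sum is written \<open>X \<diamondop> Y\<close>.  The
  orders of these terms differ, so that they are orthogonal, and since the trace gives
  \<open>\<phi>(X\<^sup>2 Y\<^sup>2) = \<parallel>X Y\<parallel>\<^sup>2\<close> and \<open>\<phi>(X\<^sup>2) \<phi>(Y\<^sup>2) = \<parallel>X \<odot> Y\<parallel>\<^sup>2\<close>, the covariance of \<open>X\<^sup>2\<close> and \<open>Y\<^sup>2\<close> is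
  \<open>\<parallel>X \<diamondop> Y\<parallel>\<^sup>2\<close> (\<open>cov_squares\<close>).

  \<^bold>\<open>Necessity.\<close>  If the limits are free, then the centered squares have a vanishing mixed moment.  This moment is
  a polynomial in joint moments, hence the limit of the covariances.

  \<^bold>\<open>Sufficiency.\<close>  Let \<open>X\<^sub>k \<diamondop> Y\<^sub>k\<close> tend to \<open>0\<close>.  It has to be shown that the expectation of
  \<open>Q\<^sub>1 \<cdots> Q\<^sub>r\<close> tends to \<open>0\<close>, where the \<open>Q\<^sub>i\<close> are centered polynomials alternately in \<open>X\<^sub>k\<close> and in \<open>Y\<^sub>k\<close>
  (\<open>asymptotically_free\<close>).  The tensor product \<open>Q\<^sub>1 \<odot> \<dots> \<odot> Q\<^sub>r\<close> has no constant term, so it suffices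
  that the product and the tensor product are asymptotically equal.  In \<open>Z \<cdot> (Q \<odot> T)\<close> with a letter \<open>Z\<close> the
  contractions are made from the end of \<open>Z\<close> into the beginning of \<open>Q \<odot> T\<close>.  Hence they stay inside \<open>Q\<close>, or
  they use up all variables of a component of \<open>Q\<close> before reaching \<open>T\<close> (\<open>mul_tens\<close>).  What remains of
  \<open>Z\<close> after such an absorption is a partial contraction \<open>F\<close> of the kernel of \<open>Z\<close> with something bounded.

  Partial contractions inherit the hypothesis: absorbing at one end commutes with contracting at the
  other end, which bounds \<open>F \<diamondop> Y\<^sub>k\<close> by \<open>X\<^sub>k \<diamondop> Y\<^sub>k\<close> for a partial contraction \<open>F\<close> of \<open>X\<^sub>k\<close>
  (\<open>norm_absorb_left_mul\<close>, \<open>partial_circ_null\<close>).  It follows that \<open>F\<close> and a polynomial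
  \<open>Q\<close> in \<open>Y\<^sub>k\<close> do not interact in the limit, and that the absorption of a component of \<open>Q\<close> by \<open>F\<close> vanishes:
  its squared norm is the expectation of a partial contraction times \<open>Q\<close>
  (\<open>partial_contract_polynomial_null\<close>).  The symmetry of the kernels enters here, because absorptions from the two
  ends of a kernel have to be interchanged.  The factors are unbounded, so the errors vanish only weakly, that is,
  when they are tested against words in \<open>X\<^sub>k\<close> and \<open>Y\<^sub>k\<close>; the norms of words are bounded since the
  moments converge.

  Apart from their symmetry, kernels enter only through the properties collected in \<open>chaos_algebra\<close>: the possible
  degrees, the norm of tensor products, and the locality of contractions.  They hold for both product formulas.
  The remaining work is of a functional analytic nature.  Multiple integrals are elements of \<open>L\<^sup>2\<close> whose products are defined
  by duality, and that this product is associative (\<open>is_l2_product_assoc\<close>) is shown by cutting off with resolvents.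
\<close>

section \<open>Complex Hilbert spaces\<close>

lemma cinner_add_right:
  fixes x :: "'a::chilbert_space"
  shows "cinner x (y + z) = cinner x y + cinner x z"
  by (metis cinner_add_left cinner_commute complex_cnj_add)

lemma cinner_scaleC_right:
  fixes x :: "'a::chilbert_space"
  shows "cinner x (scaleC c y) = cnj c * cinner x y"
  by (metis cinner_commute cinner_scaleC_left complex_cnj_mult)

lemma scaleC_one [simp]: "scaleC 1 x = (x :: 'a::chilbert_space)"
  using scaleC_of_real[of 1 x] by simp

lemma scaleC_minus1: "scaleC (-1) x = - (x :: 'a::chilbert_space)"
  using scaleC_of_real[of "-1" x] by simp

lemma scaleC_zero_left [simp]: "scaleC 0 x = (0 :: 'a::chilbert_space)"
  using scaleC_of_real[of 0 x] by simp

lemma scaleC_zero_right [simp]: "scaleC c (0 :: 'a::chilbert_space) = 0"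
  using scaleC_add_right[of c "0::'a" 0] by simp

lemma scaleC_minus_right: "scaleC c (- x) = - scaleC c (x :: 'a::chilbert_space)"
  using scaleC_add_right[of c x "-x"] by (simp add: minus_unique)

lemma scaleC_diff_right: "scaleC c (x - y) = scaleC c x - scaleC c (y :: 'a::chilbert_space)"
  using scaleC_add_right[of c x "-y"] by (simp add: scaleC_minus_right)

lemma scaleC_minus_left: "scaleC (- c) x = - scaleC c (x :: 'a::chilbert_space)"
  using scaleC_add_left[of c "-c" x] by (simp add: minus_unique)

lemma cinner_scaleR_left:
  fixes x :: "'a::chilbert_space"
  shows "cinner (r *\<^sub>R x) y = r *\<^sub>R cinner x y"
  by (metis cinner_scaleC_left scaleC_of_real scaleR_conv_of_real)

lemma cinner_scaleR_right:
  fixes x :: "'a::chilbert_space"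
  shows "cinner x (r *\<^sub>R y) = r *\<^sub>R cinner x y"
  by (metis cinner_scaleC_right complex_cnj_complex_of_real scaleC_of_real scaleR_conv_of_real)

lemma cinner_self:
  fixes x :: "'a::chilbert_space"
  shows "cinner x x = complex_of_real ((norm x)\<^sup>2)"
proof (rule complex_eqI)
  have "Im (cinner x x) = - Im (cinner x x)"
    using arg_cong[OF cinner_commute[of x x], of Im] by simp
  then show "Im (cinner x x) = Im (complex_of_real ((norm x)\<^sup>2))" by simp
qed (simp add: Re_cinner power2_norm_eq_inner)

lemma norm_scaleC: "norm (scaleC c x) = cmod c * norm (x :: 'a::chilbert_space)"
proof -
  have "complex_of_real ((norm (scaleC c x))\<^sup>2) = complex_of_real ((cmod c * norm x)\<^sup>2)"
    unfolding cinner_self[symmetric] cinner_scaleC_left cinner_scaleC_right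
    by (simp add: cinner_self power_mult_distrib mult_ac)
      (metis complex_norm_square of_real_power)
  then show ?thesis
    by (metis norm_ge_zero of_real_eq_iff power2_eq_iff_nonneg zero_le_mult_iff)
qed

text \<open>Rotating \<open>x\<close> by a phase makes the complex inner product real and nonnegative, so that it is the
  real inner product, for which the inequality is known.\<close>

lemma cinner_bound:
  fixes x :: "'a::chilbert_space"
  shows "cmod (cinner x y) \<le> norm x * norm y"
proof (cases "cinner x y = 0")
  case False
  define u where "u = cnj (cinner x y) / cmod (cinner x y)"
  have cu: "cmod u = 1" using False by (simp add: u_def norm_divide)
  have "u * cinner x y = cmod (cinner x y)"
    unfolding u_def using False
    by (simp add: complex_norm_square[symmetric] mult.commute power2_eq_square)
  then have "cmod (cinner x y) = Re (cinner (scaleC u x) y)"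
    by (simp add: cinner_scaleC_left)
  also have "\<dots> = inner (scaleC u x) y" by (rule Re_cinner)
  also have "\<dots> \<le> norm (scaleC u x) * norm y" by (rule norm_cauchy_schwarz)
  finally show ?thesis by (simp add: norm_scaleC cu)
qed auto

interpretation cinner: bounded_bilinear "cinner :: 'a::chilbert_space \<Rightarrow> 'a \<Rightarrow> complex"
proof
  show "\<exists>K. \<forall>a b. norm (cinner (a::'a) b) \<le> norm a * norm b * K"
    by (rule exI[of _ 1]) (simp add: cinner_bound)
qed (simp_all add: cinner_add_left cinner_add_right cinner_scaleR_left cinner_scaleR_right)

interpretation scaleC: bounded_bilinear "scaleC :: complex \<Rightarrow> 'a::chilbert_space \<Rightarrow> 'a"
proof
  show "scaleC (r *\<^sub>R a) b = r *\<^sub>R scaleC a b" for r a and b :: 'a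
    by (simp add: scaleR_conv_of_real scaleC_of_real flip: scaleC_scaleC)
  show "scaleC a (r *\<^sub>R b) = r *\<^sub>R scaleC a b" for r a and b :: 'a
    by (simp add: scaleC_scaleC mult.commute flip: scaleC_of_real)
  show "\<exists>K. \<forall>a b. norm (scaleC a (b::'a)) \<le> norm a * norm b * K"
    by (rule exI[of _ 1]) (simp add: norm_scaleC)
qed (simp_all add: scaleC_add_left scaleC_add_right)

lemma cinner_eq_0_imp_eq:
  fixes x y :: "'a::chilbert_space"
  assumes "\<And>z. cinner x z = cinner y z"
  shows "x = y"
proof -
  have "cinner (x - y) (x - y) = 0" using assms[of "x - y"] by (simp add: cinner.diff_left)
  then show ?thesis by (simp add: cinner_self)
qed

lemma norm_eq_sqrt_Re_cinner: "(norm x)\<^sup>2 = Re (cinner x (x :: 'a::chilbert_space))"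
  by (simp add: cinner_self)

text \<open>The Riesz representation theorem: a minimising sequence of
  \<open>\<parallel>x\<parallel>\<^sup>2 / 2 - f x\<close> is a Cauchy sequence by the parallelogram law, and the Euler equation at
  its limit says that the limit represents \<open>f\<close>.\<close>

lemma riesz_representation:
  fixes f :: "'a::{real_inner, complete_space} \<Rightarrow> real"
  assumes "bounded_linear f"
  shows "\<exists>z. \<forall>x. f x = inner x z"
proof -
  interpret bounded_linear f by fact
  obtain K where K: "\<And>x. \<bar>f x\<bar> \<le> norm x * K" using bounded by auto
  define Q where "Q x = (norm x)\<^sup>2 / 2 - f x" for x
  have Qlow: "- (K\<^sup>2) / 2 \<le> Q x" for x
  proof -
    have "0 \<le> (norm x - K)\<^sup>2" by simp
    then show ?thesis using K[of x] unfolding Q_def by (simp add: power2_diff)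
  qed
  define m where "m = Inf (range Q)"
  have bdd: "bdd_below (range Q)" using Qlow by (meson bdd_below.I2)
  have mQ: "m \<le> Q x" for x unfolding m_def by (rule cInf_lower[OF _ bdd]) auto
  have "\<exists>x. Q x < m + inverse (real (Suc k))" for k
    using cInf_lessD[of "range Q" "m + inverse (real (Suc k))"] unfolding m_def by auto
  then obtain s where s: "\<And>k. Q (s k) < m + inverse (real (Suc k))" by metis
  have par: "(norm (x - y))\<^sup>2 = 4 * (Q x + Q y - 2 * Q ((1/2) *\<^sub>R (x + y)))" for x y
    unfolding Q_def
    by (simp add: scaleR add power2_norm_eq_inner inner_diff inner_add inner_commute field_simps)
  have dist: "(norm (s i - s j))\<^sup>2 \<le> 4 * (inverse (real (Suc i)) + inverse (real (Suc j)))" for i j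
    using par[of "s i" "s j"] s[of i] s[of j] mQ[of "(1/2) *\<^sub>R (s i + s j)"] by simp
  have "Cauchy s"
  proof (rule metric_CauchyI)
    fix e :: real assume e: "0 < e"
    obtain N where N: "inverse (real (Suc N)) < e\<^sup>2 / 8"
      using reals_Archimedean[of "e\<^sup>2 / 8"] e by auto
    have "dist (s i) (s j) < e" if "i \<ge> N" "j \<ge> N" for i j
    proof -
      have le: "inverse (real (Suc l)) \<le> inverse (real (Suc N))" if "l \<ge> N" for l
        using that by (simp add: field_simps)
      have "(norm (s i - s j))\<^sup>2 \<le> 4 * (inverse (real (Suc N)) + inverse (real (Suc N)))"
        using that by (intro order.trans[OF dist] mult_left_mono add_mono le) auto
      also have "\<dots> < e\<^sup>2" using N by simp
      finally have "(norm (s i - s j))\<^sup>2 < e\<^sup>2" .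
      then show ?thesis using e by (simp add: dist_norm power2_less_imp_less)
    qed
    then show "\<exists>N. \<forall>i\<ge>N. \<forall>j\<ge>N. dist (s i) (s j) < e" by blast
  qed
  then obtain z where z: "s \<longlonglongrightarrow> z" using Cauchy_convergent convergent_def by blast
  have lim1: "(\<lambda>k. Q (s k)) \<longlonglongrightarrow> Q z" unfolding Q_def
    by (intro tendsto_intros z tendsto) simp
  have lim2: "(\<lambda>k. m + inverse (real (Suc k))) \<longlonglongrightarrow> m + 0"
    by (intro tendsto_intros LIMSEQ_inverse_real_of_nat)
  have "Q z \<le> m + 0"
    by (intro LIMSEQ_le[OF lim1 lim2] exI[of _ 0] allI impI less_imp_le s)
  then have Qz: "Q z \<le> m" by simp
  have "f v = inner v z" for v
  proof (rule ccontr)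
    assume ne: "f v \<noteq> inner v z"
    define d where "d = f v - inner v z"
    have ineq: "0 \<le> - t * d + t\<^sup>2 * ((norm v)\<^sup>2 / 2)" for t
    proof -
      have "Q (z + t *\<^sub>R v) = Q z - t * d + t\<^sup>2 * ((norm v)\<^sup>2 / 2)"
      proof -
        have "(norm (z + t *\<^sub>R v))\<^sup>2 = (norm z)\<^sup>2 + 2 * t * inner v z + t\<^sup>2 * (norm v)\<^sup>2"
          unfolding power2_norm_eq_inner
          by (simp add: inner_add inner_commute algebra_simps) (simp add: power2_eq_square)
        then show ?thesis unfolding Q_def d_def by (simp add: add scaleR field_simps)
      qed
      then show ?thesis using mQ[of "z + t *\<^sub>R v"] Qz by simp
    qed
    define c where "c = (norm v)\<^sup>2 / 2"
    have "c \<ge> 0" by (simp add: c_def)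
    have "0 \<le> - (d / (c + 1)) * d + (d / (c + 1))\<^sup>2 * c" using ineq[of "d / (c + 1)"] by (simp add: c_def)
    also have "\<dots> = - (d\<^sup>2 / (c + 1)\<^sup>2)"
      using \<open>c \<ge> 0\<close> by (simp add: divide_simps power2_eq_square) (simp add: algebra_simps)
    finally have "d\<^sup>2 / (c + 1)\<^sup>2 \<le> 0" by simp
    then have "d = 0" using \<open>c \<ge> 0\<close> by (simp add: divide_le_0_iff)
    then show False using ne by (simp add: d_def)
  qed
  then show ?thesis by blast
qed

section \<open>Adjoints of operators\<close>

lemma op_scaleC_apply [simp]: "blinfun_apply (op_scaleC c T) x = scaleC c (T x)"
proof -
  have "bounded_linear (\<lambda>x. scaleC c (blinfun_apply T x))"
    by (intro bounded_linear_compose[OF scaleC.bounded_linear_right] blinfun.bounded_linear_right)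
  then show ?thesis unfolding op_scaleC_def by (simp add: bounded_linear_Blinfun_apply)
qed

text \<open>Riesz gives an adjoint for the real inner product.  It is the complex adjoint because the
  imaginary part of \<open>cinner a b\<close> is the real inner product of \<open>- \<i> a\<close> with \<open>b\<close>, and \<open>T\<close> commutes
  with \<open>\<i>\<close>.\<close>

lemma op_adj_exists:
  assumes "complex_linear T"
  shows "\<exists>S. \<forall>x y. cinner (blinfun_apply T x) y = cinner x (blinfun_apply S y)"
proof -
  have "\<exists>z. \<forall>x. inner (T x) y = inner x z" for y
    by (rule riesz_representation) (intro bounded_linear_inner_left_comp blinfun.bounded_linear_right)
  then obtain S where S: "\<And>x y. inner (T x) y = inner x (S y)" by metis
  have C: "cinner (T x) y = cinner x (S y)" for x y
  proof (rule complex_eqI)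
    show "Re (cinner (T x) y) = Re (cinner x (S y))" by (simp add: Re_cinner S)
    have im: "Im (cinner a b) = inner (scaleC (- \<i>) a) b" for a b :: 'a
      unfolding Re_cinner[symmetric] cinner_scaleC_left by simp
    show "Im (cinner (T x) y) = Im (cinner x (S y))"
      using assms S[of "scaleC (- \<i>) x" y] by (simp add: im complex_linear_def)
  qed
  have bl: "bounded_linear S"
  proof (rule bounded_linear_intro[where K = "norm T"])
    fix x y r
    show "S (x + y) = S x + S y"
      by (rule vector_eq_ldot[THEN iffD1]) (auto simp: inner_add_right simp flip: S)
    show "S (r *\<^sub>R x) = r *\<^sub>R S x"
      by (rule vector_eq_ldot[THEN iffD1]) (auto simp flip: S)
    have "(norm (S x))\<^sup>2 = inner (T (S x)) x" by (simp add: power2_norm_eq_inner S)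
    also have "\<dots> \<le> norm (T (S x)) * norm x" by (rule norm_cauchy_schwarz)
    also have "\<dots> \<le> norm T * norm (S x) * norm x"
      by (intro mult_right_mono norm_blinfun) auto
    finally have "norm (S x) * norm (S x) \<le> norm (S x) * (norm x * norm T)"
      by (simp add: power2_eq_square mult_ac)
    then show "norm (S x) \<le> norm x * norm T"
      by (cases "norm (S x) = 0") (auto simp: mult_le_cancel_left)
  qed
  show ?thesis
    by (rule exI[of _ "Blinfun S"]) (simp add: bounded_linear_Blinfun_apply[OF bl] C)
qed

lemma op_adj_unique:
  assumes "\<And>x y. cinner (blinfun_apply T x) y = cinner x (blinfun_apply S y)"
  shows "op_adj T = S"
  unfolding op_adj_def
proof (rule the_equality)
  fix S' assume "\<forall>x y. cinner (blinfun_apply T x) y = cinner x (blinfun_apply S' y)"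
  then have "cinner x (S' y) = cinner x (S y)" for x y using assms by metis
  then have "S' y = S y" for y by (intro cinner_eq_0_imp_eq) (metis cinner_commute)
  then show "S' = S" by (rule blinfun_eqI)
qed (use assms in blast)

lemma cinner_op_adj:
  assumes "complex_linear T"
  shows "cinner (blinfun_apply T x) y = cinner x (op_adj T y)"
  using op_adj_exists[OF assms] op_adj_unique by metis

lemma cinner_op_adj_left:
  assumes "complex_linear T"
  shows "cinner (op_adj T x) y = cinner x (blinfun_apply T y)"
  by (metis assms cinner_commute cinner_op_adj)

lemma op_adj_op_adj: "complex_linear T \<Longrightarrow> op_adj (op_adj T) = T"
  by (rule op_adj_unique) (rule cinner_op_adj_left)

lemma op_adj_plus:
  "complex_linear S \<Longrightarrow> complex_linear T \<Longrightarrow> op_adj (S + T) = op_adj S + op_adj T"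
  by (rule op_adj_unique)
     (simp add: plus_blinfun.rep_eq cinner_add_left cinner_add_right cinner_op_adj)

lemma op_adj_compose:
  "complex_linear S \<Longrightarrow> complex_linear T \<Longrightarrow> op_adj (S o\<^sub>L T) = op_adj T o\<^sub>L op_adj S"
  by (rule op_adj_unique) (simp add: cinner_op_adj)

lemma op_adj_scaleC:
  "complex_linear T \<Longrightarrow> op_adj (op_scaleC c T) = op_scaleC (cnj c) (op_adj T)"
  by (rule op_adj_unique) (simp add: cinner_op_adj cinner_scaleC_left cinner_scaleC_right)

lemma op_adj_id [simp]: "op_adj id_blinfun = id_blinfun"
  by (rule op_adj_unique) simp

lemma norm_op_adj_le:
  assumes "complex_linear T"
  shows "norm (op_adj T) \<le> norm T"
proof (rule norm_blinfun_bound)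
  fix x
  have "complex_of_real ((norm (op_adj T x))\<^sup>2) = cinner (T (op_adj T x)) x"
    by (simp only: cinner_self[symmetric] cinner_op_adj[OF assms])
  then have "(norm (op_adj T x))\<^sup>2 \<le> norm (T (op_adj T x)) * norm x"
    by (metis cinner_bound norm_of_real abs_of_nonneg zero_le_power2)
  also have "\<dots> \<le> norm T * norm (op_adj T x) * norm x"
    by (intro mult_right_mono norm_blinfun) auto
  finally have "norm (op_adj T x) * norm (op_adj T x) \<le> norm (op_adj T x) * (norm T * norm x)"
    by (simp add: power2_eq_square mult_ac)
  then show "norm (op_adj T x) \<le> norm T * norm x"
    by (cases "norm (op_adj T x) = 0") (auto simp: mult_le_cancel_left)
qed simp

section \<open>Tracial von Neumann algebras and their \<open>L\<^sup>2\<close>-spaces\<close>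

lemma limitin_weak_operator_topology:
  fixes X :: "nat \<Rightarrow> 'h::chilbert_space op"
  assumes "X \<longlonglongrightarrow> T"
  shows "limitin weak_operator_topology X T sequentially"
proof -
  define F where "F = (\<lambda>T::'h op. \<lambda>(x, y). cinner (blinfun_apply T x) y)"
  have "(\<lambda>k. F (X k) p) \<longlonglongrightarrow> F T p" for p
    unfolding F_def split_def by (intro tendsto_intros cinner.tendsto assms blinfun.tendsto)
  then have lim: "limitin euclidean (\<lambda>k. F (X k)) (F T) sequentially"
    unfolding euclidean_product_topology[symmetric] limitin_componentwise by simp
  show ?thesis
    unfolding limitin_def
  proof (intro conjI allI impI)
    fix U assume U: "openin weak_operator_topology U \<and> T \<in> U"
    then obtain G where G: "openin euclidean G" "U = F -` G \<inter> UNIV"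
      unfolding weak_operator_topology_def openin_pullback_topology F_def by blast
    then have "\<forall>\<^sub>F k in sequentially. F (X k) \<in> G" using lim U unfolding limitin_def by auto
    then show "\<forall>\<^sub>F k in sequentially. X k \<in> U" using G by simp
  qed (simp add: weak_operator_topology_def topspace_pullback_topology)
qed

lemma von_neumann_algebra_norm_closed:
  assumes "von_neumann_algebra A" "\<And>k. X k \<in> A" "X \<longlonglongrightarrow> T"
  shows "T \<in> A"
  using assms limitin_closedin[OF limitin_weak_operator_topology[OF assms(3)], of A]
  unfolding von_neumann_algebra_def by simp

lemma blinfun_compose_assoc: "(X o\<^sub>L Y) o\<^sub>L Z = X o\<^sub>L (Y o\<^sub>L Z)"
  by (rule blinfun_eqI) simp

lemma seq_approx:
  fixes x :: "'a::metric_space"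
  assumes "closure (g ` A) = UNIV"
  shows "\<exists>a. range a \<subseteq> A \<and> (\<lambda>j::nat. g (a j)) \<longlonglongrightarrow> x"
proof -
  have "x \<in> closure (g ` A)" using assms by simp
  then obtain s where s: "\<And>k. s k \<in> g ` A" "s \<longlonglongrightarrow> x" unfolding closure_sequential by blast
  then have "\<exists>a. a \<in> A \<and> g a = s k" for k by (metis imageE)
  then obtain a where "\<And>k. a k \<in> A \<and> g (a k) = s k" by metis
  then show ?thesis using s by (intro exI[of _ a]) auto
qed

locale tracial_wstar =
  fixes W :: "('h::chilbert_space, 'l::chilbert_space) wstar_space"
  assumes tracial: "tracial_wstar_space W"
begin

abbreviation "A \<equiv> wstar_alg W"
abbreviation "\<phi> \<equiv> wstar_state W"
abbreviation "\<iota> \<equiv> wstar_emb W"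

lemma vna: "von_neumann_algebra A"
  using tracial unfolding tracial_wstar_space_def Let_def by simp

lemma A_linear: "X \<in> A \<Longrightarrow> complex_linear X"
  and A_id [simp]: "id_blinfun \<in> A"
  and A_add [simp]: "X \<in> A \<Longrightarrow> Y \<in> A \<Longrightarrow> X + Y \<in> A"
  and A_compose [simp]: "X \<in> A \<Longrightarrow> Y \<in> A \<Longrightarrow> X o\<^sub>L Y \<in> A"
  and A_scale [simp]: "X \<in> A \<Longrightarrow> op_scaleC c X \<in> A"
  and A_adj [simp]: "X \<in> A \<Longrightarrow> op_adj X \<in> A"
  using vna unfolding von_neumann_algebra_def by auto

lemmas tracialD = tracial[unfolded tracial_wstar_space_def Let_def]

lemma state_add: "X \<in> A \<Longrightarrow> Y \<in> A \<Longrightarrow> \<phi> (X + Y) = \<phi> X + \<phi> Y"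
  using tracialD[THEN conjunct2, THEN conjunct1] by blast

lemma state_scale: "X \<in> A \<Longrightarrow> \<phi> (op_scaleC c X) = c * \<phi> X"
  using tracialD[THEN conjunct2, THEN conjunct2, THEN conjunct1] by blast

lemma state_id [simp]: "\<phi> id_blinfun = 1"
  by (rule tracialD[THEN conjunct2, THEN conjunct2, THEN conjunct2, THEN conjunct1])

lemma state_continuous: "continuous_map (subtopology weak_operator_topology A) euclidean \<phi>"
  by (rule tracialD[THEN conjunct2, THEN conjunct2, THEN conjunct2, THEN conjunct2, THEN conjunct1])

lemma state_trace: "X \<in> A \<Longrightarrow> Y \<in> A \<Longrightarrow> \<phi> (X o\<^sub>L Y) = \<phi> (Y o\<^sub>L X)"
  using tracialD[THEN conjunct2, THEN conjunct2, THEN conjunct2, THEN conjunct2, THEN conjunct2, THEN conjunct2, THEN conjunct2, THEN conjunct1] by blast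

lemma emb_add: "X \<in> A \<Longrightarrow> Y \<in> A \<Longrightarrow> \<iota> (X + Y) = \<iota> X + \<iota> Y"
  using tracialD[THEN conjunct2, THEN conjunct2, THEN conjunct2, THEN conjunct2, THEN conjunct2, THEN conjunct2, THEN conjunct2, THEN conjunct2, THEN conjunct1] by blast

lemma emb_scale: "X \<in> A \<Longrightarrow> \<iota> (op_scaleC c X) = scaleC c (\<iota> X)"
  using tracialD[THEN conjunct2, THEN conjunct2, THEN conjunct2, THEN conjunct2, THEN conjunct2, THEN conjunct2, THEN conjunct2, THEN conjunct2, THEN conjunct2, THEN conjunct1] by blast

lemma cinner_emb: "X \<in> A \<Longrightarrow> Y \<in> A \<Longrightarrow> cinner (\<iota> X) (\<iota> Y) = \<phi> (X o\<^sub>L op_adj Y)"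
  using tracialD[THEN conjunct2, THEN conjunct2, THEN conjunct2, THEN conjunct2, THEN conjunct2, THEN conjunct2, THEN conjunct2, THEN conjunct2, THEN conjunct2, THEN conjunct2, THEN conjunct1] by blast

lemma emb_dense: "closure (\<iota> ` A) = UNIV"
  by (rule tracialD[THEN conjunct2, THEN conjunct2, THEN conjunct2, THEN conjunct2, THEN conjunct2, THEN conjunct2, THEN conjunct2, THEN conjunct2, THEN conjunct2, THEN conjunct2, THEN conjunct2])

lemmas A_adj_adj [simp] = op_adj_op_adj[OF A_linear]

lemma A_adj_compose: "X \<in> A \<Longrightarrow> Y \<in> A \<Longrightarrow> op_adj (X o\<^sub>L Y) = op_adj Y o\<^sub>L op_adj X"
  by (simp add: op_adj_compose A_linear)

lemma op_scaleC_minus1: "op_scaleC (-1) X = - X"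
  by (rule blinfun_eqI) (simp add: scaleC_minus1 uminus_blinfun.rep_eq)

lemma A_minus [simp]: "X \<in> A \<Longrightarrow> - X \<in> A"
  using A_scale[of X "-1"] by (simp add: op_scaleC_minus1)

lemma A_diff [simp]: "X \<in> A \<Longrightarrow> Y \<in> A \<Longrightarrow> X - Y \<in> A"
  using A_add[of X "- Y"] by simp

lemma emb_diff: "X \<in> A \<Longrightarrow> Y \<in> A \<Longrightarrow> \<iota> (X - Y) = \<iota> X - \<iota> Y"
  using emb_add[of X "- Y"] emb_scale[of Y "-1"] by (simp add: op_scaleC_minus1 scaleC_minus1)

lemma cinner_emb_left:
  assumes "X \<in> A" "Y \<in> A" "Z \<in> A"
  shows "cinner (\<iota> (X o\<^sub>L Y)) (\<iota> Z) = cinner (\<iota> Y) (\<iota> (op_adj X o\<^sub>L Z))"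
  using assms state_trace[of X "Y o\<^sub>L op_adj Z"]
  by (simp add: cinner_emb A_adj_compose blinfun_compose_assoc)

lemma cinner_emb_adj:
  assumes "X \<in> A" "Y \<in> A"
  shows "cinner (\<iota> (op_adj X)) (\<iota> (op_adj Y)) = cinner (\<iota> Y) (\<iota> X)"
  using assms state_trace[of "op_adj X" Y] by (simp add: cinner_emb)

lemma norm_emb_adj: "X \<in> A \<Longrightarrow> norm (\<iota> (op_adj X)) = norm (\<iota> X)"
  by (rule power2_eq_imp_eq) (simp_all add: norm_eq_sqrt_Re_cinner cinner_emb_adj)

text \<open>Weak continuity makes the trace bounded for the operator norm: otherwise there would be
  operators of norm tending to \<open>0\<close> on which it takes the value \<open>1\<close>.\<close>

lemma state_bounded: "\<exists>C. \<forall>X\<in>A. cmod (\<phi> X) \<le> C * norm X"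
proof (rule ccontr)
  assume "\<nexists>C. \<forall>X\<in>A. cmod (\<phi> X) \<le> C * norm X"
  then have "\<forall>k::nat. \<exists>X. X \<in> A \<and> cmod (\<phi> X) > real (Suc k) * norm X" by (metis not_le)
  then obtain X where X: "\<And>k. X k \<in> A" "\<And>k::nat. cmod (\<phi> (X k)) > real (Suc k) * norm (X k)"
    by metis
  have nz: "\<phi> (X k) \<noteq> 0" for k
  proof
    assume "\<phi> (X k) = 0"
    then have "real (Suc k) * norm (X k) < 0" using X(2)[of k] by simp
    moreover have "0 \<le> real (Suc k) * norm (X k)" by simp
    ultimately show False by linarith
  qed
  define Y where "Y k = op_scaleC (inverse (\<phi> (X k))) (X k)" for k
  have YA: "Y k \<in> A" for k using X(1) by (simp add: Y_def)
  have Y1: "\<phi> (Y k) = 1" for k using X(1) nz by (simp add: Y_def state_scale)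
  have "norm (Y k) \<le> inverse (real (Suc k))" for k
  proof (rule norm_blinfun_bound)
    fix x
    have "norm (Y k x) = norm (X k x) / cmod (\<phi> (X k))"
      by (simp add: Y_def norm_scaleC norm_inverse divide_inverse_commute)
    also have "\<dots> \<le> (norm (X k) * norm x) / cmod (\<phi> (X k))"
      by (intro divide_right_mono norm_blinfun) simp
    also have "\<dots> = (norm (X k) / cmod (\<phi> (X k))) * norm x" by simp
    also have "\<dots> \<le> inverse (real (Suc k)) * norm x"
      using X(2)[of k] nz[of k] by (intro mult_right_mono) (auto simp: field_simps)
    finally show "norm (Y k x) \<le> inverse (real (Suc k)) * norm x" .
  qed simp
  then have "Y \<longlonglongrightarrow> 0"
    by (intro Lim_null_comparison[OF _ LIMSEQ_inverse_real_of_nat]) auto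
  then have "limitin (subtopology weak_operator_topology A) Y 0 sequentially"
    using YA limitin_weak_operator_topology[of Y 0] von_neumann_algebra_norm_closed[OF vna]
    by (auto simp: limitin_subtopology)
  then have "limitin euclidean (\<phi> \<circ> Y) (\<phi> 0) sequentially"
    by (rule continuous_map_limit[OF state_continuous])
  moreover have "\<phi> 0 = 0" using state_add[of 0 0] von_neumann_algebra_norm_closed[OF vna YA \<open>Y \<longlonglongrightarrow> 0\<close>] by simp
  ultimately have "(\<lambda>k::nat. 1::complex) \<longlonglongrightarrow> 0" by (simp add: o_def Y1)
  then show False using LIMSEQ_unique[OF tendsto_const] by fastforce
qed

text \<open>Left multiplication is bounded for the \<open>L\<^sup>2\<close>-norm.  The usual proof takes the square root of
  \<open>\<parallel>Z\<parallel> - Z\<close> for \<open>Z = X\<^sup>*X\<close>; the following argument needs no functional calculus.  The \<open>L\<^sup>2\<close>-norms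
  of \<open>Z\<^sup>k Y\<close> are logarithmically convex in \<open>k\<close>, and by the boundedness of the trace they grow at most
  like \<open>\<parallel>Z\<parallel>\<^sup>k\<close>; hence already their first ratio is bounded by \<open>\<parallel>Z\<parallel>\<close>.\<close>

lemma norm_emb_compose_selfadjoint:
  assumes Z: "Z \<in> A" "op_adj Z = Z" and Y: "Y \<in> A"
  shows "norm (\<iota> (Z o\<^sub>L Y)) \<le> norm Z * norm (\<iota> Y)"
proof (rule ccontr)
  assume neg: "\<not> norm (\<iota> (Z o\<^sub>L Y)) \<le> norm Z * norm (\<iota> Y)"
  define P where "P k = ((o\<^sub>L) Z ^^ k) Y" for k
  define n where "n k = norm (\<iota> (P k))" for k
  have P0: "P 0 = Y" and PS: "P (Suc k) = Z o\<^sub>L P k" for k by (simp_all add: P_def)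
  have PA: "P k \<in> A" for k by (induction k) (auto simp: P0 PS Z Y)
  have conv: "(n (Suc k))\<^sup>2 \<le> n k * n (Suc (Suc k))" for k
  proof -
    have "(n (Suc k))\<^sup>2 = Re (cinner (\<iota> (P k)) (\<iota> (P (Suc (Suc k)))))"
      using cinner_emb_left[OF Z(1) PA[of k] PA[of "Suc k"]]
      by (simp add: n_def norm_eq_sqrt_Re_cinner PS Z)
    also have "\<dots> \<le> cmod (cinner (\<iota> (P k)) (\<iota> (P (Suc (Suc k)))))" by (rule complex_Re_le_cmod)
    also have "\<dots> \<le> n k * n (Suc (Suc k))" unfolding n_def by (rule cinner_bound)
    finally show ?thesis .
  qed
  obtain C' where C': "\<And>X. X \<in> A \<Longrightarrow> cmod (\<phi> X) \<le> C' * norm X" using state_bounded by blast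
  define C where "C = max C' 0"
  have C: "cmod (\<phi> X) \<le> C * norm X" if "X \<in> A" for X
    using C'[OF that] mult_right_mono[of C' C "norm X"] by (simp add: C_def)
  have "C \<ge> 0" by (simp add: C_def)
  have Pn: "norm (P k) \<le> norm Z ^ k * norm Y" for k
  proof (induction k)
    case (Suc k)
    have "norm (P (Suc k)) \<le> norm Z * norm (P k)" unfolding PS by (rule norm_blinfun_compose)
    also have "\<dots> \<le> norm Z * (norm Z ^ k * norm Y)" by (intro mult_left_mono Suc) simp
    finally show ?case by simp
  qed (simp add: P0)
  have up: "(n k)\<^sup>2 \<le> C * (norm Z ^ k * norm Y)\<^sup>2" for k
  proof -
    have "(n k)\<^sup>2 = Re (\<phi> (P k o\<^sub>L op_adj (P k)))"
      using PA by (simp add: n_def norm_eq_sqrt_Re_cinner cinner_emb)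
    also have "\<dots> \<le> C * norm (P k o\<^sub>L op_adj (P k))"
      using PA by (intro order.trans[OF complex_Re_le_cmod C]) simp
    also have "\<dots> \<le> C * (norm (P k) * norm (P k))"
      using norm_op_adj_le[OF A_linear[OF PA[of k]]] \<open>C \<ge> 0\<close>
      by (intro mult_left_mono order.trans[OF norm_blinfun_compose]) auto
    also have "\<dots> \<le> C * ((norm Z ^ k * norm Y) * (norm Z ^ k * norm Y))"
      using \<open>C \<ge> 0\<close> by (intro mult_left_mono mult_mono Pn) auto
    finally show ?thesis by (simp add: power2_eq_square)
  qed
  define r where "r = n 1 / n 0"
  have n0: "n 0 > 0"
  proof (rule ccontr)
    assume "\<not> n 0 > 0"
    then have "n 0 = 0" by (simp add: n_def)
    with conv[of 0] have "n 1 = 0" by simp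
    with neg show False by (simp add: n_def PS P0)
  qed
  have rZ: "r > norm Z"
  proof -
    have "norm Z * n 0 < n 1" using neg by (simp add: n_def PS P0 not_le)
    then show ?thesis using n0 unfolding r_def by (rule pos_less_divide_eq[THEN iffD2, rotated])
  qed
  have r0: "r > 0" using rZ norm_ge_zero[of Z] by linarith
  have n1: "n (Suc 0) = r * n 0" using n0 by (simp add: r_def)
  have step: "n (Suc (Suc k)) \<ge> r * n (Suc k)" if k: "n k > 0" "n (Suc k) \<ge> r * n k" for k
  proof -
    have p: "0 \<le> n (Suc k)" by (simp add: n_def)
    have "(r * n (Suc k)) * n k = n (Suc k) * (r * n k)" by (simp only: mult_ac)
    also have "\<dots> \<le> n (Suc k) * n (Suc k)" by (rule mult_left_mono[OF k(2) p])
    also have "\<dots> \<le> n (Suc (Suc k)) * n k"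
      using conv[of k] by (simp only: power2_eq_square mult.commute)
    finally show ?thesis by (rule mult_right_le_imp_le) (rule k(1))
  qed
  have pos: "n k > 0 \<and> n (Suc k) \<ge> r * n k" for k
  proof (induction k)
    case 0 show ?case using n0 n1 by (simp only: order.refl simp_thms)
  next
    case (Suc k)
    have "0 < r * n k" using Suc r0 by (intro mult_pos_pos) auto
    then show ?case using Suc step[of k] by linarith
  qed
  have low: "r ^ k * n 0 \<le> n k" for k
  proof (induction k)
    case (Suc k)
    have "r ^ Suc k * n 0 = r * (r ^ k * n 0)" by simp
    also have "\<dots> \<le> r * n k" using Suc r0 by (intro mult_left_mono) auto
    also have "\<dots> \<le> n (Suc k)" using pos by blast
    finally show ?case .
  qed simp
  have both: "(r ^ k * n 0)\<^sup>2 \<le> C * (norm Z ^ k * norm Y)\<^sup>2" for k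
    using r0 n0 by (intro order.trans[OF power_mono[OF low[of k]] up]) simp
  have rat: "(n 0)\<^sup>2 \<le> C * (norm Y)\<^sup>2 * ((norm Z / r)\<^sup>2) ^ k" for k
  proof -
    have "(n 0)\<^sup>2 * (r ^ k)\<^sup>2 \<le> C * (norm Y)\<^sup>2 * (norm Z ^ k)\<^sup>2"
      using both[of k] by (simp add: power_mult_distrib mult_ac)
    then have "(n 0)\<^sup>2 \<le> C * (norm Y)\<^sup>2 * (norm Z ^ k)\<^sup>2 / (r ^ k)\<^sup>2"
      using r0 by (simp add: pos_le_divide_eq)
    also have "\<dots> = C * (norm Y)\<^sup>2 * ((norm Z / r)\<^sup>2) ^ k"
      by (simp add: power_divide power_mult[symmetric] mult.commute)
    finally show ?thesis .
  qed
  have "norm Z / r < 1" using rZ r0 by simp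
  then have "(norm Z / r)\<^sup>2 < 1" using r0 by (intro power_less_one_iff[THEN iffD2]) auto
  then have "(\<lambda>k. C * (norm Y)\<^sup>2 * ((norm Z / r)\<^sup>2) ^ k) \<longlonglongrightarrow> C * (norm Y)\<^sup>2 * 0"
    by (intro tendsto_intros LIMSEQ_realpow_zero) auto
  then have "(n 0)\<^sup>2 \<le> 0" using rat by (intro LIMSEQ_le_const) (auto intro: exI[of _ 0])
  then show False using n0 by simp
qed

lemma norm_emb_compose_bound: "X \<in> A \<Longrightarrow> \<exists>C\<ge>0. \<forall>Y\<in>A. norm (\<iota> (X o\<^sub>L Y)) \<le> C * norm (\<iota> Y)"
proof (intro exI conjI ballI)
  fix Y assume X: "X \<in> A" and Y: "Y \<in> A"
  define Z where "Z = op_adj X o\<^sub>L X"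
  have Z: "Z \<in> A" "op_adj Z = Z" using X by (simp_all add: Z_def A_adj_compose)
  have "(norm (\<iota> (X o\<^sub>L Y)))\<^sup>2 = Re (cinner (\<iota> Y) (\<iota> (Z o\<^sub>L Y)))"
    using X Y by (simp add: norm_eq_sqrt_Re_cinner cinner_emb_left Z_def blinfun_compose_assoc)
  also have "\<dots> \<le> norm (\<iota> Y) * norm (\<iota> (Z o\<^sub>L Y))"
    by (rule order.trans[OF complex_Re_le_cmod cinner_bound])
  also have "\<dots> \<le> norm (\<iota> Y) * (norm Z * norm (\<iota> Y))"
    using norm_emb_compose_selfadjoint[OF Z Y] by (intro mult_left_mono) auto
  also have "\<dots> = (sqrt (norm Z) * norm (\<iota> Y))\<^sup>2" by (simp add: power2_eq_square)
  finally show "norm (\<iota> (X o\<^sub>L Y)) \<le> sqrt (norm (op_adj X o\<^sub>L X)) * norm (\<iota> Y)"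
    unfolding Z_def by (rule power2_le_imp_le) simp
qed simp

end

context tracial_wstar
begin

lemma blinfun_compose_id [simp]: "X o\<^sub>L id_blinfun = X" "id_blinfun o\<^sub>L X = X"
  by (auto intro: blinfun_eqI)

declare cinner.zero_left [simp] cinner.zero_right [simp]

section \<open>The involution and the left action on \<open>L\<^sup>2\<close>\<close>

definition approximates :: "(nat \<Rightarrow> 'h op) \<Rightarrow> 'l \<Rightarrow> bool" where
  "approximates a \<xi> \<longleftrightarrow> range a \<subseteq> A \<and> (\<lambda>j. \<iota> (a j)) \<longlonglongrightarrow> \<xi>"

lemma approximates_exists: "\<exists>a. approximates a \<xi>"
  unfolding approximates_def by (rule seq_approx[OF emb_dense])

lemma approximates_const: "X \<in> A \<Longrightarrow> approximates (\<lambda>_. X) (\<iota> X)"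
  by (auto simp: approximates_def)

lemma approximates_add:
  assumes "approximates a \<xi>" "approximates b \<eta>"
  shows "approximates (\<lambda>j. a j + b j) (\<xi> + \<eta>)"
proof -
  have m: "a j \<in> A" "b j \<in> A" for j using assms by (auto simp: approximates_def)
  show ?thesis using assms m unfolding approximates_def by (auto simp: emb_add intro: tendsto_add)
qed

lemma approximates_scale:
  assumes "approximates a \<xi>"
  shows "approximates (\<lambda>j. op_scaleC c (a j)) (scaleC c \<xi>)"
proof -
  have m: "a j \<in> A" for j using assms by (auto simp: approximates_def)
  show ?thesis using assms m unfolding approximates_def
    by (auto simp: emb_scale intro: scaleC.tendsto tendsto_const)
qed

text \<open>Additive maps that are bounded for the \<open>L\<^sup>2\<close>-norm extend from the dense subspace of bounded
  elements to \<open>L\<^sup>2\<close>.  The limit does not depend on the approximating sequence, so that the choice in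
  the definitions of the involution \<open>J\<close> and of the left multiplication \<open>Lm\<close> is unique.\<close>

lemma bounded_extension:
  assumes T: "\<And>X. X \<in> A \<Longrightarrow> T X \<in> A"
    and diff: "\<And>X Y. X \<in> A \<Longrightarrow> Y \<in> A \<Longrightarrow> T (X - Y) = T X - T Y"
    and bound: "\<And>X. X \<in> A \<Longrightarrow> norm (\<iota> (T X)) \<le> C * norm (\<iota> X)"
  shows "\<exists>\<eta>. \<forall>a. approximates a \<xi> \<longrightarrow> (\<lambda>j. \<iota> (T (a j))) \<longlonglongrightarrow> \<eta>"
proof -
  obtain s where s: "approximates s \<xi>" using approximates_exists by blast
  have sA: "s j \<in> A" for j using s by (auto simp: approximates_def)
  have d: "norm (\<iota> (T X) - \<iota> (T Y)) \<le> \<bar>C\<bar> * norm (\<iota> X - \<iota> Y)" if "X \<in> A" "Y \<in> A" for X Y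
  proof -
    have "norm (\<iota> (T X) - \<iota> (T Y)) = norm (\<iota> (T (X - Y)))"
      unfolding diff[OF that] emb_diff[OF T[OF that(1)] T[OF that(2)]] ..
    also have "\<dots> \<le> C * norm (\<iota> (X - Y))" by (rule bound[OF A_diff[OF that]])
    also have "\<dots> \<le> \<bar>C\<bar> * norm (\<iota> X - \<iota> Y)"
      unfolding emb_diff[OF that] by (rule mult_right_mono) simp_all
    finally show ?thesis .
  qed
  have "Cauchy (\<lambda>j. \<iota> (T (s j)))"
  proof (rule metric_CauchyI)
    fix e :: real assume e: "e > 0"
    have "(\<lambda>j. \<iota> (s j)) \<longlonglongrightarrow> \<xi>" using s unfolding approximates_def by (rule conjunct2)
    then have C: "Cauchy (\<lambda>j. \<iota> (s j))" by (rule LIMSEQ_imp_Cauchy)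
    have "0 < \<bar>C\<bar> + 1" by linarith
    then have "0 < e / (\<bar>C\<bar> + 1)" using e by (intro divide_pos_pos)
    from metric_CauchyD[OF C this] obtain N
      where N: "\<And>i j. i \<ge> N \<Longrightarrow> j \<ge> N \<Longrightarrow> dist (\<iota> (s i)) (\<iota> (s j)) < e / (\<bar>C\<bar> + 1)"
      by blast
    have "dist (\<iota> (T (s i))) (\<iota> (T (s j))) < e" if "i \<ge> N" "j \<ge> N" for i j
    proof -
      have "dist (\<iota> (T (s i))) (\<iota> (T (s j))) \<le> \<bar>C\<bar> * dist (\<iota> (s i)) (\<iota> (s j))"
        unfolding dist_norm by (rule d[OF sA sA])
      also have "\<dots> \<le> (\<bar>C\<bar> + 1) * dist (\<iota> (s i)) (\<iota> (s j))" by (intro mult_right_mono) auto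
      also have "\<dots> < (\<bar>C\<bar> + 1) * (e / (\<bar>C\<bar> + 1))"
        by (rule mult_strict_left_mono[OF N[OF that] \<open>0 < \<bar>C\<bar> + 1\<close>])
      also have "\<dots> = e" using \<open>0 < \<bar>C\<bar> + 1\<close> by (simp only: times_divide_eq_right nonzero_mult_div_cancel_left less_irrefl)
      finally show ?thesis .
    qed
    then show "\<exists>N. \<forall>i\<ge>N. \<forall>j\<ge>N. dist (\<iota> (T (s i))) (\<iota> (T (s j))) < e" by blast
  qed
  from Cauchy_convergent[OF this] obtain \<eta> where \<eta>: "(\<lambda>j. \<iota> (T (s j))) \<longlonglongrightarrow> \<eta>"
    unfolding convergent_def by blast
  have "(\<lambda>j. \<iota> (T (a j))) \<longlonglongrightarrow> \<eta>" if a: "approximates a \<xi>" for a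
  proof -
    have aA: "a j \<in> A" for j using a by (auto simp: approximates_def)
    have "(\<lambda>j. \<iota> (a j) - \<iota> (s j)) \<longlonglongrightarrow> \<xi> - \<xi>"
      using a s unfolding approximates_def by (intro tendsto_diff) auto
    then have "(\<lambda>j. \<bar>C\<bar> * norm (\<iota> (a j) - \<iota> (s j))) \<longlonglongrightarrow> \<bar>C\<bar> * norm (\<xi> - \<xi>)"
      by (rule tendsto_mult_left[OF tendsto_norm])
    then have lim: "(\<lambda>j. \<bar>C\<bar> * norm (\<iota> (a j) - \<iota> (s j))) \<longlonglongrightarrow> 0" by simp
    have "(\<lambda>j. \<iota> (T (a j)) - \<iota> (T (s j))) \<longlonglongrightarrow> 0"
      by (rule Lim_null_comparison[OF always_eventually lim]) (intro allI d aA sA)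
    from tendsto_add[OF this \<eta>] show ?thesis by simp
  qed
  then show ?thesis by blast
qed

definition J :: "'l \<Rightarrow> 'l" where
  "J \<xi> = (SOME \<eta>. \<forall>a. approximates a \<xi> \<longrightarrow> (\<lambda>j. \<iota> (op_adj (a j))) \<longlonglongrightarrow> \<eta>)"

definition Lm :: "'h op \<Rightarrow> 'l \<Rightarrow> 'l" where
  "Lm X \<xi> = (SOME \<eta>. \<forall>a. approximates a \<xi> \<longrightarrow> (\<lambda>j. \<iota> (X o\<^sub>L a j)) \<longlonglongrightarrow> \<eta>)"

lemma op_adj_minus: "complex_linear X \<Longrightarrow> op_adj (- X) = - op_adj X"
  using op_adj_scaleC[of X "-1"] by (simp add: op_scaleC_minus1)

lemma J_approx: "approximates a \<xi> \<Longrightarrow> (\<lambda>j. \<iota> (op_adj (a j))) \<longlonglongrightarrow> J \<xi>"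
proof -
  have "op_adj (X - Y) = op_adj X - op_adj Y" if "X \<in> A" "Y \<in> A" for X Y
    using op_adj_plus[of X "- Y"] that A_linear A_minus by (simp add: op_adj_minus)
  then have "\<exists>\<eta>. \<forall>a. approximates a \<xi> \<longrightarrow> (\<lambda>j. \<iota> (op_adj (a j))) \<longlonglongrightarrow> \<eta>"
    by (intro bounded_extension[where C = 1]) (auto simp: norm_emb_adj)
  then show "approximates a \<xi> \<Longrightarrow> (\<lambda>j. \<iota> (op_adj (a j))) \<longlonglongrightarrow> J \<xi>"
    unfolding J_def by (rule someI2_ex) blast
qed

lemma blinfun_compose_diff_right: "X o\<^sub>L (Y - Z) = (X o\<^sub>L Y) - (X o\<^sub>L Z)"
  by (rule blinfun_eqI) (simp add: blinfun.diff_right minus_blinfun.rep_eq)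

lemma Lm_approx:
  assumes "X \<in> A"
  shows "approximates a \<xi> \<Longrightarrow> (\<lambda>j. \<iota> (X o\<^sub>L a j)) \<longlonglongrightarrow> Lm X \<xi>"
proof -
  obtain C where "\<forall>Y\<in>A. norm (\<iota> (X o\<^sub>L Y)) \<le> C * norm (\<iota> Y)"
    using norm_emb_compose_bound[OF assms] by blast
  then have "\<exists>\<eta>. \<forall>a. approximates a \<xi> \<longrightarrow> (\<lambda>j. \<iota> (X o\<^sub>L a j)) \<longlonglongrightarrow> \<eta>"
    using assms by (intro bounded_extension[where C = C]) (auto simp: blinfun_compose_diff_right)
  then show "approximates a \<xi> \<Longrightarrow> (\<lambda>j. \<iota> (X o\<^sub>L a j)) \<longlonglongrightarrow> Lm X \<xi>"
    unfolding Lm_def by (rule someI2_ex) blast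
qed

lemma J_emb [simp]: "X \<in> A \<Longrightarrow> J (\<iota> X) = \<iota> (op_adj X)"
  using LIMSEQ_unique[OF J_approx[OF approximates_const] tendsto_const] by simp

lemma Lm_emb [simp]: "X \<in> A \<Longrightarrow> Y \<in> A \<Longrightarrow> Lm X (\<iota> Y) = \<iota> (X o\<^sub>L Y)"
  using LIMSEQ_unique[OF Lm_approx[OF _ approximates_const] tendsto_const] by simp

lemma approximates_J:
  assumes "approximates a \<xi>"
  shows "approximates (\<lambda>j. op_adj (a j)) (J \<xi>)"
  using J_approx[OF assms] assms unfolding approximates_def by auto

lemma approximates_Lm:
  assumes "X \<in> A" "approximates a \<xi>"
  shows "approximates (\<lambda>j. X o\<^sub>L a j) (Lm X \<xi>)"
  using Lm_approx[OF assms] assms unfolding approximates_def by auto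

lemma is_l2_adjoint_iff: "is_l2_adjoint W \<xi> \<eta> \<longleftrightarrow> \<eta> = J \<xi>"
proof
  obtain a where a: "approximates a \<xi>" using approximates_exists by blast
  assume "is_l2_adjoint W \<xi> \<eta>"
  then have "(\<lambda>j. \<iota> (op_adj (a j))) \<longlonglongrightarrow> \<eta>"
    using a unfolding is_l2_adjoint_def approximates_def by blast
  then show "\<eta> = J \<xi>" using J_approx[OF a] LIMSEQ_unique by blast
next
  assume "\<eta> = J \<xi>"
  then show "is_l2_adjoint W \<xi> \<eta>"
    unfolding is_l2_adjoint_def using J_approx unfolding approximates_def by blast
qed

lemma J_add: "J (\<xi> + \<eta>) = J \<xi> + J \<eta>"
proof -
  obtain a where a: "approximates a \<xi>" using approximates_exists by blast
  obtain b where b: "approximates b \<eta>" using approximates_exists by blast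
  have m: "a j \<in> A" "b j \<in> A" for j using a b by (auto simp: approximates_def)
  have "(\<lambda>j. \<iota> (op_adj (a j + b j))) \<longlonglongrightarrow> J \<xi> + J \<eta>"
    using tendsto_add[OF J_approx[OF a] J_approx[OF b]] m
    by (simp add: op_adj_plus A_linear emb_add)
  then show ?thesis using LIMSEQ_unique J_approx[OF approximates_add[OF a b]] by blast
qed

lemma J_scale: "J (scaleC c \<xi>) = scaleC (cnj c) (J \<xi>)"
proof -
  obtain a where a: "approximates a \<xi>" using approximates_exists by blast
  have m: "a j \<in> A" for j using a by (auto simp: approximates_def)
  have "(\<lambda>j. \<iota> (op_adj (op_scaleC c (a j)))) \<longlonglongrightarrow> scaleC (cnj c) (J \<xi>)"
    using scaleC.tendsto[OF tendsto_const J_approx[OF a]] m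
    by (simp add: op_adj_scaleC A_linear emb_scale)
  then show ?thesis using LIMSEQ_unique J_approx[OF approximates_scale[OF a]] by blast
qed

lemma J_J [simp]: "J (J \<xi>) = \<xi>"
proof -
  obtain a where a: "approximates a \<xi>" using approximates_exists by blast
  have m: "a j \<in> A" for j using a by (auto simp: approximates_def)
  have "(\<lambda>j. \<iota> (a j)) \<longlonglongrightarrow> J (J \<xi>)" using J_approx[OF approximates_J[OF a]] m by simp
  then show ?thesis using a LIMSEQ_unique unfolding approximates_def by blast
qed

lemma J_diff: "J (\<xi> - \<eta>) = J \<xi> - J \<eta>"
  using J_add[of \<xi> "scaleC (-1) \<eta>"] J_scale[of "-1" \<eta>] by (simp add: scaleC_minus1)

lemma cinner_J: "cinner (J \<xi>) (J \<eta>) = cinner \<eta> \<xi>"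
proof -
  obtain a where a: "approximates a \<xi>" using approximates_exists by blast
  obtain b where b: "approximates b \<eta>" using approximates_exists by blast
  have m: "a j \<in> A" "b j \<in> A" for j using a b by (auto simp: approximates_def)
  have "(\<lambda>j. cinner (\<iota> (b j)) (\<iota> (a j))) \<longlonglongrightarrow> cinner (J \<xi>) (J \<eta>)"
    using cinner.tendsto[OF J_approx[OF a] J_approx[OF b]] m by (simp add: cinner_emb_adj)
  moreover have "(\<lambda>j. cinner (\<iota> (b j)) (\<iota> (a j))) \<longlonglongrightarrow> cinner \<eta> \<xi>"
    using a b unfolding approximates_def by (intro cinner.tendsto) auto
  ultimately show ?thesis using LIMSEQ_unique by blast
qed

lemma norm_J: "norm (J \<xi>) = norm \<xi>"
  by (rule power2_eq_imp_eq) (simp_all add: norm_eq_sqrt_Re_cinner cinner_J)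

lemma cinner_Lm:
  assumes X: "X \<in> A"
  shows "cinner (Lm X \<xi>) \<eta> = cinner \<xi> (Lm (op_adj X) \<eta>)"
proof -
  obtain a where a: "approximates a \<xi>" using approximates_exists by blast
  obtain b where b: "approximates b \<eta>" using approximates_exists by blast
  have m: "a j \<in> A" "b j \<in> A" for j using a b by (auto simp: approximates_def)
  have "(\<lambda>j. cinner (\<iota> (X o\<^sub>L a j)) (\<iota> (b j))) \<longlonglongrightarrow> cinner (Lm X \<xi>) \<eta>"
    using b by (intro cinner.tendsto Lm_approx X a) (auto simp: approximates_def)
  moreover have "(\<lambda>j. cinner (\<iota> (a j)) (\<iota> (op_adj X o\<^sub>L b j))) \<longlonglongrightarrow> cinner \<xi> (Lm (op_adj X) \<eta>)"
    using a X by (intro cinner.tendsto Lm_approx b) (auto simp: approximates_def)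
  ultimately show ?thesis using LIMSEQ_unique m X by (simp add: cinner_emb_left)
qed

lemma Lm_compose:
  assumes "X \<in> A" "Y \<in> A"
  shows "Lm (X o\<^sub>L Y) \<xi> = Lm X (Lm Y \<xi>)"
proof -
  obtain a where a: "approximates a \<xi>" using approximates_exists by blast
  have "(\<lambda>j. \<iota> (X o\<^sub>L Y o\<^sub>L a j)) \<longlonglongrightarrow> Lm X (Lm Y \<xi>)"
    unfolding blinfun_compose_assoc by (rule Lm_approx[OF assms(1) approximates_Lm[OF assms(2) a]])
  then show ?thesis by (rule LIMSEQ_unique[OF Lm_approx[OF A_compose[OF assms] a]])
qed

lemma Lm_id [simp]: "Lm id_blinfun \<xi> = \<xi>"
proof -
  obtain a where a: "approximates a \<xi>" using approximates_exists by blast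
  show ?thesis
    using LIMSEQ_unique[OF Lm_approx[OF A_id a]] a unfolding approximates_def by simp
qed

lemma Lm_bound:
  assumes X: "X \<in> A" and C: "\<And>Y. Y \<in> A \<Longrightarrow> norm (\<iota> (X o\<^sub>L Y)) \<le> C * norm (\<iota> Y)"
  shows "norm (Lm X \<xi>) \<le> C * norm \<xi>"
proof -
  obtain a where a: "approximates a \<xi>" using approximates_exists by blast
  have m: "a j \<in> A" for j using a by (auto simp: approximates_def)
  show ?thesis
  proof (rule LIMSEQ_le)
    show "(\<lambda>j. norm (\<iota> (X o\<^sub>L a j))) \<longlonglongrightarrow> norm (Lm X \<xi>)" by (intro tendsto_intros Lm_approx X a)
    show "(\<lambda>j. C * norm (\<iota> (a j))) \<longlonglongrightarrow> C * norm \<xi>"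
      using a unfolding approximates_def by (intro tendsto_intros) auto
  qed (use C m in blast)
qed

lemma emb_total: assumes "\<And>X. X \<in> A \<Longrightarrow> cinner \<xi> (\<iota> X) = cinner \<eta> (\<iota> X)" shows "\<xi> = \<eta>"
proof (rule cinner_eq_0_imp_eq)
  fix \<zeta>
  obtain a where a: "approximates a \<zeta>" using approximates_exists by blast
  have m: "a j \<in> A" for j using a by (auto simp: approximates_def)
  have "(\<lambda>j. cinner \<xi> (\<iota> (a j))) \<longlonglongrightarrow> cinner \<xi> \<zeta>" "(\<lambda>j. cinner \<eta> (\<iota> (a j))) \<longlonglongrightarrow> cinner \<eta> \<zeta>"
    using a unfolding approximates_def by (auto intro: cinner.tendsto tendsto_const)
  then show "cinner \<xi> \<zeta> = cinner \<eta> \<zeta>" using LIMSEQ_unique assms[OF m] by simp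
qed

section \<open>Products in \<open>L\<^sup>2\<close>\<close>

text \<open>The inner product form of the definition: since \<open>\<phi>(a b X\<^sup>*) = \<langle>a, X b\<^sup>*\<rangle>\<close> is continuous in
  \<open>a\<close> and \<open>b\<close> for the \<open>L\<^sup>2\<close>-norm, the limit over approximations can be carried out.\<close>

lemma is_l2_product_iff:
  "is_l2_product W \<xi> \<eta> \<zeta> \<longleftrightarrow> (\<forall>X\<in>A. cinner \<xi> (Lm X (J \<eta>)) = cinner \<zeta> (\<iota> X))"
proof -
  have lim: "(\<lambda>j. \<phi> (a j o\<^sub>L b j o\<^sub>L op_adj X)) \<longlonglongrightarrow> cinner \<xi> (Lm X (J \<eta>))"
    if a: "approximates a \<xi>" and b: "approximates b \<eta>" and X: "X \<in> A" for a b X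
  proof -
    have m: "a j \<in> A" "b j \<in> A" for j using a b by (auto simp: approximates_def)
    have "(\<lambda>j. cinner (\<iota> (a j)) (\<iota> (X o\<^sub>L op_adj (b j)))) \<longlonglongrightarrow> cinner \<xi> (Lm X (J \<eta>))"
      using a unfolding approximates_def by (intro cinner.tendsto Lm_approx X approximates_J b) auto
    then show ?thesis using m X by (simp add: cinner_emb A_adj_compose blinfun_compose_assoc)
  qed
  obtain a where a: "approximates a \<xi>" using approximates_exists by blast
  obtain b where b: "approximates b \<eta>" using approximates_exists by blast
  show ?thesis
  proof
    assume P: "is_l2_product W \<xi> \<eta> \<zeta>"
    show "\<forall>X\<in>A. cinner \<xi> (Lm X (J \<eta>)) = cinner \<zeta> (\<iota> X)"
    proof
      fix X assume X: "X \<in> A"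
      have "range a \<subseteq> A \<and> range b \<subseteq> A \<and> (\<lambda>j. \<iota> (a j)) \<longlonglongrightarrow> \<xi> \<and> (\<lambda>j. \<iota> (b j)) \<longlonglongrightarrow> \<eta>"
        using a b by (simp add: approximates_def)
      then have "(\<lambda>j. \<phi> (a j o\<^sub>L b j o\<^sub>L op_adj X)) \<longlonglongrightarrow> cinner \<zeta> (\<iota> X)"
        using P[unfolded is_l2_product_def, rule_format, of a b X] X by simp
      then show "cinner \<xi> (Lm X (J \<eta>)) = cinner \<zeta> (\<iota> X)"
        by (rule LIMSEQ_unique[OF lim[OF a b X]])
    qed
  next
    assume eq: "\<forall>X\<in>A. cinner \<xi> (Lm X (J \<eta>)) = cinner \<zeta> (\<iota> X)"
    show "is_l2_product W \<xi> \<eta> \<zeta>"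
      unfolding is_l2_product_def
    proof (intro allI impI ballI, elim conjE)
      fix a b X
      assume "range a \<subseteq> A" "range b \<subseteq> A" "(\<lambda>j. \<iota> (a j)) \<longlonglongrightarrow> \<xi>" "(\<lambda>j. \<iota> (b j)) \<longlonglongrightarrow> \<eta>"
        and X: "X \<in> A"
      then have "(\<lambda>j. \<phi> (a j o\<^sub>L b j o\<^sub>L op_adj X)) \<longlonglongrightarrow> cinner \<xi> (Lm X (J \<eta>))"
        by (intro lim) (simp_all add: approximates_def)
      then show "(\<lambda>j. \<phi> (a j o\<^sub>L b j o\<^sub>L op_adj X)) \<longlonglongrightarrow> cinner \<zeta> (\<iota> X)"
        using eq X by simp
    qed
  qed
qed

lemma is_l2_product_unique:
  "is_l2_product W \<xi> \<eta> \<zeta> \<Longrightarrow> is_l2_product W \<xi> \<eta> \<zeta>' \<Longrightarrow> \<zeta> = \<zeta>'"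
  by (rule emb_total) (simp add: is_l2_product_iff)

lemma l2_mult_eq: "is_l2_product W \<xi> \<eta> \<zeta> \<Longrightarrow> l2_mult W \<xi> \<eta> = \<zeta>"
  unfolding l2_mult_def by (rule the_equality) (auto intro: is_l2_product_unique)

lemma Lm_add: "X \<in> A \<Longrightarrow> Lm X (\<xi> + \<eta>) = Lm X \<xi> + Lm X \<eta>"
  by (rule cinner_eq_0_imp_eq) (simp add: cinner_Lm cinner_add_left)

lemma Lm_scale: "X \<in> A \<Longrightarrow> Lm X (scaleC c \<xi>) = scaleC c (Lm X \<xi>)"
  by (rule cinner_eq_0_imp_eq) (simp add: cinner_Lm cinner_scaleC_left)

lemma J_zero [simp]: "J 0 = 0"
  using J_scale[of 0 0] by simp

lemma Lm_zero [simp]: "X \<in> A \<Longrightarrow> Lm X 0 = 0"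
  using Lm_scale[of X 0 0] by simp

lemma Lm_diff: "X \<in> A \<Longrightarrow> Lm X (\<xi> - \<eta>) = Lm X \<xi> - Lm X \<eta>"
  by (rule cinner_eq_0_imp_eq) (simp add: cinner_Lm cinner.diff_left)

lemma is_l2_product_add_left:
  "is_l2_product W \<xi> \<eta> \<zeta> \<Longrightarrow> is_l2_product W \<xi>' \<eta> \<zeta>' \<Longrightarrow> is_l2_product W (\<xi> + \<xi>') \<eta> (\<zeta> + \<zeta>')"
  by (simp add: is_l2_product_iff cinner_add_left)

lemma is_l2_product_add_right:
  "is_l2_product W \<xi> \<eta> \<zeta> \<Longrightarrow> is_l2_product W \<xi> \<eta>' \<zeta>' \<Longrightarrow> is_l2_product W \<xi> (\<eta> + \<eta>') (\<zeta> + \<zeta>')"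
  by (simp add: is_l2_product_iff cinner_add_left cinner_add_right J_add Lm_add)

lemma is_l2_product_scale_left:
  "is_l2_product W \<xi> \<eta> \<zeta> \<Longrightarrow> is_l2_product W (scaleC c \<xi>) \<eta> (scaleC c \<zeta>)"
  by (simp add: is_l2_product_iff cinner_scaleC_left)

lemma is_l2_product_scale_right:
  "is_l2_product W \<xi> \<eta> \<zeta> \<Longrightarrow> is_l2_product W \<xi> (scaleC c \<eta>) (scaleC c \<zeta>)"
  by (simp add: is_l2_product_iff cinner_scaleC_left cinner_scaleC_right J_scale Lm_scale)

lemma is_l2_product_zero_left: "is_l2_product W 0 \<eta> 0"
  by (simp add: is_l2_product_iff)

lemma is_l2_product_zero_right: "is_l2_product W \<xi> 0 0"
  by (simp add: is_l2_product_iff)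

lemma is_l2_product_J:
  assumes "is_l2_product W \<xi> \<eta> \<zeta>"
  shows "is_l2_product W (J \<eta>) (J \<xi>) (J \<zeta>)"
  unfolding is_l2_product_iff
proof
  fix X assume X: "X \<in> A"
  have "cinner (J \<eta>) (Lm X (J (J \<xi>))) = cinner (Lm (op_adj X) (J \<eta>)) \<xi>"
    using cinner_Lm[of "op_adj X" "J \<eta>" \<xi>] X by simp
  also have "\<dots> = cnj (cinner \<zeta> (\<iota> (op_adj X)))"
    using assms X unfolding is_l2_product_iff by (subst cinner_commute) simp
  also have "\<dots> = cinner (J \<zeta>) (\<iota> X)"
    using cinner_J[of \<zeta> "\<iota> (op_adj X)"] X by (subst cinner_commute) simp
  finally show "cinner (J \<eta>) (Lm X (J (J \<xi>))) = cinner (J \<zeta>) (\<iota> X)" .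
qed

lemma l2_one_emb: "l2_one W = \<iota> id_blinfun" by (simp add: l2_one_def)

lemma J_one [simp]: "J (l2_one W) = l2_one W" by (simp add: l2_one_emb)

lemma is_l2_product_one_right: "is_l2_product W \<xi> (l2_one W) \<xi>"
  by (simp add: is_l2_product_iff l2_one_emb)

lemma is_l2_product_one_left: "is_l2_product W (l2_one W) \<xi> \<xi>"
  using is_l2_product_J[OF is_l2_product_one_right[of "J \<xi>"]] by simp

lemma is_l2_product_expect:
  "is_l2_product W \<xi> \<eta> \<zeta> \<Longrightarrow> cinner \<zeta> (l2_one W) = cinner \<xi> (J \<eta>)"
  unfolding is_l2_product_iff l2_one_emb by (drule bspec[OF _ A_id]) simp

end

instance chilbert_space \<subseteq> banach ..

section \<open>Associativity of the product in \<open>L\<^sup>2\<close>\<close>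

text \<open>This identity is the reason why \<open>1 + \<i> t a\<close> is bounded below for self-adjoint \<open>a\<close>, both as an
  operator and as a left multiplication on \<open>L\<^sup>2\<close>.\<close>

lemma norm_add_imaginary:
  fixes x y :: "'a::chilbert_space"
  assumes "cinner y x = cinner x y"
  shows "(norm (x + scaleC (\<i> * complex_of_real t) y))\<^sup>2 = (norm x)\<^sup>2 + t\<^sup>2 * (norm y)\<^sup>2"
proof -
  have "cinner (x + scaleC (\<i> * complex_of_real t) y) (x + scaleC (\<i> * complex_of_real t) y)
     = cinner x x + t\<^sup>2 * cinner y y"
    using assms by (simp add: cinner_add_left cinner_add_right cinner_scaleC_left
        cinner_scaleC_right algebra_simps power2_eq_square)
  then have "complex_of_real ((norm (x + scaleC (\<i> * complex_of_real t) y))\<^sup>2)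
     = complex_of_real ((norm x)\<^sup>2 + t\<^sup>2 * (norm y)\<^sup>2)"
    unfolding cinner_self by simp
  then show ?thesis unfolding of_real_eq_iff .
qed

context tracial_wstar
begin

lemma A_zero [simp]: "0 \<in> A"
proof -
  have "op_scaleC 0 id_blinfun = (0 :: 'h op)" by (rule blinfun_eqI) simp
  then show ?thesis using A_scale[OF A_id, of 0] by simp
qed

lemma neumann_series:
  assumes E: "E \<in> A" and n: "norm E \<le> 1/2"
  shows "\<exists>S\<in>A. (id_blinfun - E) o\<^sub>L S = id_blinfun \<and> S o\<^sub>L (id_blinfun - E) = id_blinfun"
proof -
  interpret comp: bounded_bilinear "(o\<^sub>L) :: 'h op \<Rightarrow> 'h op \<Rightarrow> 'h op"
    by (rule bounded_bilinear_blinfun_compose)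
  define P where "P k = ((o\<^sub>L) E ^^ k) id_blinfun" for k
  have P0: "P 0 = id_blinfun" and PS: "P (Suc k) = E o\<^sub>L P k" for k by (simp_all add: P_def)
  have PS': "P (Suc k) = P k o\<^sub>L E" for k
  proof (induction k)
    case 0 show ?case by (simp only: PS P0 blinfun_compose_id)
  next
    case (Suc k)
    have "P (Suc (Suc k)) = E o\<^sub>L P (Suc k)" by (rule PS)
    also have "\<dots> = (E o\<^sub>L P k) o\<^sub>L E" by (simp only: Suc blinfun_compose_assoc)
    finally show ?case by (simp only: PS)
  qed
  have PA: "P k \<in> A" for k
  proof (induction k)
    case 0 show ?case by (simp only: P0 A_id)
  next
    case (Suc k) show ?case unfolding PS by (rule A_compose[OF E Suc])
  qed
  have Pn: "norm (P k) \<le> (1/2) ^ k" for k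
  proof (induction k)
    case 0 show ?case unfolding P0 by (simp add: norm_blinfun_bound)
  next
    case (Suc k)
    have "norm (P (Suc k)) \<le> norm E * norm (P k)" unfolding PS by (rule norm_blinfun_compose)
    also have "\<dots> \<le> (1/2) * (1/2) ^ k" by (rule mult_mono[OF n Suc]) simp_all
    finally show ?case by simp
  qed
  have sum: "summable P"
    by (rule summable_comparison_test'[of "\<lambda>k. (1/2)^k" 0]) (simp_all add: Pn)
  define S where "S = suminf P"
  have SA: "S \<in> A"
  proof (rule von_neumann_algebra_norm_closed[OF vna])
    show "(\<lambda>n. sum P {..<n}) \<longlonglongrightarrow> S" unfolding S_def by (rule summable_LIMSEQ[OF sum])
    show "sum P {..<n} \<in> A" for n by (induction n) (simp_all add: PA)
  qed
  have head: "S - id_blinfun = (\<Sum>k. P (Suc k))"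
    using suminf_split_head[OF sum] by (simp add: S_def P0)
  have ES: "E o\<^sub>L S = S - id_blinfun"
    unfolding head unfolding S_def PS by (rule bounded_linear.suminf[OF comp.bounded_linear_right sum])
  have SE: "S o\<^sub>L E = S - id_blinfun"
    unfolding head unfolding S_def PS' by (rule bounded_linear.suminf[OF comp.bounded_linear_left sum])
  show ?thesis
    by (rule bexI[OF _ SA]) (simp add: comp.diff_left comp.diff_right ES SE)
qed

definition affine_op :: "'h op \<Rightarrow> real \<Rightarrow> 'h op" where
  "affine_op a t = id_blinfun + op_scaleC (\<i> * complex_of_real t) a"

definition resolvent :: "'h op \<Rightarrow> real \<Rightarrow> 'h op \<Rightarrow> bool" where
  "resolvent a t r \<longleftrightarrow> r \<in> A \<and> affine_op a t o\<^sub>L r = id_blinfun \<and> r o\<^sub>L affine_op a t = id_blinfun"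

lemma affine_op_A: "a \<in> A \<Longrightarrow> affine_op a t \<in> A" by (simp add: affine_op_def)

lemma affine_op_apply: "affine_op a t x = x + scaleC (\<i> * complex_of_real t) (blinfun_apply a x)"
  by (simp add: affine_op_def plus_blinfun.rep_eq)

lemma resolvent_apply:
  assumes "resolvent a t r"
  shows "blinfun_apply r (affine_op a t x) = x" "affine_op a t (r x) = x"
proof -
  have "(r o\<^sub>L affine_op a t) x = id_blinfun x" "(affine_op a t o\<^sub>L r) x = id_blinfun x"
    using assms unfolding resolvent_def by simp_all
  then show "blinfun_apply r (affine_op a t x) = x" "affine_op a t (r x) = x" by simp_all
qed

lemma resolvent_norm:
  assumes a: "a \<in> A" "op_adj a = a" and r: "resolvent a t r"
  shows "norm r \<le> 1"
proof (rule norm_blinfun_bound)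
  fix x
  define y where "y = r x"
  have x: "x = affine_op a t y"
    unfolding y_def by (rule resolvent_apply(2)[OF r, symmetric])
  have "cinner (blinfun_apply a y) y = cinner y (blinfun_apply a y)"
    using cinner_op_adj[OF A_linear[OF a(1)], of y y] by (simp add: a(2))
  then have "(norm x)\<^sup>2 = (norm y)\<^sup>2 + t\<^sup>2 * (norm (blinfun_apply a y))\<^sup>2"
    unfolding x affine_op_apply by (rule norm_add_imaginary)
  then have "(norm y)\<^sup>2 \<le> (norm x)\<^sup>2" by simp
  then have "norm y \<le> norm x" by (rule power2_le_imp_le) simp
  then show "norm (blinfun_apply r x) \<le> 1 * norm x" unfolding y_def by simp
qed simp

text \<open>The resolvent is found inside the algebra by the method of continuity.  The set of \<open>t\<close> for which
  \<open>1 + \<i> t a\<close> is invertible in the algebra contains, with each of its points, an interval of fixed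
  length, because the inverses are contractions.\<close>

lemma resolvent_step:
  assumes a: "a \<in> A" "op_adj a = a" and r: "resolvent a t r" and s: "\<bar>s - t\<bar> * norm a \<le> 1/2"
  shows "\<exists>r'. resolvent a s r'"
proof -
  interpret comp: bounded_bilinear "(o\<^sub>L) :: 'h op \<Rightarrow> 'h op \<Rightarrow> 'h op"
    by (rule bounded_bilinear_blinfun_compose)
  have rA: "r \<in> A" using r by (simp add: resolvent_def)
  define E where "E = op_scaleC (- (\<i> * complex_of_real (s - t))) (a o\<^sub>L r)"
  have EA: "E \<in> A" using a rA by (simp add: E_def)
  have "norm E \<le> \<bar>s - t\<bar> * norm a"
  proof (rule norm_blinfun_bound)
    fix x
    have "norm (E x) = \<bar>s - t\<bar> * norm (a (r x))"
      unfolding E_def op_scaleC_apply norm_scaleC blinfun_apply_blinfun_compose norm_minus_cancel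
        norm_mult norm_ii norm_of_real mult_1_left ..
    also have "\<dots> \<le> \<bar>s - t\<bar> * (norm a * norm (r x))" by (intro mult_left_mono norm_blinfun) simp
    also have "\<dots> \<le> \<bar>s - t\<bar> * (norm a * (1 * norm x))"
      by (intro mult_left_mono order.trans[OF norm_blinfun mult_right_mono[OF resolvent_norm[OF a r]]])
         simp_all
    finally show "norm (E x) \<le> \<bar>s - t\<bar> * norm a * norm x" by simp
  qed simp
  then have "norm E \<le> 1/2" using s by simp
  from neumann_series[OF EA this] obtain S where S: "S \<in> A"
    "(id_blinfun - E) o\<^sub>L S = id_blinfun" "S o\<^sub>L (id_blinfun - E) = id_blinfun" by blast
  have rx: "r (affine_op a t x) = x" "affine_op a t (r x) = x" for x
    by (rule resolvent_apply[OF r])+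
  have fac: "affine_op a s = (id_blinfun - E) o\<^sub>L affine_op a t"
  proof (rule blinfun_eqI)
    fix x
    have "((id_blinfun - E) o\<^sub>L affine_op a t) x =
        affine_op a t x + scaleC (\<i> * complex_of_real (s - t)) (a x)"
      by (simp add: minus_blinfun.rep_eq E_def rx scaleC_minus_left)
    also have "\<dots> = x + scaleC (\<i> * complex_of_real t + \<i> * complex_of_real (s - t)) (a x)"
      unfolding affine_op_apply scaleC_add_left by (rule add.assoc)
    also have "\<i> * complex_of_real t + \<i> * complex_of_real (s - t) = \<i> * complex_of_real s"
      by (simp add: algebra_simps)
    also have "x + scaleC (\<i> * complex_of_real s) (a x) = affine_op a s x"
      by (rule affine_op_apply[symmetric])
    finally show "affine_op a s x = ((id_blinfun - E) o\<^sub>L affine_op a t) x" ..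
  qed
  have "resolvent a s (r o\<^sub>L S)"
    unfolding resolvent_def
  proof (intro conjI)
    show "r o\<^sub>L S \<in> A" by (rule A_compose[OF rA S(1)])
    have "affine_op a s o\<^sub>L (r o\<^sub>L S) = (id_blinfun - E) o\<^sub>L ((affine_op a t o\<^sub>L r) o\<^sub>L S)"
      unfolding fac by (simp only: blinfun_compose_assoc)
    then show "affine_op a s o\<^sub>L (r o\<^sub>L S) = id_blinfun"
      using r S(2) by (simp add: resolvent_def)
    have "(r o\<^sub>L S) o\<^sub>L affine_op a s = r o\<^sub>L ((S o\<^sub>L (id_blinfun - E)) o\<^sub>L affine_op a t)"
      unfolding fac by (simp only: blinfun_compose_assoc)
    then show "(r o\<^sub>L S) o\<^sub>L affine_op a s = id_blinfun"
      using r S(3) by (simp add: resolvent_def)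
  qed
  then show ?thesis by blast
qed

lemma resolvent_exists:
  assumes a: "a \<in> A" "op_adj a = a"
  shows "\<exists>r. resolvent a t r"
proof -
  define \<delta> where "\<delta> = 1 / (2 * (norm a + 1))"
  have "0 < norm a + 1" using norm_ge_zero[of a] by linarith
  then have \<delta>: "\<delta> > 0" "\<delta> * norm a \<le> 1/2" by (simp_all add: \<delta>_def divide_simps)
  have "\<forall>t. \<bar>t\<bar> \<le> real k * \<delta> \<longrightarrow> (\<exists>r. resolvent a t r)" for k
  proof (induction k)
    case 0
    have "affine_op a 0 = id_blinfun" by (rule blinfun_eqI) (simp add: affine_op_apply)
    then have "resolvent a 0 id_blinfun" by (simp add: resolvent_def)
    then show ?case by auto
  next
    case (Suc k)
    show ?case
    proof (intro allI impI)
      fix t assume t: "\<bar>t\<bar> \<le> real (Suc k) * \<delta>"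
      define u where "u = max (- (real k * \<delta>)) (min t (real k * \<delta>))"
      have k: "0 \<le> real k * \<delta>" using \<delta> by simp
      have t': "\<bar>t\<bar> \<le> real k * \<delta> + \<delta>" using t by (simp add: algebra_simps)
      have "\<bar>u\<bar> \<le> real k * \<delta>" "\<bar>t - u\<bar> \<le> \<delta>" using k t' \<delta>(1) unfolding u_def by linarith+
      then obtain r where "resolvent a u r" using Suc by blast
      moreover have "\<bar>t - u\<bar> * norm a \<le> 1/2"
        using mult_right_mono[OF \<open>\<bar>t - u\<bar> \<le> \<delta>\<close>, of "norm a"] \<delta>(2) by simp
      ultimately show "\<exists>r. resolvent a t r" by (rule resolvent_step[OF a])
    qed
  qed
  moreover obtain k :: nat where "\<bar>t\<bar> / \<delta> \<le> real k" using real_arch_simple by blast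
  ultimately show ?thesis using \<delta>(1) by (simp add: pos_divide_le_eq)
qed

lemma resolvent_commute:
  assumes "a \<in> A" "t \<noteq> 0" "resolvent a t r"
  shows "r o\<^sub>L a = a o\<^sub>L r"
proof (rule blinfun_eqI)
  fix x
  have "affine_op a t (r x) = r (affine_op a t x)"
    unfolding resolvent_apply[OF assms(3)] ..
  moreover have "complex_linear r" using assms(3) A_linear by (simp add: resolvent_def)
  ultimately have "scaleC (\<i> * complex_of_real t) (a (r x)) = scaleC (\<i> * complex_of_real t) (r (a x))"
    by (simp add: affine_op_apply blinfun.add_right complex_linear_def)
  then have "scaleC (inverse (\<i> * complex_of_real t)) (scaleC (\<i> * complex_of_real t) (a (r x)))
    = scaleC (inverse (\<i> * complex_of_real t)) (scaleC (\<i> * complex_of_real t) (r (a x)))"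
    by (rule arg_cong)
  moreover have "inverse (\<i> * complex_of_real t) * (\<i> * complex_of_real t) = 1"
    using assms(2) by (intro left_inverse) simp
  ultimately have "a (r x) = r (a x)" unfolding scaleC_scaleC by (simp only: scaleC_one)
  then show "(r o\<^sub>L a) x = (a o\<^sub>L r) x" by simp
qed

lemma resolvent_emb_bounds:
  assumes a: "a \<in> A" "op_adj a = a" and r: "resolvent a t r" and Y: "Y \<in> A"
  shows "norm (\<iota> (r o\<^sub>L Y)) \<le> norm (\<iota> Y)"
    and "\<bar>t\<bar> * norm (\<iota> (a o\<^sub>L r o\<^sub>L Y)) \<le> norm (\<iota> Y)"
proof -
  have rA: "r \<in> A" using r by (simp add: resolvent_def)
  define U where "U = r o\<^sub>L Y"
  have U: "U \<in> A" using rA Y by (simp add: U_def)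
  have aU: "a o\<^sub>L U \<in> A" using a U by simp
  have "Y = (affine_op a t o\<^sub>L r) o\<^sub>L Y" using r by (simp add: resolvent_def)
  also have "\<dots> = U + op_scaleC (\<i> * complex_of_real t) (a o\<^sub>L U)"
    by (rule blinfun_eqI) (simp add: affine_op_apply U_def plus_blinfun.rep_eq)
  finally have "\<iota> Y = \<iota> U + scaleC (\<i> * complex_of_real t) (\<iota> (a o\<^sub>L U))"
    using emb_add[OF U A_scale[OF aU]] emb_scale[OF aU] by metis
  moreover have "cinner (\<iota> (a o\<^sub>L U)) (\<iota> U) = cinner (\<iota> U) (\<iota> (a o\<^sub>L U))"
    using cinner_emb_left[OF a(1) U U] by (simp add: a(2))
  ultimately have eq: "(norm (\<iota> Y))\<^sup>2 = (norm (\<iota> U))\<^sup>2 + t\<^sup>2 * (norm (\<iota> (a o\<^sub>L U)))\<^sup>2"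
    using norm_add_imaginary by metis
  then have "(norm (\<iota> U))\<^sup>2 \<le> (norm (\<iota> Y))\<^sup>2" by simp
  then show "norm (\<iota> (r o\<^sub>L Y)) \<le> norm (\<iota> Y)" unfolding U_def by (rule power2_le_imp_le) simp
  have "(\<bar>t\<bar> * norm (\<iota> (a o\<^sub>L U)))\<^sup>2 \<le> (norm (\<iota> Y))\<^sup>2" unfolding power_mult_distrib eq by simp
  then show "\<bar>t\<bar> * norm (\<iota> (a o\<^sub>L r o\<^sub>L Y)) \<le> norm (\<iota> Y)"
    unfolding U_def blinfun_compose_assoc by (rule power2_le_imp_le) simp
qed

lemma resolvent_adj:
  assumes a: "a \<in> A" "op_adj a = a" and r: "resolvent a t r"
  shows "resolvent a (- t) (op_adj r)"
proof -
  have rA: "r \<in> A" using r by (simp add: resolvent_def)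
  have adj: "op_adj (affine_op a t) = affine_op a (- t)"
    using a by (simp add: affine_op_def op_adj_plus op_adj_scaleC A_linear)
  have "op_adj (affine_op a t o\<^sub>L r) = op_adj r o\<^sub>L affine_op a (- t)"
    "op_adj (r o\<^sub>L affine_op a t) = affine_op a (- t) o\<^sub>L op_adj r"
    using rA affine_op_A[OF a(1)] by (simp_all add: A_adj_compose adj)
  then show ?thesis using r rA by (simp add: resolvent_def)
qed

lemma resolvent_near_one:
  assumes a: "a \<in> A" "op_adj a = a" and r: "resolvent a t r" and Y: "Y \<in> A"
  shows "norm (\<iota> (op_adj r o\<^sub>L Y) - \<iota> Y) \<le> \<bar>t\<bar> * norm (\<iota> (a o\<^sub>L Y))"
proof -
  have r': "resolvent a (- t) (op_adj r)" by (rule resolvent_adj[OF a r])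
  have rA: "op_adj r \<in> A" using r' by (simp add: resolvent_def)
  have aY: "a o\<^sub>L Y \<in> A" using a Y by simp
  have lin: "complex_linear (op_adj r)" by (rule A_linear[OF rA])
  have "(op_adj r o\<^sub>L Y) - Y = op_scaleC (\<i> * complex_of_real t) (op_adj r o\<^sub>L (a o\<^sub>L Y))"
  proof (rule blinfun_eqI)
    fix x
    have "op_adj r (affine_op a (- t) (Y x)) = Y x"
      by (rule resolvent_apply(1)[OF r'])
    then have "op_adj r (Y x) - scaleC (\<i> * complex_of_real t) (op_adj r (a (Y x))) = Y x"
      using lin by (simp add: affine_op_apply blinfun.add_right blinfun.diff_right complex_linear_def scaleC_minus_left
          blinfun.minus_right)
    then show "((op_adj r o\<^sub>L Y) - Y) x = op_scaleC (\<i> * complex_of_real t) (op_adj r o\<^sub>L (a o\<^sub>L Y)) x"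
      by (simp add: minus_blinfun.rep_eq algebra_simps)
  qed
  then have "\<iota> (op_adj r o\<^sub>L Y) - \<iota> Y = scaleC (\<i> * complex_of_real t) (\<iota> (op_adj r o\<^sub>L (a o\<^sub>L Y)))"
    using emb_diff[OF A_compose[OF rA Y] Y] emb_scale[OF A_compose[OF rA aY]] by metis
  then have "norm (\<iota> (op_adj r o\<^sub>L Y) - \<iota> Y) = \<bar>t\<bar> * norm (\<iota> (op_adj r o\<^sub>L (a o\<^sub>L Y)))"
    by (simp add: norm_scaleC norm_mult)
  also have "\<dots> \<le> \<bar>t\<bar> * norm (\<iota> (a o\<^sub>L Y))"
    by (intro mult_left_mono resolvent_emb_bounds(1)[OF a r' aY]) simp
  finally show ?thesis .
qed

text \<open>For bounded sequences weak convergence need only be tested on bounded elements.\<close>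

lemma weakly_null_dense:
  assumes bound: "\<And>j. norm (d j) \<le> C" and lim: "\<And>Y. Y \<in> A \<Longrightarrow> (\<lambda>j. cinner (d j) (\<iota> Y)) \<longlonglongrightarrow> 0"
  shows "(\<lambda>j. cinner (d j) v) \<longlonglongrightarrow> 0"
proof (rule LIMSEQ_I)
  fix e :: real assume e: "e > 0"
  have C: "0 \<le> C" using bound[of 0] norm_ge_zero order.trans by blast
  obtain a where a: "approximates a v" using approximates_exists by blast
  have "(\<lambda>j. \<iota> (a j)) \<longlonglongrightarrow> v" using a by (simp add: approximates_def)
  moreover have "0 < e / (2 * (C + 1))" using e C by simp
  ultimately obtain N where N: "norm (\<iota> (a N) - v) < e / (2 * (C + 1))"
    using LIMSEQ_D by blast
  have aN: "a N \<in> A" using a by (auto simp: approximates_def)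
  have "e / 2 > 0" using e by simp
  from LIMSEQ_D[OF lim[OF aN] this] obtain M where M: "\<And>j. j \<ge> M \<Longrightarrow> cmod (cinner (d j) (\<iota> (a N))) < e / 2"
    by auto
  show "\<exists>no. \<forall>j\<ge>no. norm (cinner (d j) v - 0) < e"
  proof (intro exI allI impI)
    fix j assume j: "j \<ge> M"
    have "cinner (d j) v = cinner (d j) (\<iota> (a N)) - cinner (d j) (\<iota> (a N) - v)"
      by (simp add: cinner.diff_right)
    then have "cmod (cinner (d j) v) \<le> cmod (cinner (d j) (\<iota> (a N))) + cmod (cinner (d j) (\<iota> (a N) - v))"
      by (metis norm_triangle_ineq4)
    also have "cmod (cinner (d j) (\<iota> (a N) - v)) \<le> C * (e / (2 * (C + 1)))"
      by (rule order.trans[OF cinner_bound mult_mono[OF bound less_imp_le[OF N] C norm_ge_zero]])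
    also have "\<dots> \<le> e / 2" using C e by (simp add: field_simps)
    finally show "norm (cinner (d j) v - 0) < e" using M[OF j] by simp
  qed
qed

text \<open>Unbounded factors cannot be approximated by bounded ones independently of each other, so
  associativity needs a cut-off.  With \<open>r\<close> the resolvent of a self-adjoint approximation \<open>a\<close> of
  \<open>F\<close>, the operators \<open>r\<close> and \<open>b = r a\<close> are bounded uniformly in \<open>a\<close>; \<open>r (F \<eta>)\<close> and \<open>b \<eta>\<close> have
  the same weak limit, and for the bounded factor \<open>b\<close> associativity holds.  Finally \<open>r\<close> tends to the
  identity as \<open>t\<close> tends to \<open>0\<close>.\<close>

lemma is_l2_product_assoc:
  assumes F: "J F = F" and \<pi>: "is_l2_product W F \<eta> \<pi>" and \<rho>: "is_l2_product W \<eta> \<zeta> \<rho>"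
    and \<tau>: "is_l2_product W F \<rho> \<tau>"
  shows "is_l2_product W \<pi> \<zeta> \<tau>"
  unfolding is_l2_product_iff
proof
  fix X assume X: "X \<in> A"
  define v where "v = Lm X (J \<zeta>)"
  obtain a0 where a0: "approximates a0 F" using approximates_exists by blast
  define a where "a j = op_scaleC (1/2) (a0 j + op_adj (a0 j))" for j
  have "approximates a (scaleC (1/2) (F + J F))"
    unfolding a_def by (intro approximates_scale approximates_add a0 approximates_J)
  moreover have "scaleC (1/2) (F + J F) = F"
    using scaleC_add_left[of "1/2" "1/2" F] by (simp add: F scaleC_add_right)
  ultimately have aF: "approximates a F" by simp
  have a0A: "a0 j \<in> A" for j using a0 by (auto simp: approximates_def)
  have aA: "a j \<in> A" for j using aF by (auto simp: approximates_def)
  have asa: "op_adj (a j) = a j" for j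
    using a0A by (simp add: a_def op_adj_scaleC op_adj_plus A_linear add.commute)
  have alim: "(\<lambda>j. \<iota> (a j)) \<longlonglongrightarrow> F" using aF by (simp add: approximates_def)
  then have "Bseq (\<lambda>j. \<iota> (a j))" by (intro convergent_imp_Bseq convergentI)
  then obtain M where M: "\<And>j. norm (\<iota> (a j)) \<le> M" and M0: "M > 0" by (auto simp: Bseq_def)
  have right: "\<exists>K\<ge>0. \<forall>j. norm (\<iota> (a j o\<^sub>L Y)) \<le> K" if Y: "Y \<in> A" for Y
  proof -
    obtain C where C: "C \<ge> 0" "\<And>Z. Z \<in> A \<Longrightarrow> norm (\<iota> (op_adj Y o\<^sub>L Z)) \<le> C * norm (\<iota> Z)"
      using norm_emb_compose_bound[OF A_adj[OF Y]] by blast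
    have "norm (\<iota> (a j o\<^sub>L Y)) \<le> C * M" for j
    proof -
      have "norm (\<iota> (a j o\<^sub>L Y)) = norm (\<iota> (op_adj Y o\<^sub>L a j))"
        using norm_emb_adj[OF A_compose[OF aA Y], of j] by (simp add: A_adj_compose aA Y asa)
      also have "\<dots> \<le> C * norm (\<iota> (a j))" by (rule C(2)[OF aA])
      also have "\<dots> \<le> C * M" by (rule mult_left_mono[OF M C(1)])
      finally show ?thesis .
    qed
    then show ?thesis using C(1) M0 by (intro exI[of _ "C * M"]) simp
  qed
  \<comment> \<open>It has to be shown that \<open>L = 0\<close>.  The estimate has two free parameters: \<open>Y\<close> approximates \<open>v\<close>,
    which is not bounded, and \<open>t\<close> tends to \<open>0\<close> for fixed \<open>Y\<close>.\<close>
  define L where "L = cinner \<pi> v - cinner \<tau> (\<iota> X)"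
  have main: "cmod L \<le> 2 * norm \<pi> * norm (v - \<iota> Y) + t * (norm \<pi> * K + norm \<tau> * K')"
    if Y: "Y \<in> A" and t: "t > 0" and K: "\<And>j. norm (\<iota> (a j o\<^sub>L Y)) \<le> K"
      and K': "\<And>j. norm (\<iota> (a j o\<^sub>L X)) \<le> K'" for Y t K K'
  proof -
    have "\<forall>j. \<exists>r. resolvent (a j) t r" using resolvent_exists[OF aA asa] by blast
    then obtain r where r: "\<And>j. resolvent (a j) t (r j)" by metis
    have rA: "r j \<in> A" for j using r[of j] by (simp add: resolvent_def)
    define b where "b j = r j o\<^sub>L a j" for j
    have bA: "b j \<in> A" for j by (simp add: b_def rA aA)
    have rb: "norm (Lm (r j) \<xi>) \<le> norm \<xi>" for j \<xi>
      using Lm_bound[OF rA, of j 1] resolvent_emb_bounds(1)[OF aA asa r] by simp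
    have bb: "norm (Lm (b j) \<xi>) \<le> (1 / t) * norm \<xi>" for j \<xi>
    proof (rule Lm_bound[OF bA])
      fix Z assume "Z \<in> A"
      then have "t * norm (\<iota> (b j o\<^sub>L Z)) \<le> norm (\<iota> Z)"
        using resolvent_emb_bounds(2)[OF aA asa r, of Z j] resolvent_commute[OF aA _ r, of j] t
        by (simp add: b_def)
      then show "norm (\<iota> (b j o\<^sub>L Z)) \<le> (1 / t) * norm (\<iota> Z)" using t by (simp add: field_simps)
    qed
    \<comment> \<open>The two vectors have the same weak limit because \<open>r F - b = r (F - a)\<close> is small.\<close>
    have weak: "(\<lambda>j. cinner (Lm (r j) p - Lm (b j) e) w) \<longlonglongrightarrow> 0"
      if pe: "is_l2_product W F e p" for e p w
    proof (rule weakly_null_dense)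
      show "norm (Lm (r j) p - Lm (b j) e) \<le> norm p + (1 / t) * norm e" for j
        by (rule order.trans[OF norm_triangle_ineq4 add_mono[OF rb bb]])
      fix Z assume Z: "Z \<in> A"
      have "cinner (Lm (r j) p - Lm (b j) e) (\<iota> Z) = cinner (Lm (r j) (F - \<iota> (a j))) (Lm Z (J e))" for j
      proof -
        have "cinner (Lm (r j) p) (\<iota> Z) = cinner p (\<iota> (op_adj (r j) o\<^sub>L Z))"
          using rA Z by (simp add: cinner_Lm)
        also have "\<dots> = cinner F (Lm (op_adj (r j) o\<^sub>L Z) (J e))"
          using pe rA Z by (simp add: is_l2_product_iff)
        also have "\<dots> = cinner (Lm (r j) F) (Lm Z (J e))"
          using rA Z by (simp add: Lm_compose cinner_Lm)
        finally have 1: "cinner (Lm (r j) p) (\<iota> Z) = cinner (Lm (r j) F) (Lm Z (J e))" .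
        have "cinner (Lm (b j) e) (\<iota> Z) = cinner e (\<iota> (op_adj (b j) o\<^sub>L Z))"
          using bA Z by (simp add: cinner_Lm)
        also have "\<dots> = cinner (\<iota> (op_adj Z o\<^sub>L b j)) (J e)"
          using cinner_J[of "\<iota> (op_adj (b j) o\<^sub>L Z)" e, symmetric] bA Z by (simp add: A_adj_compose)
        also have "\<dots> = cinner (\<iota> (b j)) (Lm Z (J e))"
          using cinner_Lm[of "op_adj Z" "\<iota> (b j)" "J e"] bA Z by simp
        finally have 2: "cinner (Lm (b j) e) (\<iota> Z) = cinner (Lm (r j) (\<iota> (a j))) (Lm Z (J e))"
          using rA aA by (simp add: b_def)
        show ?thesis using rA by (simp add: cinner.diff_left Lm_diff 1 2)
      qed
      moreover have "(\<lambda>j. cinner (Lm (r j) (F - \<iota> (a j))) (Lm Z (J e))) \<longlonglongrightarrow> 0"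
      proof (rule Lim_null_comparison[OF always_eventually])
        show "\<forall>j. norm (cinner (Lm (r j) (F - \<iota> (a j))) (Lm Z (J e))) \<le> norm (F - \<iota> (a j)) * norm (Lm Z (J e))"
          by (intro allI order.trans[OF cinner_bound] mult_right_mono rb) simp
        have "(\<lambda>j. norm (F - \<iota> (a j)) * norm (Lm Z (J e))) \<longlonglongrightarrow> norm (F - F) * norm (Lm Z (J e))"
          by (rule tendsto_mult_right[OF tendsto_norm[OF tendsto_diff[OF tendsto_const alim]]])
        then show "(\<lambda>j. norm (F - \<iota> (a j)) * norm (Lm Z (J e))) \<longlonglongrightarrow> 0" by simp
      qed
      ultimately show "(\<lambda>j. cinner (Lm (r j) p - Lm (b j) e) (\<iota> Z)) \<longlonglongrightarrow> 0" by simp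
    qed
    \<comment> \<open>Associativity for the bounded factor \<open>b\<close>.\<close>
    have exact: "cinner (Lm (b j) \<eta>) v = cinner (Lm (b j) \<rho>) (\<iota> X)" for j
    proof -
      have "cinner (Lm (b j) \<eta>) v = cinner \<eta> (Lm (op_adj (b j) o\<^sub>L X) (J \<zeta>))"
        using bA X by (simp add: cinner_Lm v_def Lm_compose)
      also have "\<dots> = cinner \<rho> (\<iota> (op_adj (b j) o\<^sub>L X))"
        using \<rho> bA X by (simp add: is_l2_product_iff)
      also have "\<dots> = cinner (Lm (b j) \<rho>) (\<iota> X)" using bA X by (simp add: cinner_Lm)
      finally show ?thesis .
    qed
    define g where "g j = cinner (Lm (r j) \<pi>) v - cinner (Lm (r j) \<tau>) (\<iota> X)" for j
    have "g j = cinner (Lm (r j) \<pi> - Lm (b j) \<eta>) v - cinner (Lm (r j) \<tau> - Lm (b j) \<rho>) (\<iota> X)" for j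
      by (simp add: g_def cinner.diff_left exact)
    then have "g = (\<lambda>j. cinner (Lm (r j) \<pi> - Lm (b j) \<eta>) v - cinner (Lm (r j) \<tau> - Lm (b j) \<rho>) (\<iota> X))"
      by (rule ext)
    then have g0: "g \<longlonglongrightarrow> 0"
      using tendsto_diff[OF weak[OF \<pi>, of v] weak[OF \<tau>, of "\<iota> X"]] by simp
    \<comment> \<open>The resolvent is close to the identity on vectors \<open>\<iota> Z\<close>, uniformly in \<open>j\<close>.\<close>
    have near: "cmod (cinner \<xi> (\<iota> Z) - cinner (Lm (r j) \<xi>) (\<iota> Z)) \<le> norm \<xi> * (t * N)"
      if "Z \<in> A" "norm (\<iota> (a j o\<^sub>L Z)) \<le> N" for \<xi> Z N j
    proof -
      have "cinner \<xi> (\<iota> Z) - cinner (Lm (r j) \<xi>) (\<iota> Z) = - cinner \<xi> (\<iota> (op_adj (r j) o\<^sub>L Z) - \<iota> Z)"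
        using that rA by (simp add: cinner_Lm cinner.diff_right)
      then have "cmod (cinner \<xi> (\<iota> Z) - cinner (Lm (r j) \<xi>) (\<iota> Z)) \<le> norm \<xi> * norm (\<iota> (op_adj (r j) o\<^sub>L Z) - \<iota> Z)"
        using cinner_bound by simp
      also have "\<dots> \<le> norm \<xi> * (t * N)"
      proof (rule mult_left_mono)
        have "norm (\<iota> (op_adj (r j) o\<^sub>L Z) - \<iota> Z) \<le> t * norm (\<iota> (a j o\<^sub>L Z))"
          using resolvent_near_one[OF aA asa r that(1), of j] t by simp
        also have "\<dots> \<le> t * N" using t by (intro mult_left_mono that(2)) simp
        finally show "norm (\<iota> (op_adj (r j) o\<^sub>L Z) - \<iota> Z) \<le> t * N" .
      qed simp
      finally show ?thesis .
    qed
    have est: "cmod L \<le> (2 * norm \<pi> * norm (v - \<iota> Y) + t * (norm \<pi> * K + norm \<tau> * K')) + cmod (g j)" for j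
    proof -
      have "L = cinner \<pi> (v - \<iota> Y) - cinner (Lm (r j) \<pi>) (v - \<iota> Y)
          + (cinner \<pi> (\<iota> Y) - cinner (Lm (r j) \<pi>) (\<iota> Y))
          - (cinner \<tau> (\<iota> X) - cinner (Lm (r j) \<tau>) (\<iota> X)) + g j"
        by (simp add: L_def g_def cinner.diff_right)
      then have "cmod L \<le> cmod (cinner \<pi> (v - \<iota> Y)) + cmod (cinner (Lm (r j) \<pi>) (v - \<iota> Y))
          + cmod (cinner \<pi> (\<iota> Y) - cinner (Lm (r j) \<pi>) (\<iota> Y))
          + cmod (cinner \<tau> (\<iota> X) - cinner (Lm (r j) \<tau>) (\<iota> X)) + cmod (g j)"
        by (simp only:) (intro order.trans[OF norm_triangle_ineq] order.trans[OF norm_triangle_ineq4] add_mono order.refl)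
      moreover have "cmod (cinner \<pi> (v - \<iota> Y)) \<le> norm \<pi> * norm (v - \<iota> Y)" by (rule cinner_bound)
      moreover have "cmod (cinner (Lm (r j) \<pi>) (v - \<iota> Y)) \<le> norm \<pi> * norm (v - \<iota> Y)"
        by (rule order.trans[OF cinner_bound mult_right_mono[OF rb]]) simp
      moreover have "cmod (cinner \<pi> (\<iota> Y) - cinner (Lm (r j) \<pi>) (\<iota> Y)) \<le> norm \<pi> * (t * K)"
        by (rule near[OF Y K])
      moreover have "cmod (cinner \<tau> (\<iota> X) - cinner (Lm (r j) \<tau>) (\<iota> X)) \<le> norm \<tau> * (t * K')"
        by (rule near[OF X K'])
      ultimately show ?thesis by (simp add: algebra_simps)
    qed
    have "(\<lambda>j. (2 * norm \<pi> * norm (v - \<iota> Y) + t * (norm \<pi> * K + norm \<tau> * K')) + cmod (g j)) \<longlonglongrightarrow>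
        (2 * norm \<pi> * norm (v - \<iota> Y) + t * (norm \<pi> * K + norm \<tau> * K')) + cmod 0"
      by (rule tendsto_add[OF tendsto_const tendsto_norm[OF g0]])
    then show ?thesis using est by (intro LIMSEQ_le_const) auto
  qed
  have "cmod L \<le> 2 * norm \<pi> * norm (v - \<iota> Y)" if Y: "Y \<in> A" for Y
  proof -
    obtain K where K: "\<And>j. norm (\<iota> (a j o\<^sub>L Y)) \<le> K" using right[OF Y] by blast
    obtain K' where K': "\<And>j. norm (\<iota> (a j o\<^sub>L X)) \<le> K'" using right[OF X] by blast
    let ?B = "norm \<pi> * K + norm \<tau> * K'"
    have lim: "(\<lambda>n. 2 * norm \<pi> * norm (v - \<iota> Y) + inverse (real (Suc n)) * ?B) \<longlonglongrightarrow>
        2 * norm \<pi> * norm (v - \<iota> Y) + 0 * ?B"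
      by (rule tendsto_add[OF tendsto_const tendsto_mult[OF LIMSEQ_inverse_real_of_nat tendsto_const]])
    have "cmod L \<le> 2 * norm \<pi> * norm (v - \<iota> Y) + 0 * ?B"
    proof (rule LIMSEQ_le_const[OF lim], intro exI allI impI)
      fix n show "cmod L \<le> 2 * norm \<pi> * norm (v - \<iota> Y) + inverse (real (Suc n)) * ?B"
        by (rule main[OF Y _ K K']) simp
    qed
    then show ?thesis by simp
  qed
  note bound = this
  obtain c where c: "approximates c v" using approximates_exists by blast
  have cA: "c j \<in> A" for j using c by (auto simp: approximates_def)
  have clim: "(\<lambda>j. \<iota> (c j)) \<longlonglongrightarrow> v" using c by (simp add: approximates_def)
  have lim: "(\<lambda>j. 2 * norm \<pi> * norm (v - \<iota> (c j))) \<longlonglongrightarrow> 2 * norm \<pi> * norm (v - v)"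
    by (rule tendsto_mult_left[OF tendsto_norm[OF tendsto_diff[OF tendsto_const clim]]])
  have "cmod L \<le> 2 * norm \<pi> * norm (v - v)"
    by (rule LIMSEQ_le_const[OF lim]) (use bound[OF cA] in blast)
  then have "L = 0" by simp
  then show "cinner \<pi> (Lm X (J \<zeta>)) = cinner \<tau> (\<iota> X)" by (simp add: L_def v_def)
qed

end

section \<open>Algebras of elements of \<open>L\<^sup>2\<close>\<close>

text \<open>A linear space of elements of \<open>L\<^sup>2\<close> whose products exist in \<open>L\<^sup>2\<close> and stay inside the space.
  It is a \<open>*\<close>-algebra with trace, although its elements need not be bounded operators.\<close>

locale l2_algebra = tracial_wstar W
  for W :: "('h::chilbert_space, 'l::chilbert_space) wstar_space" +
  fixes D :: "'l set"
  assumes D_add [simp]: "x \<in> D \<Longrightarrow> y \<in> D \<Longrightarrow> x + y \<in> D"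
    and D_scale [simp]: "x \<in> D \<Longrightarrow> scaleC c x \<in> D"
    and D_one [simp]: "l2_one W \<in> D"
    and D_J [simp]: "x \<in> D \<Longrightarrow> J x \<in> D"
    and D_product: "x \<in> D \<Longrightarrow> y \<in> D \<Longrightarrow> \<exists>z\<in>D. is_l2_product W x y z"
begin

abbreviation mul :: "'l \<Rightarrow> 'l \<Rightarrow> 'l" (infixl "\<cdot>" 70) where "x \<cdot> y \<equiv> l2_mult W x y"
abbreviation one :: 'l where "one \<equiv> l2_one W"

lemma D_zero [simp]: "0 \<in> D"
  using D_scale[OF D_one, of 0] by simp

lemma D_minus [simp]: "x \<in> D \<Longrightarrow> - x \<in> D"
  using D_scale[of x "-1"] by (simp add: scaleC_minus1)

lemma D_diff [simp]: "x \<in> D \<Longrightarrow> y \<in> D \<Longrightarrow> x - y \<in> D"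
  using D_add[of x "- y"] by simp

lemma D_sum [simp]: "(\<And>i. i \<in> S \<Longrightarrow> u i \<in> D) \<Longrightarrow> sum u S \<in> D"
  by (induction S rule: infinite_finite_induct) auto

lemma mul_product_D: "x \<in> D \<Longrightarrow> y \<in> D \<Longrightarrow> is_l2_product W x y (x \<cdot> y) \<and> x \<cdot> y \<in> D"
  by (drule (1) D_product, elim bexE) (simp add: l2_mult_eq)

lemma mul_product: "x \<in> D \<Longrightarrow> y \<in> D \<Longrightarrow> is_l2_product W x y (x \<cdot> y)"
  using mul_product_D by blast

lemma mul_D [simp]: "x \<in> D \<Longrightarrow> y \<in> D \<Longrightarrow> x \<cdot> y \<in> D"
  using mul_product_D by blast

lemma mul_add_left: "x \<in> D \<Longrightarrow> x' \<in> D \<Longrightarrow> y \<in> D \<Longrightarrow> (x + x') \<cdot> y = x \<cdot> y + x' \<cdot> y"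
  by (rule l2_mult_eq[OF is_l2_product_add_left[OF mul_product mul_product]])

lemma mul_add_right: "x \<in> D \<Longrightarrow> y \<in> D \<Longrightarrow> y' \<in> D \<Longrightarrow> x \<cdot> (y + y') = x \<cdot> y + x \<cdot> y'"
  by (rule l2_mult_eq[OF is_l2_product_add_right[OF mul_product mul_product]])

lemma mul_scale_left: "x \<in> D \<Longrightarrow> y \<in> D \<Longrightarrow> scaleC c x \<cdot> y = scaleC c (x \<cdot> y)"
  by (rule l2_mult_eq[OF is_l2_product_scale_left[OF mul_product]])

lemma mul_scale_right: "x \<in> D \<Longrightarrow> y \<in> D \<Longrightarrow> x \<cdot> scaleC c y = scaleC c (x \<cdot> y)"
  by (rule l2_mult_eq[OF is_l2_product_scale_right[OF mul_product]])

lemma mul_zero_left [simp]: "0 \<cdot> y = 0"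
  by (rule l2_mult_eq[OF is_l2_product_zero_left])

lemma mul_zero_right [simp]: "x \<cdot> 0 = 0"
  by (rule l2_mult_eq[OF is_l2_product_zero_right])

lemma mul_diff_left: "x \<in> D \<Longrightarrow> x' \<in> D \<Longrightarrow> y \<in> D \<Longrightarrow> (x - x') \<cdot> y = x \<cdot> y - x' \<cdot> y"
  using mul_add_left[of "x - x'" x' y] by simp

lemma mul_diff_right: "x \<in> D \<Longrightarrow> y \<in> D \<Longrightarrow> y' \<in> D \<Longrightarrow> x \<cdot> (y - y') = x \<cdot> y - x \<cdot> y'"
  using mul_add_right[of x "y - y'" y'] by simp

lemma mul_one_left [simp]: "one \<cdot> x = x"
  by (rule l2_mult_eq[OF is_l2_product_one_left])

lemma mul_one_right [simp]: "x \<cdot> one = x"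
  by (rule l2_mult_eq[OF is_l2_product_one_right])

lemma mul_sum_left: "(\<And>i. i \<in> S \<Longrightarrow> u i \<in> D) \<Longrightarrow> y \<in> D \<Longrightarrow> sum u S \<cdot> y = (\<Sum>i\<in>S. u i \<cdot> y)"
  by (induction S rule: infinite_finite_induct) (auto simp: mul_add_left)

lemma mul_sum_right: "(\<And>i. i \<in> S \<Longrightarrow> u i \<in> D) \<Longrightarrow> y \<in> D \<Longrightarrow> y \<cdot> sum u S = (\<Sum>i\<in>S. y \<cdot> u i)"
  by (induction S rule: infinite_finite_induct) (auto simp: mul_add_right)

lemma J_mul: "x \<in> D \<Longrightarrow> y \<in> D \<Longrightarrow> J (x \<cdot> y) = J y \<cdot> J x"
  by (rule l2_mult_eq[OF is_l2_product_J[OF mul_product], symmetric])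

lemma J_sum: "J (sum u S) = (\<Sum>i\<in>S. J (u i))"
  by (induction S rule: infinite_finite_induct) (auto simp: J_add)

lemma mul_assoc_selfadjoint:
  assumes "x \<in> D" "y \<in> D" "z \<in> D" "J x = x"
  shows "x \<cdot> y \<cdot> z = x \<cdot> (y \<cdot> z)"
  by (rule l2_mult_eq[OF is_l2_product_assoc[OF assms(4) mul_product[OF assms(1,2)]
        mul_product[OF assms(2,3)] mul_product[OF assms(1) mul_D[OF assms(2,3)]]]])

text \<open>The self-adjoint case extends to all first factors by splitting them into real and imaginary
  parts.\<close>

lemma mul_assoc:
  assumes x: "x \<in> D" and y: "y \<in> D" and z: "z \<in> D"
  shows "x \<cdot> y \<cdot> z = x \<cdot> (y \<cdot> z)"
proof -
  define u v where "u = scaleC (1/2) (x + J x)" and "v = scaleC (\<i>/2) (J x - x)"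
  have u: "u \<in> D" using x by (simp add: u_def)
  have v: "v \<in> D" using x by (simp add: v_def)
  have Ju: "J u = u" unfolding u_def J_scale J_add J_J by (simp add: add.commute)
  have "J v = scaleC (- (\<i>/2)) (x - J x)" unfolding v_def J_scale J_diff J_J by simp
  also have "\<dots> = v" unfolding v_def scaleC_minus_left scaleC_minus_right[symmetric] by simp
  finally have Jv: "J v = v" .
  have "scaleC \<i> v = scaleC (- (1/2)) (J x - x)" unfolding v_def scaleC_scaleC by simp
  then have "u + scaleC \<i> v = scaleC (1/2) x + scaleC (1/2) x"
    unfolding u_def by (simp add: scaleC_add_right scaleC_diff_right scaleC_minus_left)
  also have "\<dots> = x" using scaleC_add_left[of "1/2" "1/2" x] by simp
  finally have eq: "x = u + scaleC \<i> v" ..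
  have mul: "x \<cdot> w = u \<cdot> w + scaleC \<i> (v \<cdot> w)" if "w \<in> D" for w
    unfolding eq using u v that by (simp add: mul_add_left mul_scale_left)
  have "x \<cdot> y \<cdot> z = u \<cdot> y \<cdot> z + scaleC \<i> (v \<cdot> y \<cdot> z)"
    unfolding mul[OF y] using u v y z by (simp add: mul_add_left mul_scale_left)
  also have "\<dots> = x \<cdot> (y \<cdot> z)"
    unfolding mul[OF mul_D[OF y z]] mul_assoc_selfadjoint[OF u y z Ju] mul_assoc_selfadjoint[OF v y z Jv] ..
  finally show ?thesis .
qed

lemma cinner_mul_one: "x \<in> D \<Longrightarrow> y \<in> D \<Longrightarrow> cinner (x \<cdot> y) one = cinner x (J y)"
  by (rule is_l2_product_expect[OF mul_product])

lemma cinner_eq_expect: "x \<in> D \<Longrightarrow> y \<in> D \<Longrightarrow> cinner x y = cinner (x \<cdot> J y) one"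
  by (simp add: cinner_mul_one)

lemma trace_commute: "x \<in> D \<Longrightarrow> y \<in> D \<Longrightarrow> cinner (x \<cdot> y) one = cinner (y \<cdot> x) one"
  using cinner_J[of "J y" x] by (simp add: cinner_mul_one)

lemma cinner_mul_right:
  assumes "x \<in> D" "y \<in> D" "z \<in> D"
  shows "cinner (x \<cdot> y) z = cinner x (z \<cdot> J y)"
  using cinner_eq_expect[of "x \<cdot> y" z] cinner_eq_expect[of x "z \<cdot> J y"] assms
  by (simp add: J_mul mul_assoc)

lemma cinner_mul_left:
  assumes "x \<in> D" "y \<in> D" "z \<in> D"
  shows "cinner (x \<cdot> y) z = cinner y (J x \<cdot> z)"
proof -
  have "cinner (x \<cdot> y) z = cinner (x \<cdot> (y \<cdot> J z)) one"
    using cinner_eq_expect[of "x \<cdot> y" z] assms by (simp add: mul_assoc)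
  also have "\<dots> = cinner (y \<cdot> (J z \<cdot> x)) one"
    using assms trace_commute[of x "y \<cdot> J z"] by (simp add: mul_assoc)
  also have "\<dots> = cinner y (J x \<cdot> z)" using assms by (simp add: cinner_mul_one J_mul)
  finally show ?thesis .
qed

lemma norm_mul_J: "x \<in> D \<Longrightarrow> norm (x \<cdot> J x) = norm (J x \<cdot> x)"
proof -
  assume x: "x \<in> D"
  have "cinner (x \<cdot> J x) (x \<cdot> J x) = cinner (J x) (J x \<cdot> (x \<cdot> J x))"
    using x by (intro cinner_mul_left) auto
  also have "\<dots> = cinner (J x \<cdot> x) (J x \<cdot> x)"
    using x cinner_mul_right[of "J x" x "J x \<cdot> x"] by (simp add: mul_assoc)
  finally have "cinner (x \<cdot> J x) (x \<cdot> J x) = cinner (J x \<cdot> x) (J x \<cdot> x)" .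
  then show ?thesis
    by - (rule power2_eq_imp_eq, simp_all add: norm_eq_sqrt_Re_cinner)
qed

text \<open>By the trace property the left-hand side is \<open>\<phi>(x\<^sup>* x y y\<^sup>*)\<close>, to which the Cauchy-Schwarz
  inequality applies.  This bounds products by moments of the single factors.\<close>

lemma norm_mul_le:
  assumes "x \<in> D" "y \<in> D"
  shows "(norm (x \<cdot> y))\<^sup>2 \<le> norm (J x \<cdot> x) * norm (y \<cdot> J y)"
proof -
  have "cinner (x \<cdot> y) (x \<cdot> y) = cinner (J x \<cdot> x) (y \<cdot> J y)"
  proof -
    have "cinner (x \<cdot> y) (x \<cdot> y) = cinner x (x \<cdot> (y \<cdot> J y))"
      using assms by (simp add: cinner_mul_right mul_assoc)
    also have "\<dots> = cnj (cinner (y \<cdot> J y) (J x \<cdot> x))"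
      using assms by (subst cinner_commute) (simp add: cinner_mul_left)
    also have "\<dots> = cinner (J x \<cdot> x) (y \<cdot> J y)" by (rule cinner_commute[symmetric])
    finally show ?thesis .
  qed
  then have "(norm (x \<cdot> y))\<^sup>2 = Re (cinner (J x \<cdot> x) (y \<cdot> J y))" by (simp add: norm_eq_sqrt_Re_cinner)
  also have "\<dots> \<le> norm (J x \<cdot> x) * norm (y \<cdot> J y)"
    by (rule order.trans[OF complex_Re_le_cmod cinner_bound])
  finally show ?thesis .
qed

lemma l2_prod_Nil [simp]: "l2_prod W [] = one" by (simp add: l2_prod_def)
lemma l2_prod_Cons [simp]: "l2_prod W (x # xs) = x \<cdot> l2_prod W xs" by (simp add: l2_prod_def)

lemma l2_prod_D [simp]: "set xs \<subseteq> D \<Longrightarrow> l2_prod W xs \<in> D"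
  by (induction xs) auto

lemma l2_prod_append: "set xs \<subseteq> D \<Longrightarrow> set ys \<subseteq> D \<Longrightarrow> l2_prod W (xs @ ys) = l2_prod W xs \<cdot> l2_prod W ys"
  by (induction xs) (auto simp: mul_assoc)

lemma J_l2_prod: "set xs \<subseteq> D \<Longrightarrow> J (l2_prod W xs) = l2_prod W (rev (map J xs))"
proof (induction xs)
  case (Cons x xs)
  have "set (rev (map J xs)) \<subseteq> D" using Cons.prems by auto
  then show ?case using Cons by (simp add: J_mul l2_prod_append)
qed simp

lemma l2_power_D [simp]: "x \<in> D \<Longrightarrow> l2_power W x i \<in> D"
  unfolding l2_power_def by (rule l2_prod_D) auto

lemma l2_power_simps [simp]: "l2_power W x 0 = one" "l2_power W x (Suc i) = x \<cdot> l2_power W x i"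
  by (simp_all add: l2_power_def)

lemma l2_power_commute: "x \<in> D \<Longrightarrow> l2_power W x i \<cdot> x = x \<cdot> l2_power W x i"
  by (induction i) (simp_all add: mul_assoc)

lemma J_l2_power: "x \<in> D \<Longrightarrow> J (l2_power W x i) = l2_power W (J x) i"
  unfolding l2_power_def by (subst J_l2_prod) auto

lemma l2_poly_D [simp]: "x \<in> D \<Longrightarrow> l2_poly W P x \<in> D"
  unfolding l2_poly_def by (intro D_sum D_scale l2_power_D)

end

section \<open>Graded algebras\<close>

text \<open>\<open>H q\<close> plays the role of the multiple integrals of order \<open>q\<close>.  Everything is
  stated for finite sums of such integrals, so that no convergence questions arise inside the algebra.\<close>

locale graded_algebra = l2_algebra W D
  for W :: "('h::chilbert_space, 'l::chilbert_space) wstar_space" and D :: "'l set" +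
  fixes H :: "nat \<Rightarrow> 'l set"
  assumes H_add [simp]: "x \<in> H q \<Longrightarrow> y \<in> H q \<Longrightarrow> x + y \<in> H q"
    and H_scale [simp]: "x \<in> H q \<Longrightarrow> scaleC c x \<in> H q"
    and H_zero [simp]: "0 \<in> H q"
    and H_J [simp]: "x \<in> H q \<Longrightarrow> J x \<in> H q"
    and H_D [simp]: "x \<in> H q \<Longrightarrow> x \<in> D"
    and H_orthogonal: "x \<in> H q \<Longrightarrow> y \<in> H r \<Longrightarrow> q \<noteq> r \<Longrightarrow> cinner x y = 0"
    and D_decompose: "x \<in> D \<Longrightarrow> \<exists>N u. (\<forall>q. u q \<in> H q) \<and> x = (\<Sum>q\<le>N. u q)"
    and H_0: "x \<in> H 0 \<Longrightarrow> \<exists>c. x = scaleC c (l2_one W)"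
    and one_H_0 [simp]: "l2_one W \<in> H 0"
begin

lemma H_diff [simp]: "x \<in> H q \<Longrightarrow> y \<in> H q \<Longrightarrow> x - y \<in> H q"
  using H_add[of x q "scaleC (-1) y"] H_scale[of y q "-1"] by (simp add: scaleC_minus1)

text \<open>The orthogonal projection to \<open>H q\<close>.  It exists on \<open>D\<close>, whose elements are finite sums of
  homogeneous elements.\<close>

definition comp :: "nat \<Rightarrow> 'l \<Rightarrow> 'l" where
  "comp q x = (THE y. y \<in> H q \<and> (\<forall>z\<in>H q. cinner x z = cinner y z))"

lemma H_eqI: "x \<in> H q \<Longrightarrow> y \<in> H q \<Longrightarrow> (\<And>z. z \<in> H q \<Longrightarrow> cinner x z = cinner y z) \<Longrightarrow> x = y"
proof -
  assume xy: "x \<in> H q" "y \<in> H q" and eq: "\<And>z. z \<in> H q \<Longrightarrow> cinner x z = cinner y z"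
  have "cinner (x - y) (x - y) = 0" using eq[of "x - y"] xy by (simp add: cinner.diff_left)
  then show "x = y" by (simp add: cinner_self)
qed

lemma comp_unique:
  assumes "y \<in> H q" "\<And>z. z \<in> H q \<Longrightarrow> cinner x z = cinner y z"
  shows "comp q x = y"
  unfolding comp_def
proof (rule the_equality)
  fix y' assume y': "y' \<in> H q \<and> (\<forall>z\<in>H q. cinner x z = cinner y' z)"
  show "y' = y" by (rule H_eqI[of _ q]) (use y' assms in auto)
qed (use assms in blast)

lemma comp_sum_homogeneous:
  assumes "\<And>i. i \<in> S \<Longrightarrow> u i \<in> H i" "finite S"
  shows "comp q (sum u S) = (if q \<in> S then u q else 0)"
proof (rule comp_unique)
  fix z assume z: "z \<in> H q"
  have "cinner (sum u S) z = (\<Sum>i\<in>S. if i = q then cinner (u i) z else 0)"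
    unfolding cinner.sum_left
    by (rule sum.cong) (auto intro: H_orthogonal[OF assms(1) z])
  also have "\<dots> = cinner (if q \<in> S then u q else 0) z" using assms(2) by (simp add: sum.delta')
  finally show "cinner (sum u S) z = cinner (if q \<in> S then u q else 0) z" .
qed (use assms in auto)

definition deg_le :: "nat \<Rightarrow> 'l \<Rightarrow> bool" where
  "deg_le N x \<longleftrightarrow> (\<exists>u. (\<forall>q. u q \<in> H q) \<and> x = (\<Sum>q\<le>N. u q))"

lemma deg_leE:
  assumes "deg_le N x"
  shows "x \<in> D" "comp q x \<in> H q" "q > N \<Longrightarrow> comp q x = 0" "x = (\<Sum>q\<le>N. comp q x)"
proof -
  obtain u where u: "\<And>q. u q \<in> H q" and x: "x = (\<Sum>q\<le>N. u q)" using assms by (auto simp: deg_le_def)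
  have c: "comp q x = (if q \<in> {..N} then u q else 0)" for q
    unfolding x by (rule comp_sum_homogeneous) (auto simp: u)
  show "x \<in> D" unfolding x by (rule D_sum) (rule H_D[OF u])
  show "comp q x \<in> H q" using u by (simp add: c)
  show "q > N \<Longrightarrow> comp q x = 0" by (simp add: c)
  have "(\<Sum>q\<le>N. comp q x) = (\<Sum>q\<le>N. u q)" by (rule sum.cong) (auto simp: c)
  then show "x = (\<Sum>q\<le>N. comp q x)" using x by simp
qed

lemma deg_exists: "x \<in> D \<Longrightarrow> \<exists>N. deg_le N x"
  using D_decompose unfolding deg_le_def by blast

lemma comp_H [simp]: "x \<in> D \<Longrightarrow> comp q x \<in> H q"
  using deg_exists deg_leE(2) by blast

lemma comp_D [simp]: "x \<in> D \<Longrightarrow> comp q x \<in> D"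
  using H_D comp_H by blast

lemma cinner_comp: "x \<in> D \<Longrightarrow> z \<in> H q \<Longrightarrow> cinner (comp q x) z = cinner x z"
proof -
  assume "x \<in> D" and z: "z \<in> H q"
  then obtain N where N: "deg_le N x" using deg_exists by blast
  have "cinner x z = (\<Sum>i\<le>N. cinner (comp i x) z)"
    by (subst deg_leE(4)[OF N]) (rule cinner.sum_left)
  also have "\<dots> = (\<Sum>i\<le>N. if i = q then cinner (comp i x) z else 0)"
    by (rule sum.cong) (auto intro: H_orthogonal[OF deg_leE(2)[OF N] z])
  also have "\<dots> = cinner (comp q x) z" using deg_leE(3)[OF N] by (simp add: sum.delta')
  finally show "cinner (comp q x) z = cinner x z" ..
qed

lemma cinner_comp_right: "x \<in> D \<Longrightarrow> z \<in> H q \<Longrightarrow> cinner z (comp q x) = cinner z x"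
  using cinner_comp by (metis cinner_commute)

lemma comp_add: "x \<in> D \<Longrightarrow> y \<in> D \<Longrightarrow> comp q (x + y) = comp q x + comp q y"
  by (rule comp_unique) (auto simp: cinner_comp cinner_add_left)

lemma comp_scale: "x \<in> D \<Longrightarrow> comp q (scaleC c x) = scaleC c (comp q x)"
  by (rule comp_unique) (auto simp: cinner_comp cinner_scaleC_left)

lemma comp_diff: "x \<in> D \<Longrightarrow> y \<in> D \<Longrightarrow> comp q (x - y) = comp q x - comp q y"
  by (rule comp_unique) (auto simp: cinner_comp cinner.diff_left)

lemma comp_zero [simp]: "comp q 0 = 0"
  by (rule comp_unique) auto

lemma comp_sum: "(\<And>i. i \<in> S \<Longrightarrow> u i \<in> D) \<Longrightarrow> comp q (sum u S) = (\<Sum>i\<in>S. comp q (u i))"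
  by (induction S rule: infinite_finite_induct) (auto simp: comp_add)

lemma comp_J: "x \<in> D \<Longrightarrow> comp q (J x) = J (comp q x)"
proof (rule comp_unique)
  fix z assume x: "x \<in> D" and z: "z \<in> H q"
  show "cinner (J x) z = cinner (J (comp q x)) z"
    using cinner_J[of x "J z"] cinner_J[of "comp q x" "J z"] x z by (simp add: cinner_comp_right)
qed auto

lemma comp_homogeneous: "x \<in> H r \<Longrightarrow> comp q x = (if q = r then x else 0)"
  by (rule comp_unique) (auto simp: H_orthogonal)

lemma deg_le_iff: "deg_le N x \<longleftrightarrow> x \<in> D \<and> (\<forall>q>N. comp q x = 0)"
proof (intro iffI conjI allI impI)
  assume a: "x \<in> D \<and> (\<forall>q>N. comp q x = 0)"
  then obtain M where M: "deg_le M x" using deg_exists by blast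
  have "(\<Sum>q\<le>N. comp q x) = (\<Sum>q\<le>max N M. comp q x)"
    using a by (intro sum.mono_neutral_left) auto
  also have "\<dots> = (\<Sum>q\<le>M. comp q x)"
    using deg_leE(3)[OF M] by (intro sum.mono_neutral_right) auto
  also have "\<dots> = x" using deg_leE(4)[OF M] ..
  finally show "deg_le N x" unfolding deg_le_def using a comp_H by metis
qed (auto dest: deg_leE(1,3))

lemma deg_le_D: "deg_le N x \<Longrightarrow> x \<in> D" by (rule deg_leE(1))

lemma deg_le_comp_zero: "deg_le N x \<Longrightarrow> q > N \<Longrightarrow> comp q x = 0" by (rule deg_leE(3))

lemma deg_le_sum: "deg_le N x \<Longrightarrow> (\<Sum>q\<le>N. comp q x) = x" using deg_leE(4) by simp

lemma deg_le_mono: "deg_le N x \<Longrightarrow> N \<le> M \<Longrightarrow> deg_le M x" by (auto simp: deg_le_iff)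

lemma deg_le_homogeneous: "x \<in> H q \<Longrightarrow> deg_le q x"
  by (auto simp: deg_le_iff comp_homogeneous)

lemma deg_le_add [simp]: "deg_le N x \<Longrightarrow> deg_le N y \<Longrightarrow> deg_le N (x + y)"
  by (auto simp: deg_le_iff comp_add)

lemma deg_le_diff [simp]: "deg_le N x \<Longrightarrow> deg_le N y \<Longrightarrow> deg_le N (x - y)"
  by (auto simp: deg_le_iff comp_diff)

lemma deg_le_scale [simp]: "deg_le N x \<Longrightarrow> deg_le N (scaleC c x)"
  by (auto simp: deg_le_iff comp_scale)

lemma deg_le_J [simp]: "deg_le N x \<Longrightarrow> deg_le N (J x)"
  by (auto simp: deg_le_iff comp_J)

lemma deg_le_zero [simp]: "deg_le N 0" by (simp add: deg_le_iff)

lemma deg_le_sum_I [simp]: "(\<And>i. i \<in> S \<Longrightarrow> deg_le N (u i)) \<Longrightarrow> deg_le N (sum u S)"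
  by (induction S rule: infinite_finite_induct) auto

lemma D_eqI: "x \<in> D \<Longrightarrow> y \<in> D \<Longrightarrow> (\<And>q. comp q x = comp q y) \<Longrightarrow> x = y"
proof -
  assume "x \<in> D" "y \<in> D" and eq: "\<And>q. comp q x = comp q y"
  then obtain N M where NM: "deg_le N x" "deg_le M y" using deg_exists by blast
  then have "deg_le (max N M) x" "deg_le (max N M) y" using deg_le_mono by auto
  then have "x = (\<Sum>q\<le>max N M. comp q x)" "y = (\<Sum>q\<le>max N M. comp q y)"
    by (simp_all add: deg_le_sum)
  then show "x = y" using eq by simp
qed

lemma D_induct [consumes 1, case_names homogeneous add]:
  assumes "x \<in> D" and hom: "\<And>q u. u \<in> H q \<Longrightarrow> P u"
    and add: "\<And>u v. u \<in> D \<Longrightarrow> v \<in> D \<Longrightarrow> P u \<Longrightarrow> P v \<Longrightarrow> P (u + v)"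
  shows "P x"
proof -
  obtain N where N: "deg_le N x" using assms(1) deg_exists by blast
  have "P (\<Sum>q\<le>M. comp q x)" for M
  proof (induction M)
    case 0 show ?case using hom[OF comp_H[OF assms(1)]] by simp
  next
    case (Suc M)
    have "P ((\<Sum>q\<le>M. comp q x) + comp (Suc M) x)"
      by (rule add[OF _ _ Suc hom[OF comp_H[OF assms(1)]]]) (use assms(1) in simp_all)
    then show ?case by simp
  qed
  from this[of N] show ?thesis unfolding deg_le_sum[OF N] .
qed

lemma norm_sum_homogeneous:
  assumes "\<And>i. i \<in> S \<Longrightarrow> u i \<in> H i" "finite S"
  shows "(norm (sum u S))\<^sup>2 = (\<Sum>i\<in>S. (norm (u i))\<^sup>2)"
proof -
  have "cinner (sum u S) (sum u S) = (\<Sum>i\<in>S. \<Sum>j\<in>S. if j = i then cinner (u i) (u i) else 0)"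
    unfolding cinner.sum_left cinner.sum_right
    by (intro sum.cong refl) (auto intro: H_orthogonal[OF assms(1) assms(1)])
  also have "\<dots> = (\<Sum>i\<in>S. cinner (u i) (u i))" using assms(2) by (intro sum.cong refl) (simp add: sum.delta')
  finally show ?thesis by (simp add: norm_eq_sqrt_Re_cinner)
qed

lemma norm_deg_le: "deg_le N x \<Longrightarrow> (norm x)\<^sup>2 = (\<Sum>q\<le>N. (norm (comp q x))\<^sup>2)"
  using norm_sum_homogeneous[of "{..N}" "\<lambda>q. comp q x"] deg_le_sum[of N x] deg_le_D[of N x] by simp

lemma norm_comp_le: "x \<in> D \<Longrightarrow> norm (comp q x) \<le> norm x"
proof -
  assume "x \<in> D"
  then obtain N where N: "deg_le N x" using deg_exists by blast
  have M: "deg_le (max N q) x" using N deg_le_mono by simp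
  have "(norm (comp q x))\<^sup>2 \<le> (\<Sum>i\<le>max N q. (norm (comp i x))\<^sup>2)"
    by (rule member_le_sum) auto
  then have "(norm (comp q x))\<^sup>2 \<le> (norm x)\<^sup>2" using norm_deg_le[OF M] by simp
  then show "norm (comp q x) \<le> norm x" by (rule power2_le_imp_le) simp
qed

text \<open>Degree \<open>0\<close> carries nothing but the expectation.\<close>

lemma comp_0_centered:
  assumes "x \<in> D" "cinner x one = 0"
  shows "comp 0 x = 0"
proof -
  obtain c where c: "comp 0 x = scaleC c one" using H_0 comp_H assms(1) by blast
  have "cinner (comp 0 x) (comp 0 x) = cinner x (comp 0 x)" using assms(1) by (simp add: cinner_comp)
  also have "\<dots> = 0" unfolding c cinner_scaleC_right using assms(2) by simp
  finally show ?thesis by (simp add: cinner_self)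
qed

text \<open>The product of largest degree of the homogeneous parts: for multiple integrals this is the
  integral of the tensor product of the kernels.\<close>

definition tens :: "'l \<Rightarrow> 'l \<Rightarrow> 'l" (infixl "\<odot>" 70) where
  "x \<odot> y = (\<Sum>q\<in>{q. comp q x \<noteq> 0}. \<Sum>r\<in>{r. comp r y \<noteq> 0}. comp (q + r) (comp q x \<cdot> comp r y))"

lemma tens_expand:
  assumes "deg_le N x" "deg_le M y"
  shows "x \<odot> y = (\<Sum>q\<le>N. \<Sum>r\<le>M. comp (q + r) (comp q x \<cdot> comp r y))"
proof -
  have "x \<odot> y = (\<Sum>q\<le>N. \<Sum>r\<in>{r. comp r y \<noteq> 0}. comp (q + r) (comp q x \<cdot> comp r y))"
    unfolding tens_def using deg_le_comp_zero[OF assms(1)]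
    by (intro sum.mono_neutral_left) (auto simp: not_less[symmetric])
  also have "\<dots> = (\<Sum>q\<le>N. \<Sum>r\<le>M. comp (q + r) (comp q x \<cdot> comp r y))"
    using deg_le_comp_zero[OF assms(2)]
    by (intro sum.cong sum.mono_neutral_left) (auto simp: not_less[symmetric])
  finally show ?thesis .
qed

lemma tens_D [simp]: "x \<in> D \<Longrightarrow> y \<in> D \<Longrightarrow> x \<odot> y \<in> D"
  unfolding tens_def by (intro D_sum comp_D mul_D)

lemma tens_homogeneous: "x \<in> H q \<Longrightarrow> y \<in> H r \<Longrightarrow> x \<odot> y = comp (q + r) (x \<cdot> y)"
proof -
  assume x: "x \<in> H q" and y: "y \<in> H r"
  have "x \<odot> y = (\<Sum>i\<le>q. \<Sum>j\<le>r. if i = q then (if j = r then comp (q + r) (x \<cdot> y) else 0) else 0)"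
    unfolding tens_expand[OF deg_le_homogeneous[OF x] deg_le_homogeneous[OF y]]
    by (intro sum.cong refl) (auto simp: comp_homogeneous[OF x] comp_homogeneous[OF y])
  also have "\<dots> = comp (q + r) (x \<cdot> y)"
    by (subst sum.swap) (simp add: sum.delta')
  finally show "x \<odot> y = comp (q + r) (x \<cdot> y)" .
qed

lemma tens_H [simp]: "x \<in> H q \<Longrightarrow> y \<in> H r \<Longrightarrow> x \<odot> y \<in> H (q + r)"
  by (simp add: tens_homogeneous)

lemma tens_add_left: "x \<in> D \<Longrightarrow> x' \<in> D \<Longrightarrow> y \<in> D \<Longrightarrow> (x + x') \<odot> y = x \<odot> y + x' \<odot> y"
proof -
  assume D: "x \<in> D" "x' \<in> D" "y \<in> D"
  obtain N where d1: "deg_le N x" using deg_exists[OF D(1)] by blast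
  obtain N' where d2: "deg_le N' x'" using deg_exists[OF D(2)] by blast
  obtain M where d3: "deg_le M y" using deg_exists[OF D(3)] by blast
  note d = d1 d2 d3
  have d': "deg_le (max N N') x" "deg_le (max N N') x'"
    by (rule deg_le_mono[OF d1], simp, rule deg_le_mono[OF d2], simp)
  show "(x + x') \<odot> y = x \<odot> y + x' \<odot> y"
    unfolding tens_expand[OF deg_le_add[OF d'] d(3)] tens_expand[OF d'(1) d(3)] tens_expand[OF d'(2) d(3)]
    using D by (simp add: comp_add mul_add_left sum.distrib)
qed

lemma tens_add_right: "x \<in> D \<Longrightarrow> y \<in> D \<Longrightarrow> y' \<in> D \<Longrightarrow> x \<odot> (y + y') = x \<odot> y + x \<odot> y'"
proof -
  assume D: "x \<in> D" "y \<in> D" "y' \<in> D"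
  obtain N where d1: "deg_le N y" using deg_exists[OF D(2)] by blast
  obtain N' where d2: "deg_le N' y'" using deg_exists[OF D(3)] by blast
  obtain M where d3: "deg_le M x" using deg_exists[OF D(1)] by blast
  note d = d1 d2 d3
  have d': "deg_le (max N N') y" "deg_le (max N N') y'"
    by (rule deg_le_mono[OF d1], simp, rule deg_le_mono[OF d2], simp)
  show "x \<odot> (y + y') = x \<odot> y + x \<odot> y'"
    unfolding tens_expand[OF d(3) deg_le_add[OF d']] tens_expand[OF d(3) d'(1)] tens_expand[OF d(3) d'(2)]
    using D by (simp add: comp_add mul_add_right sum.distrib)
qed

lemma tens_scale_left: "x \<in> D \<Longrightarrow> y \<in> D \<Longrightarrow> scaleC c x \<odot> y = scaleC c (x \<odot> y)"
proof -
  assume D: "x \<in> D" "y \<in> D"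
  obtain N where d1: "deg_le N x" using deg_exists[OF D(1)] by blast
  obtain M where d2: "deg_le M y" using deg_exists[OF D(2)] by blast
  note d = d1 d2
  show "scaleC c x \<odot> y = scaleC c (x \<odot> y)"
    unfolding tens_expand[OF deg_le_scale[OF d(1)] d(2)] tens_expand[OF d] scaleC.sum_right
    using D by (simp add: comp_scale mul_scale_left)
qed

lemma tens_scale_right: "x \<in> D \<Longrightarrow> y \<in> D \<Longrightarrow> x \<odot> scaleC c y = scaleC c (x \<odot> y)"
proof -
  assume D: "x \<in> D" "y \<in> D"
  obtain N where d1: "deg_le N x" using deg_exists[OF D(1)] by blast
  obtain M where d2: "deg_le M y" using deg_exists[OF D(2)] by blast
  note d = d1 d2
  show "x \<odot> scaleC c y = scaleC c (x \<odot> y)"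
    unfolding tens_expand[OF d(1) deg_le_scale[OF d(2)]] tens_expand[OF d] scaleC.sum_right
    using D by (simp add: comp_scale mul_scale_right)
qed

lemma tens_zero [simp]: "0 \<odot> x = 0" "x \<odot> 0 = 0" by (simp_all add: tens_def)

lemma tens_diff_left: "x \<in> D \<Longrightarrow> x' \<in> D \<Longrightarrow> y \<in> D \<Longrightarrow> (x - x') \<odot> y = x \<odot> y - x' \<odot> y"
  using tens_add_left[of "x - x'" x' y] by simp

lemma tens_sum_left: "(\<And>i. i \<in> S \<Longrightarrow> u i \<in> D) \<Longrightarrow> y \<in> D \<Longrightarrow> sum u S \<odot> y = (\<Sum>i\<in>S. u i \<odot> y)"
  by (induction S rule: infinite_finite_induct) (auto simp: tens_add_left)

lemma tens_sum_right: "(\<And>i. i \<in> S \<Longrightarrow> u i \<in> D) \<Longrightarrow> y \<in> D \<Longrightarrow> y \<odot> sum u S = (\<Sum>i\<in>S. y \<odot> u i)"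
  by (induction S rule: infinite_finite_induct) (auto simp: tens_add_right)

lemma J_tens: "x \<in> D \<Longrightarrow> y \<in> D \<Longrightarrow> J (x \<odot> y) = J y \<odot> J x"
proof -
  assume D: "x \<in> D" "y \<in> D"
  obtain N where d1: "deg_le N x" using deg_exists[OF D(1)] by blast
  obtain M where d2: "deg_le M y" using deg_exists[OF D(2)] by blast
  note d = d1 d2
  have "J (x \<odot> y) = (\<Sum>q\<le>N. \<Sum>r\<le>M. comp (r + q) (comp r (J y) \<cdot> comp q (J x)))"
    unfolding tens_expand[OF d] using D by (simp add: J_sum comp_J[symmetric] J_mul add.commute)
  also have "\<dots> = J y \<odot> J x"
    unfolding tens_expand[OF deg_le_J[OF d(2)] deg_le_J[OF d(1)]] by (rule sum.swap)
  finally show "J (x \<odot> y) = J y \<odot> J x" .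
qed

lemma deg_le_tens: "deg_le N x \<Longrightarrow> deg_le M y \<Longrightarrow> deg_le (N + M) (x \<odot> y)"
proof -
  assume d: "deg_le N x" "deg_le M y"
  have "deg_le (N + M) (comp (q + r) (comp q x \<cdot> comp r y))" if "q \<le> N" "r \<le> M" for q r
    using that deg_le_D[OF d(1)] deg_le_D[OF d(2)]
    by (intro deg_le_mono[OF deg_le_homogeneous[of _ "q + r"]] comp_H) auto
  then show ?thesis unfolding tens_expand[OF d] by (intro deg_le_sum_I) auto
qed

lemma tens_one_left [simp]: "x \<in> D \<Longrightarrow> one \<odot> x = x"
proof (induction rule: D_induct)
  case (homogeneous q u)
  then show ?case using tens_homogeneous[of one 0 u q] by (simp add: comp_homogeneous)
next
  case (add u v) then show ?case by (simp add: tens_add_right)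
qed

lemma tens_one_right [simp]: "x \<in> D \<Longrightarrow> x \<odot> one = x"
  using J_tens[of one "J x"] by simp

lemma comp_0_tens:
  assumes "x \<in> D" "y \<in> D" "comp 0 x = 0"
  shows "comp 0 (x \<odot> y) = 0"
proof -
  obtain N where d1: "deg_le N x" using deg_exists[OF assms(1)] by blast
  obtain M where d2: "deg_le M y" using deg_exists[OF assms(2)] by blast
  note d = d1 d2
  show ?thesis
    unfolding tens_expand[OF d] using assms
    by (simp add: comp_sum comp_homogeneous[OF comp_H]) (auto intro!: sum.neutral)
qed

text \<open>The part of the product in which at least one variable is contracted.\<close>

definition circ :: "'l \<Rightarrow> 'l \<Rightarrow> 'l" (infixl "\<diamondop>" 70) where "x \<diamondop> y = x \<cdot> y - x \<odot> y"

lemma circ_D [simp]: "x \<in> D \<Longrightarrow> y \<in> D \<Longrightarrow> x \<diamondop> y \<in> D" by (simp add: circ_def)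

lemma circ_add_left: "x \<in> D \<Longrightarrow> x' \<in> D \<Longrightarrow> y \<in> D \<Longrightarrow> (x + x') \<diamondop> y = x \<diamondop> y + x' \<diamondop> y"
  by (simp add: circ_def mul_add_left tens_add_left)

lemma circ_add_right: "x \<in> D \<Longrightarrow> y \<in> D \<Longrightarrow> y' \<in> D \<Longrightarrow> x \<diamondop> (y + y') = x \<diamondop> y + x \<diamondop> y'"
  by (simp add: circ_def mul_add_right tens_add_right)

lemma circ_scale_right: "x \<in> D \<Longrightarrow> y \<in> D \<Longrightarrow> x \<diamondop> scaleC c y = scaleC c (x \<diamondop> y)"
  by (simp add: circ_def mul_scale_right tens_scale_right scaleC_diff_right)

lemma circ_sum_left: "(\<And>i. i \<in> S \<Longrightarrow> u i \<in> D) \<Longrightarrow> y \<in> D \<Longrightarrow> sum u S \<diamondop> y = (\<Sum>i\<in>S. u i \<diamondop> y)"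
  by (simp add: circ_def mul_sum_left tens_sum_left sum_subtractf)

lemma circ_sum_right: "(\<And>i. i \<in> S \<Longrightarrow> u i \<in> D) \<Longrightarrow> y \<in> D \<Longrightarrow> y \<diamondop> sum u S = (\<Sum>i\<in>S. y \<diamondop> u i)"
  by (simp add: circ_def mul_sum_right tens_sum_right sum_subtractf)

lemma J_circ: "x \<in> D \<Longrightarrow> y \<in> D \<Longrightarrow> J (x \<diamondop> y) = J y \<diamondop> J x"
  by (simp add: circ_def J_diff J_mul J_tens)

lemma circ_one [simp]: "x \<in> D \<Longrightarrow> x \<diamondop> one = 0" "x \<in> D \<Longrightarrow> one \<diamondop> x = 0"
  by (simp_all add: circ_def)

end

section \<open>Contractions without kernels\<close>

text \<open>These three properties are all that is used of the product formulas.  For integrals of kernels \<open>f\<close>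
  and \<open>g\<close> of \<open>i\<close> and \<open>j\<close> variables, the component of degree \<open>e\<close> of the product is the integral of the
  contraction in which \<open>i + j - e\<close> variables disappear; this restricts the degrees that can occur.  The tensor
  product of kernels multiplies norms.  Locality says that a contraction of \<open>f\<close> with \<open>g \<otimes> h\<close> that does
  not go beyond the variables of \<open>g\<close> leaves \<open>h\<close> alone: the condition
  \<open>i \<le> d + q\<close> states that at most \<open>2 q\<close> variables disappear, so that the \<open>q\<close> variables of \<open>u\<close> suffice.\<close>

locale chaos_algebra = graded_algebra W D H
  for W :: "('h::chilbert_space, 'l::chilbert_space) wstar_space" and D :: "'l set"
    and H :: "nat \<Rightarrow> 'l set" +
  assumes degree_mul: "a \<in> H i \<Longrightarrow> b \<in> H j \<Longrightarrow> i + j < e \<or> e + i < j \<or> e + j < i \<Longrightarrow> comp e (a \<cdot> b) = 0"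
    and norm_tens: "u \<in> H q \<Longrightarrow> v \<in> H r \<Longrightarrow> norm (u \<odot> v) = norm u * norm v"
    and locality: "a \<in> H i \<Longrightarrow> u \<in> H q \<Longrightarrow> v \<in> H r \<Longrightarrow> i \<le> d + q \<Longrightarrow>
      comp (d + r) (a \<cdot> (u \<odot> v)) = comp d (a \<cdot> u) \<odot> v"
begin

lemma deg_le_mul_homogeneous: "a \<in> H i \<Longrightarrow> b \<in> H j \<Longrightarrow> deg_le (i + j) (a \<cdot> b)"
  by (simp add: deg_le_iff degree_mul)

lemma mul_expand:
  assumes "deg_le N x" "deg_le M y"
  shows "x \<cdot> y = (\<Sum>q\<le>N. \<Sum>r\<le>M. comp q x \<cdot> comp r y)"
proof -
  have x: "x \<in> D" and y: "y \<in> D" using assms by (simp_all add: deg_le_D)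
  have "x \<cdot> y = (\<Sum>q\<le>N. comp q x) \<cdot> (\<Sum>r\<le>M. comp r y)" by (simp add: deg_le_sum assms)
  also have "\<dots> = (\<Sum>q\<le>N. \<Sum>r\<le>M. comp q x \<cdot> comp r y)"
    using x y by (simp add: mul_sum_left mul_sum_right) (rule sum.swap)
  finally show ?thesis .
qed

lemma deg_le_mul:
  assumes "deg_le N x" "deg_le M y"
  shows "deg_le (N + M) (x \<cdot> y)"
  unfolding mul_expand[OF assms]
proof (intro deg_le_sum_I)
  have x: "x \<in> D" and y: "y \<in> D" using assms by (simp_all add: deg_le_D)
  fix q r assume "q \<in> {..N}" "r \<in> {..M}"
  then show "deg_le (N + M) (comp q x \<cdot> comp r y)"
    by (intro deg_le_mono[OF deg_le_mul_homogeneous[OF comp_H[OF x] comp_H[OF y]]]) simp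
qed

lemma deg_le_circ: "deg_le N x \<Longrightarrow> deg_le M y \<Longrightarrow> deg_le (N + M) (x \<diamondop> y)"
  unfolding circ_def by (intro deg_le_diff deg_le_mul deg_le_tens)

lemma comp_top_mul:
  assumes x: "deg_le N x" and c: "c \<in> H l"
  shows "comp (N + l) (x \<cdot> c) = comp N x \<odot> c"
proof -
  have xD: "x \<in> D" using x by (rule deg_le_D)
  have "x \<cdot> c = (\<Sum>q\<le>N. comp q x \<cdot> c)"
    using mul_sum_left[of "{..N}" "\<lambda>q. comp q x" c] deg_le_sum[OF x] xD c by simp
  then have "comp (N + l) (x \<cdot> c) = (\<Sum>q\<le>N. comp (N + l) (comp q x \<cdot> c))"
    using xD c by (simp add: comp_sum)
  also have "\<dots> = (\<Sum>q\<le>N. if q = N then comp N x \<odot> c else 0)"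
    by (rule sum.cong) (auto simp: degree_mul[OF comp_H[OF xD] c] tens_homogeneous[OF comp_H[OF xD] c])
  finally show ?thesis by simp
qed

lemma tens_assoc_homogeneous:
  assumes a: "a \<in> H i" and b: "b \<in> H j" and c: "c \<in> H l"
  shows "a \<odot> b \<odot> c = a \<odot> (b \<odot> c)"
proof -
  have left: "x \<odot> y \<odot> z = comp (i + j + l) (x \<cdot> y \<cdot> z)"
    if "x \<in> H i" "y \<in> H j" "z \<in> H l" for x y z i j l
    using comp_top_mul[OF deg_le_mul_homogeneous[OF that(1,2)] that(3)] tens_homogeneous[OF that(1,2)]
    by simp
  have "a \<odot> (b \<odot> c) = J (J c \<odot> J b \<odot> J a)" using a b c by (simp add: J_tens H_D)
  also have "\<dots> = J (comp (l + j + i) (J c \<cdot> J b \<cdot> J a))"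
    unfolding left[OF H_J[OF c] H_J[OF b] H_J[OF a]] ..
  also have "\<dots> = comp (i + j + l) (a \<cdot> (b \<cdot> c))"
    using a b c by (simp add: comp_J[symmetric] J_mul H_D add_ac)
  also have "\<dots> = a \<odot> b \<odot> c" unfolding left[OF a b c] using a b c by (simp add: mul_assoc H_D)
  finally show ?thesis ..
qed

lemma tens_assoc: "x \<in> D \<Longrightarrow> y \<in> D \<Longrightarrow> z \<in> D \<Longrightarrow> x \<odot> y \<odot> z = x \<odot> (y \<odot> z)"
proof (induction x rule: D_induct)
  case (homogeneous i a)
  note a = homogeneous(1)
  from homogeneous(2,3) show ?case
  proof (induction y rule: D_induct)
    case (homogeneous j b)
    note b = homogeneous(1)
    from homogeneous(2) show ?case
    proof (induction z rule: D_induct)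
      case (homogeneous l c) then show ?case by (rule tens_assoc_homogeneous[OF a b])
    next
      case (add u v) then show ?case using a b by (simp add: tens_add_right H_D)
    qed
  next
    case (add u v) then show ?case using a by (simp add: tens_add_right tens_add_left H_D)
  qed
next
  case (add u v) then show ?case by (simp add: tens_add_left)
qed

lemma norm_tens_le:
  assumes "deg_le N x" "deg_le M y"
  shows "norm (x \<odot> y) \<le> (real N + 1) * (real M + 1) * (norm x * norm y)"
proof -
  have x: "x \<in> D" and y: "y \<in> D" using assms by (simp_all add: deg_le_D)
  have "norm (x \<odot> y) \<le> (\<Sum>q\<le>N. norm (\<Sum>r\<le>M. comp (q + r) (comp q x \<cdot> comp r y)))"
    unfolding tens_expand[OF assms] by (rule norm_sum)
  also have "\<dots> \<le> (\<Sum>q\<le>N. \<Sum>r\<le>M. norm x * norm y)"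
  proof (intro sum_mono order.trans[OF norm_sum])
    fix q r
    have "norm (comp (q + r) (comp q x \<cdot> comp r y)) = norm (comp q x) * norm (comp r y)"
      using norm_tens[OF comp_H[OF x] comp_H[OF y], of q r]
      by (simp add: tens_homogeneous[OF comp_H[OF x] comp_H[OF y]])
    also have "\<dots> \<le> norm x * norm y" by (intro mult_mono norm_comp_le x y) simp_all
    finally show "norm (comp (q + r) (comp q x \<cdot> comp r y)) \<le> norm x * norm y" .
  qed
  also have "\<dots> = (real N + 1) * (real M + 1) * (norm x * norm y)" by (simp add: add.commute)
  finally show ?thesis .
qed

text \<open>Contracting all variables of \<open>u\<close> with the last (first) variables of \<open>a\<close> is adjoint to
  tensoring with \<open>u\<^sup>*\<close>.\<close>

lemma cinner_absorb_right:
  assumes a: "a \<in> H (p + q)" and u: "u \<in> H q" and z: "z \<in> H p"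
  shows "cinner (comp p (a \<cdot> u)) z = cinner a (z \<odot> J u)"
proof -
  have "cinner (comp p (a \<cdot> u)) z = cinner a (z \<cdot> J u)"
    using a u z by (simp add: cinner_comp cinner_mul_right H_D)
  also have "\<dots> = cinner a (comp (p + q) (z \<cdot> J u))"
    using a u z by (simp add: cinner_comp_right H_D)
  finally show ?thesis using tens_homogeneous[OF z H_J[OF u]] by simp
qed

lemma cinner_absorb_left:
  assumes a: "a \<in> H (p + q)" and u: "u \<in> H q" and z: "z \<in> H p"
  shows "cinner (comp p (u \<cdot> a)) z = cinner a (J u \<odot> z)"
proof -
  have "cinner (comp p (u \<cdot> a)) z = cinner a (J u \<cdot> z)"
    using a u z by (simp add: cinner_comp cinner_mul_left H_D)
  also have "\<dots> = cinner a (comp (p + q) (J u \<cdot> z))"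
    using a u z by (simp add: cinner_comp_right H_D)
  finally show ?thesis using tens_homogeneous[OF H_J[OF u] z] by (simp add: add.commute)
qed

lemma norm_absorb_right:
  assumes a: "a \<in> H (p + q)" and u: "u \<in> H q"
  shows "norm (comp p (a \<cdot> u)) \<le> norm a * norm u"
proof -
  define z where "z = comp p (a \<cdot> u)"
  have z: "z \<in> H p" using a u by (simp add: z_def H_D)
  have "(norm z)\<^sup>2 = Re (cinner a (z \<odot> J u))"
    using cinner_absorb_right[OF a u z] by (simp add: z_def[symmetric] norm_eq_sqrt_Re_cinner)
  also have "\<dots> \<le> norm a * norm (z \<odot> J u)" by (rule order.trans[OF complex_Re_le_cmod cinner_bound])
  also have "\<dots> = norm z * (norm a * norm u)" by (simp add: norm_tens[OF z H_J[OF u]] norm_J)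
  finally have "norm z * norm z \<le> norm z * (norm a * norm u)" by (simp add: power2_eq_square)
  then show ?thesis unfolding z_def[symmetric]
    by (cases "norm z = 0") (auto simp: mult_le_cancel_left)
qed

lemma norm_absorb_left:
  assumes a: "a \<in> H (p + q)" and u: "u \<in> H q"
  shows "norm (comp p (u \<cdot> a)) \<le> norm u * norm a"
  using norm_absorb_right[OF H_J[OF a] H_J[OF u]] a u
  by (simp add: J_mul[symmetric] comp_J H_D norm_J mult.commute)

text \<open>Contracting \<open>f\<close> completely with \<open>h\<close> and then with \<open>u\<close> amounts to contracting it with
  \<open>h \<otimes> u\<close>; on the other side of the inner product this is the associativity of tensor products.\<close>

lemma absorb_right_twice:
  assumes f: "f \<in> H (p + q + s)" and h: "h \<in> H s" and u: "u \<in> H q"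
  shows "comp p (comp (p + q) (f \<cdot> h) \<cdot> u) = comp p (f \<cdot> (h \<odot> u))"
proof (rule H_eqI[of _ p])
  have f': "f \<in> H (p + (s + q))" using f by (simp add: add_ac)
  have fh: "comp (p + q) (f \<cdot> h) \<in> H (p + q)" using f h by (simp add: H_D)
  show "comp p (comp (p + q) (f \<cdot> h) \<cdot> u) \<in> H p" "comp p (f \<cdot> (h \<odot> u)) \<in> H p"
    using f h u by (simp_all add: H_D)
  fix z assume z: "z \<in> H p"
  have "cinner (comp p (comp (p + q) (f \<cdot> h) \<cdot> u)) z = cinner (comp (p + q) (f \<cdot> h)) (z \<odot> J u)"
    by (rule cinner_absorb_right[OF fh u z])
  also have "\<dots> = cinner f (z \<odot> J u \<odot> J h)"
    by (rule cinner_absorb_right[OF f h]) (use z u in simp)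
  also have "\<dots> = cinner f (z \<odot> J (h \<odot> u))" using z u h by (simp add: J_tens tens_assoc H_D)
  also have "\<dots> = cinner (comp p (f \<cdot> (h \<odot> u))) z"
    by (rule cinner_absorb_right[OF f' tens_H[OF h u] z, symmetric])
  finally show "cinner (comp p (comp (p + q) (f \<cdot> h) \<cdot> u)) z = cinner (comp p (f \<cdot> (h \<odot> u))) z" .
qed

lemma absorb_left_twice:
  assumes f: "f \<in> H (p + q + s)" and h: "h \<in> H s" and u: "u \<in> H q"
  shows "comp p (u \<cdot> comp (p + q) (h \<cdot> f)) = comp p ((u \<odot> h) \<cdot> f)"
proof -
  have "J (comp p (u \<cdot> comp (p + q) (h \<cdot> f))) = J (comp p ((u \<odot> h) \<cdot> f))"
    using absorb_right_twice[OF H_J[OF f] H_J[OF h] H_J[OF u]] f h u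
    by (simp add: comp_J[symmetric] J_mul J_tens H_D)
  then show ?thesis by (metis J_J)
qed

lemma locality_left:
  assumes "a \<in> H i" "u \<in> H q" "v \<in> H r" "i \<le> d + q"
  shows "comp (d + r) ((v \<odot> u) \<cdot> a) = v \<odot> comp d (u \<cdot> a)"
proof -
  have "comp (d + r) ((v \<odot> u) \<cdot> a) = J (comp (d + r) (J a \<cdot> (J u \<odot> J v)))"
    using assms by (simp add: comp_J[symmetric] J_mul J_tens H_D)
  also have "\<dots> = J (comp d (J a \<cdot> J u) \<odot> J v)"
    by (subst locality[of "J a" i "J u" q "J v" r d]) (use assms in simp_all)
  also have "\<dots> = v \<odot> comp d (u \<cdot> a)" using assms by (simp add: J_tens comp_J[symmetric] J_mul H_D)
  finally show ?thesis .
qed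

text \<open>If the contraction of \<open>a\<close> with \<open>u \<odot> v\<close> reaches beyond \<open>u\<close>, then it may be performed in two
  stages.  The adjunction turns this into an instance of the locality of the mirror image.\<close>

lemma locality_beyond:
  assumes a: "a \<in> H (p + q)" and u: "u \<in> H q" and v: "v \<in> H r" and e: "e \<le> p + r"
  shows "comp e (a \<cdot> (u \<odot> v)) = comp e (comp p (a \<cdot> u) \<cdot> v)"
proof (rule H_eqI[of _ e])
  fix w assume w: "w \<in> H e"
  have D: "a \<in> D" "u \<in> D" "v \<in> D" "w \<in> D" using a u v w by (auto intro: H_D)
  have "cinner (comp e (a \<cdot> (u \<odot> v))) w = cinner a (w \<cdot> (J v \<odot> J u))"
    using D w by (simp add: cinner_comp cinner_mul_right J_tens)
  also have "\<dots> = cinner a (comp (p + q) (w \<cdot> (J v \<odot> J u)))" using D a by (simp add: cinner_comp_right)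
  also have "\<dots> = cinner a (comp p (w \<cdot> J v) \<odot> J u)"
    by (subst locality[of w e "J v" r "J u" q p]) (use w v u e in simp_all)
  also have "\<dots> = cinner (comp p (a \<cdot> u)) (comp p (w \<cdot> J v))"
    by (rule cinner_absorb_right[OF a u, symmetric]) (use D in simp)
  also have "\<dots> = cinner (comp p (a \<cdot> u)) (w \<cdot> J v)"
    by (rule cinner_comp_right) (use D in simp_all)
  also have "\<dots> = cinner (comp p (a \<cdot> u) \<cdot> v) w" using D by (simp add: cinner_mul_right)
  also have "\<dots> = cinner (comp e (comp p (a \<cdot> u) \<cdot> v)) w" using D w by (simp add: cinner_comp)
  finally show "cinner (comp e (a \<cdot> (u \<odot> v))) w = cinner (comp e (comp p (a \<cdot> u) \<cdot> v)) w" .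
qed (use a u v in \<open>simp_all add: H_D\<close>)

lemma comp_tens_homogeneous:
  assumes x: "x \<in> D" and v: "v \<in> H r"
  shows "comp e (x \<odot> v) = (if r \<le> e then comp (e - r) x \<odot> v else 0)"
  using x
proof (induction rule: D_induct)
  case (homogeneous q u)
  then show ?case using comp_homogeneous[OF tens_H[OF homogeneous v]] by (auto simp: comp_homogeneous[OF homogeneous])
next
  case (add u w)
  then show ?case using v by (simp add: tens_add_left comp_add H_D)
qed

lemma comp_circ_homogeneous:
  assumes "a \<in> H i" "b \<in> H j"
  shows "comp e (a \<diamondop> b) = (if e = i + j then 0 else comp e (a \<cdot> b))"
proof -
  have "comp e (a \<diamondop> b) = comp e (a \<cdot> b) - (if e = i + j then a \<odot> b else 0)"
    unfolding circ_def comp_homogeneous[OF tens_H[OF assms], symmetric]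
    using assms by (simp add: comp_diff H_D)
  then show ?thesis by (simp add: tens_homogeneous[OF assms])
qed

lemma mul_tens_homogeneous:
  assumes a: "a \<in> H i" and u: "u \<in> H q" and v: "v \<in> H r"
  shows "a \<cdot> (u \<odot> v) = (a \<cdot> u) \<odot> v + (if q \<le> i then comp (i - q) (a \<cdot> u) \<diamondop> v else 0)"
proof (rule D_eqI)
  have D: "a \<in> D" "u \<in> D" "v \<in> D" using a u v by (auto intro: H_D)
  show "a \<cdot> (u \<odot> v) \<in> D" "(a \<cdot> u) \<odot> v + (if q \<le> i then comp (i - q) (a \<cdot> u) \<diamondop> v else 0) \<in> D"
    using D by auto
  fix e
  have t: "comp e ((a \<cdot> u) \<odot> v) = (if r \<le> e then comp (e - r) (a \<cdot> u) \<odot> v else 0)"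
    by (rule comp_tens_homogeneous[OF _ v]) (use D in simp)
  show "comp e (a \<cdot> (u \<odot> v)) = comp e ((a \<cdot> u) \<odot> v + (if q \<le> i then comp (i - q) (a \<cdot> u) \<diamondop> v else 0))"
  proof (cases "q \<le> i")
    case True
    define p where "p = i - q"
    have i: "i = p + q" using True by (simp add: p_def)
    define A where "A = comp p (a \<cdot> u)"
    have A: "A \<in> H p" using D by (simp add: A_def)
    have c: "comp e (A \<diamondop> v) = (if e = p + r then 0 else comp e (A \<cdot> v))"
      by (rule comp_circ_homogeneous[OF A v])
    have "comp e (a \<cdot> (u \<odot> v)) = comp e ((a \<cdot> u) \<odot> v) + comp e (A \<diamondop> v)"
    proof (cases "e < p + r")
      case True
      have "comp (e - r) (a \<cdot> u) = 0" if "r \<le> e"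
        by (rule degree_mul[OF a u]) (use True that i in linarith)
      then show ?thesis
        using True locality_beyond[OF a[unfolded i] u v, of e] by (simp add: t c A_def[symmetric])
    next
      case False
      then have "comp e (a \<cdot> (u \<odot> v)) = comp (e - r) (a \<cdot> u) \<odot> v"
        using locality[OF a u v, of "e - r"] i by simp
      moreover have "comp e (A \<diamondop> v) = 0"
        using False degree_mul[OF A v, of e] by (auto simp: c)
      ultimately show ?thesis using False by (simp add: t)
    qed
    then show ?thesis using True D A by (simp add: comp_add A_def p_def)
  next
    case False
    have "comp e (a \<cdot> (u \<odot> v)) = (if r \<le> e then comp (e - r) (a \<cdot> u) \<odot> v else 0)"
    proof (cases "r \<le> e")
      case True then show ?thesis using locality[OF a u v, of "e - r"] False by simp
    next
      case r: False
      then show ?thesis using degree_mul[OF a tens_H[OF u v], of e] False by simp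
    qed
    then show ?thesis using False by (simp add: t)
  qed
qed

text \<open>The basic expansion.  In the product of \<open>a\<close> with a tensor product \<open>x \<odot> v\<close> either the contraction
  stays inside \<open>x\<close>, or it uses up all variables of a component of \<open>x\<close> and the rest of \<open>a\<close> is multiplied with
  \<open>v\<close>, contracting at least one more variable.  Products and tensor products of several factors thus differ
  only by terms in which one factor has been absorbed completely.\<close>

lemma mul_tens:
  assumes a: "a \<in> H i" and x: "x \<in> D" and v: "v \<in> D"
  shows "a \<cdot> (x \<odot> v) = (a \<cdot> x) \<odot> v + (\<Sum>q\<le>i. comp (i - q) (a \<cdot> comp q x) \<diamondop> v)"
  using x
proof (induction rule: D_induct)
  case (homogeneous q u)
  note u = homogeneous
  have "(\<Sum>j\<le>i. comp (i - j) (a \<cdot> comp j u) \<diamondop> v) = (\<Sum>j\<le>i. if j = q then comp (i - q) (a \<cdot> u) \<diamondop> v else 0)"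
    by (intro sum.cong refl) (simp add: comp_homogeneous[OF u] circ_def)
  then have s: "(\<Sum>j\<le>i. comp (i - j) (a \<cdot> comp j u) \<diamondop> v) = (if q \<le> i then comp (i - q) (a \<cdot> u) \<diamondop> v else 0)"
    by simp
  show ?case unfolding s
    using v
  proof (induction rule: D_induct)
    case (homogeneous r v) then show ?case by (rule mul_tens_homogeneous[OF a u])
  next
    case (add v w)
    then show ?case using a u
      by (simp add: tens_add_right mul_add_right circ_add_right H_D)
  qed
next
  case (add u w)
  then show ?case using a v
    by (simp add: tens_add_left mul_add_right circ_add_left comp_add sum.distrib H_D)
qed

lemma tens_mul:
  assumes a: "a \<in> H i" and x: "x \<in> D" and v: "v \<in> D"
  shows "(v \<odot> x) \<cdot> a = v \<odot> (x \<cdot> a) + (\<Sum>q\<le>i. v \<diamondop> comp (i - q) (comp q x \<cdot> a))"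
proof -
  have "J ((v \<odot> x) \<cdot> a) = J (v \<odot> (x \<cdot> a) + (\<Sum>q\<le>i. v \<diamondop> comp (i - q) (comp q x \<cdot> a)))"
    using mul_tens[OF H_J[OF a] D_J[OF x] D_J[OF v]] a x v
    by (simp add: J_mul J_tens J_add J_sum J_circ comp_J[symmetric] H_D)
  then show ?thesis by (metis J_J)
qed

text \<open>Absorbing \<open>h\<close> from the left commutes with multiplication from the right, as long as the
  contraction on the right does not reach the variables used by \<open>h\<close>.\<close>

lemma comp_absorb_left_mul:
  assumes h: "h \<in> H q" and f: "f \<in> H (p + q)" and b: "b \<in> H r" and e: "r \<le> p + e"
  shows "comp e (comp p (h \<cdot> f) \<cdot> b) = comp e (h \<cdot> comp (e + q) (f \<cdot> b))"
proof (rule H_eqI[of _ e])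
  fix v assume v: "v \<in> H e"
  have D: "h \<in> D" "f \<in> D" "b \<in> D" "v \<in> D" using h f b v by (auto intro: H_D)
  have "cinner (comp e (h \<cdot> comp (e + q) (f \<cdot> b))) v = cinner (comp (e + q) (f \<cdot> b)) (J h \<odot> v)"
    by (rule cinner_absorb_left[OF _ h v]) (use D in simp)
  also have "\<dots> = cinner (f \<cdot> b) (J h \<odot> v)"
    using D tens_H[OF H_J[OF h] v] by (intro cinner_comp) (simp_all add: add.commute)
  also have "\<dots> = cinner f ((J h \<odot> v) \<cdot> J b)" using D by (simp add: cinner_mul_right)
  also have "\<dots> = cinner f (comp (p + q) ((J h \<odot> v) \<cdot> J b))" using D f by (simp add: cinner_comp_right)
  also have "\<dots> = cinner f (J h \<odot> comp p (v \<cdot> J b))"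
    by (subst locality_left[of "J b" r v e "J h" q p]) (use b v h e in simp_all)
  also have "\<dots> = cinner (comp p (h \<cdot> f)) (comp p (v \<cdot> J b))"
    by (rule cinner_absorb_left[OF f h, symmetric]) (use D in simp)
  also have "\<dots> = cinner (comp p (h \<cdot> f)) (v \<cdot> J b)"
    by (rule cinner_comp_right) (use D in simp_all)
  also have "\<dots> = cinner (comp p (h \<cdot> f) \<cdot> b) v" using D by (simp add: cinner_mul_right)
  also have "\<dots> = cinner (comp e (comp p (h \<cdot> f) \<cdot> b)) v" using D v by (simp add: cinner_comp)
  finally show "cinner (comp e (comp p (h \<cdot> f) \<cdot> b)) v = cinner (comp e (h \<cdot> comp (e + q) (f \<cdot> b))) v" ..
qed (use h f b in \<open>simp_all add: H_D\<close>)

lemma norm_comp_absorb_left_mul: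
  assumes h: "h \<in> H q" and f: "f \<in> H (p + q)" and b: "b \<in> H r"
  shows "norm (comp e (comp p (h \<cdot> f) \<cdot> b)) \<le> norm h * norm (comp (e + q) (f \<cdot> b))"
proof (cases "r \<le> p + e")
  case True
  have "comp (e + q) (f \<cdot> b) \<in> H (e + q)" using f b by (simp add: H_D)
  from norm_absorb_left[OF this h] show ?thesis
    unfolding comp_absorb_left_mul[OF h f b True] .
next
  case False
  have "comp p (h \<cdot> f) \<in> H p" using h f by (simp add: H_D)
  from degree_mul[OF this b, of e] False have "comp e (comp p (h \<cdot> f) \<cdot> b) = 0" by simp
  then show ?thesis by simp
qed

text \<open>Absorbing \<open>h\<close> into the left end of \<open>f\<close> commutes, degree by degree, with contractions at the
  right end.  Therefore whatever is small about \<open>f \<diamondop> b\<close> remains small after \<open>f\<close> has been partially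
  contracted with a bounded element.\<close>

lemma norm_absorb_left_mul:
  assumes h: "h \<in> H q" and f: "f \<in> H (p + q)" and b: "b \<in> H r"
  shows "norm (comp p (h \<cdot> f) \<cdot> b) \<le> norm h * norm (f \<cdot> b)"
    and "norm (comp p (h \<cdot> f) \<diamondop> b) \<le> norm h * norm (f \<diamondop> b)"
proof -
  define F where "F = comp p (h \<cdot> f)"
  have F: "F \<in> H p" using h f by (simp add: F_def H_D)
  have shift: "(\<Sum>e\<le>p + r. s (e + q)) \<le> (\<Sum>e\<le>p + q + r. s e)" if "\<And>e. 0 \<le> s e" for s :: "nat \<Rightarrow> real"
  proof -
    have "(\<Sum>e\<le>p + r. s (e + q)) = sum s ((\<lambda>e. e + q) ` {..p + r})" by (subst sum.reindex) auto
    also have "\<dots> \<le> (\<Sum>e\<le>p + q + r. s e)" by (intro sum_mono2) (use that in auto)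
    finally show ?thesis .
  qed
  have main: "norm y \<le> norm h * norm x"
    if dx: "deg_le (p + q + r) x" and dy: "deg_le (p + r) y"
      and le: "\<And>e. norm (comp e y) \<le> norm h * norm (comp (e + q) x)" for x y
  proof -
    have "(norm y)\<^sup>2 = (\<Sum>e\<le>p + r. (norm (comp e y))\<^sup>2)" by (rule norm_deg_le[OF dy])
    also have "\<dots> \<le> (\<Sum>e\<le>p + r. (norm h)\<^sup>2 * (norm (comp (e + q) x))\<^sup>2)"
      by (intro sum_mono order.trans[OF power_mono[OF le]]) (simp_all add: power_mult_distrib)
    also have "\<dots> \<le> (norm h)\<^sup>2 * (\<Sum>e\<le>p + q + r. (norm (comp e x))\<^sup>2)"
      unfolding sum_distrib_left[symmetric] by (intro mult_left_mono shift) simp_all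
    also have "\<dots> = (norm h * norm x)\<^sup>2" by (simp add: norm_deg_le[OF dx] power_mult_distrib)
    finally show ?thesis by (rule power2_le_imp_le) simp
  qed
  have "norm (comp e (F \<cdot> b)) \<le> norm h * norm (comp (e + q) (f \<cdot> b))" for e
    unfolding F_def by (rule norm_comp_absorb_left_mul[OF h f b])
  from main[OF deg_le_mul_homogeneous[OF f b] deg_le_mul_homogeneous[OF F b] this]
  show "norm (comp p (h \<cdot> f) \<cdot> b) \<le> norm h * norm (f \<cdot> b)" unfolding F_def .
  have "norm (comp e (F \<diamondop> b)) \<le> norm h * norm (comp (e + q) (f \<diamondop> b))" for e
    unfolding comp_circ_homogeneous[OF F b] comp_circ_homogeneous[OF f b]
    using norm_comp_absorb_left_mul[OF h f b, of e] by (simp add: F_def)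
  from main[OF deg_le_circ[OF deg_le_homogeneous[OF f] deg_le_homogeneous[OF b]]
      deg_le_circ[OF deg_le_homogeneous[OF F] deg_le_homogeneous[OF b]] this]
  show "norm (comp p (h \<cdot> f) \<diamondop> b) \<le> norm h * norm (f \<diamondop> b)" unfolding F_def .
qed

lemma norm_absorb_right_mul:
  assumes h: "h \<in> H q" and g: "g \<in> H (p + q)" and b: "b \<in> H r"
  shows "norm (b \<cdot> comp p (g \<cdot> h)) \<le> norm h * norm (b \<cdot> g)"
    and "norm (b \<diamondop> comp p (g \<cdot> h)) \<le> norm h * norm (b \<diamondop> g)"
proof -
  note D = H_D[OF h] H_D[OF g] H_D[OF b]
  have eq: "J (b \<cdot> comp p (g \<cdot> h)) = comp p (J h \<cdot> J g) \<cdot> J b"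
    "J (b \<diamondop> comp p (g \<cdot> h)) = comp p (J h \<cdot> J g) \<diamondop> J b"
    "J (b \<cdot> g) = J g \<cdot> J b" "J (b \<diamondop> g) = J g \<diamondop> J b"
    using D by (simp_all add: J_mul J_circ comp_J[symmetric])
  show "norm (b \<cdot> comp p (g \<cdot> h)) \<le> norm h * norm (b \<cdot> g)"
    using norm_absorb_left_mul(1)[OF H_J[OF h] H_J[OF g] H_J[OF b]]
    unfolding eq[symmetric] norm_J .
  show "norm (b \<diamondop> comp p (g \<cdot> h)) \<le> norm h * norm (b \<diamondop> g)"
    using norm_absorb_left_mul(2)[OF H_J[OF h] H_J[OF g] H_J[OF b]]
    unfolding eq[symmetric] norm_J .
qed

end

section \<open>Sequences of pairs of multiple integrals\<close>

definition bounded_seq :: "(nat \<Rightarrow> 'a::real_normed_vector) \<Rightarrow> bool" where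
  "bounded_seq v \<longleftrightarrow> (\<exists>C. \<forall>k. norm (v k) \<le> C)"

lemma bounded_seqI: "(\<And>k. norm (v k) \<le> C) \<Longrightarrow> bounded_seq v"
  unfolding bounded_seq_def by blast

lemma bounded_seqE:
  assumes "bounded_seq v" obtains C where "C \<ge> 0" "\<And>k. norm (v k) \<le> C"
proof -
  obtain C where C: "\<And>k. norm (v k) \<le> C" using assms unfolding bounded_seq_def by blast
  have "0 \<le> C" using order.trans[OF norm_ge_zero C[of 0]] .
  then show ?thesis using C that by blast
qed

lemma bounded_seq_const [simp]: "bounded_seq (\<lambda>_. c)"
  by (rule bounded_seqI) (rule order.refl)

lemma bounded_seq_le:
  assumes "bounded_seq u" "\<And>k. norm (v k) \<le> norm (u k)"
  shows "bounded_seq v"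
  using assms unfolding bounded_seq_def by (meson order.trans)

lemma bounded_seq_add: "bounded_seq u \<Longrightarrow> bounded_seq v \<Longrightarrow> bounded_seq (\<lambda>k. u k + v k)"
  by (elim bounded_seqE) (rule bounded_seqI, rule norm_triangle_mono)

lemma bounded_seq_diff: "bounded_seq u \<Longrightarrow> bounded_seq v \<Longrightarrow> bounded_seq (\<lambda>k. u k - v k)"
  by (elim bounded_seqE) (rule bounded_seqI, rule order.trans[OF norm_triangle_ineq4 add_mono])

lemma bounded_seq_sum:
  "(\<And>i. i \<in> S \<Longrightarrow> bounded_seq (u i)) \<Longrightarrow> bounded_seq (\<lambda>k. \<Sum>i\<in>S. u i k)"
  by (induction S rule: infinite_finite_induct) (simp_all add: bounded_seq_add)

lemma bounded_seq_mult_le: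
  assumes "bounded_seq u" "bounded_seq v" "\<And>k. norm (w k) \<le> norm (u k) * norm (v k)"
  shows "bounded_seq w"
proof -
  obtain C where C: "C \<ge> 0" "\<And>k. norm (u k) \<le> C" using bounded_seqE[OF assms(1)] by blast
  obtain C' where C': "C' \<ge> 0" "\<And>k. norm (v k) \<le> C'" using bounded_seqE[OF assms(2)] by blast
  have "norm (w k) \<le> C * C'" for k
    using order.trans[OF assms(3) mult_mono[OF C(2) C'(2) C(1) norm_ge_zero]] .
  then show ?thesis by (rule bounded_seqI)
qed

lemma bounded_seq_scaleC:
  "bounded_seq c \<Longrightarrow> bounded_seq v \<Longrightarrow> bounded_seq (\<lambda>k. scaleC (c k) (v k :: 'a::chilbert_space))"
  by (rule bounded_seq_mult_le[of c v]) (simp_all add: norm_scaleC)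

lemma null_times_bounded:
  assumes u: "(u :: nat \<Rightarrow> 'a::real_normed_vector) \<longlonglongrightarrow> 0" and v: "bounded_seq (v :: nat \<Rightarrow> 'b::real_normed_vector)"
    and w: "\<And>k. norm (w k :: 'c::real_normed_vector) \<le> norm (u k) * norm (v k)"
  shows "w \<longlonglongrightarrow> 0"
proof -
  obtain C where C: "C \<ge> 0" "\<And>k. norm (v k) \<le> C" using bounded_seqE[OF v] by blast
  have "(\<lambda>k. norm (u k) * C) \<longlonglongrightarrow> norm (0::'a) * C"
    by (rule tendsto_mult_right[OF tendsto_norm[OF u]])
  then have lim: "(\<lambda>k. norm (u k) * C) \<longlonglongrightarrow> 0" by simp
  have "norm (w k) \<le> norm (u k) * C" for k
    using order.trans[OF w mult_left_mono[OF C(2) norm_ge_zero]] .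
  then show ?thesis by (intro Lim_null_comparison[OF always_eventually lim] allI)
qed

lemma bounded_seq_norm_square:
  assumes "bounded_seq u" "bounded_seq v" "\<And>k. (norm (w k))\<^sup>2 \<le> norm (u k) * norm (v k)"
  shows "bounded_seq w"
proof -
  obtain C where C: "C \<ge> 0" "\<And>k. norm (u k) \<le> C" using bounded_seqE[OF assms(1)] by blast
  obtain C' where C': "C' \<ge> 0" "\<And>k. norm (v k) \<le> C'" using bounded_seqE[OF assms(2)] by blast
  have "norm (w k) \<le> sqrt (C * C')" for k
  proof (rule real_le_rsqrt)
    show "(norm (w k))\<^sup>2 \<le> C * C'"
      using order.trans[OF assms(3) mult_mono[OF C(2) C'(2) C(1) norm_ge_zero]] .
  qed
  then show ?thesis by (rule bounded_seqI)
qed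

text \<open>The two sequences are indexed by a truth value, so that every statement about them comes
  with its mirror image.\<close>

locale integral_pair = chaos_algebra W D H
  for W :: "('h::chilbert_space, 'l::chilbert_space) wstar_space" and D :: "'l set"
    and H :: "nat \<Rightarrow> 'l set" +
  fixes z :: "bool \<Rightarrow> nat \<Rightarrow> 'l" and dz :: "bool \<Rightarrow> nat"
  assumes z_H [simp]: "z b k \<in> H (dz b)"
    and z_J [simp]: "J (z b k) = z b k"
    and z_sym: "h \<in> H q \<Longrightarrow> p + q = dz b \<Longrightarrow> comp p (z b k \<cdot> h) = comp p (h \<cdot> z b k)"
    and words_bounded: "bounded_seq (\<lambda>k. l2_prod W (map (\<lambda>b. z b k) w))"
    and mixed_null: "(\<lambda>k. z b k \<diamondop> z (\<not> b) k) \<longlonglongrightarrow> 0"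
begin

lemma z_D [simp]: "z b k \<in> D" by (rule H_D[OF z_H])

definition word :: "bool list \<Rightarrow> nat \<Rightarrow> 'l" where
  "word w k = l2_prod W (map (\<lambda>b. z b k) w)"

abbreviation pow :: "bool \<Rightarrow> nat \<Rightarrow> nat \<Rightarrow> 'l" where
  "pow b i k \<equiv> l2_power W (z b k) i"

lemma word_D [simp]: "word w k \<in> D"
  unfolding word_def by (rule l2_prod_D) auto

lemma word_Nil [simp]: "word [] k = one" and word_Cons: "word (b # w) k = z b k \<cdot> word w k"
  by (simp_all add: word_def)

lemma word_append: "word (w @ w') k = word w k \<cdot> word w' k"
  unfolding word_def map_append by (rule l2_prod_append) auto

lemma J_word: "J (word w k) = word (rev w) k"
proof -
  have "set (map (\<lambda>b. z b k) w) \<subseteq> D" by auto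
  from J_l2_prod[OF this] show ?thesis by (simp add: word_def rev_map o_def)
qed

lemma word_bounded: "bounded_seq (word w)"
  using words_bounded[of w] unfolding word_def .

lemma pow_word: "pow b i k = word (replicate i b) k"
  by (simp add: word_def l2_power_def)

lemma pow_D [simp]: "pow b i k \<in> D" by simp

text \<open>The norm of a tensor product is controlled by the norms of the factors only up to a constant that
  depends on the degrees, hence the degrees must not grow with \<open>k\<close>.\<close>

definition deg_bounded :: "(nat \<Rightarrow> 'l) \<Rightarrow> bool" where
  "deg_bounded v \<longleftrightarrow> (\<exists>N. \<forall>k. deg_le N (v k))"

lemma deg_boundedD: "deg_bounded v \<Longrightarrow> v k \<in> D"
  unfolding deg_bounded_def using deg_le_D by blast

lemma deg_bounded_homogeneous: "(\<And>k. v k \<in> H q) \<Longrightarrow> deg_bounded v"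
  unfolding deg_bounded_def using deg_le_homogeneous by blast

lemma deg_bounded2:
  assumes "deg_bounded u" "deg_bounded v"
    and "\<And>N M k. deg_le N (u k) \<Longrightarrow> deg_le M (v k) \<Longrightarrow> deg_le (N + M) (w k)"
  shows "deg_bounded w"
proof -
  obtain N where N: "\<And>k. deg_le N (u k)" using assms(1) unfolding deg_bounded_def by blast
  obtain M where M: "\<And>k. deg_le M (v k)" using assms(2) unfolding deg_bounded_def by blast
  show ?thesis unfolding deg_bounded_def
    by (rule exI[of _ "N + M"]) (intro allI assms(3) N M)
qed

lemma deg_bounded_add: "deg_bounded u \<Longrightarrow> deg_bounded v \<Longrightarrow> deg_bounded (\<lambda>k. u k + v k)"
  by (erule (1) deg_bounded2) (intro deg_le_add; erule deg_le_mono, simp)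

lemma deg_bounded_diff: "deg_bounded u \<Longrightarrow> deg_bounded v \<Longrightarrow> deg_bounded (\<lambda>k. u k - v k)"
  by (erule (1) deg_bounded2) (intro deg_le_diff; erule deg_le_mono, simp)

lemma deg_bounded_mul: "deg_bounded u \<Longrightarrow> deg_bounded v \<Longrightarrow> deg_bounded (\<lambda>k. u k \<cdot> v k)"
  by (erule (1) deg_bounded2) (rule deg_le_mul)

lemma deg_bounded_tens: "deg_bounded u \<Longrightarrow> deg_bounded v \<Longrightarrow> deg_bounded (\<lambda>k. u k \<odot> v k)"
  by (erule (1) deg_bounded2) (rule deg_le_tens)

lemma deg_bounded_circ: "deg_bounded u \<Longrightarrow> deg_bounded v \<Longrightarrow> deg_bounded (\<lambda>k. u k \<diamondop> v k)"
  by (erule (1) deg_bounded2) (rule deg_le_circ)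

lemma deg_bounded_scale: "deg_bounded v \<Longrightarrow> deg_bounded (\<lambda>k. scaleC (c k) (v k))"
  unfolding deg_bounded_def using deg_le_scale by blast

lemma deg_bounded_zero [simp]: "deg_bounded (\<lambda>_. 0)"
  unfolding deg_bounded_def by simp

lemma deg_bounded_one [simp]: "deg_bounded (\<lambda>_. one)"
  by (rule deg_bounded_homogeneous[of _ 0]) simp

lemma deg_bounded_sum: "(\<And>i. i \<in> S \<Longrightarrow> deg_bounded (u i)) \<Longrightarrow> deg_bounded (\<lambda>k. \<Sum>i\<in>S. u i k)"
  by (induction S rule: infinite_finite_induct) (simp_all add: deg_bounded_add)

lemma deg_bounded_z: "deg_bounded (z b)"
  by (rule deg_bounded_homogeneous[OF z_H])

lemma deg_bounded_word: "deg_bounded (word w)"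
proof (induction w)
  case (Cons b w)
  then show ?case using deg_bounded_mul[OF deg_bounded_z Cons, of b] by (simp add: word_Cons)
qed simp

lemma bounded_tens:
  assumes "deg_bounded u" "deg_bounded v" "bounded_seq u" "bounded_seq v"
  shows "bounded_seq (\<lambda>k. u k \<odot> v k)"
proof -
  obtain N where N: "\<And>k. deg_le N (u k)" using assms(1) unfolding deg_bounded_def by blast
  obtain M where M: "\<And>k. deg_le M (v k)" using assms(2) unfolding deg_bounded_def by blast
  have "bounded_seq (\<lambda>k. ((real N + 1) * (real M + 1)) *\<^sub>R u k)"
    by (rule bounded_seq_mult_le[of "\<lambda>_. (real N + 1) * (real M + 1)", OF bounded_seq_const assms(3)]) simp
  then show ?thesis
    by (rule bounded_seq_mult_le[OF _ assms(4)])
       (use norm_tens_le[OF N M] in \<open>simp add: mult.assoc\<close>)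
qed

lemma null_tens:
  assumes "deg_bounded u" "deg_bounded v" "u \<longlonglongrightarrow> 0" "bounded_seq v"
  shows "(\<lambda>k. u k \<odot> v k) \<longlonglongrightarrow> 0"
proof -
  obtain N where N: "\<And>k. deg_le N (u k)" using assms(1) unfolding deg_bounded_def by blast
  obtain M where M: "\<And>k. deg_le M (v k)" using assms(2) unfolding deg_bounded_def by blast
  have "(\<lambda>k. ((real N + 1) * (real M + 1)) *\<^sub>R u k) \<longlonglongrightarrow> ((real N + 1) * (real M + 1)) *\<^sub>R 0"
    by (rule tendsto_scaleR[OF tendsto_const assms(3)])
  then have "(\<lambda>k. ((real N + 1) * (real M + 1)) *\<^sub>R u k) \<longlonglongrightarrow> 0" by simp
  then show ?thesis
    by (rule null_times_bounded[OF _ assms(4)])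
       (use norm_tens_le[OF N M] in \<open>simp add: mult.assoc\<close>)
qed

section \<open>Partial contractions of a single integral\<close>

text \<open>\<open>partial b p F\<close>: the terms of \<open>F\<close> have \<open>p\<close> variables left after the other variables of
  \<open>z b k\<close> have been contracted with bounded elements.  By the symmetry of the kernels these may be
  the first or the last variables.\<close>

definition partial :: "bool \<Rightarrow> nat \<Rightarrow> (nat \<Rightarrow> 'l) \<Rightarrow> bool" where
  "partial b p F \<longleftrightarrow> (\<exists>q h. p + q = dz b \<and> (\<forall>k. h k \<in> H q) \<and> bounded_seq h \<and>
     (\<forall>k. F k = comp p (z b k \<cdot> h k)))"

lemma partialE:
  assumes "partial b p F"
  obtains q h where "dz b = p + q" "\<And>k. h k \<in> H q" "bounded_seq h"
    "\<And>k. F k = comp p (z b k \<cdot> h k)" "\<And>k. F k = comp p (h k \<cdot> z b k)"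
proof -
  obtain q h where *: "p + q = dz b" "\<And>k. h k \<in> H q" "bounded_seq h" "\<And>k. F k = comp p (z b k \<cdot> h k)"
    using assms unfolding partial_def by blast
  have "F k = comp p (h k \<cdot> z b k)" for k unfolding *(4) by (rule z_sym[OF *(2,1)])
  from that[OF *(1)[symmetric] *(2,3,4) this] show ?thesis .
qed

lemma partial_contract:
  assumes "\<And>k. h k \<in> H q" "bounded_seq h" "q \<le> dz b"
  shows "partial b (dz b - q) (\<lambda>k. comp (dz b - q) (z b k \<cdot> h k))"
  unfolding partial_def using assms by (intro exI[of _ q] exI[of _ h]) simp

lemma partial_H:
  assumes "partial b p F"
  shows "F k \<in> H p"
proof -
  obtain q h where *: "\<And>k. h k \<in> H q" "\<And>k. F k = comp p (z b k \<cdot> h k)"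
    by (rule partialE[OF assms]) (rule that; assumption)
  show ?thesis unfolding *(2) by (rule comp_H[OF mul_D[OF z_D H_D[OF *(1)]]])
qed

lemma partial_D: "partial b p F \<Longrightarrow> F k \<in> D"
  by (rule H_D[OF partial_H])

lemma z_bounded: "bounded_seq (z b)"
proof -
  have "word [b] = z b" by (rule ext) (simp add: word_def)
  then show ?thesis using word_bounded[of "[b]"] by simp
qed

lemma partial_bounded:
  assumes "partial b p F" shows "bounded_seq F"
proof -
  obtain q h where *: "dz b = p + q" "\<And>k. h k \<in> H q" "bounded_seq h" "\<And>k. F k = comp p (z b k \<cdot> h k)"
    by (rule partialE[OF assms]) (rule that; assumption)
  show ?thesis
    by (rule bounded_seq_mult_le[OF z_bounded[of b] *(3)])
       (unfold *(4), rule norm_absorb_right[OF _ *(2)], use z_H[of b] *(1) in simp)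
qed

lemma partial_mul_bound:
  assumes "partial b p F"
  shows "\<exists>h :: nat \<Rightarrow> 'l. bounded_seq h \<and> (\<forall>k r. \<forall>y\<in>H r.
    norm (F k \<cdot> y) \<le> norm (h k) * norm (z b k \<cdot> y) \<and>
    norm (F k \<diamondop> y) \<le> norm (h k) * norm (z b k \<diamondop> y) \<and>
    norm (y \<diamondop> F k) \<le> norm (h k) * norm (y \<diamondop> z b k))"
proof -
  obtain q h where *: "dz b = p + q" "\<And>k. h k \<in> H q" "bounded_seq h" "\<And>k. F k = comp p (z b k \<cdot> h k)"
    "\<And>k. F k = comp p (h k \<cdot> z b k)"
    by (rule partialE[OF assms]) (rule that; assumption)
  have z: "z b k \<in> H (p + q)" for k using z_H[of b k] *(1) by simp
  have "norm (F k \<cdot> y) \<le> norm (h k) * norm (z b k \<cdot> y) \<and>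
    norm (F k \<diamondop> y) \<le> norm (h k) * norm (z b k \<diamondop> y) \<and>
    norm (y \<diamondop> F k) \<le> norm (h k) * norm (y \<diamondop> z b k)" if y: "y \<in> H r" for k y r
  proof (intro conjI)
    show "norm (F k \<cdot> y) \<le> norm (h k) * norm (z b k \<cdot> y)"
      unfolding *(5) by (rule norm_absorb_left_mul(1)[OF *(2) z y])
    show "norm (F k \<diamondop> y) \<le> norm (h k) * norm (z b k \<diamondop> y)"
      unfolding *(5) by (rule norm_absorb_left_mul(2)[OF *(2) z y])
    show "norm (y \<diamondop> F k) \<le> norm (h k) * norm (y \<diamondop> z b k)"
      unfolding *(4) by (rule norm_absorb_right_mul(2)[OF *(2) z y])
  qed
  then show ?thesis using *(3) by (intro exI[of _ h]) blast
qed

text \<open>The hypothesis that the mixed contractions of \<open>z b\<close> and \<open>z (\<not> b)\<close> vanish passes to their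
  partial contractions, by \<open>norm_absorb_left_mul\<close> for the left factor and its mirror image for the
  right one.\<close>

lemma partial_circ_null:
  assumes F: "partial b p F" and G: "partial (\<not> b) p' G"
  shows "(\<lambda>k. F k \<diamondop> G k) \<longlonglongrightarrow> 0"
proof -
  obtain h where h: "bounded_seq h"
    "\<And>k y r. y \<in> H r \<Longrightarrow> norm (F k \<diamondop> y) \<le> norm (h k :: 'l) * norm (z b k \<diamondop> y)"
    using partial_mul_bound[OF F] by blast
  obtain h' where h': "bounded_seq h'"
    "\<And>k y r. y \<in> H r \<Longrightarrow> norm (y \<diamondop> G k) \<le> norm (h' k :: 'l) * norm (y \<diamondop> z (\<not> b) k)"
    using partial_mul_bound[OF G] by blast
  have 1: "(\<lambda>k. z b k \<diamondop> G k) \<longlonglongrightarrow> 0"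
    by (rule null_times_bounded[OF mixed_null[of b] h'(1)])
       (subst mult.commute, rule h'(2)[OF z_H])
  show ?thesis
    by (rule null_times_bounded[OF 1 h(1)])
       (subst mult.commute, rule h(2)[OF partial_H[OF G]])
qed

text \<open>The absorption bound replaces first the one and then the other occurrence of \<open>F\<close> by the integral
  \<open>z b\<close> itself, so that fourth moments of \<open>z b\<close> control those of \<open>F\<close>.\<close>

lemma partial_fourth_moment:
  assumes F: "partial b p F"
  shows "bounded_seq (\<lambda>k. F k \<cdot> J (F k))" "bounded_seq (\<lambda>k. J (F k) \<cdot> F k)"
proof -
  obtain h where h: "bounded_seq h"
    "\<And>k y r. y \<in> H r \<Longrightarrow> norm (F k \<cdot> y) \<le> norm (h k :: 'l) * norm (z b k \<cdot> y)"
    using partial_mul_bound[OF F] by blast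
  have "bounded_seq (word [b, b])" by (rule word_bounded)
  moreover have "word [b, b] = (\<lambda>k. z b k \<cdot> z b k)" by (rule ext) (simp add: word_def)
  ultimately have zz: "bounded_seq (\<lambda>k. z b k \<cdot> z b k)" by simp
  have "bounded_seq (\<lambda>k. F k \<cdot> z b k)"
    by (rule bounded_seq_mult_le[OF h(1) zz]) (rule h(2)[OF z_H])
  then have "bounded_seq (\<lambda>k. z b k \<cdot> J (F k))"
  proof (rule bounded_seq_le)
    fix k
    have "z b k \<cdot> J (F k) = J (F k \<cdot> z b k)" using partial_D[OF F] by (simp add: J_mul)
    then show "norm (z b k \<cdot> J (F k)) \<le> norm (F k \<cdot> z b k)" by (simp add: norm_J)
  qed
  then show 1: "bounded_seq (\<lambda>k. F k \<cdot> J (F k))"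
    by (rule bounded_seq_mult_le[OF h(1)]) (rule h(2)[OF H_J[OF partial_H[OF F]]])
  show "bounded_seq (\<lambda>k. J (F k) \<cdot> F k)"
    by (rule bounded_seq_le[OF 1]) (simp add: norm_mul_J partial_D[OF F])
qed

text \<open>The squared norm of \<open>w F w'\<close> is the inner product of \<open>w\<^sup>* w F\<close> with \<open>F w' w'\<^sup>*\<close>.  After the
  Cauchy-Schwarz inequality only products of \<open>F\<close> with one word are left, and \<open>norm_mul_le\<close> bounds them by
  moments of words and fourth moments of \<open>F\<close>.\<close>

lemma word_partial_word_bounded:
  assumes F: "partial b p F"
  shows "bounded_seq (\<lambda>k. word w k \<cdot> F k \<cdot> word w' k)"
proof -
  have FD: "F k \<in> D" for k by (rule partial_D[OF F])
  have left: "bounded_seq (\<lambda>k. word u k \<cdot> F k)" for u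
  proof (rule bounded_seq_norm_square[OF _ partial_fourth_moment(1)[OF F]])
    show "bounded_seq (word (rev u @ u))" by (rule word_bounded)
    show "(norm (word u k \<cdot> F k))\<^sup>2 \<le> norm (word (rev u @ u) k) * norm (F k \<cdot> J (F k))" for k
      using norm_mul_le[of "word u k" "F k"] FD by (simp add: word_append J_word)
  qed
  have right: "bounded_seq (\<lambda>k. F k \<cdot> word u k)" for u
  proof (rule bounded_seq_norm_square[OF partial_fourth_moment(2)[OF F]])
    show "bounded_seq (word (u @ rev u))" by (rule word_bounded)
    show "(norm (F k \<cdot> word u k))\<^sup>2 \<le> norm (J (F k) \<cdot> F k) * norm (word (u @ rev u) k)" for k
      using norm_mul_le[of "F k" "word u k"] FD by (simp add: word_append J_word)
  qed
  show ?thesis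
  proof (rule bounded_seq_norm_square[OF left[of "rev w @ w"] right[of "w' @ rev w'"]])
    fix k
    define u v where "u = word w k" and "v = word w' k"
    have D: "u \<in> D" "v \<in> D" "F k \<in> D" by (simp_all add: u_def v_def FD)
    have "cinner (u \<cdot> F k \<cdot> v) (u \<cdot> F k \<cdot> v) = cinner (u \<cdot> (F k \<cdot> v)) (u \<cdot> (F k \<cdot> v))"
      using D by (simp add: mul_assoc)
    also have "\<dots> = cnj (cinner (J u \<cdot> u \<cdot> F k \<cdot> v) (F k \<cdot> v))"
      using D by (subst cinner_mul_left, simp_all, subst cinner_commute) (simp add: mul_assoc)
    also have "\<dots> = cnj (cinner (J u \<cdot> u \<cdot> F k) (F k \<cdot> (v \<cdot> J v)))"
      using D by (subst cinner_mul_right, simp_all) (simp add: mul_assoc)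
    finally have "(norm (u \<cdot> F k \<cdot> v))\<^sup>2 \<le> cmod (cinner (J u \<cdot> u \<cdot> F k) (F k \<cdot> (v \<cdot> J v)))"
      unfolding norm_eq_sqrt_Re_cinner by (metis complex_Re_le_cmod complex_mod_cnj)
    also have "\<dots> \<le> norm (J u \<cdot> u \<cdot> F k) * norm (F k \<cdot> (v \<cdot> J v))" by (rule cinner_bound)
    finally show "(norm (word w k \<cdot> F k \<cdot> word w' k))\<^sup>2 \<le>
        norm (word (rev w @ w) k \<cdot> F k) * norm (F k \<cdot> word (w' @ rev w') k)"
      by (simp add: u_def v_def word_append J_word)
  qed
qed

end

context integral_pair
begin

section \<open>Boundedness of tensor products of polynomials\<close>

definition polynomial :: "bool \<Rightarrow> (nat \<Rightarrow> 'l) \<Rightarrow> bool" where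
  "polynomial b P \<longleftrightarrow> (\<exists>N c. (\<forall>i. bounded_seq (c i :: nat \<Rightarrow> complex)) \<and>
     (\<forall>k. P k = (\<Sum>i\<le>N::nat. scaleC (c i k) (pow b i k))))"

lemma polynomialE:
  assumes "polynomial b P"
  obtains N c where "\<And>i. bounded_seq (c i :: nat \<Rightarrow> complex)"
    "P = (\<lambda>k. \<Sum>i\<le>N. scaleC (c i k) (pow b i k))"
proof -
  obtain N c where *: "\<forall>i. bounded_seq (c i :: nat \<Rightarrow> complex)"
    "\<forall>k. P k = (\<Sum>i\<le>N::nat. scaleC (c i k) (pow b i k))"
    using assms unfolding polynomial_def by blast
  have "P = (\<lambda>k. \<Sum>i\<le>N. scaleC (c i k) (pow b i k))" by (rule ext) (use *(2) in blast)
  then show ?thesis using that *(1) by blast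
qed

lemma polynomial_pow: "polynomial b (pow b j)"
  unfolding polynomial_def
proof (intro exI[of _ j] exI[of _ "\<lambda>i _. if i = j then 1 else 0"] conjI allI)
  fix k
  have "(\<Sum>i\<le>j. scaleC (if i = j then 1 else 0) (pow b i k)) = (\<Sum>i\<le>j. if i = j then pow b j k else 0)"
    by (intro sum.cong) auto
  then show "pow b j k = (\<Sum>i\<le>j. scaleC (if i = j then 1 else 0) (pow b i k))" by simp
qed simp

lemma pow_deg_bounded: "deg_bounded (pow b i)"
  using deg_bounded_word[of "replicate i b"] unfolding pow_word[abs_def] .

lemma pow_bounded: "bounded_seq (pow b i)"
  using word_bounded[of "replicate i b"] unfolding pow_word[abs_def] .

lemma polynomial_deg_bounded: "polynomial b P \<Longrightarrow> deg_bounded P"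
  by (elim polynomialE) (simp add: deg_bounded_sum deg_bounded_scale pow_deg_bounded)

lemma polynomial_D: "polynomial b P \<Longrightarrow> P k \<in> D"
  by (rule deg_boundedD[OF polynomial_deg_bounded])

lemma polynomial_J:
  assumes "polynomial b P"
  shows "polynomial b (\<lambda>k. J (P k))"
proof -
  obtain N c where c: "\<And>i. bounded_seq (c i :: nat \<Rightarrow> complex)"
    "P = (\<lambda>k. \<Sum>i\<le>N. scaleC (c i k) (pow b i k))" by (rule polynomialE[OF assms]) (rule that; assumption)
  have "J (P k) = (\<Sum>i\<le>N. scaleC (cnj (c i k)) (pow b i k))" for k
    unfolding c(2) J_sum by (simp add: J_scale J_l2_power)
  moreover have "bounded_seq (\<lambda>k. cnj (c i k))" for i
    by (rule bounded_seq_le[OF c(1)[of i]]) simp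
  ultimately show ?thesis unfolding polynomial_def by (intro exI[of _ N] exI[of _ "\<lambda>i k. cnj (c i k)"]) simp
qed

text \<open>Weak convergence will be tested against words, so that sequences have to stay bounded when they are
  multiplied by words.  No \<open>L\<^sup>2\<close>-bound for the product of two elements follows from \<open>L\<^sup>2\<close>-bounds for the
  factors.\<close>

definition left_bounded :: "(nat \<Rightarrow> 'l) \<Rightarrow> bool" where
  "left_bounded v \<longleftrightarrow> deg_bounded v \<and> (\<forall>w. bounded_seq (\<lambda>k. word w k \<cdot> v k))"

lemma left_bounded_bounded: "left_bounded v \<Longrightarrow> bounded_seq v"
  unfolding left_bounded_def by (drule conjunct2, drule spec[of _ "[]"]) simp

lemma left_bounded_D: "left_bounded v \<Longrightarrow> v k \<in> D"
  unfolding left_bounded_def by (blast dest: deg_boundedD)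

lemma left_bounded_add:
  assumes "left_bounded u" "left_bounded v"
  shows "left_bounded (\<lambda>k. u k + v k)"
proof -
  have "bounded_seq (\<lambda>k. word w k \<cdot> u k + word w k \<cdot> v k)" for w
    using assms unfolding left_bounded_def by (intro bounded_seq_add) blast+
  then show ?thesis
    using assms left_bounded_D[OF assms(1)] left_bounded_D[OF assms(2)]
    unfolding left_bounded_def by (simp add: mul_add_right deg_bounded_add)
qed

lemma left_bounded_diff:
  assumes "left_bounded u" "left_bounded v"
  shows "left_bounded (\<lambda>k. u k - v k)"
proof -
  have "bounded_seq (\<lambda>k. word w k \<cdot> u k - word w k \<cdot> v k)" for w
    using assms unfolding left_bounded_def by (intro bounded_seq_diff) blast+
  then show ?thesis
    using assms left_bounded_D[OF assms(1)] left_bounded_D[OF assms(2)]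
    unfolding left_bounded_def by (simp add: mul_diff_right deg_bounded_diff)
qed

lemma left_bounded_zero: "left_bounded (\<lambda>_. 0)"
  by (simp add: left_bounded_def)

lemma left_bounded_sum:
  "(\<And>i. i \<in> S \<Longrightarrow> left_bounded (u i)) \<Longrightarrow> left_bounded (\<lambda>k. \<Sum>i\<in>S. u i k)"
  by (induction S rule: infinite_finite_induct) (simp_all add: left_bounded_add left_bounded_zero)

lemma left_bounded_scale:
  assumes "left_bounded v" "bounded_seq c"
  shows "left_bounded (\<lambda>k. scaleC (c k) (v k))"
proof -
  have "bounded_seq (\<lambda>k. scaleC (c k) (word w k \<cdot> v k))" for w
    using assms unfolding left_bounded_def by (intro bounded_seq_scaleC) blast+
  then show ?thesis
    using assms left_bounded_D[OF assms(1)]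
    unfolding left_bounded_def by (simp add: mul_scale_right deg_bounded_scale)
qed

lemma left_bounded_word_mul:
  assumes "left_bounded v"
  shows "left_bounded (\<lambda>k. word w k \<cdot> v k)"
proof -
  have vD: "v k \<in> D" for k by (rule left_bounded_D[OF assms])
  have "bounded_seq (\<lambda>k. word w' k \<cdot> (word w k \<cdot> v k))" for w'
  proof -
    have "bounded_seq (\<lambda>k. word (w' @ w) k \<cdot> v k)" using assms unfolding left_bounded_def by blast
    then show ?thesis using vD by (simp add: word_append mul_assoc)
  qed
  then show ?thesis using assms unfolding left_bounded_def
    by (simp add: deg_bounded_mul deg_bounded_word)
qed

lemma left_bounded_partial_word:
  assumes F: "partial b p F"
  shows "left_bounded (\<lambda>k. F k \<cdot> word w k)"
proof -
  have "bounded_seq (\<lambda>k. word w' k \<cdot> (F k \<cdot> word w k))" for w'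
    using word_partial_word_bounded[OF F, of w' w] partial_D[OF F] by (simp add: mul_assoc)
  moreover have "deg_bounded (\<lambda>k. F k \<cdot> word w k)"
    by (intro deg_bounded_mul deg_bounded_word deg_bounded_homogeneous[OF partial_H[OF F]])
  ultimately show ?thesis by (simp add: left_bounded_def)
qed

lemma left_bounded_partial: "partial b p F \<Longrightarrow> left_bounded F"
  using left_bounded_partial_word[of b p F "[]"] by simp

lemma left_bounded_partial_polynomial:
  assumes F: "partial b p F" and P: "polynomial b' P"
  shows "left_bounded (\<lambda>k. F k \<cdot> P k)"
proof -
  obtain N c where c: "\<And>i. bounded_seq (c i :: nat \<Rightarrow> complex)"
    "P = (\<lambda>k. \<Sum>i\<le>N. scaleC (c i k) (pow b' i k))" by (rule polynomialE[OF P]) (rule that; assumption)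
  have "left_bounded (\<lambda>k. \<Sum>i\<le>N. scaleC (c i k) (F k \<cdot> pow b' i k))"
    unfolding pow_word by (intro left_bounded_sum left_bounded_scale left_bounded_partial_word[OF F] c)
  moreover have "F k \<cdot> P k = (\<Sum>i\<le>N. scaleC (c i k) (F k \<cdot> pow b' i k))" for k
    unfolding c(2) using partial_D[OF F] by (simp add: mul_sum_right mul_scale_right)
  ultimately show ?thesis by simp
qed

lemma left_bounded_word: "left_bounded (word w)"
proof -
  have "bounded_seq (\<lambda>k. word w' k \<cdot> word w k)" for w'
    using word_bounded[of "w' @ w"] unfolding word_append[abs_def] .
  then show ?thesis by (simp add: left_bounded_def deg_bounded_word)
qed

lemma left_bounded_polynomial:
  assumes P: "polynomial b' P"
  shows "left_bounded P"
proof -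
  obtain N c where c: "\<And>i. bounded_seq (c i :: nat \<Rightarrow> complex)"
    "P = (\<lambda>k. \<Sum>i\<le>N. scaleC (c i k) (pow b' i k))" by (rule polynomialE[OF P]) (rule that; assumption)
  have "left_bounded (\<lambda>k. word (replicate i b') k)" for i using left_bounded_word by simp
  then show ?thesis unfolding c(2) pow_word by (intro left_bounded_sum left_bounded_scale c)
qed

lemma comp_bounded: "deg_bounded v \<Longrightarrow> bounded_seq v \<Longrightarrow> bounded_seq (\<lambda>k. comp q (v k))"
  by (rule bounded_seq_le, assumption, rule norm_comp_le, rule deg_boundedD)

lemma partial_contract_comp:
  assumes "deg_bounded v" "bounded_seq v" "q \<le> dz b"
  shows "partial b (dz b - q) (\<lambda>k. comp (dz b - q) (z b k \<cdot> comp q (v k)))"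
  by (rule partial_contract) (use assms deg_boundedD comp_bounded in auto)

text \<open>A letter multiplied from the left acts on the first factor \<open>v\<close> of a tensor, up to the terms in
  which \<open>v\<close> is contracted completely.  In those terms \<open>v\<close> is replaced by a partial contraction.\<close>

lemma left_bounded_tens:
  assumes T: "\<And>b p G. partial b p G \<Longrightarrow> left_bounded (\<lambda>k. G k \<cdot> T k)"
    and dT: "deg_bounded T" and bT: "bounded_seq T" and v: "left_bounded v"
  shows "left_bounded (\<lambda>k. v k \<odot> T k)"
proof -
  have TD: "T k \<in> D" for k by (rule deg_boundedD[OF dT])
  have "bounded_seq (\<lambda>k. word w k \<cdot> (v k \<odot> T k))" for w
    using v
  proof (induction w arbitrary: v rule: rev_induct)
    case Nil
    then show ?case
      using bounded_tens[OF _ dT left_bounded_bounded[OF Nil] bT] by (simp add: left_bounded_def)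
  next
    case (snoc b w)
    have vD: "v k \<in> D" for k by (rule left_bounded_D[OF snoc.prems])
    define G where "G q k = comp (dz b - q) (z b k \<cdot> comp q (v k))" for q k
    have G: "partial b (dz b - q) (G q)" if "q \<le> dz b" for q
      unfolding G_def by (rule partial_contract_comp[OF _ left_bounded_bounded[OF snoc.prems] that])
        (use snoc.prems in \<open>simp add: left_bounded_def\<close>)
    have GD: "G q k \<in> D" for q k unfolding G_def by (intro comp_D mul_D z_D vD)
    have "word (w @ [b]) k \<cdot> (v k \<odot> T k) = word w k \<cdot> ((z b k \<cdot> v k) \<odot> T k)
        + (\<Sum>q\<le>dz b. word w k \<cdot> (G q k \<cdot> T k) - word w k \<cdot> (G q k \<odot> T k))" for k
    proof -
      have "word (w @ [b]) k \<cdot> (v k \<odot> T k) = word w k \<cdot> (z b k \<cdot> (v k \<odot> T k))"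
        using vD TD by (simp add: word_append word_Cons mul_assoc)
      also have "z b k \<cdot> (v k \<odot> T k) = (z b k \<cdot> v k) \<odot> T k + (\<Sum>q\<le>dz b. G q k \<diamondop> T k)"
        unfolding G_def by (rule mul_tens[OF z_H vD TD])
      finally show ?thesis
        using vD TD GD by (simp add: mul_add_right mul_sum_right circ_def mul_diff_right)
    qed
    moreover have "bounded_seq (\<lambda>k. word w k \<cdot> ((z b k \<cdot> v k) \<odot> T k)
        + (\<Sum>q\<le>dz b. word w k \<cdot> (G q k \<cdot> T k) - word w k \<cdot> (G q k \<odot> T k)))"
    proof (intro bounded_seq_add bounded_seq_sum bounded_seq_diff)
      have "left_bounded (\<lambda>k. word [b] k \<cdot> v k)" by (rule left_bounded_word_mul[OF snoc.prems])
      then have "left_bounded (\<lambda>k. z b k \<cdot> v k)" by (simp add: word_Cons)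
      then show "bounded_seq (\<lambda>k. word w k \<cdot> ((z b k \<cdot> v k) \<odot> T k))" by (rule snoc.IH)
      fix q assume "q \<in> {..dz b}"
      then have q: "partial b (dz b - q) (G q)" using G by simp
      show "bounded_seq (\<lambda>k. word w k \<cdot> (G q k \<cdot> T k))" using T[OF q] unfolding left_bounded_def by blast
      show "bounded_seq (\<lambda>k. word w k \<cdot> (G q k \<odot> T k))" by (rule snoc.IH[OF left_bounded_partial[OF q]])
    qed
    ultimately show ?case by simp
  qed
  moreover have "deg_bounded (\<lambda>k. v k \<odot> T k)"
    using v dT by (intro deg_bounded_tens) (simp add: left_bounded_def)
  ultimately show ?thesis by (simp add: left_bounded_def)
qed

fun tensors :: "(nat \<Rightarrow> 'l) list \<Rightarrow> nat \<Rightarrow> 'l" where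
  "tensors [] k = one"
| "tensors (P # Ps) k = P k \<odot> tensors Ps k"

definition polynomials :: "(nat \<Rightarrow> 'l) list \<Rightarrow> bool" where
  "polynomials Ps \<longleftrightarrow> (\<forall>P\<in>set Ps. \<exists>b. polynomial b P)"

lemma polynomials_simps [simp]:
  "polynomials []" "polynomials (P # Ps) \<longleftrightarrow> (\<exists>b. polynomial b P) \<and> polynomials Ps"
  by (simp_all add: polynomials_def)

lemma tensors_deg_bounded: "polynomials Ps \<Longrightarrow> deg_bounded (tensors Ps)"
proof (induction Ps)
  case Nil
  have "tensors [] = (\<lambda>_. one)" by (rule ext) simp
  then show ?case by simp
next
  case (Cons P Ps)
  then obtain b where P: "polynomial b P" by auto
  have "deg_bounded (\<lambda>k. P k \<odot> tensors Ps k)"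
    by (rule deg_bounded_tens[OF polynomial_deg_bounded[OF P]]) (use Cons in simp)
  moreover have "tensors (P # Ps) = (\<lambda>k. P k \<odot> tensors Ps k)" by (rule ext) simp
  ultimately show ?case by simp
qed

lemma tensors_D: "polynomials Ps \<Longrightarrow> tensors Ps k \<in> D"
  by (rule deg_boundedD[OF tensors_deg_bounded])

lemma J_tensors:
  assumes "polynomials Ps"
  shows "J (tensors Ps k) = tensors (rev (map (\<lambda>P k. J (P k)) Ps)) k \<and>
    polynomials (rev (map (\<lambda>P k. J (P k)) Ps))"
  using assms
proof (induction Ps)
  case (Cons P Ps)
  then obtain b where P: "polynomial b P" by auto
  let ?R = "rev (map (\<lambda>P k. J (P k)) Ps)"
  have Ps: "polynomials Ps" using Cons.prems by simp
  have snoc: "tensors (Qs @ [Q]) k = tensors Qs k \<odot> Q k" if "polynomials Qs" "Q k \<in> D" for Qs Q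
    using that(1)
  proof (induction Qs)
    case Nil then show ?case using that(2) by simp
  next
    case (Cons R Qs)
    then have "R k \<in> D" "tensors Qs k \<in> D" using polynomial_D tensors_D by auto
    then show ?case using Cons that(2) by (simp add: tens_assoc)
  qed
  have "J (tensors (P # Ps) k) = J (tensors Ps k) \<odot> J (P k)"
    using polynomial_D[OF P] tensors_D[OF Ps] by (simp add: J_tens)
  also have "\<dots> = tensors (?R @ [\<lambda>k. J (P k)]) k"
    using Cons.IH[OF Ps] snoc[of ?R "\<lambda>k. J (P k)"] polynomial_D[OF P] by simp
  finally have 1: "J (tensors (P # Ps) k) = tensors (rev (map (\<lambda>P k. J (P k)) (P # Ps))) k" by simp
  have "polynomials (?R @ [\<lambda>k. J (P k)])"
    using Cons.IH[OF Ps] polynomial_J[OF P] unfolding polynomials_def by auto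
  with 1 show ?case by simp
qed simp

text \<open>The induction has to carry along the products with partial contractions, because by
  \<open>left_bounded_tens\<close> a letter that absorbs the first factor turns into a partial contraction in front
  of the remaining ones.  A partial contraction that absorbs a further factor is again a partial contraction.\<close>

lemma tensors_left_bounded:
  assumes "polynomials Ps"
  shows "bounded_seq (tensors Ps) \<and> (\<forall>b p G. partial b p G \<longrightarrow> left_bounded (\<lambda>k. G k \<cdot> tensors Ps k))"
  using assms
proof (induction Ps)
  case Nil
  have "tensors [] = (\<lambda>_. one)" by (rule ext) simp
  then show ?case using left_bounded_partial by simp
next
  case (Cons P Ps)
  then obtain b where P: "polynomial b P" by auto
  have Ps: "polynomials Ps" using Cons.prems by simp
  note IH = Cons.IH[OF Ps]
  note dT = tensors_deg_bounded[OF Ps]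
  have TD: "tensors Ps k \<in> D" for k by (rule tensors_D[OF Ps])
  have PD: "P k \<in> D" for k by (rule polynomial_D[OF P])
  have lbT: "left_bounded (\<lambda>k. v k \<odot> tensors Ps k)" if "left_bounded v" for v
    by (rule left_bounded_tens[OF _ dT _ that]) (use IH in blast)+
  have eq: "tensors (P # Ps) = (\<lambda>k. P k \<odot> tensors Ps k)" by (rule ext) simp
  have "left_bounded (\<lambda>k. P k \<odot> tensors Ps k)" by (rule lbT[OF left_bounded_polynomial[OF P]])
  then have "bounded_seq (tensors (P # Ps))" unfolding eq by (rule left_bounded_bounded)
  moreover have "left_bounded (\<lambda>k. G k \<cdot> tensors (P # Ps) k)" if G: "partial c p G" for c p G
  proof -
    define G' where "G' q k = comp (p - q) (G k \<cdot> comp q (P k))" for q k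
    have G': "partial c (p - q) (G' q)" if q: "q \<le> p" for q
    proof -
      obtain s h where h: "dz c = p + s" "\<And>k. h k \<in> H s" "bounded_seq h" "\<And>k. G k = comp p (z c k \<cdot> h k)"
        using G unfolding partial_def by (metis (no_types))
      have p: "p = p - q + q" using q by simp
      have z: "z c k \<in> H (p - q + q + s)" for k using z_H[of c k] h(1) q by simp
      have "G' q k = comp (p - q) (z c k \<cdot> (h k \<odot> comp q (P k)))" for k
        using absorb_right_twice[OF z h(2) comp_H[OF PD]] p unfolding G'_def h(4) by simp
      moreover have "bounded_seq (\<lambda>k. h k \<odot> comp q (P k))"
        by (rule bounded_tens[OF deg_bounded_homogeneous[OF h(2)] deg_bounded_homogeneous[OF comp_H[OF PD]] h(3)
              comp_bounded[OF polynomial_deg_bounded[OF P] left_bounded_bounded[OF left_bounded_polynomial[OF P]]]])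
      moreover have "h k \<odot> comp q (P k) \<in> H (s + q)" for k using tens_H[OF h(2) comp_H[OF PD]] .
      ultimately show ?thesis
        unfolding partial_def using h(1) q
        by (intro exI[of _ "s + q"] exI[of _ "\<lambda>k. h k \<odot> comp q (P k)"]) simp
    qed
    have "G k \<cdot> tensors (P # Ps) k = (G k \<cdot> P k) \<odot> tensors Ps k
        + (\<Sum>q\<le>p. G' q k \<cdot> tensors Ps k - G' q k \<odot> tensors Ps k)" for k
      using mul_tens[OF partial_H[OF G] PD TD] by (simp add: G'_def circ_def)
    moreover have "left_bounded (\<lambda>k. (G k \<cdot> P k) \<odot> tensors Ps k
        + (\<Sum>q\<le>p. G' q k \<cdot> tensors Ps k - G' q k \<odot> tensors Ps k))"
      by (intro left_bounded_add left_bounded_sum left_bounded_diff lbT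
          left_bounded_partial_polynomial[OF G P] left_bounded_partial[OF G'])
        (use IH G' in auto)
    ultimately show ?thesis by simp
  qed
  ultimately show ?case by blast
qed

lemma tensors_bounded: "polynomials Ps \<Longrightarrow> bounded_seq (tensors Ps)"
  using tensors_left_bounded by blast

lemma word_tensors_bounded:
  assumes "polynomials Ps"
  shows "bounded_seq (\<lambda>k. word w k \<cdot> tensors Ps k)"
proof (cases Ps)
  case Nil then show ?thesis using word_bounded by simp
next
  case (Cons P Qs)
  then obtain b where P: "polynomial b P" and Qs: "polynomials Qs" using assms by auto
  have "left_bounded (\<lambda>k. P k \<odot> tensors Qs k)"
    by (rule left_bounded_tens[OF _ tensors_deg_bounded[OF Qs] tensors_bounded[OF Qs] left_bounded_polynomial[OF P]])
       (use tensors_left_bounded[OF Qs] in blast)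
  then show ?thesis unfolding Cons left_bounded_def by simp
qed

section \<open>Weakly vanishing sequences\<close>

text \<open>A weak notion is needed because the error terms are products of a sequence that vanishes in
  \<open>L\<^sup>2\<close> with unbounded factors, which need not vanish in \<open>L\<^sup>2\<close>.  Words suffice as test vectors: the
  empty word yields expectations, and the others allow to multiply by words.\<close>

definition weakly_null :: "(nat \<Rightarrow> 'l) \<Rightarrow> bool" where
  "weakly_null v \<longleftrightarrow> (\<forall>w. (\<lambda>k. cinner (word w k) (v k)) \<longlonglongrightarrow> 0)"

lemma weakly_null_add: "weakly_null u \<Longrightarrow> weakly_null v \<Longrightarrow> weakly_null (\<lambda>k. u k + v k)"
  unfolding weakly_null_def cinner_add_right by (intro allI tendsto_add_zero) blast+

lemma weakly_null_zero: "weakly_null (\<lambda>_. 0)"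
  by (simp add: weakly_null_def)

lemma weakly_null_diff: "weakly_null u \<Longrightarrow> weakly_null v \<Longrightarrow> weakly_null (\<lambda>k. u k - v k)"
proof -
  assume u: "weakly_null u" and v: "weakly_null v"
  have "(\<lambda>k. cinner (word w k) (u k) - cinner (word w k) (v k)) \<longlonglongrightarrow> 0 - 0" for w
    by (rule tendsto_diff) (use u v in \<open>simp_all add: weakly_null_def\<close>)
  then show ?thesis by (simp add: weakly_null_def cinner.diff_right)
qed

lemma weakly_null_sum: "(\<And>i. i \<in> S \<Longrightarrow> weakly_null (u i)) \<Longrightarrow> weakly_null (\<lambda>k. \<Sum>i\<in>S. u i k)"
  by (induction S rule: infinite_finite_induct) (simp_all add: weakly_null_add weakly_null_zero)

lemma weakly_null_scale:
  assumes "weakly_null v" "bounded_seq c"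
  shows "weakly_null (\<lambda>k. scaleC (c k) (v k))"
  unfolding weakly_null_def
proof
  fix w
  have "(\<lambda>k. cinner (word w k) (v k)) \<longlonglongrightarrow> 0" using assms(1) by (simp add: weakly_null_def)
  then show "(\<lambda>k. cinner (word w k) (scaleC (c k) (v k))) \<longlonglongrightarrow> 0"
    by (rule null_times_bounded[OF _ assms(2)]) (simp add: cinner_scaleC_right norm_mult mult.commute)
qed

lemma null_weakly_null:
  assumes "v \<longlonglongrightarrow> 0" shows "weakly_null v"
  unfolding weakly_null_def
proof
  fix w
  show "(\<lambda>k. cinner (word w k) (v k)) \<longlonglongrightarrow> 0"
    by (rule null_times_bounded[OF assms word_bounded[of w]])
       (subst mult.commute, rule cinner_bound)
qed

lemma weakly_null_word_mul:
  assumes "weakly_null v" "\<And>k. v k \<in> D"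
  shows "weakly_null (\<lambda>k. word w k \<cdot> v k)"
  unfolding weakly_null_def
proof
  fix u
  have "cinner (word u k) (word w k \<cdot> v k) = cinner (word (rev w @ u) k) (v k)" for k
    using cinner_mul_left[of "J (word w k)" "word u k" "v k"] assms(2) by (simp add: word_append J_word)
  then show "(\<lambda>k. cinner (word u k) (word w k \<cdot> v k)) \<longlonglongrightarrow> 0"
    using assms(1) by (simp add: weakly_null_def)
qed

text \<open>A vanishing factor on the left suffices, since the other factor and the test words may be
  moved to the other side of the inner product, where they are bounded.\<close>

lemma weakly_null_mul:
  assumes s: "s \<longlonglongrightarrow> 0" "\<And>k. s k \<in> D" and y: "\<And>k. y k \<in> D"
    and b: "\<And>w. bounded_seq (\<lambda>k. word w k \<cdot> J (y k))"
  shows "weakly_null (\<lambda>k. s k \<cdot> y k)"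
  unfolding weakly_null_def
proof
  fix w
  have "cmod (cinner (word w k) (s k \<cdot> y k)) = cmod (cinner (s k) (word w k \<cdot> J (y k)))" for k
    using cinner_mul_right[of "s k" "y k" "word w k"] s y cinner_commute[of "word w k" "s k \<cdot> y k"] by simp
  then have "cmod (cinner (word w k) (s k \<cdot> y k)) \<le> norm (s k) * norm (word w k \<cdot> J (y k))" for k
    using cinner_bound[of "s k" "word w k \<cdot> J (y k)"] by simp
  then show "(\<lambda>k. cinner (word w k) (s k \<cdot> y k)) \<longlonglongrightarrow> 0"
    by (rule null_times_bounded[OF s(1) b])
qed

lemma weakly_null_mul_tensors:
  assumes s: "s \<longlonglongrightarrow> 0" "deg_bounded s" and Ps: "polynomials Ps"
  shows "weakly_null (\<lambda>k. s k \<cdot> tensors Ps k)" "weakly_null (\<lambda>k. s k \<diamondop> tensors Ps k)"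
proof -
  show 1: "weakly_null (\<lambda>k. s k \<cdot> tensors Ps k)"
  proof (rule weakly_null_mul[OF s(1) deg_boundedD[OF s(2)] tensors_D[OF Ps]])
    fix w
    have "polynomials (rev (map (\<lambda>P k. J (P k)) Ps))" using J_tensors[OF Ps] by blast
    from word_tensors_bounded[OF this, of w]
    show "bounded_seq (\<lambda>k. word w k \<cdot> J (tensors Ps k))" using J_tensors[OF Ps] by simp
  qed
  have "weakly_null (\<lambda>k. s k \<odot> tensors Ps k)"
    by (rule null_weakly_null[OF null_tens[OF s(2) tensors_deg_bounded[OF Ps] s(1) tensors_bounded[OF Ps]]])
  from weakly_null_diff[OF 1 this] show "weakly_null (\<lambda>k. s k \<diamondop> tensors Ps k)" by (simp add: circ_def)
qed

end

context integral_pair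
begin

section \<open>Products with a partial contraction\<close>

text \<open>Such sequences need not vanish in \<open>L\<^sup>2\<close>.  They are weakly null, because the powers can be moved to
  the test words on the other side of the inner product.\<close>

inductive null_times_pow :: "bool \<Rightarrow> (nat \<Rightarrow> 'l) \<Rightarrow> bool" for c where
  base: "s \<longlonglongrightarrow> 0 \<Longrightarrow> deg_bounded s \<Longrightarrow> null_times_pow c (\<lambda>k. s k \<cdot> pow c i k)"
| add: "null_times_pow c u \<Longrightarrow> null_times_pow c v \<Longrightarrow> null_times_pow c (\<lambda>k. u k + v k)"
| scale: "null_times_pow c v \<Longrightarrow> bounded_seq a \<Longrightarrow> null_times_pow c (\<lambda>k. scaleC (a k) (v k))"

lemma null_times_pow_D: "null_times_pow c v \<Longrightarrow> v k \<in> D"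
  by (induction rule: null_times_pow.induct) (auto intro!: mul_D pow_D D_add D_scale intro: deg_boundedD)

lemma null_times_pow_null:
  assumes "s \<longlonglongrightarrow> 0" "deg_bounded s" shows "null_times_pow c s"
  using base[OF assms, of c 0] deg_boundedD[OF assms(2)] by simp

lemma null_times_pow_sum:
  "(\<And>i. i \<in> S \<Longrightarrow> null_times_pow c (u i)) \<Longrightarrow> null_times_pow c (\<lambda>k. \<Sum>i\<in>S. u i k)"
  by (induction S rule: infinite_finite_induct) (simp_all add: add null_times_pow_null)

lemma null_times_pow_mul:
  "null_times_pow c v \<Longrightarrow> null_times_pow c (\<lambda>k. v k \<cdot> z c k)"
proof (induction rule: null_times_pow.induct)
  case (base s i)
  have "null_times_pow c (\<lambda>k. s k \<cdot> pow c (Suc i) k)" by (rule null_times_pow.base[OF base])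
  moreover have "s k \<cdot> pow c (Suc i) k = s k \<cdot> pow c i k \<cdot> z c k" for k
    using deg_boundedD[OF base(2)] by (simp add: mul_assoc l2_power_commute)
  ultimately show ?case by simp
next
  case (add u v)
  from null_times_pow.add[OF add.IH] show ?case
    using null_times_pow_D[OF add.hyps(1)] null_times_pow_D[OF add.hyps(2)] by (simp add: mul_add_left)
next
  case (scale v a)
  from null_times_pow.scale[OF scale.IH scale.hyps(2)] show ?case
    using null_times_pow_D[OF scale.hyps(1)] by (simp add: mul_scale_left)
qed

lemma null_times_pow_weakly_null: "null_times_pow c v \<Longrightarrow> weakly_null v"
proof (induction rule: null_times_pow.induct)
  case (base s i)
  show ?case
  proof (rule weakly_null_mul[OF base(1) deg_boundedD[OF base(2)] pow_D])
    fix w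
    show "bounded_seq (\<lambda>k. word w k \<cdot> J (pow c i k))"
      using word_bounded[of "w @ replicate i c"]
      by (simp add: word_append[abs_def] pow_word J_word)
  qed
qed (simp_all add: weakly_null_add weakly_null_scale)

text \<open>For a partial contraction \<open>F\<close> of the one sequence, \<open>F\<close> times a power of the other sequence is
  the tensor product up to errors that vanish.  An error is created when one of the factors
  absorbs a component of the power to its left, and is afterwards multiplied by the remaining factors.\<close>

lemma partial_circ_pow:
  assumes F: "partial b p F"
  shows "null_times_pow (\<not> b) (\<lambda>k. F k \<diamondop> pow (\<not> b) i k)"
proof (induction i)
  case 0
  have "(\<lambda>k. F k \<diamondop> pow (\<not> b) 0 k) = (\<lambda>_. 0)" by (rule ext) (simp add: partial_D[OF F])
  then show ?case using null_times_pow_null[of "\<lambda>_. 0"] by simp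
next
  case (Suc i)
  define c where "c = (\<not> b)"
  have FD: "F k \<in> D" for k by (rule partial_D[OF F])
  define G where "G q k = comp (dz c - q) (comp q (pow c i k) \<cdot> z c k)" for q k
  have G: "partial c (dz c - q) (G q)" if q: "q \<le> dz c" for q
  proof -
    have "G q = (\<lambda>k. comp (dz c - q) (z c k \<cdot> comp q (pow c i k)))"
      unfolding G_def by (rule ext, rule z_sym[symmetric, of _ q]) (use q in simp_all)
    then show ?thesis using partial_contract_comp[OF pow_deg_bounded pow_bounded q, of c i] by simp
  qed
  have "F k \<diamondop> pow c (Suc i) k = (F k \<diamondop> pow c i k) \<cdot> z c k + (\<Sum>q\<le>dz c. F k \<diamondop> G q k)" for k
  proof -
    have "pow c (Suc i) k = pow c i k \<cdot> z c k" by (simp add: l2_power_commute)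
    then show ?thesis
      using tens_mul[OF z_H[of c k] pow_D[of c k i] FD[of k]] FD[of k]
      by (simp add: circ_def mul_diff_left mul_assoc G_def)
  qed
  moreover have "null_times_pow c (\<lambda>k. (F k \<diamondop> pow c i k) \<cdot> z c k + (\<Sum>q\<le>dz c. F k \<diamondop> G q k))"
  proof (intro add null_times_pow_sum null_times_pow_mul)
    show "null_times_pow c (\<lambda>k. F k \<diamondop> pow c i k)" using Suc by (simp add: c_def)
    fix q assume "q \<in> {..dz c}"
    then have "partial (\<not> b) (dz c - q) (G q)" using G by (simp add: c_def)
    then show "null_times_pow c (\<lambda>k. F k \<diamondop> G q k)"
      by (intro null_times_pow_null partial_circ_null[OF F] deg_bounded_circ
          deg_bounded_homogeneous[OF partial_H[OF F]] deg_bounded_homogeneous[OF partial_H])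
  qed
  ultimately show ?case by (simp add: c_def)
qed

lemma partial_circ_polynomial:
  assumes F: "partial b p F" and P: "polynomial (\<not> b) P"
  shows "null_times_pow (\<not> b) (\<lambda>k. F k \<diamondop> P k)"
proof -
  obtain N c where c: "\<And>i. bounded_seq (c i :: nat \<Rightarrow> complex)"
    "P = (\<lambda>k. \<Sum>i\<le>N. scaleC (c i k) (pow (\<not> b) i k))" by (rule polynomialE[OF P]) (rule that; assumption)
  have "null_times_pow (\<not> b) (\<lambda>k. \<Sum>i\<le>N. scaleC (c i k) (F k \<diamondop> pow (\<not> b) i k))"
    by (intro null_times_pow_sum scale partial_circ_pow[OF F] c)
  moreover have "F k \<diamondop> P k = (\<Sum>i\<le>N. scaleC (c i k) (F k \<diamondop> pow (\<not> b) i k))" for k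
    unfolding c(2) using partial_D[OF F] by (simp add: circ_sum_right circ_scale_right)
  ultimately show ?thesis by simp
qed

text \<open>Absorbing a component of positive degree of a polynomial of the other sequence leaves nothing in the
  limit.  The square of the norm of the result \<open>\<kappa>\<close> is the expectation of \<open>\<rho> P\<close>, where \<open>\<rho>\<close> is \<open>F\<close>
  after absorption of \<open>\<kappa>\<^sup>*\<close> from the left, which is again a partial contraction; and that
  expectation is the one of \<open>\<rho> \<diamondop> P\<close>, which is weakly null.\<close>

lemma partial_contract_polynomial_null:
  assumes F: "partial b p F" and P: "polynomial (\<not> b) P" and q: "1 \<le> q" "q \<le> p"
  shows "(\<lambda>k. comp (p - q) (F k \<cdot> comp q (P k))) \<longlonglongrightarrow> 0"
proof -
  have FD: "F k \<in> D" for k by (rule partial_D[OF F])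
  have PD: "P k \<in> D" for k by (rule polynomial_D[OF P])
  have FH: "F k \<in> H (p - q + q)" "F k \<in> H (q + (p - q))" for k using partial_H[OF F, of k] q by simp_all
  define \<kappa> where "\<kappa> k = comp (p - q) (F k \<cdot> comp q (P k))" for k
  have \<kappa>: "\<kappa> k \<in> H (p - q)" for k unfolding \<kappa>_def by (intro comp_H mul_D FD comp_D PD)
  have bP: "bounded_seq (\<lambda>k. comp q (P k))"
    by (rule comp_bounded[OF polynomial_deg_bounded[OF P] left_bounded_bounded[OF left_bounded_polynomial[OF P]]])
  have b\<kappa>: "bounded_seq \<kappa>"
    by (rule bounded_seq_mult_le[OF partial_bounded[OF F] bP])
       (unfold \<kappa>_def, rule norm_absorb_right[OF FH(1) comp_H[OF PD]])
  define \<rho> where "\<rho> k = comp q (J (\<kappa> k) \<cdot> F k)" for k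
  \<comment> \<open>Seen from \<open>z b k\<close>, the factors \<open>h k\<close> and \<open>J (\<kappa> k)\<close> may be absorbed at either end, by the symmetry
    of its kernel; absorbing both at the same end amounts to absorbing their tensor product.\<close>
  have \<rho>: "partial b q \<rho>"
  proof -
    obtain s h where h: "dz b = p + s" "\<And>k. h k \<in> H s" "bounded_seq h" "\<And>k. F k = comp p (z b k \<cdot> h k)"
      "\<And>k. F k = comp p (h k \<cdot> z b k)" by (rule partialE[OF F]) (rule that; assumption)
    have zH: "z b k \<in> H (q + (p - q) + s)" for k using z_H[of b k] h(1) q by simp
    have hH: "J (\<kappa> k) \<odot> h k \<in> H (p - q + s)" for k by (rule tens_H[OF H_J[OF \<kappa>] h(2)])
    have "\<rho> k = comp q ((J (\<kappa> k) \<odot> h k) \<cdot> z b k)" for k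
      using absorb_left_twice[OF zH h(2) H_J[OF \<kappa>]] q unfolding \<rho>_def h(5) by simp
    also have "\<dots> k = comp q (z b k \<cdot> (J (\<kappa> k) \<odot> h k))" for k
      by (rule z_sym[symmetric, OF hH]) (use h(1) q in simp)
    finally have "\<rho> k = comp q (z b k \<cdot> (J (\<kappa> k) \<odot> h k))" for k .
    moreover have "bounded_seq (\<lambda>k. J (\<kappa> k) \<odot> h k)"
      by (rule bounded_tens[OF deg_bounded_homogeneous[OF H_J[OF \<kappa>]] deg_bounded_homogeneous[OF h(2)] _ h(3)])
         (rule bounded_seq_le[OF b\<kappa>], simp add: norm_J)
    ultimately show ?thesis
      unfolding partial_def using h(1) q hH
      by (intro exI[of _ "p - q + s"] exI[of _ "\<lambda>k. J (\<kappa> k) \<odot> h k"]) simp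
  qed
  have \<rho>D: "\<rho> k \<in> D" for k by (rule partial_D[OF \<rho>])
  have "complex_of_real ((norm (\<kappa> k))\<^sup>2) = cinner (\<rho> k \<diamondop> P k) one" for k
  proof -
    have "complex_of_real ((norm (\<kappa> k))\<^sup>2) = cinner (\<kappa> k) (\<kappa> k)" by (rule cinner_self[symmetric])
    also have "\<dots> = cinner (F k) (\<kappa> k \<odot> J (comp q (P k)))"
      using cinner_absorb_right[OF FH(1) comp_H[OF PD] \<kappa>[of k], of k] unfolding \<kappa>_def .
    also have "\<dots> = cinner (\<rho> k) (J (comp q (P k)))"
      using cinner_absorb_left[OF FH(2) H_J[OF \<kappa>] H_J[OF comp_H[OF PD]], of k k k] by (simp add: \<rho>_def)
    also have "\<dots> = cinner (\<rho> k) (comp q (J (P k)))" using PD by (simp add: comp_J)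
    also have "\<dots> = cinner (\<rho> k) (J (P k))" using PD partial_H[OF \<rho>] by (intro cinner_comp_right) auto
    also have "\<dots> = cinner (\<rho> k \<cdot> P k) one" using \<rho>D PD by (simp add: cinner_mul_one)
    also have "\<dots> = cinner (\<rho> k \<diamondop> P k) one + cinner (\<rho> k \<odot> P k) one"
      by (simp add: circ_def flip: cinner_add_left)
    also have "cinner (\<rho> k \<odot> P k) one = cinner (comp 0 (\<rho> k \<odot> P k)) one"
      using \<rho>D PD by (intro cinner_comp[symmetric]) auto
    also have "comp 0 (\<rho> k \<odot> P k) = 0"
      using comp_homogeneous[OF partial_H[OF \<rho>], of 0 k] q \<rho>D PD by (intro comp_0_tens) auto
    finally show ?thesis by simp
  qed
  note eq = this
  have "weakly_null (\<lambda>k. \<rho> k \<diamondop> P k)"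
    by (rule null_times_pow_weakly_null[OF partial_circ_polynomial[OF \<rho> P]])
  then have "(\<lambda>k. cinner one (\<rho> k \<diamondop> P k)) \<longlonglongrightarrow> 0"
    unfolding weakly_null_def by (drule_tac spec[of _ "[]"]) simp
  then have "(\<lambda>k. norm (cinner one (\<rho> k \<diamondop> P k))) \<longlonglongrightarrow> 0" by (rule tendsto_norm_zero)
  moreover have "norm (cinner one (\<rho> k \<diamondop> P k)) = (norm (\<kappa> k))\<^sup>2" for k
  proof -
    have "norm (cinner one (\<rho> k \<diamondop> P k)) = cmod (cinner (\<rho> k \<diamondop> P k) one)"
      using cinner_commute[of one "\<rho> k \<diamondop> P k"] by simp
    also have "\<dots> = (norm (\<kappa> k))\<^sup>2"
      unfolding eq[symmetric] by (simp only: norm_of_real abs_of_nonneg zero_le_power2)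
    finally show ?thesis .
  qed
  ultimately have "(\<lambda>k. (norm (\<kappa> k))\<^sup>2) \<longlonglongrightarrow> 0" by simp
  then have "(\<lambda>k. sqrt ((norm (\<kappa> k))\<^sup>2)) \<longlonglongrightarrow> sqrt 0" by (rule tendsto_real_sqrt)
  then have "\<kappa> \<longlonglongrightarrow> 0" by (simp add: tendsto_norm_zero_iff)
  then show ?thesis by (simp add: \<kappa>_def[abs_def])
qed

text \<open>Expanding \<open>s \<cdot> (z\<^sup>i \<odot> T)\<close> by \<open>mul_tens\<close> expresses the tensor product by products with the
  vanishing factor \<open>s\<close> or partial contractions of it, to which \<open>weakly_null_mul_tensors\<close> applies.\<close>

lemma weakly_null_tensors:
  assumes "null_times_pow c v" and Ps: "polynomials Ps"
  shows "weakly_null (\<lambda>k. v k \<odot> tensors Ps k)"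
  using assms(1)
proof (induction rule: null_times_pow.induct)
  case (base s i)
  have TD: "tensors Ps k \<in> D" for k by (rule tensors_D[OF Ps])
  have sD: "s k \<in> D" for k by (rule deg_boundedD[OF base(2)])
  obtain N where N: "\<And>k. deg_le N (s k)" using base(2) unfolding deg_bounded_def by blast
  have Ps': "polynomials (pow c i # Ps)" using Ps polynomial_pow by auto
  define \<kappa> where "\<kappa> e q k = comp (e - q) (comp e (s k) \<cdot> comp q (pow c i k))" for e q k
  have se0: "(\<lambda>k. comp e (s k)) \<longlonglongrightarrow> 0" for e
    by (rule null_times_bounded[OF base(1) bounded_seq_const[of "1::real"]]) (simp add: norm_comp_le sD)
  have \<kappa>0: "\<kappa> e q \<longlonglongrightarrow> 0" if "q \<le> e" for e q
  proof (rule null_times_bounded[OF se0 comp_bounded[OF pow_deg_bounded pow_bounded]])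
    fix k
    have "comp e (s k) \<in> H (e - q + q)" using that comp_H[OF sD] by simp
    from norm_absorb_right[OF this comp_H[OF pow_D]]
    show "norm (\<kappa> e q k) \<le> norm (comp e (s k)) * norm (comp q (pow c i k))" unfolding \<kappa>_def .
  qed
  have d\<kappa>: "deg_bounded (\<kappa> e q)" for e q
    unfolding \<kappa>_def by (rule deg_bounded_homogeneous[of _ "e - q"]) (intro comp_H mul_D comp_D sD pow_D)
  have "(s k \<cdot> pow c i k) \<odot> tensors Ps k =
      s k \<cdot> tensors (pow c i # Ps) k - (\<Sum>e\<le>N. \<Sum>q\<le>e. \<kappa> e q k \<diamondop> tensors Ps k)" for k
  proof -
    have s: "(\<Sum>e\<le>N. comp e (s k)) = s k" by (rule deg_le_sum[OF N])
    have "s k \<cdot> (pow c i k \<odot> tensors Ps k) = (\<Sum>e\<le>N. comp e (s k) \<cdot> (pow c i k \<odot> tensors Ps k))"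
      using mul_sum_left[of "{..N}" "\<lambda>e. comp e (s k)" "pow c i k \<odot> tensors Ps k"] sD TD by (simp add: s)
    also have "\<dots> = (\<Sum>e\<le>N. (comp e (s k) \<cdot> pow c i k) \<odot> tensors Ps k + (\<Sum>q\<le>e. \<kappa> e q k \<diamondop> tensors Ps k))"
      unfolding \<kappa>_def by (intro sum.cong refl mul_tens comp_H sD pow_D TD)
    also have "\<dots> = (\<Sum>e\<le>N. (comp e (s k) \<cdot> pow c i k) \<odot> tensors Ps k) + (\<Sum>e\<le>N. \<Sum>q\<le>e. \<kappa> e q k \<diamondop> tensors Ps k)"
      by (rule sum.distrib)
    also have "(\<Sum>e\<le>N. (comp e (s k) \<cdot> pow c i k) \<odot> tensors Ps k) = (s k \<cdot> pow c i k) \<odot> tensors Ps k"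
    proof -
      have "(\<Sum>e\<le>N. (comp e (s k) \<cdot> pow c i k) \<odot> tensors Ps k) = (\<Sum>e\<le>N. comp e (s k) \<cdot> pow c i k) \<odot> tensors Ps k"
        by (rule tens_sum_left[symmetric]) (use sD TD in simp_all)
      also have "(\<Sum>e\<le>N. comp e (s k) \<cdot> pow c i k) = s k \<cdot> pow c i k"
        using mul_sum_left[of "{..N}" "\<lambda>e. comp e (s k)" "pow c i k"] sD by (simp add: s)
      finally show ?thesis .
    qed
    finally show ?thesis by simp
  qed
  moreover have "weakly_null (\<lambda>k. s k \<cdot> tensors (pow c i # Ps) k - (\<Sum>e\<le>N. \<Sum>q\<le>e. \<kappa> e q k \<diamondop> tensors Ps k))"
    by (intro weakly_null_diff weakly_null_sum weakly_null_mul_tensors(1)[OF base Ps']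
        weakly_null_mul_tensors(2)[OF \<kappa>0 d\<kappa> Ps]) simp
  ultimately show ?case by simp
next
  case (add u v)
  from weakly_null_add[OF add.IH] show ?case
    using null_times_pow_D[OF add.hyps(1)] null_times_pow_D[OF add.hyps(2)] tensors_D[OF Ps]
    by (simp add: tens_add_left)
next
  case (scale v a)
  from weakly_null_scale[OF scale.IH scale.hyps(2)] show ?case
    using null_times_pow_D[OF scale.hyps(1)] tensors_D[OF Ps] by (simp add: tens_scale_left)
qed

text \<open>The absorption of a whole component of \<open>P\<close> vanishes in the limit: in positive degrees because
  \<open>P\<close> belongs to the other sequence, in degree \<open>0\<close> because \<open>P\<close> is centered.  This is the place where
  both conditions on alternating products enter.\<close>

lemma partial_circ_tensors:
  assumes F: "partial b p F" and P: "polynomial (\<not> b) P" and P0: "\<And>k. comp 0 (P k) = 0"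
    and Ps: "polynomials Ps"
  shows "weakly_null (\<lambda>k. F k \<diamondop> tensors (P # Ps) k)"
proof -
  have FD: "F k \<in> D" for k by (rule partial_D[OF F])
  have PD: "P k \<in> D" for k by (rule polynomial_D[OF P])
  have TD: "tensors Ps k \<in> D" for k by (rule tensors_D[OF Ps])
  define \<kappa> where "\<kappa> q k = comp (p - q) (F k \<cdot> comp q (P k))" for q k
  have \<kappa>0: "\<kappa> q \<longlonglongrightarrow> 0" if "q \<le> p" for q
  proof (cases "q = 0")
    case True
    have "\<kappa> q = (\<lambda>_. 0)" by (rule ext) (simp add: \<kappa>_def True P0)
    then show ?thesis by simp
  next
    case False
    then show ?thesis
      using partial_contract_polynomial_null[OF F P, of q] that by (simp add: \<kappa>_def[abs_def])
  qed
  have d\<kappa>: "deg_bounded (\<kappa> q)" for q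
    unfolding \<kappa>_def by (rule deg_bounded_homogeneous[of _ "p - q"]) (intro comp_H mul_D comp_D FD PD)
  have "F k \<diamondop> tensors (P # Ps) k = (F k \<diamondop> P k) \<odot> tensors Ps k + (\<Sum>q\<le>p. \<kappa> q k \<diamondop> tensors Ps k)" for k
    using mul_tens[OF partial_H[OF F] PD TD, of k k k] FD[of k] PD[of k] TD[of k]
    unfolding circ_def[of "F k"] tensors.simps
    by (simp add: tens_diff_left tens_assoc \<kappa>_def)
  moreover have "weakly_null (\<lambda>k. (F k \<diamondop> P k) \<odot> tensors Ps k + (\<Sum>q\<le>p. \<kappa> q k \<diamondop> tensors Ps k))"
    by (intro weakly_null_add weakly_null_sum weakly_null_mul_tensors(2)[OF \<kappa>0 d\<kappa> Ps]
        weakly_null_tensors[OF partial_circ_polynomial[OF F P] Ps]) simp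
  ultimately show ?thesis by simp
qed

section \<open>Asymptotic freeness\<close>

text \<open>By induction on the exponent: in \<open>z \<cdot> (z\<^sup>i \<odot> T)\<close> the letter \<open>z\<close> either stays inside \<open>z\<^sup>i\<close> or
  absorbs one of its components and becomes a partial contraction.\<close>

lemma polynomial_circ_tensors:
  assumes P: "polynomial b P" and T: "\<And>k. T k \<in> D"
    and step: "\<And>p F. partial b p F \<Longrightarrow> weakly_null (\<lambda>k. F k \<diamondop> T k)"
  shows "weakly_null (\<lambda>k. P k \<diamondop> T k)"
proof -
  have pow: "weakly_null (\<lambda>k. pow b i k \<diamondop> T k)" for i
  proof (induction i)
    case 0
    have "(\<lambda>k. pow b 0 k \<diamondop> T k) = (\<lambda>_. 0)" by (rule ext) (simp add: T)
    then show ?case using weakly_null_zero by simp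
  next
    case (Suc i)
    define G where "G q k = comp (dz b - q) (z b k \<cdot> comp q (pow b i k))" for q k
    have "pow b (Suc i) k \<diamondop> T k = word [b] k \<cdot> (pow b i k \<diamondop> T k) + (\<Sum>q\<le>dz b. G q k \<diamondop> T k)" for k
      using mul_tens[OF z_H[of b k] pow_D[of b k i] T[of k]] T[of k]
      by (simp add: word_Cons circ_def mul_diff_right mul_assoc G_def)
    moreover have "weakly_null (\<lambda>k. word [b] k \<cdot> (pow b i k \<diamondop> T k) + (\<Sum>q\<le>dz b. G q k \<diamondop> T k))"
    proof (intro weakly_null_add weakly_null_sum weakly_null_word_mul Suc circ_D pow_D T)
      fix q assume "q \<in> {..dz b}"
      then show "weakly_null (\<lambda>k. G q k \<diamondop> T k)"
        unfolding G_def by (intro step[OF partial_contract_comp[OF pow_deg_bounded pow_bounded]]) simp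
    qed
    ultimately show ?case by simp
  qed
  obtain N c where c: "\<And>i. bounded_seq (c i :: nat \<Rightarrow> complex)"
    "P = (\<lambda>k. \<Sum>i\<le>N. scaleC (c i k) (pow b i k))" by (rule polynomialE[OF P]) (rule that; assumption)
  have "weakly_null (\<lambda>k. \<Sum>i\<le>N. scaleC (c i k) (pow b i k \<diamondop> T k))"
    by (intro weakly_null_sum weakly_null_scale pow c)
  moreover have "P k \<diamondop> T k = (\<Sum>i\<le>N. scaleC (c i k) (pow b i k \<diamondop> T k))" for k
  proof -
    have "scaleC a (pow b i k) \<diamondop> T k = scaleC a (pow b i k \<diamondop> T k)" for a i
      using T by (simp add: circ_def mul_scale_left tens_scale_left scaleC_diff_right)
    then show ?thesis unfolding c(2) using T by (simp add: circ_sum_left)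
  qed
  ultimately show ?thesis by simp
qed

lemma weakly_null_polynomial_mul:
  assumes P: "polynomial b P" and v: "weakly_null v" "\<And>k. v k \<in> D"
  shows "weakly_null (\<lambda>k. P k \<cdot> v k)"
proof -
  obtain N c where c: "\<And>i. bounded_seq (c i :: nat \<Rightarrow> complex)"
    "P = (\<lambda>k. \<Sum>i\<le>N. scaleC (c i k) (pow b i k))" by (rule polynomialE[OF P]) (rule that; assumption)
  have "weakly_null (\<lambda>k. \<Sum>i\<le>N. scaleC (c i k) (word (replicate i b) k \<cdot> v k))"
    by (intro weakly_null_sum weakly_null_scale weakly_null_word_mul v c)
  moreover have "P k \<cdot> v k = (\<Sum>i\<le>N. scaleC (c i k) (word (replicate i b) k \<cdot> v k))" for k
    unfolding c(2) using v(2) by (simp add: mul_sum_left mul_scale_left pow_word)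
  ultimately show ?thesis by simp
qed

text \<open>By induction on the number of factors.  A new first factor multiplies the error of the remaining ones,
  which preserves weak convergence, and adds the error of \<open>polynomial_circ_tensors\<close>.\<close>

lemma alternating_product_tensors:
  assumes "\<And>b P. (b, P) \<in> set Ps \<Longrightarrow> polynomial b P \<and> (\<forall>k. comp 0 (P k) = 0)"
    and "distinct_adj (map fst Ps)"
  shows "weakly_null (\<lambda>k. l2_prod W (map (\<lambda>(b, P). P k) Ps) - tensors (map snd Ps) k)"
  using assms
proof (induction Ps)
  case Nil then show ?case by (simp add: weakly_null_zero)
next
  case (Cons bP Ps)
  obtain b P where bP: "bP = (b, P)" by (cases bP)
  have P: "polynomial b P" "\<And>k. comp 0 (P k) = 0" using Cons.prems(1)[of b P] by (auto simp: bP)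
  have Ps: "polynomial c Q" "comp 0 (Q k) = 0" if "(c, Q) \<in> set Ps" for c Q k
    using Cons.prems(1)[of c Q] that by auto
  have polys: "polynomials (map snd Ps)"
    unfolding polynomials_def
  proof
    fix Q assume "Q \<in> set (map snd Ps)"
    then obtain c where "(c, Q) \<in> set Ps" by auto
    then show "\<exists>c. polynomial c Q" using Ps(1) by blast
  qed
  have PD: "P k \<in> D" for k by (rule polynomial_D[OF P(1)])
  have TD: "tensors (map snd Ps) k \<in> D" for k by (rule tensors_D[OF polys])
  have set: "set (map (\<lambda>(b, P). P k) Ps) \<subseteq> D" for k
  proof
    fix x assume "x \<in> set (map (\<lambda>(b, P). P k) Ps)"
    then obtain c Q where "(c, Q) \<in> set Ps" "x = Q k" by auto
    then show "x \<in> D" using polynomial_D[OF Ps(1)] by blast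
  qed
  have prodD: "l2_prod W (map (\<lambda>(b, P). P k) Ps) \<in> D" for k by (rule l2_prod_D[OF set])
  have IH: "weakly_null (\<lambda>k. l2_prod W (map (\<lambda>(b, P). P k) Ps) - tensors (map snd Ps) k)"
  proof (rule Cons.IH)
    show "polynomial c Q \<and> (\<forall>k. comp 0 (Q k) = 0)" if "(c, Q) \<in> set Ps" for c Q using Ps that by blast
    show "distinct_adj (map fst Ps)" using Cons.prems(2) by (auto dest: distinct_adj_ConsD)
  qed
  have "weakly_null (\<lambda>k. P k \<diamondop> tensors (map snd Ps) k)"
  proof (rule polynomial_circ_tensors[OF P(1) TD])
    fix p F assume F: "partial b p F"
    show "weakly_null (\<lambda>k. F k \<diamondop> tensors (map snd Ps) k)"
    proof (cases Ps)
      case Nil then show ?thesis using partial_D[OF F] by (simp add: weakly_null_zero)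
    next
      case (Cons cQ Qs)
      obtain c Q where cQ: "cQ = (c, Q)" by (cases cQ)
      have "c = (\<not> b)" using \<open>distinct_adj (map fst (bP # Ps))\<close> by (simp add: Cons cQ bP)
      moreover have "polynomial c Q" by (rule Ps(1)) (simp add: Cons cQ)
      moreover have "comp 0 (Q k) = 0" for k by (rule Ps(2)[of c]) (simp add: Cons cQ)
      moreover have "polynomials (map snd Qs)" using polys by (simp add: Cons)
      ultimately show ?thesis using partial_circ_tensors[OF F] by (simp add: Cons cQ)
    qed
  qed
  moreover have "weakly_null (\<lambda>k. P k \<cdot> (l2_prod W (map (\<lambda>(b, P). P k) Ps) - tensors (map snd Ps) k))"
    by (rule weakly_null_polynomial_mul[OF P(1) IH]) (intro D_diff prodD TD)
  ultimately have "weakly_null (\<lambda>k. P k \<cdot> (l2_prod W (map (\<lambda>(b, P). P k) Ps) - tensors (map snd Ps) k)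
      + P k \<diamondop> tensors (map snd Ps) k)" by (intro weakly_null_add)
  moreover have "P k \<cdot> (l2_prod W (map (\<lambda>(b, P). P k) Ps) - tensors (map snd Ps) k)
      + P k \<diamondop> tensors (map snd Ps) k = l2_prod W (map (\<lambda>(b, P). P k) (bP # Ps)) - tensors (map snd (bP # Ps)) k" for k
    using PD prodD TD by (simp add: mul_diff_right circ_def bP)
  ultimately show ?case by simp
qed

theorem asymptotically_free:
  assumes Ps: "\<And>b P. (b, P) \<in> set Ps \<Longrightarrow> polynomial b P \<and> (\<forall>k. comp 0 (P k) = 0)"
    and adj: "distinct_adj (map fst Ps)" and ne: "Ps \<noteq> []"
  shows "(\<lambda>k. cinner (l2_prod W (map (\<lambda>(b, P). P k) Ps)) one) \<longlonglongrightarrow> 0"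
proof -
  obtain b P Qs where Cons: "Ps = (b, P) # Qs" using ne by (cases Ps) auto
  have P: "polynomial b P" "\<And>k. comp 0 (P k) = 0" using Ps[of b P] by (auto simp: Cons)
  have polys: "polynomials (map snd Qs)"
    unfolding polynomials_def
  proof
    fix Q assume "Q \<in> set (map snd Qs)"
    then obtain c where "(c, Q) \<in> set Qs" by auto
    then have "(c, Q) \<in> set Ps" by (simp add: Cons)
    from conjunct1[OF Ps[OF this]] show "\<exists>c. polynomial c Q" by (rule exI)
  qed
  have "comp 0 (tensors (map snd Ps) k) = 0" for k
    using comp_0_tens[OF polynomial_D[OF P(1)] tensors_D[OF polys] P(2)] by (simp add: Cons)
  moreover have TD: "tensors (map snd Ps) k \<in> D" for k
    using polynomial_D[OF P(1)] tensors_D[OF polys] by (simp add: Cons)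
  ultimately have zero: "cinner one (tensors (map snd Ps) k) = 0" for k
    using cinner_comp_right[OF TD one_H_0, of k] by simp
  have "weakly_null (\<lambda>k. l2_prod W (map (\<lambda>(b, P). P k) Ps) - tensors (map snd Ps) k)"
    by (rule alternating_product_tensors[OF Ps adj])
  from this[unfolded weakly_null_def, THEN spec, of "[]"]
  have "(\<lambda>k. cinner one (l2_prod W (map (\<lambda>(b, P). P k) Ps) - tensors (map snd Ps) k)) \<longlonglongrightarrow> 0"
    by simp
  then have "(\<lambda>k. cinner one (l2_prod W (map (\<lambda>(b, P). P k) Ps))) \<longlonglongrightarrow> 0"
    by (simp add: cinner.diff_right zero)
  then have "(\<lambda>k. cnj (cinner one (l2_prod W (map (\<lambda>(b, P). P k) Ps)))) \<longlonglongrightarrow> cnj 0"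
    by (rule tendsto_cnj)
  then show ?thesis by (simp add: cinner_commute[of _ one])
qed

end

section \<open>Integration over products of half-lines\<close>

abbreviation half_line :: "real measure" where "half_line \<equiv> restrict_space lborel {0..}"

interpretation half_lines: product_sigma_finite "\<lambda>_::nat. half_line"
  unfolding product_sigma_finite_def
  by (auto intro!: sigma_finite_measure_restrict_space lborel.sigma_finite_measure_axioms)

lemma sigma_finite_orthant: "sigma_finite_measure (orthant n)"
  unfolding orthant_def by (rule half_lines.sigma_finite) simp

lemma pair_sigma_finite_orthant: "pair_sigma_finite (orthant n) (orthant m)"
  unfolding pair_sigma_finite_def by (simp add: sigma_finite_orthant)

definition join :: "nat \<Rightarrow> nat \<Rightarrow> (nat \<Rightarrow> real) \<times> (nat \<Rightarrow> real) \<Rightarrow> nat \<Rightarrow> real" where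
  "join n m x = (\<lambda>i\<in>{..<n + m}. if i < n then fst x i else snd x (i - n))"

definition reversal :: "nat \<Rightarrow> (nat \<Rightarrow> real) \<Rightarrow> nat \<Rightarrow> real" where
  "reversal p s = (\<lambda>i\<in>{..<p}. s (p - 1 - i))"

definition first_part :: "nat \<Rightarrow> (nat \<Rightarrow> real) \<Rightarrow> nat \<Rightarrow> real" where
  "first_part n t = (\<lambda>i\<in>{..<n}. t i)"

definition last_part :: "nat \<Rightarrow> nat \<Rightarrow> (nat \<Rightarrow> real) \<Rightarrow> nat \<Rightarrow> real" where
  "last_part n m t = (\<lambda>i\<in>{..<m}. t (n + i))"

lemma component_measurable: "i < n \<Longrightarrow> (\<lambda>t. t i) \<in> measurable (orthant n) half_line"
  unfolding orthant_def by (rule measurable_component_singleton) simp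

lemma space_orthant: "space (orthant n) = {..<n} \<rightarrow>\<^sub>E {0..}"
  by (simp add: orthant_def space_PiM space_restrict_space)

lemma extensional_orthant: "t \<in> space (orthant n) \<Longrightarrow> i \<ge> n \<Longrightarrow> t i = undefined"
  by (auto simp: space_orthant PiE_def extensional_def)

lemma join_measurable [measurable]: "join n m \<in> measurable (orthant n \<Otimes>\<^sub>M orthant m) (orthant (n + m))"
proof -
  have "(\<lambda>x. if i < n then fst x i else snd x (i - n)) \<in> measurable (orthant n \<Otimes>\<^sub>M orthant m) half_line"
    if "i < n + m" for i
  proof (cases "i < n")
    case True
    then show ?thesis
      by (simp add: measurable_compose[OF measurable_fst component_measurable])
  next
    case False
    then have "i - n < m" using that by simp
    then show ?thesis using False
      by (simp add: measurable_compose[OF measurable_snd component_measurable])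
  qed
  then show ?thesis
    unfolding join_def orthant_def[of "n + m"] by (intro measurable_restrict) simp
qed

lemma reversal_measurable [measurable]: "reversal p \<in> measurable (orthant p) (orthant p)"
  unfolding reversal_def orthant_def[of p]
  by (intro measurable_restrict measurable_component_singleton) auto

lemma first_part_measurable [measurable]: "first_part n \<in> measurable (orthant (n + m)) (orthant n)"
  unfolding first_part_def orthant_def
  by (intro measurable_restrict measurable_component_singleton) auto

lemma last_part_measurable [measurable]: "last_part n m \<in> measurable (orthant (n + m)) (orthant m)"
  unfolding last_part_def orthant_def
  by (intro measurable_restrict measurable_component_singleton) auto

lemma first_part_id: "t \<in> space (orthant n) \<Longrightarrow> first_part n t = t"
  by (rule ext) (auto simp: first_part_def extensional_orthant)

lemma first_part_join: "s \<in> space (orthant n) \<Longrightarrow> first_part n (join n m (s, t)) = s"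
  by (rule ext) (auto simp: first_part_def join_def extensional_orthant)

lemma last_part_join: "t \<in> space (orthant m) \<Longrightarrow> last_part n m (join n m (s, t)) = t"
  by (rule ext) (auto simp: last_part_def join_def extensional_orthant)

lemma reversal_reversal: "s \<in> space (orthant p) \<Longrightarrow> reversal p (reversal p s) = s"
  by (rule ext) (auto simp: reversal_def extensional_orthant)

lemma distr_join: "distr (orthant n \<Otimes>\<^sub>M orthant m) (orthant (n + m)) (join n m) = orthant (n + m)"
proof -
  interpret n: sigma_finite_measure "orthant n" by (rule sigma_finite_orthant)
  interpret m: sigma_finite_measure "orthant m" by (rule sigma_finite_orthant)
  have "distr (orthant n \<Otimes>\<^sub>M orthant m) (orthant (n + m)) (join n m) = Pi\<^sub>M {..<n + m} (\<lambda>_. half_line)"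
  proof (rule half_lines.PiM_eqI)
    show "sets (distr (orthant n \<Otimes>\<^sub>M orthant m) (orthant (n + m)) (join n m)) = sets (Pi\<^sub>M {..<n + m} (\<lambda>_. half_line))"
      by (simp add: orthant_def)
    fix A :: "nat \<Rightarrow> real set"
    assume A: "\<And>i. i \<in> {..<n + m} \<Longrightarrow> A i \<in> sets half_line"
    have box: "Pi\<^sub>E {..<n + m} A \<in> sets (orthant (n + m))"
      unfolding orthant_def by (intro sets_PiM_I_finite A) auto
    have boxes: "Pi\<^sub>E {..<n} A \<in> sets (orthant n)" "Pi\<^sub>E {..<m} (\<lambda>i. A (n + i)) \<in> sets (orthant m)"
      unfolding orthant_def by (intro sets_PiM_I_finite; simp add: A)+
    have sub: "A i \<subseteq> {0..}" if "i < n + m" for i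
      using sets.sets_into_space[OF A[of i]] that by (simp add: space_restrict_space)
    have "join n m -` Pi\<^sub>E {..<n + m} A \<inter> space (orthant n \<Otimes>\<^sub>M orthant m)
        = Pi\<^sub>E {..<n} A \<times> Pi\<^sub>E {..<m} (\<lambda>i. A (n + i))"
    proof (intro set_eqI iffI)
      fix x assume "x \<in> join n m -` Pi\<^sub>E {..<n + m} A \<inter> space (orthant n \<Otimes>\<^sub>M orthant m)"
      then have x: "\<And>i. i < n + m \<Longrightarrow> join n m x i \<in> A i" "fst x \<in> space (orthant n)" "snd x \<in> space (orthant m)"
        by (auto simp: PiE_def space_pair_measure)
      have "fst x i \<in> A i" if "i < n" for i using x(1)[of i] that by (simp add: join_def)
      moreover have "snd x i \<in> A (n + i)" if "i < m" for i using x(1)[of "n + i"] that by (simp add: join_def)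
      ultimately have "fst x \<in> Pi\<^sub>E {..<n} A" "snd x \<in> Pi\<^sub>E {..<m} (\<lambda>i. A (n + i))"
        using extensional_orthant[OF x(2)] extensional_orthant[OF x(3)]
        by (auto simp: PiE_def extensional_def)
      then show "x \<in> Pi\<^sub>E {..<n} A \<times> Pi\<^sub>E {..<m} (\<lambda>i. A (n + i))" by (cases x) simp
    next
      fix x assume x: "x \<in> Pi\<^sub>E {..<n} A \<times> Pi\<^sub>E {..<m} (\<lambda>i. A (n + i))"
      have "join n m x i \<in> A i" if "i < n + m" for i
      proof (cases "i < n")
        case True then show ?thesis using x that by (auto simp: join_def)
      next
        case False
        have "snd x \<in> Pi\<^sub>E {..<m} (\<lambda>i. A (n + i))" using x by auto
        then have "snd x (i - n) \<in> A (n + (i - n))" by (rule PiE_mem) (use False that in auto)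
        then show ?thesis using False that by (simp add: join_def)
      qed
      then have "join n m x \<in> Pi\<^sub>E {..<n + m} A" by (auto simp: join_def)
      moreover have "x \<in> space (orthant n \<Otimes>\<^sub>M orthant m)"
        using x sub sets.sets_into_space[OF boxes(1)] sets.sets_into_space[OF boxes(2)]
        by (auto simp: space_pair_measure)
      ultimately show "x \<in> join n m -` Pi\<^sub>E {..<n + m} A \<inter> space (orthant n \<Otimes>\<^sub>M orthant m)" by simp
    qed
    then have "emeasure (distr (orthant n \<Otimes>\<^sub>M orthant m) (orthant (n + m)) (join n m)) (Pi\<^sub>E {..<n + m} A)
        = emeasure (orthant n) (Pi\<^sub>E {..<n} A) * emeasure (orthant m) (Pi\<^sub>E {..<m} (\<lambda>i. A (n + i)))"
      using box boxes by (simp add: emeasure_distr m.emeasure_pair_measure_Times)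
    also have "\<dots> = (\<Prod>i<n. emeasure half_line (A i)) * (\<Prod>i<m. emeasure half_line (A (n + i)))"
    proof -
      have "emeasure (orthant n) (Pi\<^sub>E {..<n} A) = (\<Prod>i<n. emeasure half_line (A i))"
        unfolding orthant_def by (rule half_lines.emeasure_PiM) (simp_all add: A)
      moreover have "emeasure (orthant m) (Pi\<^sub>E {..<m} (\<lambda>i. A (n + i))) = (\<Prod>i<m. emeasure half_line (A (n + i)))"
        unfolding orthant_def by (rule half_lines.emeasure_PiM) (simp_all add: A)
      ultimately show ?thesis by simp
    qed
    also have "\<dots> = (\<Prod>i<n + m. emeasure half_line (A i))"
    proof -
      have "(\<Prod>i<m. emeasure half_line (A (n + i))) = (\<Prod>i\<in>{n..<n + m}. emeasure half_line (A i))"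
        by (rule prod.reindex_bij_witness[of _ "\<lambda>i. i - n" "\<lambda>i. n + i"]) auto
      moreover have "{..<n + m} = {..<n} \<union> {n..<n + m}" by auto
      moreover have "prod h ({..<n} \<union> {n..<n + m}) = prod h {..<n} * prod h {n..<n + m}" for h :: "nat \<Rightarrow> ennreal"
        by (rule prod.union_disjoint) auto
      ultimately show ?thesis by simp
    qed
    finally show "emeasure (distr (orthant n \<Otimes>\<^sub>M orthant m) (orthant (n + m)) (join n m)) (Pi\<^sub>E {..<n + m} A)
        = (\<Prod>i\<in>{..<n + m}. emeasure half_line (A i))" by simp
  qed simp
  then show ?thesis by (simp add: orthant_def)
qed

lemma distr_reversal: "distr (orthant p) (orthant p) (reversal p) = orthant p"
proof -
  have "distr (orthant p) (orthant p) (reversal p) = Pi\<^sub>M {..<p} (\<lambda>_. half_line)"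
  proof (rule half_lines.PiM_eqI)
    fix A :: "nat \<Rightarrow> real set"
    assume A: "\<And>i. i \<in> {..<p} \<Longrightarrow> A i \<in> sets half_line"
    have box: "Pi\<^sub>E {..<p} A \<in> sets (orthant p)"
      unfolding orthant_def by (intro sets_PiM_I_finite A) auto
    have box': "Pi\<^sub>E {..<p} (\<lambda>i. A (p - 1 - i)) \<in> sets (orthant p)"
      unfolding orthant_def by (intro sets_PiM_I_finite) (auto simp: A)
    have "reversal p -` Pi\<^sub>E {..<p} A \<inter> space (orthant p) = Pi\<^sub>E {..<p} (\<lambda>i. A (p - 1 - i))"
    proof (intro set_eqI iffI)
      fix s assume "s \<in> reversal p -` Pi\<^sub>E {..<p} A \<inter> space (orthant p)"
      then have s: "\<And>i. i < p \<Longrightarrow> reversal p s i \<in> A i" "s \<in> space (orthant p)" by (auto simp: PiE_def)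
      have "s i \<in> A (p - 1 - i)" if "i < p" for i
        using s(1)[of "p - 1 - i"] that by (simp add: reversal_def)
      then show "s \<in> Pi\<^sub>E {..<p} (\<lambda>i. A (p - 1 - i))"
        using extensional_orthant[OF s(2)] by (auto simp: PiE_def extensional_def)
    next
      fix s assume s: "s \<in> Pi\<^sub>E {..<p} (\<lambda>i. A (p - 1 - i))"
      have "s (p - 1 - i) \<in> A i" if "i < p" for i
      proof -
        have "s (p - 1 - i) \<in> A (p - 1 - (p - 1 - i))" using s that by (intro PiE_mem[OF s]) simp
        then show ?thesis using that by simp
      qed
      then show "s \<in> reversal p -` Pi\<^sub>E {..<p} A \<inter> space (orthant p)"
        using sets.sets_into_space[OF box'] s by (auto simp: reversal_def)
    qed
    then have "emeasure (distr (orthant p) (orthant p) (reversal p)) (Pi\<^sub>E {..<p} A)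
        = emeasure (orthant p) (Pi\<^sub>E {..<p} (\<lambda>i. A (p - 1 - i)))"
      using box by (simp add: emeasure_distr)
    also have "\<dots> = (\<Prod>i<p. emeasure half_line (A (p - 1 - i)))"
      unfolding orthant_def by (rule half_lines.emeasure_PiM) (simp_all add: A)
    also have "\<dots> = (\<Prod>i<p. emeasure half_line (A i))"
      by (rule prod.reindex_bij_witness[of _ "\<lambda>i. p - 1 - i" "\<lambda>i. p - 1 - i"]) auto
    finally show "emeasure (distr (orthant p) (orthant p) (reversal p)) (Pi\<^sub>E {..<p} A)
        = (\<Prod>i\<in>{..<p}. emeasure half_line (A i))" by simp
  qed (simp_all add: orthant_def)
  then show ?thesis by (simp add: orthant_def)
qed

lemma nn_integral_join:
  assumes [measurable]: "h \<in> borel_measurable (orthant (n + m))"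
  shows "(\<integral>\<^sup>+t. h t \<partial>orthant (n + m)) = (\<integral>\<^sup>+s. \<integral>\<^sup>+t. h (join n m (s, t)) \<partial>orthant m \<partial>orthant n)"
proof -
  interpret m: sigma_finite_measure "orthant m" by (rule sigma_finite_orthant)
  have "(\<integral>\<^sup>+t. h t \<partial>orthant (n + m)) = (\<integral>\<^sup>+x. h (join n m x) \<partial>(orthant n \<Otimes>\<^sub>M orthant m))"
    by (subst distr_join[symmetric]) (simp add: nn_integral_distr)
  also have "\<dots> = (\<integral>\<^sup>+s. \<integral>\<^sup>+t. h (join n m (s, t)) \<partial>orthant m \<partial>orthant n)"
    by (rule m.nn_integral_fst[symmetric]) measurable
  finally show ?thesis .
qed

lemma nn_integral_reversal:
  assumes [measurable]: "h \<in> borel_measurable (orthant p)"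
  shows "(\<integral>\<^sup>+s. h (reversal p s) \<partial>orthant p) = (\<integral>\<^sup>+s. h s \<partial>orthant p)"
proof -
  have "(\<integral>\<^sup>+s. h s \<partial>orthant p) = (\<integral>\<^sup>+s. h (reversal p s) \<partial>orthant p)"
    by (subst distr_reversal[symmetric]) (simp add: nn_integral_distr)
  then show ?thesis ..
qed

lemma integral_reversal:
  fixes h :: "_ \<Rightarrow> complex"
  assumes [measurable]: "h \<in> borel_measurable (orthant p)"
  shows "(\<integral>s. h (reversal p s) \<partial>orthant p) = (\<integral>s. h s \<partial>orthant p)"
proof -
  have "(\<integral>s. h s \<partial>orthant p) = (\<integral>s. h (reversal p s) \<partial>orthant p)"
    by (subst distr_reversal[symmetric]) (simp add: integral_distr)
  then show ?thesis ..
qed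

lemma integral_orthant_0: "(\<integral>s. (h s :: complex) \<partial>orthant 0) = h (\<lambda>_. undefined)"
  by (simp add: orthant_def PiM_empty lebesgue_integral_count_space_finite)

section \<open>Square-integrable kernels\<close>

text \<open>The squared \<open>L\<^sup>2\<close>-norm with values in \<open>[0, \<infinity>]\<close>, for which Tonelli's theorem requires no
  integrability.\<close>

definition energy :: "nat \<Rightarrow> kernel \<Rightarrow> ennreal" where
  "energy n f = (\<integral>\<^sup>+t. ennreal ((cmod (f t))\<^sup>2) \<partial>orthant n)"

lemma L2_kernels_iff: "f \<in> L2_kernels n \<longleftrightarrow> f \<in> borel_measurable (orthant n) \<and> energy n f < \<infinity>"
proof -
  have "integrable (orthant n) (\<lambda>t. (cmod (f t))\<^sup>2) \<longleftrightarrow> energy n f < \<infinity>"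
    if [measurable]: "f \<in> borel_measurable (orthant n)"
    unfolding energy_def by (simp add: integrable_iff_bounded)
  then show ?thesis unfolding L2_kernels_def by blast
qed

lemma integral_energy:
  assumes "f \<in> L2_kernels n"
  shows "(\<integral>t. (cmod (f t))\<^sup>2 \<partial>orthant n) = enn2real (energy n f)"
  unfolding energy_def using assms by (intro integral_eq_nn_integral) (auto simp: L2_kernels_def)

lemma L2_kernels_scale:
  assumes "f \<in> L2_kernels n" shows "(\<lambda>t. c * f t) \<in> L2_kernels n"
  using assms by (auto simp: L2_kernels_def norm_mult power_mult_distrib)

lemma L2_kernels_add:
  assumes f: "f \<in> L2_kernels n" and g: "g \<in> L2_kernels n"
  shows "(\<lambda>t. f t + g t) \<in> L2_kernels n"
proof -
  have [measurable]: "f \<in> borel_measurable (orthant n)" "g \<in> borel_measurable (orthant n)"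
    using f g by (auto simp: L2_kernels_def)
  have le: "(cmod (f t + g t))\<^sup>2 \<le> 2 * (cmod (f t))\<^sup>2 + 2 * (cmod (g t))\<^sup>2" for t
  proof -
    have "(cmod (f t + g t))\<^sup>2 \<le> (cmod (f t) + cmod (g t))\<^sup>2" by (intro power_mono norm_triangle_ineq) simp
    also have "\<dots> \<le> 2 * (cmod (f t))\<^sup>2 + 2 * (cmod (g t))\<^sup>2"
      using zero_le_power2[of "cmod (f t) - cmod (g t)"] by (simp add: power2_sum power2_diff)
    finally show ?thesis .
  qed
  have "integrable (orthant n) (\<lambda>t. 2 * (cmod (f t))\<^sup>2 + 2 * (cmod (g t))\<^sup>2)"
    using f g by (auto simp: L2_kernels_def)
  then have "integrable (orthant n) (\<lambda>t. (cmod (f t + g t))\<^sup>2)"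
    by (rule Bochner_Integration.integrable_bound) (use le in \<open>auto intro!: always_eventually\<close>)
  then show ?thesis by (simp add: L2_kernels_def)
qed

lemma L2_kernels_const: "(\<lambda>_. c) \<in> L2_kernels 0"
  by (simp add: L2_kernels_def orthant_def PiM_empty integrable_count_space)

lemma kernel_adj_reversal: "kernel_adj n f = (\<lambda>t. cnj (f (reversal n t)))"
  by (simp add: kernel_adj_def reversal_def)

lemma L2_kernels_adj:
  assumes "f \<in> L2_kernels n" shows "kernel_adj n f \<in> L2_kernels n"
proof -
  have [measurable]: "f \<in> borel_measurable (orthant n)" using assms by (simp add: L2_kernels_def)
  have "energy n (kernel_adj n f) = energy n f"
    unfolding energy_def kernel_adj_reversal complex_mod_cnj by (rule nn_integral_reversal) measurable
  moreover have "kernel_adj n f \<in> borel_measurable (orthant n)"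
    unfolding kernel_adj_reversal
    by (rule measurable_compose[OF _ borel_measurable_continuous_onI[OF continuous_on_cnj[OF continuous_on_id]]])
       measurable
  ultimately show ?thesis using assms by (simp add: L2_kernels_iff)
qed

section \<open>Contractions\<close>

text \<open>The variable \<open>s\<close> that is integrated out occupies the last \<open>p\<close> places of \<open>f\<close> and, in reversed
  order, the first \<open>p\<close> places of \<open>g\<close>.\<close>

lemma contraction_join:
  "contraction (a + p) (p + b) p f g = (\<lambda>t. \<integral>s. f (join a p (first_part a t, s)) *
     g (join p b (reversal p s, last_part a b t)) \<partial>orthant p)"
proof -
  have 1: "(\<lambda>i\<in>{..<a + p}. if i < a + p - p then t i else s (i - (a + p - p))) = join a p (first_part a t, s)"
    for t s by (rule ext) (auto simp: join_def first_part_def)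
  have 2: "(\<lambda>i\<in>{..<p + b}. if i < p then s (p - 1 - i) else t (a + p - p + (i - p)))
      = join p b (reversal p s, last_part a b t)" for t s
    by (rule ext) (auto simp: join_def reversal_def last_part_def)
  show ?thesis unfolding contraction_def 1 2 ..
qed

lemma tensor_kernel: "contraction n m 0 f g = (\<lambda>t. f (first_part n t) * g (last_part n m t))"
proof (rule ext)
  fix t
  have 1: "(\<lambda>i\<in>{..<n}. if i < n - 0 then t i else s (i - (n - 0))) = first_part n t" for s :: "nat \<Rightarrow> real"
    by (rule ext) (simp add: first_part_def)
  have 2: "(\<lambda>i\<in>{..<m}. if i < 0 then s (0 - 1 - i) else t (n - 0 + (i - 0))) = last_part n m t" for s
    by (rule ext) (simp add: last_part_def)
  show "contraction n m 0 f g t = f (first_part n t) * g (last_part n m t)"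
    unfolding contraction_def 1 2 by (rule integral_orthant_0)
qed

lemma energy_tensor:
  assumes [measurable]: "f \<in> borel_measurable (orthant n)" "g \<in> borel_measurable (orthant m)"
  shows "energy (n + m) (contraction n m 0 f g) = energy n f * energy m g"
proof -
  have "energy (n + m) (contraction n m 0 f g) =
      (\<integral>\<^sup>+s. \<integral>\<^sup>+t. ennreal ((cmod (f (first_part n (join n m (s, t))) * g (last_part n m (join n m (s, t)))))\<^sup>2)
        \<partial>orthant m \<partial>orthant n)"
    unfolding energy_def tensor_kernel by (rule nn_integral_join) measurable
  also have "\<dots> = (\<integral>\<^sup>+s. \<integral>\<^sup>+t. ennreal ((cmod (f s))\<^sup>2) * ennreal ((cmod (g t))\<^sup>2) \<partial>orthant m \<partial>orthant n)"
    by (intro nn_integral_cong)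
       (simp add: first_part_join last_part_join norm_mult power_mult_distrib ennreal_mult)
  also have "\<dots> = energy n f * energy m g"
    unfolding energy_def by (simp add: nn_integral_cmult nn_integral_multc)
  finally show ?thesis .
qed

text \<open>Without integrability the left-hand side is \<open>0\<close>, the default value of the integral.\<close>

lemma cmod_integral_le:
  fixes h :: "_ \<Rightarrow> complex"
  shows "ennreal (cmod (\<integral>s. h s \<partial>M)) \<le> (\<integral>\<^sup>+s. ennreal (cmod (h s)) \<partial>M)"
proof (cases "integrable M h")
  case True then show ?thesis by (rule integral_norm_bound_ennreal)
next
  case False then show ?thesis by (simp add: not_integrable_integral_eq)
qed

text \<open>The Cauchy-Schwarz inequality in the contracted variables, and Tonelli's theorem in the others.\<close>

lemma energy_contraction_le:
  assumes f [measurable]: "f \<in> borel_measurable (orthant (a + p))"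
    and g [measurable]: "g \<in> borel_measurable (orthant (p + b))"
  shows "contraction (a + p) (p + b) p f g \<in> borel_measurable (orthant (a + b))"
    and "energy (a + b) (contraction (a + p) (p + b) p f g) \<le> energy (a + p) f * energy (p + b) g"
proof -
  interpret p: sigma_finite_measure "orthant p" by (rule sigma_finite_orthant)
  have [measurable]: "(\<lambda>x. f (join a p (first_part a (fst x), snd x)) *
      g (join p b (reversal p (snd x), last_part a b (fst x)))) \<in> borel_measurable (orthant (a + b) \<Otimes>\<^sub>M orthant p)"
    by measurable
  show meas: "contraction (a + p) (p + b) p f g \<in> borel_measurable (orthant (a + b))"
    unfolding contraction_join by (rule p.borel_measurable_lebesgue_integral) (simp add: split_def)
  define F where "F t = (\<integral>\<^sup>+s. (ennreal (cmod (f (join a p (t, s)))))\<^sup>2 \<partial>orthant p)" for t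
  define G where "G t = (\<integral>\<^sup>+s. (ennreal (cmod (g (join p b (reversal p s, t)))))\<^sup>2 \<partial>orthant p)" for t
  have Fm [measurable]: "F \<in> borel_measurable (orthant a)" unfolding F_def by measurable
  have Gm [measurable]: "G \<in> borel_measurable (orthant b)" unfolding G_def by measurable
  have le: "ennreal ((cmod (contraction (a + p) (p + b) p f g (join a b (t1, t2))))\<^sup>2) \<le> F t1 * G t2"
    if t: "t1 \<in> space (orthant a)" "t2 \<in> space (orthant b)" for t1 t2
  proof -
    let ?f = "\<lambda>s. f (join a p (t1, s))" and ?g = "\<lambda>s. g (join p b (reversal p s, t2))"
    have [measurable]: "?f \<in> borel_measurable (orthant p)" "?g \<in> borel_measurable (orthant p)"
      using t by measurable
    have "ennreal (cmod (contraction (a + p) (p + b) p f g (join a b (t1, t2))))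
        \<le> (\<integral>\<^sup>+s. ennreal (cmod (?f s * ?g s)) \<partial>orthant p)"
      unfolding contraction_join first_part_join[OF t(1)] last_part_join[OF t(2)] by (rule cmod_integral_le)
    also have "\<dots> = (\<integral>\<^sup>+s. ennreal (cmod (?f s)) * ennreal (cmod (?g s)) \<partial>orthant p)"
      by (simp add: norm_mult ennreal_mult)
    finally have "(ennreal (cmod (contraction (a + p) (p + b) p f g (join a b (t1, t2)))))\<^sup>2
        \<le> (\<integral>\<^sup>+s. ennreal (cmod (?f s)) * ennreal (cmod (?g s)) \<partial>orthant p)\<^sup>2" by (intro power_mono) auto
    also have "\<dots> \<le> F t1 * G t2" unfolding F_def G_def by (rule Cauchy_Schwarz_nn_integral) measurable
    finally show ?thesis by (simp add: ennreal_power)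
  qed
  have "energy (a + b) (contraction (a + p) (p + b) p f g)
      = (\<integral>\<^sup>+t1. \<integral>\<^sup>+t2. ennreal ((cmod (contraction (a + p) (p + b) p f g (join a b (t1, t2))))\<^sup>2) \<partial>orthant b \<partial>orthant a)"
    unfolding energy_def using meas by (intro nn_integral_join) measurable
  also have "\<dots> \<le> (\<integral>\<^sup>+t1. \<integral>\<^sup>+t2. F t1 * G t2 \<partial>orthant b \<partial>orthant a)"
    by (intro nn_integral_mono le)
  also have "\<dots> = (\<integral>\<^sup>+t1. F t1 \<partial>orthant a) * (\<integral>\<^sup>+t2. G t2 \<partial>orthant b)"
    by (simp add: nn_integral_cmult nn_integral_multc)
  also have "(\<integral>\<^sup>+t1. F t1 \<partial>orthant a) = energy (a + p) f"
    unfolding energy_def F_def by (subst nn_integral_join) (simp_all add: ennreal_power)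
  also have "(\<integral>\<^sup>+t2. G t2 \<partial>orthant b) = energy (p + b) g"
  proof -
    interpret pb: pair_sigma_finite "orthant p" "orthant b" by (rule pair_sigma_finite_orthant)
    have "(\<integral>\<^sup>+t2. G t2 \<partial>orthant b)
        = (\<integral>\<^sup>+t2. \<integral>\<^sup>+s. ennreal ((cmod (g (join p b (s, t2))))\<^sup>2) \<partial>orthant p \<partial>orthant b)"
      unfolding G_def
    proof (rule nn_integral_cong)
      fix t2 assume t2: "t2 \<in> space (orthant b)"
      have "(\<integral>\<^sup>+s. (\<lambda>s. ennreal ((cmod (g (join p b (s, t2))))\<^sup>2)) (reversal p s) \<partial>orthant p)
          = (\<integral>\<^sup>+s. ennreal ((cmod (g (join p b (s, t2))))\<^sup>2) \<partial>orthant p)"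
        by (rule nn_integral_reversal) (use t2 in measurable)
      then show "(\<integral>\<^sup>+s. (ennreal (cmod (g (join p b (reversal p s, t2)))))\<^sup>2 \<partial>orthant p)
          = (\<integral>\<^sup>+s. ennreal ((cmod (g (join p b (s, t2))))\<^sup>2) \<partial>orthant p)" by (simp add: ennreal_power)
    qed
    also have "\<dots> = (\<integral>\<^sup>+s. \<integral>\<^sup>+t2. ennreal ((cmod (g (join p b (s, t2))))\<^sup>2) \<partial>orthant b \<partial>orthant p)"
      by (rule pb.Fubini') measurable
    also have "\<dots> = energy (p + b) g"
      unfolding energy_def by (rule nn_integral_join[symmetric]) measurable
    finally show ?thesis .
  qed
  finally show "energy (a + b) (contraction (a + p) (p + b) p f g) \<le> energy (a + p) f * energy (p + b) g" .
qed

lemma L2_kernels_contraction: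
  assumes f: "f \<in> L2_kernels n" and g: "g \<in> L2_kernels m" and p: "p \<le> min n m"
  shows "contraction n m p f g \<in> L2_kernels (n + m - 2 * p)"
proof -
  obtain a b where n: "n = a + p" and m: "m = p + b" using p
    by (metis add.commute le_add_diff_inverse min.bounded_iff)
  have "energy n f * energy m g < \<infinity>"
    using f g by (auto simp: L2_kernels_iff ennreal_mult_less_top)
  then have "contraction (a + p) (p + b) p f g \<in> L2_kernels (a + b)"
    using f g energy_contraction_le[of f a p g b] unfolding n m L2_kernels_iff
    by (auto intro: le_less_trans)
  then show ?thesis by (simp add: n m)
qed

text \<open>All contracted variables belong to \<open>u\<close>, hence \<open>v\<close> may be taken out of the integral.\<close>

lemma contraction_tensor:
  assumes "p \<le> n" "p \<le> q"
  shows "contraction n (q + r) p f (contraction q r 0 u v)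
    = contraction (n + q - 2 * p) r 0 (contraction n q p f u) v"
proof (rule ext)
  fix t
  let ?g = "\<lambda>s::nat \<Rightarrow> real. \<lambda>i\<in>{..<q + r}. if i < p then s (p - 1 - i) else t (n - p + (i - p))"
  have 1: "first_part q (?g s) = (\<lambda>i\<in>{..<q}. if i < p then s (p - 1 - i) else t (n - p + (i - p)))" for s
    by (rule ext) (auto simp: first_part_def)
  have 2: "last_part q r (?g s) = last_part (n + q - 2 * p) r t" for s
    using assms by (intro ext) (auto simp: last_part_def intro!: arg_cong[of _ _ t])
  have 3: "(\<lambda>i\<in>{..<n}. if i < n - p then first_part (n + q - 2 * p) t i else s (i - (n - p)))
     = (\<lambda>i\<in>{..<n}. if i < n - p then t i else s (i - (n - p)))" for s
    using assms by (intro ext) (auto simp: first_part_def)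
  have 4: "(\<lambda>i\<in>{..<q}. if i < p then s (p - 1 - i) else first_part (n + q - 2 * p) t (n - p + (i - p)))
     = (\<lambda>i\<in>{..<q}. if i < p then s (p - 1 - i) else t (n - p + (i - p)))" for s
    using assms by (intro ext) (auto simp: first_part_def)
  show "contraction n (q + r) p f (contraction q r 0 u v) t
    = contraction (n + q - 2 * p) r 0 (contraction n q p f u) v t"
    unfolding tensor_kernel contraction_def[of n] 1 2 3 4
    by (simp add: mult.assoc[symmetric])
qed

lemma star_contraction_tensor:
  assumes "1 \<le> p" "p \<le> n" "p \<le> q"
  shows "star_contraction n (q + r) p f (contraction q r 0 u v)
    = contraction (n + q - 2 * p + 1) r 0 (star_contraction n q p f u) v"
proof (rule ext)
  fix t
  let ?g = "\<lambda>s::nat \<Rightarrow> real. \<lambda>i\<in>{..<q + r}. if i < p - 1 then s i else t (n - p + (i - (p - 1)))"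
  have 1: "first_part q (?g s) = (\<lambda>i\<in>{..<q}. if i < p - 1 then s i else t (n - p + (i - (p - 1))))" for s
    by (rule ext) (auto simp: first_part_def)
  have 2: "last_part q r (?g s) = last_part (n + q - 2 * p + 1) r t" for s
    using assms by (intro ext) (auto simp: last_part_def intro!: arg_cong[of _ _ t])
  have 3: "(\<lambda>i\<in>{..<n}. if i \<le> n - p then first_part (n + q - 2 * p + 1) t i else s (p - 2 - (i - (n - p + 1))))
     = (\<lambda>i\<in>{..<n}. if i \<le> n - p then t i else s (p - 2 - (i - (n - p + 1))))" for s
    using assms by (intro ext) (auto simp: first_part_def)
  have 4: "(\<lambda>i\<in>{..<q}. if i < p - 1 then s i else first_part (n + q - 2 * p + 1) t (n - p + (i - (p - 1))))
     = (\<lambda>i\<in>{..<q}. if i < p - 1 then s i else t (n - p + (i - (p - 1))))" for s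
    using assms by (intro ext) (auto simp: first_part_def)
  show "star_contraction n (q + r) p f (contraction q r 0 u v) t
    = contraction (n + q - 2 * p + 1) r 0 (star_contraction n q p f u) v t"
    unfolding tensor_kernel star_contraction_def[of n] 1 2 3 4
    by (simp add: mult.assoc[symmetric])
qed

text \<open>For a symmetric kernel it does not matter whether its last or its first variables are
  contracted: the cyclic shift \<open>\<sigma>\<close> exchanges the two groups of variables, and the substitution that
  reverses \<open>s\<close> accounts for the order in which they are paired.\<close>

lemma contraction_symmetric_commute:
  assumes f: "f \<in> borel_measurable (orthant (a + q))" and sym: "symmetric_kernel (a + q) f"
    and h: "h \<in> borel_measurable (orthant q)"
  shows "AE t in orthant a. contraction (a + q) q q f h t = contraction q (a + q) q h f t"
proof -
  note [measurable] = f h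
  interpret aq: pair_sigma_finite "orthant a" "orthant q" by (rule pair_sigma_finite_orthant)
  have fqa [measurable]: "f \<in> borel_measurable (orthant (q + a))" using f by (simp add: add.commute)
  define \<sigma> where "\<sigma> i = (if i < q then a + i else if i < a + q then i - q else i)" for i
  have \<sigma>: "\<sigma> permutes {..<a + q}"
  proof (rule bij_imp_permutes)
    show "bij_betw \<sigma> {..<a + q} {..<a + q}"
      by (rule bij_betw_byWitness[where f' = "\<lambda>i. if i < a then i + q else i - a"])
         (auto simp: \<sigma>_def)
    show "\<sigma> i = i" if "i \<notin> {..<a + q}" for i using that by (auto simp: \<sigma>_def)
  qed
  have join: "join a q (t, u) \<circ> \<sigma> = join q a (u, t)" for t u
    by (rule ext) (auto simp: join_def \<sigma>_def)
  have "AE x in distr (orthant a \<Otimes>\<^sub>M orthant q) (orthant (a + q)) (join a q). f (x \<circ> \<sigma>) = f x"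
    using sym \<sigma> unfolding distr_join symmetric_kernel_def by blast
  then have "AE x in orthant a \<Otimes>\<^sub>M orthant q. f (join a q x \<circ> \<sigma>) = f (join a q x)"
    by (rule AE_distrD[rotated]) measurable
  then have "AE t in orthant a. AE u in orthant q. f (join a q (t, u) \<circ> \<sigma>) = f (join a q (t, u))"
    by (rule aq.AE_pair)
  with AE_space show ?thesis
  proof eventually_elim
    fix t
    assume t: "t \<in> space (orthant a)"
      and ae: "AE u in orthant q. f (join a q (t, u) \<circ> \<sigma>) = f (join a q (t, u))"
    have last: "last_part 0 a t = t" using first_part_id[OF t] by (simp add: last_part_def first_part_def)
    have join0: "join q 0 (s, w) = s" if "s \<in> space (orthant q)" for s w
      by (rule ext) (use that in \<open>auto simp: join_def extensional_orthant\<close>)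
    have "contraction (a + q) (q + 0) q f h t
        = (\<integral>s. f (join a q (first_part a t, s)) * h (join q 0 (reversal q s, last_part a 0 t)) \<partial>orthant q)"
      unfolding contraction_join ..
    also have "\<dots> = (\<integral>s. f (join a q (t, s)) * h (reversal q s) \<partial>orthant q)"
      using measurable_space[OF reversal_measurable]
      by (intro Bochner_Integration.integral_cong) (simp_all add: first_part_id[OF t] join0)
    also have "\<dots> = (\<integral>s. f (join q a (s, t)) * h (reversal q s) \<partial>orthant q)"
    proof (rule integral_cong_AE)
      show "AE s in orthant q. f (join a q (t, s)) * h (reversal q s) = f (join q a (s, t)) * h (reversal q s)"
        using ae by eventually_elim (simp add: join)
    qed (use t in measurable)
    also have "\<dots> = (\<integral>s. (\<lambda>s. f (join q a (reversal q s, t)) * h s) (reversal q s) \<partial>orthant q)"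
      by (intro Bochner_Integration.integral_cong) (simp_all add: reversal_reversal)
    also have "\<dots> = (\<integral>s. f (join q a (reversal q s, t)) * h s \<partial>orthant q)"
      by (rule integral_reversal) (use t in measurable)
    also have "\<dots> = (\<integral>s. h (join 0 q (first_part 0 t, s)) * f (join q a (reversal q s, last_part 0 a t)) \<partial>orthant q)"
    proof (rule Bochner_Integration.integral_cong[OF refl])
      fix s assume "s \<in> space (orthant q)"
      then have "join 0 q (first_part 0 t, s) = s"
        by (intro ext) (auto simp: join_def extensional_orthant)
      then show "f (join q a (reversal q s, t)) * h s
          = h (join 0 q (first_part 0 t, s)) * f (join q a (reversal q s, last_part 0 a t))"
        by (simp add: last mult.commute)
    qed
    also have "\<dots> = contraction (0 + q) (q + a) q h f t"
      unfolding contraction_join by simp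
    finally show "contraction (a + q) q q f h t = contraction q (a + q) q h f t"
      by (simp add: add.commute)
  qed
qed

section \<open>The algebra of multiple integrals\<close>

text \<open>\<open>c\<close> is the number of variables that disappear.  With this parametrisation the terms of the product
  formulas have the pairwise different degrees \<open>n + m - c\<close>; the even values of \<open>c\<close> belong to the
  contractions \<open>contraction\<close>, the odd ones to \<open>star_contraction\<close>, which loses \<open>2 p - 1\<close> variables.\<close>

definition mixed_contraction :: "nat \<Rightarrow> nat \<Rightarrow> nat \<Rightarrow> kernel \<Rightarrow> kernel \<Rightarrow> kernel" where
  "mixed_contraction n m c f g =
     (if even c then contraction n m (c div 2) f g else star_contraction n m (c div 2 + 1) f g)"

lemma mixed_contraction_tensor:
  assumes "c \<le> 2 * min n q"
  shows "mixed_contraction n (q + r) c f (contraction q r 0 u v)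
    = contraction (n + q - c) r 0 (mixed_contraction n q c f u) v"
proof (cases "even c")
  case True
  then show ?thesis using assms contraction_tensor[of "c div 2" n q r f u v]
    by (simp add: mixed_contraction_def)
next
  case False
  then obtain d where d: "c = 2 * d + 1" by (rule oddE)
  then have "d + 1 \<le> n" "d + 1 \<le> q" using assms by auto
  then have "n + q - 2 * (d + 1) + 1 = n + q - c" using d by simp
  then show ?thesis using assms d star_contraction_tensor[of "d + 1" n q r f u v]
    by (simp add: mixed_contraction_def)
qed

text \<open>A common form of the Wigner and the free Poisson case, which differ in whether the contractions
  with an odd number of disappearing variables are present.\<close>

locale multiple_integral_algebra = tracial_wstar W
  for W :: "('h::chilbert_space, 'l::chilbert_space) wstar_space" +
  fixes M :: "real \<Rightarrow> 'h op" and I :: "nat \<Rightarrow> kernel \<Rightarrow> 'l" and K :: "nat \<Rightarrow> kernel set"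
    and odd_terms :: bool
  assumes integrals: "multiple_integrals W M I"
    and K_L2: "f \<in> K n \<Longrightarrow> f \<in> L2_kernels n"
    and K_const: "(\<lambda>_. c) \<in> K 0"
    and K_add: "f \<in> K n \<Longrightarrow> g \<in> K n \<Longrightarrow> (\<lambda>t. f t + g t) \<in> K n"
    and K_scale: "f \<in> K n \<Longrightarrow> (\<lambda>t. c * f t) \<in> K n"
    and K_adj: "f \<in> K n \<Longrightarrow> kernel_adj n f \<in> K n"
    and K_contraction: "f \<in> K n \<Longrightarrow> g \<in> K m \<Longrightarrow> j \<le> 2 * min n m \<Longrightarrow> even j \<or> odd_terms \<Longrightarrow>
      mixed_contraction n m j f g \<in> K (n + m - j)"
    and product: "f \<in> K n \<Longrightarrow> g \<in> K m \<Longrightarrow>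
      is_l2_product W (I n f) (I m g)
        (\<Sum>c | c \<le> 2 * min n m \<and> (even c \<or> odd_terms). I (n + m - c) (mixed_contraction n m c f g))"
begin

lemma I_add: "f \<in> L2_kernels n \<Longrightarrow> g \<in> L2_kernels n \<Longrightarrow> I n (\<lambda>t. f t + g t) = I n f + I n g"
  by (rule integrals[unfolded multiple_integrals_def, THEN conjunct1, rule_format])

lemma I_scale: "f \<in> L2_kernels n \<Longrightarrow> I n (\<lambda>t. c * f t) = scaleC c (I n f)"
  by (rule integrals[unfolded multiple_integrals_def, THEN conjunct2, THEN conjunct1, rule_format])

lemma cinner_I: "f \<in> L2_kernels n \<Longrightarrow> g \<in> L2_kernels n \<Longrightarrow>
    cinner (I n f) (I n g) = (\<integral>t. f t * cnj (g t) \<partial>orthant n)"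
  by (rule integrals[unfolded multiple_integrals_def, THEN conjunct2, THEN conjunct2, THEN conjunct2, THEN conjunct1, rule_format])

lemma I_orthogonal: "f \<in> L2_kernels n \<Longrightarrow> g \<in> L2_kernels m \<Longrightarrow> n \<noteq> m \<Longrightarrow> cinner (I n f) (I m g) = 0"
  by (rule integrals[unfolded multiple_integrals_def, THEN conjunct2, THEN conjunct2, THEN conjunct2, THEN conjunct2, THEN conjunct1, rule_format])

lemma J_I: "f \<in> L2_kernels n \<Longrightarrow> J (I n f) = I n (kernel_adj n f)"
  using integrals[unfolded multiple_integrals_def, THEN conjunct2, THEN conjunct2, THEN conjunct2,
    THEN conjunct2, THEN conjunct2, rule_format, of f n] by (simp add: is_l2_adjoint_iff)

text \<open>For \<open>n = 0\<close> every family of intervals is admissible, the box is the whole one-point space, and the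
  product of increments is empty.\<close>

lemma I_one: "I 0 (\<lambda>_. 1) = l2_one W"
proof -
  have "\<forall>n a b. (\<forall>i<n. 0 \<le> a i \<and> a i \<le> b i) \<and> disjoint_family_on (\<lambda>i. {a i..b i}) {..<n} \<longrightarrow>
        I n (\<lambda>t. if \<forall>i<n. t i \<in> {a i..b i} then 1 else 0) =
        wstar_emb W (op_prod (map (\<lambda>i. M (b i) - M (a i)) [0..<n]))"
    by (rule integrals[unfolded multiple_integrals_def, THEN conjunct2, THEN conjunct2, THEN conjunct1])
  from this[rule_format, of 0 "\<lambda>_. 0" "\<lambda>_. 0"]
  have "I 0 (\<lambda>t. 1) = wstar_emb W (op_prod [])" by (simp add: disjoint_family_on_def)
  then show ?thesis by (simp add: op_prod_def l2_one_def)
qed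

lemma norm_I: "f \<in> L2_kernels n \<Longrightarrow> (norm (I n f))\<^sup>2 = enn2real (energy n f)"
proof -
  assume f: "f \<in> L2_kernels n"
  have "cinner (I n f) (I n f) = (\<integral>t. complex_of_real ((cmod (f t))\<^sup>2) \<partial>orthant n)"
    unfolding cinner_I[OF f f] by (simp only: complex_norm_square)
  also have "\<dots> = complex_of_real (enn2real (energy n f))"
    by (subst integral_complex_of_real) (simp add: integral_energy[OF f])
  finally show ?thesis by (simp add: norm_eq_sqrt_Re_cinner enn2real_nonneg)
qed

lemma I_cong_AE:
  assumes "f \<in> L2_kernels n" "g \<in> L2_kernels n" "AE t in orthant n. f t = g t"
  shows "I n f = I n g"
proof -
  have g': "(\<lambda>t. -1 * g t) \<in> L2_kernels n" by (rule L2_kernels_scale[OF assms(2)])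
  have eq: "I n (\<lambda>t. f t + -1 * g t) = I n f - I n g"
    using I_add[OF assms(1) g'] I_scale[OF assms(2), of "-1"] scaleC_minus1[of "I n g"] by simp
  have "energy n (\<lambda>t. f t + -1 * g t) = (\<integral>\<^sup>+t. 0 \<partial>orthant n)"
    unfolding energy_def by (intro nn_integral_cong_AE) (use assms(3) in \<open>eventually_elim, simp\<close>)
  then have "(norm (I n f - I n g))\<^sup>2 = 0"
    using norm_I[OF L2_kernels_add[OF assms(1) g']] unfolding eq by simp
  then show ?thesis by simp
qed

text \<open>Nothing prevents \<open>K n\<close> from being empty, so that zero has to be put into \<open>H n\<close> by hand.\<close>

definition H :: "nat \<Rightarrow> 'l set" where "H n = insert 0 (I n ` K n)"

definition D :: "'l set" where "D = {x. \<exists>N u. (\<forall>q. u q \<in> H q) \<and> x = (\<Sum>q\<le>N. u q)}"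

lemma I_H: "f \<in> K n \<Longrightarrow> I n f \<in> H n" by (simp add: H_def)

lemma zero_H: "0 \<in> H n" by (simp add: H_def)

lemma HE:
  assumes "x \<in> H n"
  obtains "x = 0" | f where "f \<in> K n" "x = I n f"
  using assms by (auto simp: H_def)

lemma add_H: "x \<in> H q \<Longrightarrow> y \<in> H q \<Longrightarrow> x + y \<in> H q"
proof -
  assume "x \<in> H q" "y \<in> H q"
  then show "x + y \<in> H q"
    by (elim HE) (auto simp: zero_H I_H I_add[symmetric] K_L2 K_add)
qed

lemma scale_H: "x \<in> H q \<Longrightarrow> scaleC c x \<in> H q"
  by (elim HE) (auto simp: zero_H I_scale[symmetric] K_L2 intro!: I_H K_scale)

lemma J_H: "x \<in> H q \<Longrightarrow> J x \<in> H q"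
  by (elim HE) (auto simp: zero_H I_H J_I K_L2 K_adj)

lemma H_D: "x \<in> H q \<Longrightarrow> x \<in> D"
proof -
  assume "x \<in> H q"
  then have "\<forall>r. (if r = q then x else 0) \<in> H r" by (simp add: zero_H)
  moreover have "x = (\<Sum>r\<le>q. if r = q then x else 0)" by (simp add: sum.delta)
  ultimately show "x \<in> D" unfolding D_def mem_Collect_eq by (intro exI conjI)
qed

lemma add_D: "x \<in> D \<Longrightarrow> y \<in> D \<Longrightarrow> x + y \<in> D"
proof -
  assume "x \<in> D" "y \<in> D"
  then obtain N u M v where u: "\<forall>q. u q \<in> H q" and x: "x = (\<Sum>q\<le>N. u q)"
    and v: "\<forall>q. v q \<in> H q" and y: "y = (\<Sum>q\<le>M. v q)" unfolding D_def by blast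
  define w where "w q = (if q \<le> N then u q else 0) + (if q \<le> M then v q else 0)" for q
  have "x = (\<Sum>q\<le>max N M. if q \<le> N then u q else 0)"
    unfolding x by (rule sum.mono_neutral_cong_left) auto
  moreover have "y = (\<Sum>q\<le>max N M. if q \<le> M then v q else 0)"
    unfolding y by (rule sum.mono_neutral_cong_left) auto
  ultimately have "x + y = (\<Sum>q\<le>max N M. w q)" by (simp add: w_def sum.distrib)
  moreover have "\<forall>q. w q \<in> H q" using u v by (simp add: w_def add_H zero_H)
  ultimately show "x + y \<in> D" unfolding D_def by blast
qed

lemma zero_D: "0 \<in> D" using H_D[OF zero_H] .

lemma sum_D: "(\<And>i. i \<in> S \<Longrightarrow> u i \<in> D) \<Longrightarrow> sum u S \<in> D"
  by (induction S rule: infinite_finite_induct) (auto simp: add_D zero_D)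

lemma D_sum_H: "x \<in> D \<Longrightarrow> \<exists>N u. (\<forall>q. u q \<in> H q) \<and> x = (\<Sum>q\<le>N. u q)"
  by (simp add: D_def)

lemma is_l2_product_sum_left:
  "finite S \<Longrightarrow> (\<And>i. i \<in> S \<Longrightarrow> is_l2_product W (u i) y (z i)) \<Longrightarrow> is_l2_product W (sum u S) y (sum z S)"
  by (induction S rule: finite_induct) (auto simp: is_l2_product_zero_left is_l2_product_add_left)

lemma is_l2_product_sum_right:
  "finite S \<Longrightarrow> (\<And>i. i \<in> S \<Longrightarrow> is_l2_product W x (u i) (z i)) \<Longrightarrow> is_l2_product W x (sum u S) (sum z S)"
  by (induction S rule: finite_induct) (auto simp: is_l2_product_zero_right is_l2_product_add_right)

lemma product_H: "x \<in> H n \<Longrightarrow> y \<in> H m \<Longrightarrow> \<exists>z\<in>D. is_l2_product W x y z"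
proof (elim HE)
  fix f g assume f: "f \<in> K n" "x = I n f" and g: "g \<in> K m" "y = I m g"
  have "(\<Sum>c | c \<le> 2 * min n m \<and> (even c \<or> odd_terms). I (n + m - c) (mixed_contraction n m c f g)) \<in> D"
    by (rule sum_D) (auto intro!: H_D I_H K_contraction f g)
  with product[OF f(1) g(1)] show ?thesis unfolding f g by blast
qed (use zero_D is_l2_product_zero_left is_l2_product_zero_right in blast)+

lemma product_D:
  assumes "x \<in> D" "y \<in> D"
  shows "\<exists>z\<in>D. is_l2_product W x y z"
proof -
  obtain N u M v where u: "\<And>q. u q \<in> H q" and x: "x = (\<Sum>q\<le>N. u q)"
    and v: "\<And>q. v q \<in> H q" and y: "y = (\<Sum>q\<le>M. v q)" using assms unfolding D_def by blast
  have "\<forall>q r. \<exists>z. z \<in> D \<and> is_l2_product W (u q) (v r) z" using product_H[OF u v] by blast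
  then obtain z where z: "\<And>q r. z q r \<in> D" "\<And>q r. is_l2_product W (u q) (v r) (z q r)" by metis
  have "is_l2_product W x y (\<Sum>q\<le>N. \<Sum>r\<le>M. z q r)"
    unfolding x y by (intro is_l2_product_sum_left is_l2_product_sum_right z) auto
  moreover have "(\<Sum>q\<le>N. \<Sum>r\<le>M. z q r) \<in> D" by (intro sum_D z)
  ultimately show ?thesis by blast
qed

lemma one_H: "l2_one W \<in> H 0"
  using I_H[OF K_const[of 1]] by (simp add: I_one)

lemma H_0_scalar:
  assumes "x \<in> H 0" shows "\<exists>c. x = scaleC c (l2_one W)"
  using assms
proof (elim HE)
  assume "x = 0" then have "x = scaleC 0 (l2_one W)" by simp
  then show ?thesis ..
next
  fix f assume f: "f \<in> K 0" "x = I 0 f"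
  have space: "t = (\<lambda>_. undefined)" if "t \<in> space (orthant 0)" for t
    using that by (auto simp: space_orthant)
  have "AE t in orthant 0. f t = f (\<lambda>_. undefined) * 1"
    using AE_space by eventually_elim (drule space, simp)
  then have "I 0 f = I 0 (\<lambda>t. f (\<lambda>_. undefined) * 1)"
    by (rule I_cong_AE[OF K_L2[OF f(1)] L2_kernels_scale[OF L2_kernels_const]])
  also have "\<dots> = scaleC (f (\<lambda>_. undefined)) (l2_one W)"
    using I_scale[OF L2_kernels_const[of 1]] by (simp add: I_one)
  finally show ?thesis using f(2) by blast
qed

sublocale graded_algebra W D H
proof unfold_locales
  fix x c assume "x \<in> D"
  then obtain N u where u: "\<forall>q. u q \<in> H q" and x: "x = (\<Sum>q\<le>N. u q)" unfolding D_def by blast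
  show "scaleC c x \<in> D" unfolding x scaleC.sum_right by (rule sum_D) (use u scale_H H_D in blast)
next
  fix x assume "x \<in> D"
  then obtain N u where u: "\<forall>q. u q \<in> H q" and x: "x = (\<Sum>q\<le>N. u q)" unfolding D_def by blast
  have "J (sum u S) = (\<Sum>i\<in>S. J (u i))" for S
    by (induction S rule: infinite_finite_induct) (auto simp: J_add)
  then show "J x \<in> D" unfolding x by (simp only:) (rule sum_D, use u J_H H_D in blast)
next
  fix x y q r assume "x \<in> H q" "y \<in> H r" "q \<noteq> r"
  then show "cinner x y = 0" by (elim HE) (auto simp: I_orthogonal K_L2)
qed (fact add_D H_D[OF one_H] product_D add_H scale_H zero_H J_H H_D D_sum_H H_0_scalar one_H)+

text \<open>The terms of the product formula have different degrees, so that each of them is a component of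
  the product.\<close>

lemma comp_product:
  assumes f: "f \<in> K n" and g: "g \<in> K m"
  shows "comp e (I n f \<cdot> I m g) =
    (if e \<le> n + m \<and> n + m - e \<le> 2 * min n m \<and> (even (n + m - e) \<or> odd_terms)
     then I e (mixed_contraction n m (n + m - e) f g) else 0)"
proof -
  let ?C = "{c. c \<le> 2 * min n m \<and> (even c \<or> odd_terms)}"
  define w where "w e = (if n + m - e \<in> ?C then I e (mixed_contraction n m (n + m - e) f g) else 0)" for e
  have w: "w e \<in> H e" if "e \<le> n + m" for e
    using that K_contraction[OF f g, of "n + m - e"] I_H[of "mixed_contraction n m (n + m - e) f g" e]
    by (auto simp: w_def)
  have inj: "inj_on (\<lambda>c. n + m - c) ?C" by (intro inj_onI) auto
  have "I n f \<cdot> I m g = (\<Sum>c\<in>?C. I (n + m - c) (mixed_contraction n m c f g))"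
    using l2_mult_eq[OF product[OF f g]] by simp
  also have "\<dots> = (\<Sum>c\<in>?C. w (n + m - c))"
    by (intro sum.cong refl) (auto simp: w_def)
  also have "\<dots> = (\<Sum>e\<in>(\<lambda>c. n + m - c) ` ?C. w e)"
    using sum.reindex[OF inj, of w] by (simp add: comp_def)
  finally have "comp e (I n f \<cdot> I m g) = (if e \<in> (\<lambda>c. n + m - c) ` ?C then w e else 0)"
    by (simp only:) (rule comp_sum_homogeneous, auto intro!: w)
  moreover have "e \<in> (\<lambda>c. n + m - c) ` ?C \<longleftrightarrow> e \<le> n + m \<and> n + m - e \<in> ?C"
    by (auto simp: image_iff intro!: exI[of _ "n + m - e"])
  ultimately show ?thesis by (auto simp: w_def)
qed

lemma tens_I:
  assumes "f \<in> K n" "g \<in> K m"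
  shows "tens (I n f) (I m g) = I (n + m) (contraction n m 0 f g)" "contraction n m 0 f g \<in> K (n + m)"
  using K_contraction[OF assms, of 0] comp_product[OF assms, of "n + m"]
  by (simp_all add: tens_homogeneous[OF I_H[OF assms(1)] I_H[OF assms(2)]] mixed_contraction_def)

sublocale chaos_algebra W D H
proof
  fix a b i j e
  assume "a \<in> H i" "b \<in> H j" "i + j < e \<or> e + i < j \<or> e + j < i"
  then show "comp e (a \<cdot> b) = 0" by (elim HE) (auto simp: comp_product)
next
  fix u v q r
  assume "u \<in> H q" "v \<in> H r"
  then show "norm (tens u v) = norm u * norm v"
  proof (elim HE)
    fix f g assume f: "f \<in> K q" "u = I q f" and g: "g \<in> K r" "v = I r g"
    have "energy (q + r) (contraction q r 0 f g) = energy q f * energy r g"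
      using K_L2[OF f(1)] K_L2[OF g(1)] by (intro energy_tensor) (simp_all add: L2_kernels_def)
    then have "(norm (tens u v))\<^sup>2 = (norm u * norm v)\<^sup>2"
      using tens_I[OF f(1) g(1)] f g K_L2
      by (simp add: norm_I enn2real_mult power_mult_distrib)
    then show ?thesis by (rule power2_eq_imp_eq) auto
  qed auto
next
  fix a u v i q r d
  assume "a \<in> H i" "u \<in> H q" "v \<in> H r" and i: "i \<le> d + q"
  then show "comp (d + r) (a \<cdot> tens u v) = tens (comp d (a \<cdot> u)) v"
  proof (elim HE)
    fix f g h assume f: "f \<in> K i" "a = I i f" and g: "g \<in> K q" "u = I q g" and h: "h \<in> K r" "v = I r h"
    define c where "c = i + q - d"
    let ?P = "d \<le> i + q \<and> c \<le> 2 * min i q \<and> (even c \<or> odd_terms)"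
    have c: "i + (q + r) - (d + r) = c" by (simp add: c_def)
    have lhs: "comp (d + r) (a \<cdot> tens u v)
        = (if ?P then I (d + r) (mixed_contraction i (q + r) c f (contraction q r 0 g h)) else 0)"
    proof -
      have "c \<le> 2 * min i (q + r) \<longleftrightarrow> c \<le> 2 * min i q"
        using i by (auto simp: c_def min_def)
      then show ?thesis
        unfolding f g h tens_I(1)[OF g(1) h(1)] comp_product[OF f(1) tens_I(2)[OF g(1) h(1)]] c
        by (intro if_cong) auto
    qed
    have rhs: "comp d (a \<cdot> u) = (if ?P then I d (mixed_contraction i q c f g) else 0)"
      unfolding f g comp_product[OF f(1) g(1)] c_def ..
    show ?thesis
    proof (cases ?P)
      case True
      then have d: "d = i + q - c" by (auto simp: c_def)
      have "mixed_contraction i q c f g \<in> K d"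
        unfolding d using True by (intro K_contraction f g) auto
      then have "tens (I d (mixed_contraction i q c f g)) v
          = I (d + r) (contraction d r 0 (mixed_contraction i q c f g) h)"
        unfolding h by (rule tens_I(1)[OF _ h(1)])
      also have "\<dots> = I (d + r) (mixed_contraction i (q + r) c f (contraction q r 0 g h))"
        unfolding d using True mixed_contraction_tensor[of c i q r f g h] by simp
      finally show ?thesis unfolding lhs rhs if_P[OF True] ..
    next
      case False
      then show ?thesis unfolding lhs rhs if_not_P[OF False] by simp
    qed
  qed auto
qed

lemma J_symmetric:
  assumes "f \<in> K n" "symmetric_kernel n f" shows "J (I n f) = I n f"
proof -
  define \<sigma> where "\<sigma> i = (if i < n then n - 1 - i else i)" for i
  have "\<sigma> permutes {..<n}"
  proof (rule bij_imp_permutes)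
    show "bij_betw \<sigma> {..<n} {..<n}"
      by (rule bij_betw_byWitness[where f' = \<sigma>]) (auto simp: \<sigma>_def)
  qed (auto simp: \<sigma>_def)
  then have "AE t in orthant n. f (t \<circ> \<sigma>) = f t" "AE t in orthant n. f t \<in> \<real>"
    using assms(2) by (auto simp: symmetric_kernel_def)
  with AE_space have "AE t in orthant n. kernel_adj n f t = f t"
  proof eventually_elim
    fix t assume t: "t \<in> space (orthant n)" "f (t \<circ> \<sigma>) = f t" "f t \<in> \<real>"
    have "(\<lambda>i\<in>{..<n}. t (n - 1 - i)) = t \<circ> \<sigma>"
      by (rule ext) (use t(1) in \<open>auto simp: \<sigma>_def extensional_orthant\<close>)
    then show "kernel_adj n f t = f t" using t by (simp add: kernel_adj_def Reals_cnj_iff)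
  qed
  then show ?thesis
    unfolding J_I[OF K_L2[OF assms(1)]] by (rule I_cong_AE[OF K_L2[OF K_adj[OF assms(1)]] K_L2[OF assms(1)]])
qed

text \<open>Here all \<open>q\<close> variables of \<open>h\<close> are contracted, so that \<open>2 q\<close> variables disappear and the component is an
  ordinary contraction in both cases.\<close>

lemma comp_symmetric_commute:
  assumes f: "f \<in> K n" "symmetric_kernel n f" and h: "h \<in> H q" and n: "p + q = n"
  shows "comp p (I n f \<cdot> h) = comp p (h \<cdot> I n f)"
  using h
proof (elim HE)
  fix g assume g: "g \<in> K q" "h = I q g"
  have c: "n + q - p = 2 * q" "q + n - p = 2 * q" using n by auto
  have K: "contraction n q q f g \<in> K p" "contraction q n q g f \<in> K p"
    using K_contraction[OF f(1) g(1), of "2 * q"] K_contraction[OF g(1) f(1), of "2 * q"] n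
    by (auto simp: mixed_contraction_def)
  have "AE t in orthant p. contraction (p + q) q q f g t = contraction q (p + q) q g f t"
    using K_L2[OF f(1)] K_L2[OF g(1)] f(2) unfolding n[symmetric]
    by (intro contraction_symmetric_commute) (simp_all add: L2_kernels_def)
  then have "I p (contraction n q q f g) = I p (contraction q n q g f)"
    unfolding n by (rule I_cong_AE[OF K_L2[OF K(1)] K_L2[OF K(2)]])
  then show ?thesis
    unfolding g(2) comp_product[OF f(1) g(1)] comp_product[OF g(1) f(1)] c
    using n by (simp add: mixed_contraction_def)
qed simp

end

lemma sum_even_terms:
  fixes h :: "nat \<Rightarrow> 'a::comm_monoid_add"
  shows "(\<Sum>c | c \<le> 2 * N \<and> even c. h c) = (\<Sum>p\<le>N. h (2 * p))"
  by (rule sum.reindex_bij_witness[of _ "\<lambda>p. 2 * p" "\<lambda>c. c div 2"]) auto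

lemma sum_odd_terms:
  fixes h :: "nat \<Rightarrow> 'a::comm_monoid_add"
  shows "(\<Sum>c | c \<le> 2 * N \<and> odd c. h c) = (\<Sum>p=1..N. h (2 * p - 1))"
  by (rule sum.reindex_bij_witness[of _ "\<lambda>p. 2 * p - 1" "\<lambda>c. c div 2 + 1"]) (auto elim!: oddE)

lemma multiple_integral_algebra_wigner:
  assumes W: "tracial_wstar_space W" and chaos: "wigner_chaos W M I K"
  shows "multiple_integral_algebra W M I K False"
proof -
  interpret tracial_wstar W by unfold_locales (rule W)
  have K: "K = L2_kernels" and integrals: "multiple_integrals W M I"
    using chaos by (auto simp: wigner_chaos_def)
  show ?thesis
  proof unfold_locales
    fix f g n m assume fg: "f \<in> K n" "g \<in> K m"
    have "is_l2_product W (I n f) (I m g) (\<Sum>p\<le>min n m. I (n + m - 2 * p) (contraction n m p f g))"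
      using chaos fg by (simp add: wigner_chaos_def)
    then show "is_l2_product W (I n f) (I m g)
        (\<Sum>c | c \<le> 2 * min n m \<and> (even c \<or> False). I (n + m - c) (mixed_contraction n m c f g))"
      by (simp add: sum_even_terms mixed_contraction_def)
  next
    fix f g n m and j :: nat assume "f \<in> K n" "g \<in> K m" "j \<le> 2 * min n m" "even j \<or> False"
    then show "mixed_contraction n m j f g \<in> K (n + m - j)"
      using L2_kernels_contraction[of f n g m "j div 2"] by (auto simp: K mixed_contraction_def)
  qed (auto simp: K intro: integrals L2_kernels_const L2_kernels_add L2_kernels_scale L2_kernels_adj)
qed

lemma multiple_integral_algebra_free_poisson:
  assumes W: "tracial_wstar_space W" and chaos: "free_poisson_chaos W M I K"
  shows "multiple_integral_algebra W M I K True"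
proof -
  interpret tracial_wstar W by unfold_locales (rule W)
  have K: "kernel_algebra K" and integrals: "multiple_integrals W M I"
    using chaos by (auto simp: free_poisson_chaos_def)
  show ?thesis
  proof unfold_locales
    fix f g n m assume fg: "f \<in> K n" "g \<in> K m"
    have prod: "is_l2_product W (I n f) (I m g)
        ((\<Sum>p\<le>min n m. I (n + m - 2 * p) (contraction n m p f g)) +
         (\<Sum>p=1..min n m. I (n + m - 2 * p + 1) (star_contraction n m p f g)))"
      using chaos fg by (simp add: free_poisson_chaos_def)
    let ?h = "\<lambda>c. I (n + m - c) (mixed_contraction n m c f g)"
    have "(\<Sum>c | c \<le> 2 * min n m. ?h c)
        = (\<Sum>c | c \<le> 2 * min n m \<and> even c. ?h c) + (\<Sum>c | c \<le> 2 * min n m \<and> odd c. ?h c)"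
      by (subst sum.union_disjoint[symmetric]) (auto intro: sum.cong)
    also have "\<dots> = (\<Sum>p\<le>min n m. I (n + m - 2 * p) (contraction n m p f g)) +
         (\<Sum>p=1..min n m. I (n + m - 2 * p + 1) (star_contraction n m p f g))"
      unfolding sum_even_terms sum_odd_terms
    proof (intro arg_cong2[of _ _ _ _ "(+)"] sum.cong refl)
      fix p assume p: "p \<in> {1..min n m}"
      then have "odd (2 * p - 1)" "(2 * p - 1) div 2 + 1 = p" "n + m - (2 * p - 1) = n + m - 2 * p + 1"
        by auto
      then show "?h (2 * p - 1) = I (n + m - 2 * p + 1) (star_contraction n m p f g)"
        by (simp add: mixed_contraction_def)
    qed (simp add: mixed_contraction_def)
    finally show "is_l2_product W (I n f) (I m g)
        (\<Sum>c | c \<le> 2 * min n m \<and> (even c \<or> True). I (n + m - c) (mixed_contraction n m c f g))"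
      using prod by simp
  next
    fix f g n m and j :: nat assume fg: "f \<in> K n" "g \<in> K m" and j: "j \<le> 2 * min n m"
    show "mixed_contraction n m j f g \<in> K (n + m - j)"
    proof (cases "even j")
      case True
      have "j div 2 \<le> min n m" using j by (auto simp: min_def split: if_splits)
      then have "contraction n m (j div 2) f g \<in> K (n + m - 2 * (j div 2))"
        using K fg unfolding kernel_algebra_def by blast
      then show ?thesis using True by (simp add: mixed_contraction_def)
    next
      case False
      then obtain d where d: "j = 2 * d + 1" by (rule oddE)
      then have d1: "d + 1 \<in> {1..min n m}" using j by auto
      then have "star_contraction n m (d + 1) f g \<in> K (n + m - 2 * (d + 1) + 1)"
        using K fg unfolding kernel_algebra_def by blast
      moreover have "n + m - 2 * (d + 1) + 1 = n + m - j" using d d1 by auto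
      ultimately show ?thesis using d by (simp add: mixed_contraction_def)
    qed
  qed (use K in \<open>auto simp: kernel_algebra_def intro: integrals\<close>)
qed

section \<open>Mixed moments\<close>

text \<open>For the limit variables no chaos decomposition is available; the algebra that they generate is spanned
  by their monomials.\<close>

inductive_set moment_span :: "('h::chilbert_space, 'l::chilbert_space) wstar_space \<Rightarrow> 'l set \<Rightarrow> 'l set"
  for W S where
  word: "set w \<subseteq> S \<Longrightarrow> l2_prod W w \<in> moment_span W S"
| add: "x \<in> moment_span W S \<Longrightarrow> y \<in> moment_span W S \<Longrightarrow> x + y \<in> moment_span W S"
| scale: "x \<in> moment_span W S \<Longrightarrow> scaleC c x \<in> moment_span W S"

context tracial_wstar
begin

lemma cinner_one_one [simp]: "cinner (l2_one W) (l2_one W) = 1"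
  by (simp add: l2_one_emb cinner_emb)

lemma l2_prod_product:
  assumes moments: "has_all_moments W Xs" and J: "\<And>x. x \<in> set Xs \<Longrightarrow> J x = x"
    and v: "set v \<subseteq> set Xs"
  shows "set w \<subseteq> set Xs \<Longrightarrow> is_l2_product W (l2_prod W w) (l2_prod W v) (l2_prod W (w @ v))"
proof (induction w)
  case Nil
  then show ?case by (simp add: l2_prod_def is_l2_product_one_left)
next
  case (Cons x w)
  have x: "x \<in> set Xs" and w: "set w \<subseteq> set Xs" using Cons.prems by auto
  have wv: "set (w @ v) \<subseteq> set Xs" using v w by simp
  have "is_l2_product W x (l2_prod W w) (l2_prod W (x # w))"
    "is_l2_product W x (l2_prod W (w @ v)) (l2_prod W (x # w @ v))"
    using moments x w wv unfolding has_all_moments_def by blast+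
  with is_l2_product_assoc[OF J[OF x] this(1) Cons.IH[OF w] this(2)] show ?case by simp
qed

lemma J_monomial:
  assumes moments: "has_all_moments W Xs" and J: "\<And>x. x \<in> set Xs \<Longrightarrow> J x = x"
  shows "set w \<subseteq> set Xs \<Longrightarrow> J (l2_prod W w) = l2_prod W (rev w)"
proof (induction w)
  case Nil
  then show ?case by (simp add: l2_prod_def)
next
  case (Cons x w)
  have x: "x \<in> set Xs" and w: "set w \<subseteq> set Xs" using Cons.prems by auto
  have "is_l2_product W x (l2_prod W w) (l2_prod W (x # w))"
    using moments x w unfolding has_all_moments_def by blast
  from is_l2_product_J[OF this] have "is_l2_product W (l2_prod W (rev w)) x (J (l2_prod W (x # w)))"
    using Cons.IH[OF w] J[OF x] by simp
  moreover have "is_l2_product W (l2_prod W (rev w)) (l2_prod W [x]) (l2_prod W (rev w @ [x]))"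
    by (rule l2_prod_product[OF moments J]) (use x w in auto)
  moreover have "l2_prod W [x] = x"
    by (simp add: l2_prod_def l2_mult_eq[OF is_l2_product_one_right])
  ultimately show ?case using is_l2_product_unique by simp
qed

lemma l2_algebra_moment_span:
  assumes moments: "has_all_moments W Xs" and J: "\<And>x. x \<in> set Xs \<Longrightarrow> J x = x"
  shows "l2_algebra W (moment_span W (set Xs))"
proof unfold_locales
  show "l2_one W \<in> moment_span W (set Xs)"
    using moment_span.word[of "[]" "set Xs" W] by (simp add: l2_prod_def)
next
  fix x assume "x \<in> moment_span W (set Xs)"
  then show "J x \<in> moment_span W (set Xs)"
    by induction
       (auto simp: J_add J_scale J_monomial[OF moments J] intro!: moment_span.intros)
next
  fix x y assume x: "x \<in> moment_span W (set Xs)" and y: "y \<in> moment_span W (set Xs)"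
  have words: "\<exists>z\<in>moment_span W (set Xs). is_l2_product W x (l2_prod W v) z" if "set v \<subseteq> set Xs" for v
    using x
  proof induction
    case (word w)
    then show ?case using l2_prod_product[OF moments J that] that
      by (intro bexI[of _ "l2_prod W (w @ v)"] moment_span.word) auto
  next
    case (add x y)
    then show ?case by (blast intro: is_l2_product_add_left moment_span.add)
  next
    case (scale x c)
    then show ?case by (blast intro: is_l2_product_scale_left moment_span.scale)
  qed
  show "\<exists>z\<in>moment_span W (set Xs). is_l2_product W x y z"
    using y
  proof induction
    case (word w)
    then show ?case by (rule words)
  next
    case (add x y)
    then show ?case by (blast intro: is_l2_product_add_right moment_span.add)
  next
    case (scale x c)
    then show ?case by (blast intro: is_l2_product_scale_right moment_span.scale)
  qed
qed (auto intro: moment_span.intros)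

end

definition centered_poly ::
    "('h::chilbert_space, 'l::chilbert_space) wstar_space \<Rightarrow> 'l list \<Rightarrow> nat \<times> complex poly \<Rightarrow> 'l" where
  "centered_poly W Xs = (\<lambda>(i, P).
     l2_poly W P (Xs ! i) - scaleC (l2_expect W (l2_poly W P (Xs ! i))) (l2_one W))"

text \<open>The prefix \<open>u\<close> of uncentered letters makes it possible to expand the centered polynomials one after the
  other.\<close>

definition mixed_moment ::
    "('h::chilbert_space, 'l::chilbert_space) wstar_space \<Rightarrow> 'l list \<Rightarrow> nat list \<Rightarrow>
     (nat \<times> complex poly) list \<Rightarrow> complex" where
  "mixed_moment W Xs u ps =
     l2_expect W (l2_prod W (map (\<lambda>i. Xs ! i) u @ map (centered_poly W Xs) ps))"

lemma free_rvs_iff: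
  "free_rvs W Xs \<longleftrightarrow> (\<forall>ps. ps \<noteq> [] \<and> fst ` set ps \<subseteq> {..<length Xs} \<and> distinct_adj (map fst ps) \<longrightarrow>
     mixed_moment W Xs [] ps = 0)"
  by (simp add: free_rvs_def mixed_moment_def centered_poly_def)

context l2_algebra
begin

lemma centered_poly_D: "set Xs \<subseteq> D \<Longrightarrow> i < length Xs \<Longrightarrow> centered_poly W Xs (i, P) \<in> D"
  unfolding centered_poly_def by (auto intro!: D_diff l2_poly_D)

lemma cinner_one_centered_poly:
  "cinner (centered_poly W Xs (i, P)) one = 0"
  by (simp add: centered_poly_def cinner.diff_left cinner_scaleC_left l2_expect_def)

lemma mixed_moment_Cons:
  assumes Xs: "set Xs \<subseteq> D" and i: "i < length Xs" and u: "set u \<subseteq> {..<length Xs}"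
    and ps: "fst ` set ps \<subseteq> {..<length Xs}"
  shows "mixed_moment W Xs u ((i, P) # ps) =
    (\<Sum>j\<le>degree P. coeff P j * mixed_moment W Xs (u @ replicate j i) ps) -
    (\<Sum>j\<le>degree P. coeff P j * mixed_moment W Xs (replicate j i) []) * mixed_moment W Xs u ps"
proof -
  define x U C where "x = Xs ! i" and "U = l2_prod W (map (\<lambda>i. Xs ! i) u)"
    and "C = l2_prod W (map (centered_poly W Xs) ps)"
  have x: "x \<in> D" using Xs i by (auto simp: x_def)
  have u': "set (map (\<lambda>i. Xs ! i) u) \<subseteq> D" using Xs u nth_mem[of _ Xs] by fastforce
  have U: "U \<in> D" unfolding U_def by (rule l2_prod_D[OF u'])
  have ps': "set (map (centered_poly W Xs) ps) \<subseteq> D"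
    using ps Xs by (auto intro!: centered_poly_D)
  have C: "C \<in> D" unfolding C_def by (rule l2_prod_D[OF ps'])
  have word: "l2_prod W (map (\<lambda>i. Xs ! i) (u @ replicate j i) @ map (centered_poly W Xs) ps)
      = U \<cdot> (l2_power W x j \<cdot> C)" for j
  proof -
    have r: "set (replicate j x) \<subseteq> D" using x by auto
    have "l2_prod W (map (\<lambda>i. Xs ! i) (u @ replicate j i) @ map (centered_poly W Xs) ps)
        = l2_prod W (map (\<lambda>i. Xs ! i) u @ (replicate j x @ map (centered_poly W Xs) ps))"
      by (simp add: x_def)
    also have "\<dots> = U \<cdot> (l2_power W x j \<cdot> C)"
      unfolding U_def C_def l2_power_def
      by (subst l2_prod_append[OF u'], use r ps' in simp) (simp only: l2_prod_append[OF r ps'])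
    finally show ?thesis .
  qed
  have word0: "l2_prod W (map (\<lambda>i. Xs ! i) u @ map (centered_poly W Xs) ps) = U \<cdot> C"
    unfolding U_def C_def by (rule l2_prod_append[OF u' ps'])
  have power: "l2_prod W (map (\<lambda>i. Xs ! i) (replicate j i) @ map (centered_poly W Xs) []) = l2_power W x j" for j
    by (simp add: l2_power_def x_def)
  have E: "l2_expect W (l2_poly W P x) = (\<Sum>j\<le>degree P. coeff P j * mixed_moment W Xs (replicate j i) [])"
    unfolding mixed_moment_def power
    by (simp add: l2_expect_def l2_poly_def cinner.sum_left cinner_scaleC_left)
  have "l2_prod W (map (\<lambda>i. Xs ! i) u @ map (centered_poly W Xs) ((i, P) # ps))
      = U \<cdot> (centered_poly W Xs (i, P) \<cdot> C)"
  proof -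
    have "set (map (centered_poly W Xs) ((i, P) # ps)) \<subseteq> D"
      using ps' centered_poly_D[OF Xs i] by simp
    from l2_prod_append[OF u' this] show ?thesis by (simp add: U_def C_def)
  qed
  also have "centered_poly W Xs (i, P) \<cdot> C
      = (\<Sum>j\<le>degree P. scaleC (coeff P j) (l2_power W x j \<cdot> C)) - scaleC (l2_expect W (l2_poly W P x)) C"
    using x C by (simp add: centered_poly_def x_def[symmetric] mul_diff_left mul_scale_left)
      (simp add: l2_poly_def mul_sum_left mul_scale_left)
  also have "U \<cdot> \<dots> = (\<Sum>j\<le>degree P. scaleC (coeff P j) (U \<cdot> (l2_power W x j \<cdot> C)))
      - scaleC (l2_expect W (l2_poly W P x)) (U \<cdot> C)"
    using x C U by (simp add: mul_diff_right mul_scale_right mul_sum_right)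
  finally show ?thesis
    unfolding E[symmetric] unfolding mixed_moment_def word word0
    by (simp add: l2_expect_def cinner.diff_left cinner.sum_left cinner_scaleC_left)
qed

lemma mixed_moment_two_squares:
  assumes X: "x \<in> D" "y \<in> D"
  shows "mixed_moment W [x, y] [] [(0, monom 1 2), (1, monom 1 2)]
    = l2_cov W (l2_power W x 2) (l2_power W y 2)"
proof -
  have monom: "l2_poly W (monom 1 2) z = l2_power W z 2" if "z \<in> D" for z
    by (simp add: l2_poly_def degree_monom_eq numeral_2_eq_2)
  define a b where "a = l2_power W x 2" and "b = l2_power W y 2"
  have ab: "a \<in> D" "b \<in> D" using X by (simp_all only: a_def b_def l2_power_D)
  have "mixed_moment W [x, y] [] [(0, monom 1 2), (1, monom 1 2)]
      = cinner ((a - scaleC (cinner a one) one) \<cdot> (b - scaleC (cinner b one) one)) one"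
    using X by (simp add: mixed_moment_def centered_poly_def monom a_def b_def l2_expect_def)
  also have "\<dots> = cinner (a \<cdot> b) one - cinner a one * cinner b one"
    using ab by (simp add: mul_diff_left mul_diff_right mul_scale_left mul_scale_right
        cinner.diff_left cinner_scaleC_left)
  finally show ?thesis by (simp add: l2_cov_def l2_expect_def a_def b_def)
qed

end

text \<open>Convergence in law is stated for monomials.  Expanding the centered polynomials turns mixed moments
  into polynomial expressions in such moments, with the same coefficients for both spaces.\<close>

lemma mixed_moment_tendsto:
  fixes W :: "('h::chilbert_space, 'l::chilbert_space) wstar_space"
    and V :: "('h2::chilbert_space, 'l2::chilbert_space) wstar_space"
  assumes W: "l2_algebra W D" and V: "l2_algebra V E"
    and X: "\<And>k. set (X k) \<subseteq> D" and Y: "set Y \<subseteq> E"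
    and law: "converges_in_law W X V Y"
    and ps: "fst ` set ps \<subseteq> {..<length Y}" and u: "set u \<subseteq> {..<length Y}"
  shows "(\<lambda>k. mixed_moment W (X k) u ps) \<longlonglongrightarrow> mixed_moment V Y u ps"
proof -
  interpret W: l2_algebra W D by (rule W)
  interpret V: l2_algebra V E by (rule V)
  show ?thesis using ps u
  proof (induction ps arbitrary: u)
    case Nil
    show ?case
    proof (cases "u = []")
      case True
      then show ?thesis by (simp add: mixed_moment_def l2_prod_def l2_expect_def)
    next
      case False
      then show ?thesis using law Nil by (simp add: mixed_moment_def converges_in_law_def)
    qed
  next
    case (Cons p ps)
    obtain i P where p: "p = (i, P)" by (cases p)
    have len: "length (X k) = length Y" for k using law by (simp add: converges_in_law_def)
    have i: "i < length Y" and ps: "fst ` set ps \<subseteq> {..<length Y}" using Cons.prems by (auto simp: p)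
    have powers: "(\<lambda>k. mixed_moment W (X k) (replicate j i) []) \<longlonglongrightarrow> mixed_moment V Y (replicate j i) []" for j
    proof (cases "j = 0")
      case True
      then show ?thesis by (simp add: mixed_moment_def l2_prod_def l2_expect_def)
    next
      case False
      then show ?thesis
        using law[unfolded converges_in_law_def, THEN conjunct2, THEN conjunct2, rule_format, of "replicate j i"] i
        by (simp add: mixed_moment_def)
    qed
    have eqW: "mixed_moment W (X k) u ((i, P) # ps) =
      (\<Sum>j\<le>degree P. coeff P j * mixed_moment W (X k) (u @ replicate j i) ps) -
      (\<Sum>j\<le>degree P. coeff P j * mixed_moment W (X k) (replicate j i) []) * mixed_moment W (X k) u ps" for k
      by (rule l2_algebra.mixed_moment_Cons[OF W X]) (use i ps Cons.prems in \<open>simp_all add: len\<close>)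
    have eqV: "mixed_moment V Y u ((i, P) # ps) =
      (\<Sum>j\<le>degree P. coeff P j * mixed_moment V Y (u @ replicate j i) ps) -
      (\<Sum>j\<le>degree P. coeff P j * mixed_moment V Y (replicate j i) []) * mixed_moment V Y u ps"
      by (rule l2_algebra.mixed_moment_Cons[OF V Y]) (use i ps Cons.prems in simp_all)
    have "set (u @ replicate j i) \<subseteq> {..<length Y}" for j using i Cons.prems by auto
    then show ?case
      unfolding p eqW eqV using Cons.prems
      by (intro tendsto_intros Cons.IH ps powers) auto
  qed
qed

section \<open>Covariances of squares and freeness of the limit\<close>

context chaos_algebra
begin

text \<open>By the trace property \<open>\<phi>(a\<^sup>2 b\<^sup>2)\<close> is the squared norm of \<open>a b\<close>, and \<open>\<phi>(a\<^sup>2) \<phi>(b\<^sup>2)\<close> is the squared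
  norm of \<open>a \<odot> b\<close>, which is the orthogonal projection of \<open>a b\<close> to the highest degree.\<close>

lemma cov_squares:
  assumes a: "a \<in> H q" "J a = a" and b: "b \<in> H r" "J b = b"
  shows "l2_cov W (l2_power W a 2) (l2_power W b 2) = complex_of_real ((norm (a \<diamondop> b))\<^sup>2)"
proof -
  define c where "c = a \<odot> b"
  have D: "a \<in> D" "b \<in> D" using a b by auto
  have c: "c = comp (q + r) (a \<cdot> b)" unfolding c_def by (rule tens_homogeneous[OF a(1) b(1)])
  have cH: "c \<in> H (q + r)" using D by (simp add: c)
  have sq: "l2_power W z 2 = z \<cdot> z" for z by (simp add: numeral_2_eq_2)
  have norm: "cinner z z = complex_of_real ((norm z)\<^sup>2)" for z :: 'l
    by (rule cinner_self)
  have ca: "cinner (a \<cdot> b) c = cinner c c"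
    using cinner_comp[OF mul_D[OF D] cH] c by simp
  have ac: "cinner c (a \<cdot> b) = cinner c c"
    using cinner_comp_right[OF mul_D[OF D] cH] c by simp
  have "cinner (a \<diamondop> b) (a \<diamondop> b) = cinner (a \<cdot> b) (a \<cdot> b) - cinner c c"
    unfolding circ_def c_def[symmetric] cinner.diff_left cinner.diff_right ca ac by simp
  also have "cinner c c = cinner a a * cinner b b"
    unfolding norm c_def norm_tens[OF a(1) b(1)] by (simp add: power_mult_distrib)
  also have "cinner (a \<cdot> b) (a \<cdot> b) = cinner (a \<cdot> a \<cdot> (b \<cdot> b)) one"
  proof -
    have "cinner (a \<cdot> b) (a \<cdot> b) = cinner (a \<cdot> b \<cdot> (b \<cdot> a)) one"
      using cinner_eq_expect[of "a \<cdot> b" "a \<cdot> b"] D a(2) b(2) by (simp add: J_mul)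
    also have "\<dots> = cinner (a \<cdot> (b \<cdot> b \<cdot> a)) one" using D by (simp add: mul_assoc)
    also have "\<dots> = cinner (b \<cdot> b \<cdot> a \<cdot> a) one" by (rule trace_commute) (use D in simp_all)
    also have "\<dots> = cinner (b \<cdot> b \<cdot> (a \<cdot> a)) one" using D by (simp add: mul_assoc)
    also have "\<dots> = cinner (a \<cdot> a \<cdot> (b \<cdot> b)) one" by (rule trace_commute) (use D in simp_all)
    finally show ?thesis .
  qed
  also have "cinner a a = cinner (a \<cdot> a) one" using cinner_eq_expect[OF D(1) D(1)] a(2) by simp
  also have "cinner b b = cinner (b \<cdot> b) one" using cinner_eq_expect[OF D(2) D(2)] b(2) by simp
  finally show ?thesis
    unfolding norm[symmetric] l2_cov_def l2_expect_def sq ..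
qed

text \<open>One direction applies freeness to the polynomial \<open>x\<^sup>2\<close> in both variables, whose mixed moment is the
  covariance.  For the other one, \<open>cov_squares\<close> turns the hypothesis into the vanishing of
  \<open>x k \<diamondop> y k\<close>, and asymptotic freeness identifies the limits of the centered alternating moments.\<close>

theorem free_limit_iff:
  fixes V :: "('h2::chilbert_space, 'l2::chilbert_space) wstar_space"
  assumes V: "tracial_wstar_space V" and F: "self_adjoint_rv V F" and G: "self_adjoint_rv V G"
    and x: "\<And>k. x k \<in> H n" "\<And>k. J (x k) = x k"
      "\<And>k h p q. h \<in> H q \<Longrightarrow> p + q = n \<Longrightarrow> comp p (x k \<cdot> h) = comp p (h \<cdot> x k)"
    and y: "\<And>k. y k \<in> H m" "\<And>k. J (y k) = y k"
      "\<And>k h p q. h \<in> H q \<Longrightarrow> p + q = m \<Longrightarrow> comp p (y k \<cdot> h) = comp p (h \<cdot> y k)"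
    and law: "converges_in_law W (\<lambda>k. [x k, y k]) V [F, G]"
  shows "free_rvs V [F, G] \<longleftrightarrow>
    (\<lambda>k. l2_cov W (l2_power W (x k) 2) (l2_power W (y k) 2)) \<longlonglongrightarrow> 0"
proof -
  interpret V: tracial_wstar V by unfold_locales (rule V)
  have J: "V.J z = z" if "z \<in> set [F, G]" for z
    using that F G by (auto simp: self_adjoint_rv_def V.is_l2_adjoint_iff)
  have momV: "has_all_moments V [F, G]" using law by (simp add: converges_in_law_def)
  interpret VE: l2_algebra V "moment_span V (set [F, G])"
    by (rule V.l2_algebra_moment_span[OF momV J])
  have sub: "set [F, G] \<subseteq> moment_span V (set [F, G])"
  proof
    fix z assume "z \<in> set [F, G]"
    then show "z \<in> moment_span V (set [F, G])"
      using moment_span.word[of "[z]" "set [F, G]" V] by simp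
  qed
  have D: "x k \<in> D" "y k \<in> D" for k by (rule H_D[OF x(1)], rule H_D[OF y(1)])
  have lim: "(\<lambda>k. mixed_moment W [x k, y k] u ps) \<longlonglongrightarrow> mixed_moment V [F, G] u ps"
    if "fst ` set ps \<subseteq> {..<2}" "set u \<subseteq> {..<2}" for u ps
    by (rule mixed_moment_tendsto[OF l2_algebra_axioms VE.l2_algebra_axioms _ sub law])
       (use that D in \<open>simp_all add: numeral_2_eq_2\<close>)
  show ?thesis
  proof
    assume free: "free_rvs V [F, G]"
    let ?ps = "[(0, monom 1 2), (1, monom 1 2)] :: (nat \<times> complex poly) list"
    have "mixed_moment V [F, G] [] ?ps = 0"
      using free unfolding free_rvs_iff by (elim allE[of _ ?ps]) simp
    then show "(\<lambda>k. l2_cov W (l2_power W (x k) 2) (l2_power W (y k) 2)) \<longlonglongrightarrow> 0"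
      using lim[of ?ps "[]"] by (simp add: mixed_moment_two_squares[OF D] del: One_nat_def)
  next
    assume cov: "(\<lambda>k. l2_cov W (l2_power W (x k) 2) (l2_power W (y k) 2)) \<longlonglongrightarrow> 0"
    define z where "z b k = (if b then y k else x k)" for b k
    define dz where "dz b = (if b then m else n)" for b
    have z_nth: "[x k, y k] ! (if b then 1 else 0) = z b k" for b k by (simp add: z_def)
    have moment_lim: "convergent (\<lambda>k. l2_expect W (l2_prod W (map (\<lambda>b. z b k) w)))" for w
    proof -
      define u :: "nat list" where "u = map (\<lambda>b. if b then 1 else 0) w"
      have "mixed_moment W [x k, y k] u [] = l2_expect W (l2_prod W (map (\<lambda>b. z b k) w))" for k
        by (simp add: mixed_moment_def u_def o_def z_nth del: One_nat_def)
      moreover have "set u \<subseteq> {..<2}" by (auto simp: u_def)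
      ultimately show ?thesis using lim[of "[]" u] by (auto simp: convergent_def)
    qed
    have norm_circ: "(\<lambda>k. x k \<diamondop> y k) \<longlonglongrightarrow> 0"
    proof -
      have "(\<lambda>k. complex_of_real ((norm (x k \<diamondop> y k))\<^sup>2)) \<longlonglongrightarrow> complex_of_real 0"
        using cov unfolding cov_squares[OF x(1,2) y(1,2)] by simp
      then have "(\<lambda>k. (norm (x k \<diamondop> y k))\<^sup>2) \<longlonglongrightarrow> 0" unfolding tendsto_of_real_iff .
      from tendsto_real_sqrt[OF this] show ?thesis by (simp add: tendsto_norm_zero_iff)
    qed
    interpret integral_pair W D H z dz
    proof
      show "z b k \<in> H (dz b)" "J (z b k) = z b k" for b k
        using x y by (auto simp: z_def dz_def)
      show "comp p (z b k \<cdot> h) = comp p (h \<cdot> z b k)" if "h \<in> H q" "p + q = dz b" for h q p b k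
        using that x(3)[of h q p k] y(3)[of h q p k] by (auto simp: z_def dz_def split: if_splits)
      \<comment> \<open>The squared norm of a word is the moment of the word followed by its reversal; it converges.\<close>
      show "bounded_seq (\<lambda>k. l2_prod W (map (\<lambda>b. z b k) w))" for w
      proof -
        have zD: "set (map (\<lambda>b. z b k) v) \<subseteq> D" for v k using D by (auto simp: z_def)
        have zJ: "J (z b k) = z b k" for b k using x y by (auto simp: z_def)
        have norm: "(norm (l2_prod W (map (\<lambda>b. z b k) w)))\<^sup>2
            = Re (l2_expect W (l2_prod W (map (\<lambda>b. z b k) (w @ rev w))))" for k
        proof -
          have "l2_prod W (map (\<lambda>b. z b k) (w @ rev w))
              = l2_prod W (map (\<lambda>b. z b k) w) \<cdot> J (l2_prod W (map (\<lambda>b. z b k) w))"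
            unfolding J_l2_prod[OF zD] map_append l2_prod_append[OF zD zD]
            by (simp add: rev_map o_def zJ)
          then show ?thesis
            using cinner_eq_expect[OF l2_prod_D[OF zD[of k w]] l2_prod_D[OF zD[of k w]]]
            by (simp add: l2_expect_def norm_eq_sqrt_Re_cinner)
        qed
        obtain C where C: "\<And>k. norm (l2_expect W (l2_prod W (map (\<lambda>b. z b k) (w @ rev w)))) \<le> C"
          using convergent_imp_Bseq[OF moment_lim[of "w @ rev w"]] by (auto simp: Bseq_def)
        show ?thesis
        proof (rule bounded_seqI)
          fix k
          have "(norm (l2_prod W (map (\<lambda>b. z b k) w)))\<^sup>2 \<le> C"
            unfolding norm by (rule order.trans[OF complex_Re_le_cmod C])
          then show "norm (l2_prod W (map (\<lambda>b. z b k) w)) \<le> sqrt C" by (rule real_le_rsqrt)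
        qed
      qed
      show "(\<lambda>k. z b k \<diamondop> z (\<not> b) k) \<longlonglongrightarrow> 0" for b
      proof (cases b)
        case True
        have "norm (y k \<diamondop> x k) = norm (x k \<diamondop> y k)" for k
          using norm_J[of "x k \<diamondop> y k"] D x(2) y(2) by (simp add: J_circ)
        then have "(\<lambda>k. norm (y k \<diamondop> x k)) \<longlonglongrightarrow> 0" using tendsto_norm_zero[OF norm_circ] by simp
        then show ?thesis using True by (simp add: z_def tendsto_norm_zero_iff)
      qed (simp add: z_def norm_circ)
    qed
    show "free_rvs V [F, G]"
      unfolding free_rvs_iff
    proof (intro allI impI, elim conjE)
      fix ps :: "(nat \<times> complex poly) list"
      assume ne: "ps \<noteq> []" and ps: "fst ` set ps \<subseteq> {..<length [F, G]}" and adj: "distinct_adj (map fst ps)"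
      have ps2: "fst ` set ps \<subseteq> {..<2}" using ps by (simp add: numeral_2_eq_2)
      define Ps where "Ps = map (\<lambda>(i, P). (i = 1, \<lambda>k. centered_poly W [x k, y k] (i, P))) ps"
      have nth: "[x k, y k] ! i = z (i = 1) k" if "i < 2" for i k
        using that by (auto simp: z_def less_2_cases_iff)
      have "(\<lambda>k. cinner (l2_prod W (map (\<lambda>(b, P). P k) Ps)) one) \<longlonglongrightarrow> 0"
      proof (rule asymptotically_free)
        show "Ps \<noteq> []" using ne by (simp add: Ps_def)
        have "inj_on (\<lambda>i::nat. i = 1) (fst ` set ps)"
        proof (rule inj_onI)
          fix i j :: nat assume ij: "i \<in> fst ` set ps" "j \<in> fst ` set ps" "(i = 1) = (j = 1)"
          then have "i < 2" "j < 2" using ps2 by blast+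
          then show "i = j" using ij(3) by linarith
        qed
        then have "distinct_adj (map (\<lambda>i. i = 1) (map fst ps))"
          using adj distinct_adj_map_iff[of "\<lambda>i. i = 1" "map fst ps"] by simp
        then show "distinct_adj (map fst Ps)" by (simp add: Ps_def split_def o_def)
        fix b P assume "(b, P) \<in> set Ps"
        then obtain i Q where iQ: "(i, Q) \<in> set ps" and b: "b = (i = 1)"
          and P: "P = (\<lambda>k. centered_poly W [x k, y k] (i, Q))" by (auto simp: Ps_def)
        have i: "i < 2" using ps2 iQ by force
        define e where "e k = l2_expect W (l2_poly W Q (z b k))" for k
        have P_eq: "P k = l2_poly W Q (z b k) - scaleC (e k) one" for k
          unfolding P centered_poly_def e_def b by (simp add: nth[OF i])
        have zD: "z b k \<in> D" for b k using D by (auto simp: z_def)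
        have "comp 0 (P k) = 0" for k
          using i D unfolding P
          by (intro comp_0_centered centered_poly_D cinner_one_centered_poly) auto
        moreover have "polynomial b P"
          unfolding polynomial_def
        proof (intro exI conjI allI)
          let ?c = "\<lambda>i k. coeff Q i - (if i = 0 then e k else 0)"
          have "e = (\<lambda>k. \<Sum>j\<le>degree Q. coeff Q j * l2_expect W (l2_prod W (map (\<lambda>b. z b k) (replicate j b))))"
            by (rule ext) (simp add: e_def l2_expect_def l2_poly_def l2_power_def cinner.sum_left cinner_scaleC_left)
          moreover have "convergent (\<lambda>k. \<Sum>j\<le>degree Q. coeff Q j *
              l2_expect W (l2_prod W (map (\<lambda>b. z b k) (replicate j b))))"
            by (intro convergent_sum convergent_mult convergent_const moment_lim)
          ultimately have "Bseq e" using convergent_imp_Bseq[of e] by simp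
          then have "bounded_seq e" by (auto simp: Bseq_def bounded_seq_def)
          then show "bounded_seq (?c i)" for i
            by (cases "i = 0") (simp_all add: bounded_seq_diff)
          show "P k = (\<Sum>i\<le>degree Q. scaleC (?c i k) (l2_power W (z b k) i))" for k
          proof -
            have "(\<Sum>i\<le>degree Q. scaleC (if i = 0 then e k else 0) (l2_power W (z b k) i))
                = (\<Sum>i\<le>degree Q. if i = 0 then scaleC (e k) one else 0)"
              by (rule sum.cong) auto
            also have "\<dots> = scaleC (e k) one" by (simp add: sum.delta)
            finally show ?thesis
              unfolding P_eq scaleC.diff_left sum_subtractf l2_poly_def by simp
          qed
        qed
        ultimately show "polynomial b P \<and> (\<forall>k. comp 0 (P k) = 0)" by blast
      qed
      moreover have "cinner (l2_prod W (map (\<lambda>(b, P). P k) Ps)) one = mixed_moment W [x k, y k] [] ps" for k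
        by (simp add: Ps_def mixed_moment_def l2_expect_def split_def o_def)
      ultimately have "(\<lambda>k. mixed_moment W [x k, y k] [] ps) \<longlonglongrightarrow> 0" by simp
      with lim[OF ps2, of "[]"] show "mixed_moment V [F, G] [] ps = 0"
        using LIMSEQ_unique by simp
    qed
  qed
qed

end

theorem theorem4p7:
  fixes W :: "('h::chilbert_space, 'l::chilbert_space) wstar_space"
    and V :: "('h2::chilbert_space, 'l2::chilbert_space) wstar_space"
    and M :: "real \<Rightarrow> 'h op"
    and I :: "nat \<Rightarrow> kernel \<Rightarrow> 'l"
    and K :: "nat \<Rightarrow> kernel set"
    and n m :: nat
    and f g :: "nat \<Rightarrow> kernel"
    and F G :: 'l2
  assumes "tracial_wstar_space W" and "tracial_wstar_space V"
    and "wigner_chaos W M I K \<or> free_poisson_chaos W M I K"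
    and "n \<ge> 1" and "m \<ge> 1"
    and "\<And>k. f k \<in> K n" and "\<And>k. symmetric_kernel n (f k)"
    and "\<And>k. g k \<in> K m" and "\<And>k. symmetric_kernel m (g k)"
    and "self_adjoint_rv V F" and "self_adjoint_rv V G"
    and "converges_in_law W (\<lambda>k. [I n (f k), I m (g k)]) V [F, G]"
  shows "free_rvs V [F, G] \<longleftrightarrow>
    (\<lambda>k. l2_cov W (l2_power W (I n (f k)) 2) (l2_power W (I m (g k)) 2)) \<longlonglongrightarrow> 0"
proof -
  obtain odd_terms where "multiple_integral_algebra W M I K odd_terms"
    using assms(1,3) multiple_integral_algebra_wigner multiple_integral_algebra_free_poisson by blast
  then interpret multiple_integral_algebra W M I K odd_terms .
  show ?thesis
    by (rule free_limit_iff[OF assms(2,10,11) I_H[OF assms(6)] J_symmetric[OF assms(6,7)]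
          comp_symmetric_commute[OF assms(6,7)] I_H[OF assms(8)] J_symmetric[OF assms(8,9)]
          comp_symmetric_commute[OF assms(8,9)] assms(12)])
qed

end
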